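(* Let $\mathfrak A=\mathfrak A_0\oplus\mathfrak A_1$ be an abelian Leibniz superalgebra over a field $k$ with a (well-ordered) linear basis $A=A_0\cup A_1$, where $A_i$ is a linear basis of $\mathfrak A_i$, $i=0,1$. Let $\mathfrak B=\mathrm{Lb}_s(B\mid R)=\mathrm{Lb}_s(B)/\mathrm{Id}(R)$ be a Leibniz superalgebra generated by a well-ordered set $B=B_0\cup B_1$ with defining relations $R$, where $R$ is a reduced Gröbner–Shirshov basis in $\mathrm{Lb}_s(B)$ and the length of the leading monomial of each polynomial in $R$ is greater than $1$. Then a Leibniz superalgebra $\mathfrak E$ is an extension of $\mathfrak B$ by $\mathfrak A$ if and only if $$\mathfrak E\cong E_{(\mathfrak A,\mathfrak B,\lfloor\ \rfloor,\cdot)}=\mathrm{Lb}_s\left(A\cup B\ \left|\ \begin{array}{ll}(aa'), & a,a'\in A\\ (ab)-\{a\cdot b\}, & a\in A,\ b\in B\\ (\nu a)-\{\nu\cdot a\}, & a\in A,\ \nu\in\mathrm{NF}(B)\\ f-\lfloor f\rfloor, & f\in R\end{array}\right.\right)$$ for some $\mathfrak B$-supermodule structure on $\mathfrak A$ (with operation denoted $\cdot$) and some map $\lfloor\ \rfloor:R\to\mathfrak A$ satisfying $|f|=|\lfloor f\rfloor|$ (i.e. $\lfloor f\rfloor\in\mathfrak A_{|f|}$) such that for all $\mu\in\mathrm{NF}(B)$, $f\in R$, writing (uniquely) $(\mu f)=\sum\alpha_ih_{i,s_i}$ as in the context, $$\mu\cdot\lfloor f\rfloor=\sum\alpha_ih_{i,\lfloor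 s_i\rfloor}\quad\text{holds in }\mathfrak A,$$ where for $x\in\mathfrak A$, $y\in\mathrm{NF}(B)$, $x\cdot y:=x\cdot(y+\mathrm{Id}(R))$ and $y\cdot x:=(y+\mathrm{Id}(R))\cdot x$, and $h_{i,\lfloor s_i\rfloor}=\{\{\{\lfloor s_i\rfloor\cdot b_{i_1}\}\cdots\}\cdot b_{i_{n_i}}\}$ if $h_{i,s_i}=[s_ib_{i_1}\cdots b_{i_{n_i}}]_L$. If this is the case, then $\mathfrak E\cong E_{(\mathfrak A,\mathfrak B,\lfloor\ \rfloor,\cdot)}=\mathfrak A\oplus\mathfrak B$ as a vector space, where $\mathfrak B$ is identified with the vector space spanned by $\mathrm{Irr}(R)$, and the multiplication in $E_{(\mathfrak A,\mathfrak B,\lfloor\ \rfloor,\cdot)}$ is given, for all $a,a'\in A$ and $\nu,\nu'\in\mathrm{Irr}(R)$, by $$((a+\nu)(a'+\nu'))=\{a\cdot\nu'\}+\{\nu\cdot a'\}+\sum\beta_jh_{j,\lfloor g_j\rfloor}+\sum\delta_i\nu_i,$$ where $\delta_i,\beta_j\in k$, $\nu_i\in\mathrm{Irr}(R)$ and the normal $R$-polynomials $h_{j,g_j}$ ($g_j\in R$) are the unique ones such that $(\nu\nu')=\sum\delta_i\nu_i+\sum\beta_jh_{j,g_j}$ in $\mathrm{Lb}_s(B)$.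
   Context: Superalgebras. $k$ is a field. A superalgebra is a $k$-vector space $\mathcal A=\mathcal A_0\oplus\mathcal A_1$ with a bilinear product $(xy)$ such that $(\mathcal A_i\mathcal A_j)\subseteq\mathcal A_{i+j}$ (indices in $\mathbb Z_2$); $|x|=i$ for $x\in\mathcal A_i$. It is a Leibniz superalgebra if $(x(yz))=((xy)z)-(-1)^{|z||y|}((xz)y)$ for all homogeneous $x,y,z$; abelian if all products vanish. Homomorphisms are parity-preserving linear multiplicative maps. $\mathfrak E$ is an extension of $\mathfrak B$ by $\mathfrak A$ if there is a short exact sequence $0\to\mathfrak A\to\mathfrak E\to\mathfrak B\to0$ of Leibniz superalgebras. Free Leibniz superalgebra. For a well-ordered set $X=X_0\cup X_1$ (disjoint; elements of $X_i$ have parity $i$), $\mathrm{Lb}_s(X)$ is the free Leibniz superalgebra over $k$ on $X$. $[f_1\cdots f_n]_L:=((\cdots((f_1f_2)f_3)\cdots)f_n)$. $\mathrm{NF}(X)=\{[a_1\cdots a_n]_L\mid a_i\in X, n\ge1\}$ is a linear basis of $\mathrm{Lb}_s(X)$; $\ell([a_1\cdots a_n]_L)=n$; parity is $\sum|a_i|$. For homogeneous $S$, $\mathrm{Id}(S)$ is the (graded, two-sided) ideal generated by $S$ and $\mathrm{Lb}_s(X\mid S)=\mathrm{Lb}_s(X)/\mathrm{Id}(S)$. Order. Every generator has degree $1$, so $\deg([a_1\cdots a_n]_L)=n$, and $\mathrm{NF}(X)$ is ordered by: $\mu<\nu$ iff $(\deg\mu,\ell(\mu),a_1,\dots,a_n)<(\deg\nu,\ell(\nu),b_1,\dots,b_m)$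 lexicographically, for $\mu=[a_1\cdots a_n]_L$, $\nu=[b_1\cdots b_m]_L$. $\overline f$ is the leading (largest) monomial of $f\ne0$; $f$ is monic if $\overline f$ has coefficient $1$; $\mathrm{supp}(f)$ is the set of monomials occurring in $f$; $f$ is homogeneous if all its monomials have the same parity. Gröbner–Shirshov bases. Let $S\subseteq\mathrm{Lb}_s(X)$ be a monic homogeneous set, $s\in S$, $a_1,\dots,a_m\in X$, $m\ge0$. Normal $S$-polynomials are (1) $[sa_1\cdots a_m]_L$, and (2) $[a_1\cdots a_tsa_{t+1}\cdots a_m]_L$ if $\ell(\overline s)=1$, $1\le t\le m$; notation $h_s$. $\mathrm{Irr}(S)=\{\mu\in\mathrm{NF}(X)\mid\mu\ne\overline{h_s}$ for every normal $S$-polynomial $h_s\}$. An element is trivial modulo $(S,\mu)$ (resp. $(S,n)$) if it is a linear combination of normal $S$-polynomials with leading monomials $<\mu$ (resp. of degree $\le n$). $S$ is a Gröbner–Shirshov basis if: for all $f\neq g$ in $S$ with $\overline f=\overline{h_g}$, $f-h_g$ is trivial modulo $(S,\overline f)$; and for all $f\in S$ with $\ell(\overline f)>1$ and $\mu\in\mathrm{NF}(X)$ with $(\mu f)\neq0$, $(\mu f)$ is trivial modulo $(S,\deg\mu+\deg\overline f)$. It is reduced if $\mathrm{supp}(s)\subseteq\mathrm{Irr}(S\setminus\{s\})$ for all $s\in S$. Unique expressions. With $R$ as in the claim, every normal $R$-polynomial has the form $h_s=[sc_1\cdots c_n]_L$ ($s\in R$, $c_i\in B$, $n\ge0$), and every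 nonzero $h\in\mathrm{Id}(R)\subseteq\mathrm{Lb}_s(B)$ has a unique expression $h=\sum_{i=1}^t\alpha_ih_{i,s_i}$ with $0\ne\alpha_i\in k$ and normal $R$-polynomials $h_{i,s_i}$ such that $\overline{h_{t,s_t}}<\cdots<\overline{h_{1,s_1}}=\overline h$ (for $h=0$ the sum is empty). This is the expression used for $(\mu f)$. Supermodules. A supermodule over a Leibniz superalgebra $\mathfrak B$ is a vector space $\mathfrak A=\mathfrak A_0\oplus\mathfrak A_1$ with bilinear maps $\mathfrak B\times\mathfrak A\to\mathfrak A$, $(x,f)\mapsto x\cdot f$ and $\mathfrak A\times\mathfrak B\to\mathfrak A$, $(f,x)\mapsto f\cdot x$ with $\mathfrak A_i\cdot\mathfrak B_j,\ \mathfrak B_i\cdot\mathfrak A_j\subseteq\mathfrak A_{i+j}$ and, for homogeneous $f\in\mathfrak A$, $x,y\in\mathfrak B$: $f\cdot(xy)=(f\cdot x)\cdot y-(-1)^{|x||y|}(f\cdot y)\cdot x$; $x\cdot(y\cdot f)=(xy)\cdot f-(-1)^{|f||y|}(x\cdot f)\cdot y$; $x\cdot(f\cdot y)=(x\cdot f)\cdot y-(-1)^{|f||y|}(xy)\cdot f$. Notation. $A$ and $B$ are disjoint, and $A\cup B$ is well-ordered with $a<b$ for $a\in A$, $b\in B$. $\{x\cdot y\}$ denotes the element $x\cdot y\in\mathfrak A$ written as a linear combination of elements of $A$, hence regarded as an element of $\mathrm{Lb}_s(A\cup B)$; similarly for $\lfloor f\rfloor$. *)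

theory Defs
  imports
    "HOL-Algebra.QuotRing"
    "HOL-Algebra.Module"
    "HOL-Algebra.Algebraic_Closure_Type"
    "HOL-Library.Poly_Mapping"
    "HOL-Library.Z2"
begin

section \<open>Leibniz superalgebras\<close>

text \<open>
  The ground field is a type \<open>'k :: field\<close>, viewed as a ring structure through
  \<^const>\<open>ring_of_type_algebra\<close>. Of the inherited record fields, \<open>mult\<close> is the (nonassociative)
  product; \<open>one\<close> has no meaning here and is never referred to by an axiom.
\<close>

record ('k, 'v) superalgebra = "('k, 'v) module" +
  hpart :: "bit \<Rightarrow> 'v set"

text \<open>The sign \<open>(-1)\<^bsup>ij\<^esup>\<close>.\<close>

definition koszul :: "bit \<Rightarrow> bit \<Rightarrow> 'k::field"
  where "koszul i j = (if i = 1 \<and> j = 1 then - 1 else 1)"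

locale superspace = module "ring_of_type_algebra :: 'k ring" V
  for V :: "('k::field, 'v) superalgebra" +
  assumes hpart_submodule: "submodule (hpart V i) (ring_of_type_algebra :: 'k ring) V"
    and hpart_decomp: "v \<in> carrier V \<Longrightarrow>
      \<exists>!p. p \<in> hpart V 0 \<times> hpart V 1 \<and> v = fst p \<oplus>\<^bsub>V\<^esub> snd p"

locale superalgebra = superspace V
  for V :: "('k::field, 'v) superalgebra" +
  assumes prod_closed: "\<lbrakk>x \<in> carrier V; y \<in> carrier V\<rbrakk> \<Longrightarrow> x \<otimes>\<^bsub>V\<^esub> y \<in> carrier V"
    and prod_add_left: "\<lbrakk>x \<in> carrier V; y \<in> carrier V; z \<in> carrier V\<rbrakk> \<Longrightarrow>
      (x \<oplus>\<^bsub>V\<^esub> y) \<otimes>\<^bsub>V\<^esub> z = (x \<otimes>\<^bsub>V\<^esub> z) \<oplus>\<^bsub>V\<^esub> (y \<otimes>\<^bsub>V\<^esub> z)"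
    and prod_add_right: "\<lbrakk>x \<in> carrier V; y \<in> carrier V; z \<in> carrier V\<rbrakk> \<Longrightarrow>
      x \<otimes>\<^bsub>V\<^esub> (y \<oplus>\<^bsub>V\<^esub> z) = (x \<otimes>\<^bsub>V\<^esub> y) \<oplus>\<^bsub>V\<^esub> (x \<otimes>\<^bsub>V\<^esub> z)"
    and prod_smult_left: "\<lbrakk>x \<in> carrier V; y \<in> carrier V\<rbrakk> \<Longrightarrow>
      (c \<odot>\<^bsub>V\<^esub> x) \<otimes>\<^bsub>V\<^esub> y = c \<odot>\<^bsub>V\<^esub> (x \<otimes>\<^bsub>V\<^esub> y)"
    and prod_smult_right: "\<lbrakk>x \<in> carrier V; y \<in> carrier V\<rbrakk> \<Longrightarrow>
      x \<otimes>\<^bsub>V\<^esub> (c \<odot>\<^bsub>V\<^esub> y) = c \<odot>\<^bsub>V\<^esub> (x \<otimes>\<^bsub>V\<^esub> y)"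
    and prod_hpart: "\<lbrakk>x \<in> hpart V i; y \<in> hpart V j\<rbrakk> \<Longrightarrow> x \<otimes>\<^bsub>V\<^esub> y \<in> hpart V (i + j)"

locale leibniz_superalgebra = superalgebra V
  for V :: "('k::field, 'v) superalgebra" +
  assumes leibniz: "\<lbrakk>x \<in> hpart V i; y \<in> hpart V j; z \<in> hpart V l\<rbrakk> \<Longrightarrow>
    x \<otimes>\<^bsub>V\<^esub> (y \<otimes>\<^bsub>V\<^esub> z) =
      ((x \<otimes>\<^bsub>V\<^esub> y) \<otimes>\<^bsub>V\<^esub> z) \<ominus>\<^bsub>V\<^esub> (koszul l j \<odot>\<^bsub>V\<^esub> ((x \<otimes>\<^bsub>V\<^esub> z) \<otimes>\<^bsub>V\<^esub> y))"

definition abelian_superalgebra :: "('k, 'v) superalgebra \<Rightarrow> bool"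
  where "abelian_superalgebra V \<longleftrightarrow>
    (\<forall>x\<in>carrier V. \<forall>y\<in>carrier V. x \<otimes>\<^bsub>V\<^esub> y = \<zero>\<^bsub>V\<^esub>)"

definition linear_maps ::
  "('k, 'v, 'm) module_scheme \<Rightarrow> ('k, 'w, 'n) module_scheme \<Rightarrow> ('v \<Rightarrow> 'w) set"
  where "linear_maps V W = {\<phi> \<in> carrier V \<rightarrow> carrier W.
    (\<forall>x\<in>carrier V. \<forall>y\<in>carrier V. \<phi> (x \<oplus>\<^bsub>V\<^esub> y) = \<phi> x \<oplus>\<^bsub>W\<^esub> \<phi> y) \<and>
    (\<forall>c. \<forall>x\<in>carrier V. \<phi> (c \<odot>\<^bsub>V\<^esub> x) = c \<odot>\<^bsub>W\<^esub> \<phi> x)}"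

definition linear_iso ::
  "('k, 'v, 'm) module_scheme \<Rightarrow> ('k, 'w, 'n) module_scheme \<Rightarrow> ('v \<Rightarrow> 'w) \<Rightarrow> bool"
  where "linear_iso V W \<phi> \<longleftrightarrow> \<phi> \<in> linear_maps V W \<and> bij_betw \<phi> (carrier V) (carrier W)"

definition superalg_hom ::
  "('k, 'v) superalgebra \<Rightarrow> ('k, 'w) superalgebra \<Rightarrow> ('v \<Rightarrow> 'w) set"
  where "superalg_hom V W = {\<phi> \<in> linear_maps V W.
    (\<forall>i. \<phi> ` hpart V i \<subseteq> hpart W i) \<and>
    (\<forall>x\<in>carrier V. \<forall>y\<in>carrier V. \<phi> (x \<otimes>\<^bsub>V\<^esub> y) = \<phi> x \<otimes>\<^bsub>W\<^esub> \<phi> y)}"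

definition superalg_iso ::
  "('k, 'v) superalgebra \<Rightarrow> ('k, 'w) superalgebra \<Rightarrow> bool"
  where "superalg_iso V W \<longleftrightarrow>
    (\<exists>\<phi>\<in>superalg_hom V W. bij_betw \<phi> (carrier V) (carrier W))"

text \<open>\<open>E\<close> is an extension of \<open>B\<close> by \<open>A\<close>: there is a short exact sequence
  \<open>0 \<rightarrow> A \<rightarrow> E \<rightarrow> B \<rightarrow> 0\<close>.\<close>

definition is_extension ::
  "('k::field, 'e) superalgebra \<Rightarrow> ('k, 'b) superalgebra \<Rightarrow> ('k, 'a) superalgebra \<Rightarrow> bool"
  where "is_extension E B A \<longleftrightarrow>
    leibniz_superalgebra A \<and> leibniz_superalgebra E \<and> leibniz_superalgebra B \<and>
    (\<exists>\<iota>\<in>superalg_hom A E. \<exists>\<pi>\<in>superalg_hom E B.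
      inj_on \<iota> (carrier A) \<and>
      \<iota> ` carrier A = {x \<in> carrier E. \<pi> x = \<zero>\<^bsub>B\<^esub>} \<and>
      \<pi> ` carrier E = carrier B)"

locale supermodule = B: leibniz_superalgebra B + M: superspace M
  for B :: "('k::field, 'b) superalgebra" and M :: "('k, 'a) superalgebra"
    and lact :: "'b \<Rightarrow> 'a \<Rightarrow> 'a" and ract :: "'a \<Rightarrow> 'b \<Rightarrow> 'a" +
  assumes lact_closed: "\<lbrakk>x \<in> carrier B; f \<in> carrier M\<rbrakk> \<Longrightarrow> lact x f \<in> carrier M"
    and ract_closed: "\<lbrakk>x \<in> carrier B; f \<in> carrier M\<rbrakk> \<Longrightarrow> ract f x \<in> carrier M"
    and lact_add_left: "\<lbrakk>x \<in> carrier B; y \<in> carrier B; f \<in> carrier M\<rbrakk> \<Longrightarrow>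
      lact (x \<oplus>\<^bsub>B\<^esub> y) f = lact x f \<oplus>\<^bsub>M\<^esub> lact y f"
    and lact_add_right: "\<lbrakk>x \<in> carrier B; f \<in> carrier M; g \<in> carrier M\<rbrakk> \<Longrightarrow>
      lact x (f \<oplus>\<^bsub>M\<^esub> g) = lact x f \<oplus>\<^bsub>M\<^esub> lact x g"
    and lact_smult_left: "\<lbrakk>x \<in> carrier B; f \<in> carrier M\<rbrakk> \<Longrightarrow>
      lact (c \<odot>\<^bsub>B\<^esub> x) f = c \<odot>\<^bsub>M\<^esub> lact x f"
    and lact_smult_right: "\<lbrakk>x \<in> carrier B; f \<in> carrier M\<rbrakk> \<Longrightarrow>
      lact x (c \<odot>\<^bsub>M\<^esub> f) = c \<odot>\<^bsub>M\<^esub> lact x f"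
    and ract_add_left: "\<lbrakk>x \<in> carrier B; f \<in> carrier M; g \<in> carrier M\<rbrakk> \<Longrightarrow>
      ract (f \<oplus>\<^bsub>M\<^esub> g) x = ract f x \<oplus>\<^bsub>M\<^esub> ract g x"
    and ract_add_right: "\<lbrakk>x \<in> carrier B; y \<in> carrier B; f \<in> carrier M\<rbrakk> \<Longrightarrow>
      ract f (x \<oplus>\<^bsub>B\<^esub> y) = ract f x \<oplus>\<^bsub>M\<^esub> ract f y"
    and ract_smult_left: "\<lbrakk>x \<in> carrier B; f \<in> carrier M\<rbrakk> \<Longrightarrow>
      ract (c \<odot>\<^bsub>M\<^esub> f) x = c \<odot>\<^bsub>M\<^esub> ract f x"
    and ract_smult_right: "\<lbrakk>x \<in> carrier B; f \<in> carrier M\<rbrakk> \<Longrightarrow>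
      ract f (c \<odot>\<^bsub>B\<^esub> x) = c \<odot>\<^bsub>M\<^esub> ract f x"
    and lact_hpart: "\<lbrakk>x \<in> hpart B i; f \<in> hpart M j\<rbrakk> \<Longrightarrow> lact x f \<in> hpart M (i + j)"
    and ract_hpart: "\<lbrakk>f \<in> hpart M i; x \<in> hpart B j\<rbrakk> \<Longrightarrow> ract f x \<in> hpart M (i + j)"
    and ract_prod: "\<lbrakk>f \<in> hpart M l; x \<in> hpart B i; y \<in> hpart B j\<rbrakk> \<Longrightarrow>
      ract f (x \<otimes>\<^bsub>B\<^esub> y) = ract (ract f x) y \<ominus>\<^bsub>M\<^esub> (koszul i j \<odot>\<^bsub>M\<^esub> ract (ract f y) x)"
    and lact_lact: "\<lbrakk>f \<in> hpart M l; x \<in> hpart B i; y \<in> hpart B j\<rbrakk> \<Longrightarrow>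
      lact x (lact y f) = lact (x \<otimes>\<^bsub>B\<^esub> y) f \<ominus>\<^bsub>M\<^esub> (koszul l j \<odot>\<^bsub>M\<^esub> ract (lact x f) y)"
    and lact_ract: "\<lbrakk>f \<in> hpart M l; x \<in> hpart B i; y \<in> hpart B j\<rbrakk> \<Longrightarrow>
      lact x (ract f y) = ract (lact x f) y \<ominus>\<^bsub>M\<^esub> (koszul l j \<odot>\<^bsub>M\<^esub> lact (x \<otimes>\<^bsub>B\<^esub> y) f)"

section \<open>Linear combinations, ideals, quotients\<close>

definition lincomb :: "('k::zero, 'v, 'm) module_scheme \<Rightarrow> ('v \<Rightarrow>\<^sub>0 'k) \<Rightarrow> 'v"
  where "lincomb V c = (\<Oplus>\<^bsub>V\<^esub>v\<in>Poly_Mapping.keys c. Poly_Mapping.lookup c v \<odot>\<^bsub>V\<^esub> v)"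

text \<open>\<open>A\<close> is a linear basis of the subspace \<open>W\<close> of \<open>V\<close>.\<close>

definition basis_of :: "('k::zero, 'v, 'm) module_scheme \<Rightarrow> 'v set \<Rightarrow> 'v set \<Rightarrow> bool"
  where "basis_of V W A \<longleftrightarrow> A \<subseteq> W \<and>
    (\<forall>c. Poly_Mapping.keys c \<subseteq> A \<and> lincomb V c = \<zero>\<^bsub>V\<^esub> \<longrightarrow> c = 0) \<and>
    (\<forall>x\<in>W. \<exists>c. Poly_Mapping.keys c \<subseteq> A \<and> x = lincomb V c)"

definition coords :: "('k::zero, 'v, 'm) module_scheme \<Rightarrow> 'v set \<Rightarrow> 'v \<Rightarrow> ('v \<Rightarrow>\<^sub>0 'k)"
  where "coords V A x = (THE c. Poly_Mapping.keys c \<subseteq> A \<and> x = lincomb V c)"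

text \<open>Graded two-sided ideals; the last conjunct says that an ideal contains the homogeneous
  components of its elements.\<close>

definition superideal :: "'v set \<Rightarrow> ('k::field, 'v) superalgebra \<Rightarrow> bool"
  where "superideal I V \<longleftrightarrow>
    submodule I (ring_of_type_algebra :: 'k ring) V \<and>
    (\<forall>x\<in>I. \<forall>y\<in>carrier V. x \<otimes>\<^bsub>V\<^esub> y \<in> I \<and> y \<otimes>\<^bsub>V\<^esub> x \<in> I) \<and>
    (\<forall>x\<in>I. \<exists>y\<in>I \<inter> hpart V 0. \<exists>z\<in>I \<inter> hpart V 1. x = y \<oplus>\<^bsub>V\<^esub> z)"

definition genideal_super :: "('k::field, 'v) superalgebra \<Rightarrow> 'v set \<Rightarrow> 'v set"
  where "genideal_super V S = \<Inter> {I. superideal I V \<and> S \<subseteq> I}"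

definition quot_superalgebra ::
  "('k, 'v) superalgebra \<Rightarrow> 'v set \<Rightarrow> ('k, 'v set) superalgebra"
  where "quot_superalgebra V I =
    \<lparr>carrier = a_rcosets\<^bsub>V\<^esub> I, monoid.mult = rcoset_mult V I, one = I +>\<^bsub>V\<^esub> \<one>\<^bsub>V\<^esub>, ring.zero = I,
     add = set_add V, module.smult = (\<lambda>c C. \<Union>x\<in>C. I +>\<^bsub>V\<^esub> (c \<odot>\<^bsub>V\<^esub> x)),
     hpart = (\<lambda>i. (\<lambda>x. I +>\<^bsub>V\<^esub> x) ` hpart V i)\<rparr>"

definition dsum ::
  "('k, 'v, 'm) module_scheme \<Rightarrow> ('k, 'w, 'n) module_scheme \<Rightarrow> ('k, 'v \<times> 'w) module"
  where "dsum V W =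
    \<lparr>carrier = carrier V \<times> carrier W,
     monoid.mult = (\<lambda>p q. (fst p \<otimes>\<^bsub>V\<^esub> fst q, snd p \<otimes>\<^bsub>W\<^esub> snd q)), one = (\<one>\<^bsub>V\<^esub>, \<one>\<^bsub>W\<^esub>),
     ring.zero = (\<zero>\<^bsub>V\<^esub>, \<zero>\<^bsub>W\<^esub>),
     add = (\<lambda>p q. (fst p \<oplus>\<^bsub>V\<^esub> fst q, snd p \<oplus>\<^bsub>W\<^esub> snd q)),
     module.smult = (\<lambda>c p. (c \<odot>\<^bsub>V\<^esub> fst p, c \<odot>\<^bsub>W\<^esub> snd p))\<rparr>"

text \<open>The left-normed product \<open>[f f\<^sub>1 \<dots> f\<^sub>n]\<^sub>L\<close>.\<close>

definition lnorm :: "('v, 'm) monoid_scheme \<Rightarrow> 'v \<Rightarrow> 'v list \<Rightarrow> 'v"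
  where "lnorm V f fs = foldl (monoid.mult V) f fs"

section \<open>The free Leibniz superalgebra\<close>

text \<open>
  \<open>Lbs X0 X1\<close> is realised on finitely supported functions on nonempty words over \<open>X0 \<union> X1\<close>; the
  word \<open>a\<^sub>1 \<dots> a\<^sub>n\<close> stands for the monomial \<open>[a\<^sub>1 \<dots> a\<^sub>n]\<^sub>L\<close>. The product of two words is forced by
  the Leibniz identity:
  \<open>(u (v b)) = ((u v) b) - (-1)\<^bsup>|b||v|\<^esup> ((u b) v)\<close> for a letter \<open>b\<close> and a word \<open>v\<close>.
  That this is the free Leibniz superalgebra on \<open>X0 \<union> X1\<close> is proved at the end of this theory
  (\<open>leibniz_superalgebra_Lbs\<close>, \<open>Lbs_universal\<close>).
\<close>

definition NF :: "'x set \<Rightarrow> 'x list set"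
  where "NF Y = {w. w \<noteq> [] \<and> set w \<subseteq> Y}"

definition lpar :: "'x set \<Rightarrow> 'x \<Rightarrow> bit"
  where "lpar X1 x = (if x \<in> X1 then 1 else 0)"

definition wpar :: "'x set \<Rightarrow> 'x list \<Rightarrow> bit"
  where "wpar X1 w = (\<Sum>x\<leftarrow>w. lpar X1 x)"

definition wmono :: "'x list \<Rightarrow> ('x list \<Rightarrow>\<^sub>0 'k::field)"
  where "wmono w = Poly_Mapping.single w 1"

definition gen :: "'x \<Rightarrow> ('x list \<Rightarrow>\<^sub>0 'k::field)"
  where "gen x = wmono [x]"

definition pscale :: "'k::field \<Rightarrow> ('y \<Rightarrow>\<^sub>0 'k) \<Rightarrow> ('y \<Rightarrow>\<^sub>0 'k)"
  where "pscale c f = Poly_Mapping.map ((*) c) f"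

definition push :: "('y \<Rightarrow> 'z) \<Rightarrow> ('y \<Rightarrow>\<^sub>0 'k::field) \<Rightarrow> ('z \<Rightarrow>\<^sub>0 'k)"
  where "push h f = (\<Sum>w\<in>Poly_Mapping.keys f. Poly_Mapping.single (h w) (Poly_Mapping.lookup f w))"

text \<open>In \<open>rev_mult X1 v u\<close> the right factor \<open>v\<close> is written backwards.\<close>

fun rev_mult :: "'x set \<Rightarrow> 'x list \<Rightarrow> 'x list \<Rightarrow> ('x list \<Rightarrow>\<^sub>0 'k::field)"
  where
    "rev_mult X1 [] u = 0"
  | "rev_mult X1 [b] u = wmono (u @ [b])"
  | "rev_mult X1 (b # c # v) u =
      push (\<lambda>w. w @ [b]) (rev_mult X1 (c # v) u) -
      pscale (koszul (lpar X1 b) (wpar X1 (c # v))) (rev_mult X1 (c # v) (u @ [b]))"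

definition word_mult :: "'x set \<Rightarrow> 'x list \<Rightarrow> 'x list \<Rightarrow> ('x list \<Rightarrow>\<^sub>0 'k::field)"
  where "word_mult X1 u v = rev_mult X1 (rev v) u"

definition free_mult ::
  "'x set \<Rightarrow> ('x list \<Rightarrow>\<^sub>0 'k::field) \<Rightarrow> ('x list \<Rightarrow>\<^sub>0 'k) \<Rightarrow> ('x list \<Rightarrow>\<^sub>0 'k)"
  where "free_mult X1 f g =
    (\<Sum>u\<in>Poly_Mapping.keys f. \<Sum>v\<in>Poly_Mapping.keys g. pscale (Poly_Mapping.lookup f u * Poly_Mapping.lookup g v) (word_mult X1 u v))"

definition Lbs :: "'x set \<Rightarrow> 'x set \<Rightarrow> ('k::field, 'x list \<Rightarrow>\<^sub>0 'k) superalgebra"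
  where "Lbs X0 X1 =
    \<lparr>carrier = {f. Poly_Mapping.keys f \<subseteq> NF (X0 \<union> X1)}, monoid.mult = free_mult X1, one = 0, ring.zero = 0,
     add = (+), module.smult = pscale,
     hpart = (\<lambda>i. {f. Poly_Mapping.keys f \<subseteq> NF (X0 \<union> X1) \<and> (\<forall>w\<in>Poly_Mapping.keys f. wpar X1 w = i)})\<rparr>"

definition Lbs_rel ::
  "'x set \<Rightarrow> 'x set \<Rightarrow> ('x list \<Rightarrow>\<^sub>0 'k::field) set \<Rightarrow> ('k, ('x list \<Rightarrow>\<^sub>0 'k) set) superalgebra"
  where "Lbs_rel X0 X1 S = quot_superalgebra (Lbs X0 X1) (genideal_super (Lbs X0 X1) S)"

definition rel_class ::
  "'x set \<Rightarrow> 'x set \<Rightarrow> ('x list \<Rightarrow>\<^sub>0 'k::field) set \<Rightarrow> ('x list \<Rightarrow>\<^sub>0 'k) \<Rightarrow> ('x list \<Rightarrow>\<^sub>0 'k) set"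
  where "rel_class X0 X1 S f =
    genideal_super (Lbs X0 X1) S +>\<^bsub>Lbs X0 X1 :: ('k, 'x list \<Rightarrow>\<^sub>0 'k) superalgebra\<^esub> f"

section \<open>Groebner--Shirshov bases\<close>

text \<open>All generators have degree 1, so degree and length of a word coincide and the order by
  (degree, length, letters) is \<^const>\<open>lenlex\<close>.\<close>

definition nf_less :: "'x::wellorder list \<Rightarrow> 'x list \<Rightarrow> bool"
  where "nf_less u v \<longleftrightarrow> (u, v) \<in> lenlex {(x, y). x < y}"

definition lmon :: "('x::wellorder list \<Rightarrow>\<^sub>0 'k::zero) \<Rightarrow> 'x list"
  where "lmon f = (THE u. u \<in> Poly_Mapping.keys f \<and> (\<forall>v\<in>Poly_Mapping.keys f. v \<noteq> u \<longrightarrow> nf_less v u))"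

definition monic_homogeneous ::
  "'x::wellorder set \<Rightarrow> 'x set \<Rightarrow> ('x list \<Rightarrow>\<^sub>0 'k::field) set \<Rightarrow> bool"
  where "monic_homogeneous X0 X1 S \<longleftrightarrow>
    (\<forall>s\<in>S. s \<noteq> 0 \<and> Poly_Mapping.lookup s (lmon s) = 1 \<and>
      (\<exists>i. s \<in> hpart (Lbs X0 X1 :: ('k, 'x list \<Rightarrow>\<^sub>0 'k) superalgebra) i))"

definition normal_of ::
  "'x::wellorder set \<Rightarrow> 'x set \<Rightarrow> ('x list \<Rightarrow>\<^sub>0 'k::field) \<Rightarrow> ('x list \<Rightarrow>\<^sub>0 'k) set"
  where "normal_of X0 X1 s =
    {lnorm (Lbs X0 X1 :: ('k, 'x list \<Rightarrow>\<^sub>0 'k) superalgebra) s (map gen as) | as.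
      set as \<subseteq> X0 \<union> X1} \<union>
    {lnorm (Lbs X0 X1 :: ('k, 'x list \<Rightarrow>\<^sub>0 'k) superalgebra) (gen a)
        (map gen as @ s # map gen bs) | a as bs.
      length (lmon s) = 1 \<and> a \<in> X0 \<union> X1 \<and> set as \<subseteq> X0 \<union> X1 \<and> set bs \<subseteq> X0 \<union> X1}"

definition Irr ::
  "'x::wellorder set \<Rightarrow> 'x set \<Rightarrow> ('x list \<Rightarrow>\<^sub>0 'k::field) set \<Rightarrow> 'x list set"
  where "Irr X0 X1 S =
    {\<mu> \<in> NF (X0 \<union> X1). \<forall>s\<in>S. \<forall>h\<in>normal_of X0 X1 s. \<mu> \<noteq> lmon h}"

text \<open>Linear combinations of normal \<open>S\<close>-polynomials whose leading monomials satisfy \<open>Q\<close>.\<close>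

definition trivial_mod ::
  "'x::wellorder set \<Rightarrow> 'x set \<Rightarrow> ('x list \<Rightarrow>\<^sub>0 'k::field) set \<Rightarrow> ('x list \<Rightarrow> bool) \<Rightarrow>
    ('x list \<Rightarrow>\<^sub>0 'k) \<Rightarrow> bool"
  where "trivial_mod X0 X1 S Q h \<longleftrightarrow>
    (\<exists>c. Poly_Mapping.keys c \<subseteq> {g. (\<exists>s\<in>S. g \<in> normal_of X0 X1 s) \<and> Q (lmon g)} \<and>
      h = (\<Sum>g\<in>Poly_Mapping.keys c. pscale (Poly_Mapping.lookup c g) g))"

definition gs_basis ::
  "'x::wellorder set \<Rightarrow> 'x set \<Rightarrow> ('x list \<Rightarrow>\<^sub>0 'k::field) set \<Rightarrow> bool"
  where "gs_basis X0 X1 S \<longleftrightarrow> monic_homogeneous X0 X1 S \<and>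
    (\<forall>f\<in>S. \<forall>g\<in>S. \<forall>h\<in>normal_of X0 X1 g. f \<noteq> g \<and> lmon f = lmon h \<longrightarrow>
      trivial_mod X0 X1 S (\<lambda>w. nf_less w (lmon f)) (f - h)) \<and>
    (\<forall>f\<in>S. \<forall>\<mu>\<in>NF (X0 \<union> X1). length (lmon f) > 1 \<and> free_mult X1 (wmono \<mu>) f \<noteq> 0 \<longrightarrow>
      trivial_mod X0 X1 S (\<lambda>w. length w \<le> length \<mu> + length (lmon f))
        (free_mult X1 (wmono \<mu>) f))"

definition reduced_gs_basis ::
  "'x::wellorder set \<Rightarrow> 'x set \<Rightarrow> ('x list \<Rightarrow>\<^sub>0 'k::field) set \<Rightarrow> bool"
  where "reduced_gs_basis X0 X1 S \<longleftrightarrow> gs_basis X0 X1 S \<and>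
    (\<forall>s\<in>S. Poly_Mapping.keys s \<subseteq> Irr X0 X1 (S - {s}))"

text \<open>
  Expressions \<open>h = \<Sum> \<alpha>\<^sub>i [s\<^sub>i c\<^sub>i\<^sub>1 c\<^sub>i\<^sub>2 \<dots>]\<^sub>L\<close> with strictly decreasing leading monomials, given by the
  list of the triples \<open>(\<alpha>\<^sub>i, s\<^sub>i, [c\<^sub>i\<^sub>1, c\<^sub>i\<^sub>2, \<dots>])\<close>. Only normal polynomials of the first kind occur,
  so this is meant for sets \<open>S\<close> whose elements have leading monomials of length greater than 1.
\<close>

type_synonym ('k, 'x) nexpr = "('k \<times> ('x list \<Rightarrow>\<^sub>0 'k) \<times> 'x list) list"

definition npoly ::
  "'x set \<Rightarrow> 'x set \<Rightarrow> ('x list \<Rightarrow>\<^sub>0 'k::field) \<Rightarrow> 'x list \<Rightarrow> ('x list \<Rightarrow>\<^sub>0 'k)"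
  where "npoly X0 X1 s c =
    lnorm (Lbs X0 X1 :: ('k, 'x list \<Rightarrow>\<^sub>0 'k) superalgebra) s (map gen c)"

definition is_nexpr ::
  "'x::wellorder set \<Rightarrow> 'x set \<Rightarrow> ('x list \<Rightarrow>\<^sub>0 'k::field) set \<Rightarrow> ('x list \<Rightarrow>\<^sub>0 'k) \<Rightarrow>
    ('k, 'x) nexpr \<Rightarrow> bool"
  where "is_nexpr X0 X1 S h es \<longleftrightarrow>
    (\<forall>(\<alpha>, s, c)\<in>set es. \<alpha> \<noteq> 0 \<and> s \<in> S \<and> set c \<subseteq> X0 \<union> X1) \<and>
    sorted_wrt (\<lambda>(\<alpha>, s, c) (\<beta>, t, d). nf_less (lmon (npoly X0 X1 t d)) (lmon (npoly X0 X1 s c))) es \<and>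
    (es \<noteq> [] \<longrightarrow> (case hd es of (\<alpha>, s, c) \<Rightarrow> lmon (npoly X0 X1 s c) = lmon h)) \<and>
    h = (\<Sum>(\<alpha>, s, c)\<leftarrow>es. pscale \<alpha> (npoly X0 X1 s c))"

definition nexpr_of ::
  "'x::wellorder set \<Rightarrow> 'x set \<Rightarrow> ('x list \<Rightarrow>\<^sub>0 'k::field) set \<Rightarrow> ('x list \<Rightarrow>\<^sub>0 'k) \<Rightarrow>
    ('k, 'x) nexpr"
  where "nexpr_of X0 X1 S h = (THE es. is_nexpr X0 X1 S h es)"

text \<open>The linear span of \<open>Irr(S)\<close>; only its vector space structure is meaningful.\<close>

definition irr_space ::
  "'x::wellorder set \<Rightarrow> 'x set \<Rightarrow> ('x list \<Rightarrow>\<^sub>0 'k::field) set \<Rightarrow> ('k, 'x list \<Rightarrow>\<^sub>0 'k) superalgebra"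
  where "irr_space X0 X1 S = (Lbs X0 X1)\<lparr>carrier := {f. Poly_Mapping.keys f \<subseteq> Irr X0 X1 S}\<rparr>"

section \<open>The extension \<open>E\<close>\<close>

text \<open>
  The disjoint union \<open>A \<union> B\<close> of generators is formed in a sum type, \<open>Inl\<close> marking \<open>A\<close> and \<open>Inr\<close>
  marking \<open>B\<close>.  \<open>brace\<close> writes an element of \<open>\<AA>\<close> as a linear combination of the letters in \<open>A\<close>.
\<close>

definition brace ::
  "('k::field, 'a) superalgebra \<Rightarrow> 'a set \<Rightarrow> 'a \<Rightarrow> (('a + 'b) list \<Rightarrow>\<^sub>0 'k)"
  where "brace \<AA> A x = push (\<lambda>a. [Inl a]) (coords \<AA> A x)"

definition emb :: "('b list \<Rightarrow>\<^sub>0 'k::field) \<Rightarrow> (('a + 'b) list \<Rightarrow>\<^sub>0 'k)"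
  where "emb f = push (map Inr) f"

text \<open>\<open>h\<^bsub>\<lfloor>s\<rfloor>\<^esub>\<close> for \<open>h\<^sub>s = [s c\<^sub>1 \<dots> c\<^sub>n]\<^sub>L\<close>, where \<open>x = \<lfloor>s\<rfloor>\<close>, and the resulting sum
  \<open>\<Sum> \<alpha>\<^sub>i h\<^bsub>i,\<lfloor>s\<^sub>i\<rfloor>\<^esub>\<close> for an expression.\<close>

definition hfloor ::
  "'b set \<Rightarrow> 'b set \<Rightarrow> ('b list \<Rightarrow>\<^sub>0 'k::field) set \<Rightarrow> ('a \<Rightarrow> ('b list \<Rightarrow>\<^sub>0 'k) set \<Rightarrow> 'a) \<Rightarrow>
    'a \<Rightarrow> 'b list \<Rightarrow> 'a"
  where "hfloor B0 B1 R ract x c = foldl (\<lambda>y b. ract y (rel_class B0 B1 R (gen b))) x c"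

definition nexpr_floor ::
  "('k::field, 'a) superalgebra \<Rightarrow> 'b set \<Rightarrow> 'b set \<Rightarrow> ('b list \<Rightarrow>\<^sub>0 'k) set \<Rightarrow>
    ('a \<Rightarrow> ('b list \<Rightarrow>\<^sub>0 'k) set \<Rightarrow> 'a) \<Rightarrow> (('b list \<Rightarrow>\<^sub>0 'k) \<Rightarrow> 'a) \<Rightarrow> ('k, 'b) nexpr \<Rightarrow> 'a"
  where "nexpr_floor \<AA> B0 B1 R ract fl es =
    foldr (\<lambda>(\<alpha>, s, c) x. (\<alpha> \<odot>\<^bsub>\<AA>\<^esub> hfloor B0 B1 R ract (fl s) c) \<oplus>\<^bsub>\<AA>\<^esub> x) es \<zero>\<^bsub>\<AA>\<^esub>"

text \<open>The conditions on the supermodule structure \<open>(lact, ract)\<close> on \<open>\<AA>\<close> and on the map \<open>fl\<close>,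
  \<open>f \<mapsto> \<lfloor>f\<rfloor>\<close>, of which only the values on \<open>R\<close> matter.\<close>

definition extension_data ::
  "('k::field, 'a) superalgebra \<Rightarrow> 'b::wellorder set \<Rightarrow> 'b set \<Rightarrow> ('b list \<Rightarrow>\<^sub>0 'k) set \<Rightarrow>
    (('b list \<Rightarrow>\<^sub>0 'k) set \<Rightarrow> 'a \<Rightarrow> 'a) \<Rightarrow> ('a \<Rightarrow> ('b list \<Rightarrow>\<^sub>0 'k) set \<Rightarrow> 'a) \<Rightarrow>
    (('b list \<Rightarrow>\<^sub>0 'k) \<Rightarrow> 'a) \<Rightarrow> bool"
  where "extension_data \<AA> B0 B1 R lact ract fl \<longleftrightarrow>
    supermodule (Lbs_rel B0 B1 R) \<AA> lact ract \<and>
    (\<forall>f\<in>R. \<forall>i. f \<in> hpart (Lbs B0 B1 :: ('k, 'b list \<Rightarrow>\<^sub>0 'k) superalgebra) i \<longrightarrow>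
      fl f \<in> hpart \<AA> i) \<and>
    (\<forall>\<mu>\<in>NF (B0 \<union> B1). \<forall>f\<in>R.
      lact (rel_class B0 B1 R (wmono \<mu>)) (fl f) =
      nexpr_floor \<AA> B0 B1 R ract fl (nexpr_of B0 B1 R (free_mult B1 (wmono \<mu>) f)))"

definition gsum :: "'a set \<Rightarrow> 'b set \<Rightarrow> ('a + 'b) set"
  where "gsum A B = Inl ` A \<union> Inr ` B"

definition ext_relations ::
  "('k::field, 'a) superalgebra \<Rightarrow> 'a set \<Rightarrow> 'a set \<Rightarrow> 'b set \<Rightarrow> 'b set \<Rightarrow> ('b list \<Rightarrow>\<^sub>0 'k) set \<Rightarrow>
    (('b list \<Rightarrow>\<^sub>0 'k) set \<Rightarrow> 'a \<Rightarrow> 'a) \<Rightarrow> ('a \<Rightarrow> ('b list \<Rightarrow>\<^sub>0 'k) set \<Rightarrow> 'a) \<Rightarrow>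
    (('b list \<Rightarrow>\<^sub>0 'k) \<Rightarrow> 'a) \<Rightarrow> (('a + 'b) list \<Rightarrow>\<^sub>0 'k) set"
  where "ext_relations \<AA> A0 A1 B0 B1 R lact ract fl =
    (let A = A0 \<union> A1; B = B0 \<union> B1; prod = free_mult (gsum A1 B1) in
      {prod (gen (Inl a)) (gen (Inl a')) | a a'. a \<in> A \<and> a' \<in> A} \<union>
      {prod (gen (Inl a)) (gen (Inr b)) - brace \<AA> A (ract a (rel_class B0 B1 R (gen b))) | a b.
        a \<in> A \<and> b \<in> B} \<union>
      {prod (emb (wmono \<nu>)) (gen (Inl a)) - brace \<AA> A (lact (rel_class B0 B1 R (wmono \<nu>)) a) | \<nu> a.
        a \<in> A \<and> \<nu> \<in> NF B} \<union>
      {emb f - brace \<AA> A (fl f) | f. f \<in> R})"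

definition ext_superalgebra ::
  "('k::field, 'a) superalgebra \<Rightarrow> 'a set \<Rightarrow> 'a set \<Rightarrow> 'b set \<Rightarrow> 'b set \<Rightarrow> ('b list \<Rightarrow>\<^sub>0 'k) set \<Rightarrow>
    (('b list \<Rightarrow>\<^sub>0 'k) set \<Rightarrow> 'a \<Rightarrow> 'a) \<Rightarrow> ('a \<Rightarrow> ('b list \<Rightarrow>\<^sub>0 'k) set \<Rightarrow> 'a) \<Rightarrow>
    (('b list \<Rightarrow>\<^sub>0 'k) \<Rightarrow> 'a) \<Rightarrow> ('k, (('a + 'b) list \<Rightarrow>\<^sub>0 'k) set) superalgebra"
  where "ext_superalgebra \<AA> A0 A1 B0 B1 R lact ract fl =
    Lbs_rel (gsum A0 B0) (gsum A1 B1) (ext_relations \<AA> A0 A1 B0 B1 R lact ract fl)"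

text \<open>The element of \<open>E\<close> denoted \<open>x + g\<close> for \<open>x\<close> in \<open>\<AA>\<close> and \<open>g\<close> in the span of \<open>Irr(R)\<close>.\<close>

definition ext_elem ::
  "('k::field, 'a) superalgebra \<Rightarrow> 'a set \<Rightarrow> 'a set \<Rightarrow> 'b set \<Rightarrow> 'b set \<Rightarrow> ('b list \<Rightarrow>\<^sub>0 'k) set \<Rightarrow>
    (('b list \<Rightarrow>\<^sub>0 'k) set \<Rightarrow> 'a \<Rightarrow> 'a) \<Rightarrow> ('a \<Rightarrow> ('b list \<Rightarrow>\<^sub>0 'k) set \<Rightarrow> 'a) \<Rightarrow>
    (('b list \<Rightarrow>\<^sub>0 'k) \<Rightarrow> 'a) \<Rightarrow> 'a \<times> ('b list \<Rightarrow>\<^sub>0 'k) \<Rightarrow> (('a + 'b) list \<Rightarrow>\<^sub>0 'k) set"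
  where "ext_elem \<AA> A0 A1 B0 B1 R lact ract fl p =
    rel_class (gsum A0 B0) (gsum A1 B1) (ext_relations \<AA> A0 A1 B0 B1 R lact ract fl)
      (brace \<AA> (A0 \<union> A1) (fst p) + emb (snd p))"

section \<open>Freeness of \<open>Lbs X0 X1\<close>\<close>

definition linext :: "('y \<Rightarrow> ('z \<Rightarrow>\<^sub>0 'k::field)) \<Rightarrow> ('y \<Rightarrow>\<^sub>0 'k) \<Rightarrow> ('z \<Rightarrow>\<^sub>0 'k)"
  where "linext F f = (\<Sum>w\<in>Poly_Mapping.keys f. pscale (Poly_Mapping.lookup f w) (F w))"

lemma lookup_pscale [simp]: "Poly_Mapping.lookup (pscale c f) w = c * Poly_Mapping.lookup f w"
  by (simp add: pscale_def Poly_Mapping.map.rep_eq when_def)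

lemma pscale_simps [simp]:
  "pscale c 0 = 0" "pscale 0 f = 0" "pscale 1 f = f" "pscale c (pscale d f) = pscale (c * d) f"
  "pscale c (- f) = - pscale c f" "pscale (- c) f = - pscale c f"
  by (auto intro!: poly_mapping_eqI)

lemma pscale_distrib:
  "pscale c (f + g) = pscale c f + pscale c g" "pscale (c + d) f = pscale c f + pscale d f"
  "pscale c (f - g) = pscale c f - pscale c g" 
  by (auto intro!: poly_mapping_eqI simp: lookup_add lookup_minus algebra_simps)

lemma pscale_sum: "pscale c (sum F W) = (\<Sum>w\<in>W. pscale c (F w))"
  by (induction W rule: infinite_finite_induct) (auto simp: pscale_distrib)

lemma linext_superset:
  assumes "finite W" "Poly_Mapping.keys f \<subseteq> W"
  shows "linext F f = (\<Sum>w\<in>W. pscale (Poly_Mapping.lookup f w) (F w))"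
  unfolding linext_def using assms
  by (intro sum.mono_neutral_left) (auto simp: in_keys_iff)

lemma linext_add: "linext F (f + g) = linext F f + linext F g"
proof -
  let ?W = "Poly_Mapping.keys f \<union> Poly_Mapping.keys g"
  have "Poly_Mapping.keys (f + g) \<subseteq> ?W" by (rule Poly_Mapping.keys_add)
  then show ?thesis
    by (simp add: linext_superset[of ?W] lookup_add pscale_distrib sum.distrib)
qed

lemma keys_pscale: "Poly_Mapping.keys (pscale c f) \<subseteq> Poly_Mapping.keys f"
  by (auto simp: in_keys_iff)

lemma linext_pscale: "linext F (pscale c f) = pscale c (linext F f)"
  using keys_pscale[of c f]
  by (simp add: linext_superset[of "Poly_Mapping.keys f"] pscale_sum)

lemma linext_0 [simp]: "linext F 0 = 0"
  by (simp add: linext_def)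

lemma linext_uminus: "linext F (- f) = - linext F f"
  using linext_pscale[of F "-1" f] by simp

lemma linext_diff: "linext F (f - g) = linext F f - linext F g"
  using linext_add[of F f "-g"] by (simp add: linext_uminus)

lemma linext_wmono [simp]: "linext F (wmono w) = F w"
  by (simp add: linext_def wmono_def)

lemma linext_fun_add: "linext (\<lambda>w. F w + G w) f = linext F f + linext G f"
  by (simp add: linext_def pscale_distrib sum.distrib)

lemma linext_fun_pscale: "linext (\<lambda>w. pscale c (F w)) f = pscale c (linext F f)"
  by (simp add: linext_def pscale_sum mult.commute)

lemma push_eq: "push h f = linext (\<lambda>w. wmono (h w)) f"
  for h :: "'y \<Rightarrow> 'z list" and f :: "'y \<Rightarrow>\<^sub>0 'k::field"
proof -
  have "Poly_Mapping.single w c = pscale c (wmono w)" for w :: "'z list" and c :: 'k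
    by (auto intro!: poly_mapping_eqI simp: wmono_def lookup_single when_def)
  then show ?thesis by (simp add: push_def linext_def)
qed

lemma free_mult_eq: "free_mult X1 f g = linext (\<lambda>u. linext (word_mult X1 u) g) f"
  by (simp add: free_mult_def linext_def pscale_sum)

lemma free_mult_add:
  "free_mult X1 (f + f') g = free_mult X1 f g + free_mult X1 f' g"
  "free_mult X1 f (g + g') = free_mult X1 f g + free_mult X1 f g'"
  by (simp_all add: free_mult_eq linext_add linext_fun_add)

lemma free_mult_pscale:
  "free_mult X1 (pscale c f) g = pscale c (free_mult X1 f g)"
  "free_mult X1 f (pscale c g) = pscale c (free_mult X1 f g)"
  by (simp_all add: free_mult_eq linext_pscale linext_fun_pscale)

lemma free_mult_0 [simp]: "free_mult X1 0 g = 0" "free_mult X1 f 0 = 0"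
  by (simp_all add: free_mult_eq linext_def)

lemma free_mult_uminus:
  "free_mult X1 (- f) g = - free_mult X1 f g" "free_mult X1 f (- g) = - free_mult X1 f g"
  using free_mult_pscale(1)[of X1 "-1" f g] free_mult_pscale(2)[of X1 f "-1" g] by simp_all

lemma free_mult_diff:
  "free_mult X1 (f - f') g = free_mult X1 f g - free_mult X1 f' g"
  "free_mult X1 f (g - g') = free_mult X1 f g - free_mult X1 f g'"
  using free_mult_add(1)[of X1 f "-f'" g] free_mult_add(2)[of X1 f g "-g'"]
  by (simp_all add: free_mult_uminus)

lemma free_mult_wmono: "free_mult X1 (wmono u) (wmono v) = word_mult X1 u v"
  by (simp add: free_mult_eq)

lemma free_mult_gen: "free_mult X1 f (gen b) = push (\<lambda>w. w @ [b]) f"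
  by (simp add: free_mult_eq push_eq gen_def word_mult_def)

lemma wmono_snoc: "free_mult X1 (wmono v) (gen b) = wmono (v @ [b])"
  by (simp add: free_mult_gen push_eq)

lemma poly_word_induct:
  fixes f :: "'x list \<Rightarrow>\<^sub>0 'k::field"
  assumes "Poly_Mapping.keys f \<subseteq> W"
    and "P 0" "\<And>w. w \<in> W \<Longrightarrow> P (wmono w)"
    and "\<And>f g. P f \<Longrightarrow> P g \<Longrightarrow> P (f + g)"
    and "\<And>c f. P f \<Longrightarrow> P (pscale c f)"
  shows "P f"
proof -
  have *: "P (\<Sum>w\<in>V. pscale (Poly_Mapping.lookup f w) (wmono w))" if "finite V" "V \<subseteq> W" for V
    using that by (induction V rule: finite_induct) (auto intro!: assms)
  have "f = (\<Sum>w\<in>Poly_Mapping.keys f. pscale (Poly_Mapping.lookup f w) (wmono w))"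
    by (rule poly_mapping_eqI)
       (auto simp: lookup_sum wmono_def lookup_single when_def in_keys_iff if_distrib sum.delta' cong: if_cong)
  with *[of "Poly_Mapping.keys f"] assms(1) show ?thesis by simp
qed

lemma wpar_simps [simp]:
  "wpar X1 [] = 0" "wpar X1 (b # w) = lpar X1 b + wpar X1 w" "wpar X1 (v @ w) = wpar X1 v + wpar X1 w"
  by (simp_all add: wpar_def)

lemma wpar_rev [simp]: "wpar X1 (rev w) = wpar X1 w"
  by (simp add: wpar_def rev_map[symmetric])

lemma word_mult_snoc:
  assumes "v \<noteq> []"
  shows "word_mult X1 u (v @ [b]) = free_mult X1 (word_mult X1 u v) (gen b) -
    pscale (koszul (lpar X1 b) (wpar X1 v)) (word_mult X1 (u @ [b]) v)"
proof -
  obtain c w where w: "rev v = c # w" using assms by (cases "rev v") auto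
  have "wpar X1 (c # w) = wpar X1 v" by (metis w wpar_rev)
  then show ?thesis by (simp add: word_mult_def w free_mult_gen)
qed

lemma leibniz_letter_word:
  assumes "v \<noteq> []"
  shows "free_mult X1 f (wmono (v @ [b])) = free_mult X1 (free_mult X1 f (wmono v)) (gen b) -
    pscale (koszul (lpar X1 b) (wpar X1 v)) (free_mult X1 (free_mult X1 f (gen b)) (wmono v))"
proof (rule poly_word_induct[where W = UNIV and f = f])
  show "free_mult X1 (wmono w) (wmono (v @ [b])) =
      free_mult X1 (free_mult X1 (wmono w) (wmono v)) (gen b) -
      pscale (koszul (lpar X1 b) (wpar X1 v)) (free_mult X1 (free_mult X1 (wmono w) (gen b)) (wmono v))" for w
    using assms by (simp add: free_mult_wmono wmono_snoc word_mult_snoc)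
qed (simp_all add: free_mult_add free_mult_pscale pscale_distrib mult.commute)

lemma word_mult_keys:
  assumes "v \<noteq> []" "w \<in> Poly_Mapping.keys (word_mult X1 u v :: 'x list \<Rightarrow>\<^sub>0 'k::field)"
  shows "w \<noteq> [] \<and> set w = set u \<union> set v \<and> wpar X1 w = wpar X1 u + wpar X1 v"
  using assms
proof (induction v arbitrary: u w rule: rev_induct)
  case (snoc b v)
  show ?case
  proof (cases "v = []")
    case True
    with snoc.prems show ?thesis by (simp add: word_mult_def wmono_def)
  next
    case False
    let ?f = "word_mult X1 u v :: 'x list \<Rightarrow>\<^sub>0 'k"
    have keys_push: "Poly_Mapping.keys (push h f) \<subseteq> h ` Poly_Mapping.keys f" 
      for h :: "'x list \<Rightarrow> 'x list" and f :: "'x list \<Rightarrow>\<^sub>0 'k"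
    proof
      fix z assume "z \<in> Poly_Mapping.keys (push h f)"
      then obtain y where "y \<in> Poly_Mapping.keys f"
          "Poly_Mapping.lookup (Poly_Mapping.single (h y) (Poly_Mapping.lookup f y)) z \<noteq> 0"
        by (auto simp: in_keys_iff push_def lookup_sum dest: sum.not_neutral_contains_not_neutral)
      then show "z \<in> h ` Poly_Mapping.keys f" by (auto simp: lookup_single when_def split: if_splits)
    qed
    from snoc.prems(2) False
    have "w \<in> Poly_Mapping.keys (push (\<lambda>w. w @ [b]) ?f) \<or>
        w \<in> Poly_Mapping.keys (word_mult X1 (u @ [b]) v :: 'x list \<Rightarrow>\<^sub>0 'k)"
      by (auto simp: word_mult_snoc free_mult_gen in_keys_iff lookup_minus)
    then show ?thesis
    proof
      assume "w \<in> Poly_Mapping.keys (push (\<lambda>w. w @ [b]) ?f)"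
      then obtain y where "w = y @ [b]" "y \<in> Poly_Mapping.keys ?f" using keys_push by blast
      with snoc.IH[OF False] show ?thesis by (auto simp: add_ac)
    next
      assume "w \<in> Poly_Mapping.keys (word_mult X1 (u @ [b]) v :: 'x list \<Rightarrow>\<^sub>0 'k)"
      with snoc.IH[OF False] show ?thesis by (auto simp: add_ac)
    qed
  qed
qed simp

lemma leibniz_letter:
  assumes "\<forall>w\<in>Poly_Mapping.keys g. w \<noteq> [] \<and> wpar X1 w = j"
  shows "free_mult X1 f (free_mult X1 g (gen b)) = free_mult X1 (free_mult X1 f g) (gen b) -
    pscale (koszul (lpar X1 b) j) (free_mult X1 (free_mult X1 f (gen b)) g)"
proof (rule poly_word_induct[where W = "{w. w \<noteq> [] \<and> wpar X1 w = j}" and f = g])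
  show "free_mult X1 f (free_mult X1 (wmono w) (gen b)) =
      free_mult X1 (free_mult X1 f (wmono w)) (gen b) -
      pscale (koszul (lpar X1 b) j) (free_mult X1 (free_mult X1 f (gen b)) (wmono w))" 
    if "w \<in> {w. w \<noteq> [] \<and> wpar X1 w = j}" for w
    using that by (auto simp: wmono_snoc leibniz_letter_word)
qed (use assms in \<open>auto simp: free_mult_add free_mult_pscale pscale_distrib mult.commute\<close>)

lemma leibniz_words:
  assumes "v \<noteq> []" "w \<noteq> []"
  shows "free_mult X1 f (free_mult X1 (wmono v) (wmono w)) =
    free_mult X1 (free_mult X1 f (wmono v)) (wmono w) -
    pscale (koszul (wpar X1 w) (wpar X1 v)) (free_mult X1 (free_mult X1 f (wmono w)) (wmono v))"
  using assms
proof (induction w arbitrary: f v rule: rev_induct)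
  case (snoc b w)
  show ?case
  proof (cases "w = []")
    case True
    have 1: "wmono [b] = gen b" by (simp add: gen_def)
    have 2: "wpar X1 [b] = lpar X1 b" by simp
    show ?thesis unfolding True append_Nil 1 2 wmono_snoc
      by (rule leibniz_letter_word[OF snoc.prems(1)])
  next
    case False
    note IH = snoc.IH[OF _ False]
    let ?m = "free_mult X1"
    let ?v = "wmono v" and ?w = "wmono w" and ?b = "gen b"
    have 1: "?m f (wmono (w @ [b])) = ?m (?m f ?w) ?b - pscale (koszul (lpar X1 b) (wpar X1 w)) (?m (?m f ?b) ?w)"
      for f by (rule leibniz_letter_word[OF False])
    have 2: "?m f (?m (?m ?v ?w) ?b) = ?m (?m f (?m ?v ?w)) ?b -
        pscale (koszul (lpar X1 b) (wpar X1 v + wpar X1 w)) (?m (?m f ?b) (?m ?v ?w))"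
      by (rule leibniz_letter) (auto simp: free_mult_wmono dest: word_mult_keys[OF False])
    have 3: "?m f (?m (?m ?v ?b) ?w) = ?m (?m f (?m ?v ?b)) ?w -
        pscale (koszul (wpar X1 w) (wpar X1 v + lpar X1 b)) (?m (?m f ?w) (?m ?v ?b))"
      using IH[of "v @ [b]" f] by (simp add: wmono_snoc)
    have 4: "?m g (?m ?v ?b) = ?m (?m g ?v) ?b - pscale (koszul (lpar X1 b) (wpar X1 v)) (?m (?m g ?b) ?v)" for g
      by (rule leibniz_letter) (use snoc.prems in \<open>auto simp: wmono_def\<close>)
    show ?thesis
      unfolding 1 
      by (cases "wpar X1 v"; cases "wpar X1 w"; cases "lpar X1 b")
        (simp_all add: 2 3 4 IH[OF snoc.prems(1)] free_mult_diff free_mult_pscale free_mult_add free_mult_uminus pscale_distrib koszul_def)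
  qed
qed simp

lemma leibniz_free:
  assumes "\<forall>w\<in>Poly_Mapping.keys g. w \<noteq> [] \<and> wpar X1 w = j"
    and "\<forall>w\<in>Poly_Mapping.keys h. w \<noteq> [] \<and> wpar X1 w = l"
  shows "free_mult X1 f (free_mult X1 g h) = free_mult X1 (free_mult X1 f g) h -
    pscale (koszul l j) (free_mult X1 (free_mult X1 f h) g)"
proof (rule poly_word_induct[where W = "{w. w \<noteq> [] \<and> wpar X1 w = j}" and f = g])
  fix v assume v: "v \<in> {w. w \<noteq> [] \<and> wpar X1 w = j}"
  show "free_mult X1 f (free_mult X1 (wmono v) h) = free_mult X1 (free_mult X1 f (wmono v)) h -
    pscale (koszul l j) (free_mult X1 (free_mult X1 f h) (wmono v))"
    by (rule poly_word_induct[where W = "{w. w \<noteq> [] \<and> wpar X1 w = l}" and f = h])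
      (use assms v in \<open>auto simp: leibniz_words free_mult_add free_mult_pscale pscale_distrib mult.commute\<close>)
qed (use assms in \<open>auto simp: free_mult_add free_mult_pscale pscale_distrib mult.commute\<close>)

lemma Lbs_simps [simp]:
  "carrier (Lbs X0 X1) = {f. Poly_Mapping.keys f \<subseteq> NF (X0 \<union> X1)}"
  "monoid.mult (Lbs X0 X1) = free_mult X1" "ring.zero (Lbs X0 X1) = 0" "add (Lbs X0 X1) = (+)"
  "module.smult (Lbs X0 X1) = pscale"
  "hpart (Lbs X0 X1) i = {f. Poly_Mapping.keys f \<subseteq> NF (X0 \<union> X1) \<and> (\<forall>w\<in>Poly_Mapping.keys f. wpar X1 w = i)}"
  by (simp_all add: Lbs_def)

lemma scalar_ring_simps [simp]:
  "carrier (ring_of_type_algebra :: 'k::field ring) = UNIV"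
  "monoid.mult (ring_of_type_algebra :: 'k::field ring) = (*)"
  "add (ring_of_type_algebra :: 'k::field ring) = (+)"
  "one (ring_of_type_algebra :: 'k::field ring) = 1"
  "ring.zero (ring_of_type_algebra :: 'k::field ring) = 0"
  by (simp_all add: ring_of_type_algebra_def)

lemma keys_subset_closed:
  fixes f g :: "'y \<Rightarrow>\<^sub>0 'k::field"
  assumes "Poly_Mapping.keys f \<subseteq> W"
  shows "Poly_Mapping.keys g \<subseteq> W \<Longrightarrow> Poly_Mapping.keys (f + g) \<subseteq> W"
    and "Poly_Mapping.keys (pscale c f) \<subseteq> W"
    and "Poly_Mapping.keys (- f) \<subseteq> W"
    and "Poly_Mapping.keys g \<subseteq> W \<Longrightarrow> Poly_Mapping.keys (f - g) \<subseteq> W"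
  using assms Poly_Mapping.keys_add[of f g] Poly_Mapping.keys_add[of f "- g"] keys_pscale[of c f]
    keys_pscale[of "- 1" f] keys_pscale[of "- 1" g]
  by auto

lemma keys_sum_subset:
  "(\<And>w. w \<in> V \<Longrightarrow> Poly_Mapping.keys (F w) \<subseteq> W) \<Longrightarrow> Poly_Mapping.keys (sum F V) \<subseteq> W"
  for F :: "'a \<Rightarrow> ('b \<Rightarrow>\<^sub>0 'k::field)"
proof (induction V rule: infinite_finite_induct)
  case (insert x V)
  then show ?case using keys_subset_closed(1)[of "F x" W "sum F V"] by simp
qed simp_all

lemma keys_free_mult:
  assumes "Poly_Mapping.keys f \<subseteq> NF Y" "Poly_Mapping.keys g \<subseteq> NF Y"
    "w \<in> Poly_Mapping.keys (free_mult X1 f g)"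
  obtains u v where "u \<in> Poly_Mapping.keys f" "v \<in> Poly_Mapping.keys g" "w \<in> NF Y"
    "wpar X1 w = wpar X1 u + wpar X1 v"
proof -
  let ?W = "{w. \<exists>u\<in>Poly_Mapping.keys f. \<exists>v\<in>Poly_Mapping.keys g.
    w \<in> NF Y \<and> wpar X1 w = wpar X1 u + wpar X1 v}"
  have "Poly_Mapping.keys (free_mult X1 f g) \<subseteq> ?W"
    unfolding free_mult_def
  proof (intro keys_sum_subset keys_subset_closed(2) subsetI)
    fix u v w assume a: "u \<in> Poly_Mapping.keys f" "v \<in> Poly_Mapping.keys g"
      "w \<in> Poly_Mapping.keys (word_mult X1 u v :: 'a list \<Rightarrow>\<^sub>0 'b)"
    then have "u \<in> NF Y" "v \<in> NF Y" using assms by auto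
    with word_mult_keys[OF _ a(3)] have
      "w \<in> NF Y \<and> wpar X1 w = wpar X1 u + wpar X1 v" by (auto simp: NF_def)
    with a show "w \<in> ?W" by blast
  qed
  with assms(3) that show thesis by blast
qed

lemma abelian_group_Lbs: "abelian_group (Lbs X0 X1 :: ('k::field, 'x list \<Rightarrow>\<^sub>0 'k) superalgebra)"
proof (rule abelian_groupI)
  fix x assume "x \<in> carrier (Lbs X0 X1 :: ('k::field, 'x list \<Rightarrow>\<^sub>0 'k) superalgebra)"
  then show "\<exists>y\<in>carrier (Lbs X0 X1). y \<oplus>\<^bsub>Lbs X0 X1\<^esub> x = \<zero>\<^bsub>Lbs X0 X1\<^esub>"
    by (intro bexI[of _ "- x"]) auto
qed (simp_all add: add_ac keys_subset_closed(1))

lemma module_Lbs: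
  "module (ring_of_type_algebra :: 'k ring) (Lbs X0 X1 :: ('k::field, 'x list \<Rightarrow>\<^sub>0 'k) superalgebra)"
  by (intro moduleI abelian_group_Lbs)
    (auto simp: pscale_distrib keys_subset_closed(2) cring_from_type_algebra)

lemma Lbs_uminus [simp]:
  assumes "Poly_Mapping.keys f \<subseteq> NF (X0 \<union> X1)"
  shows "\<ominus>\<^bsub>Lbs X0 X1\<^esub> f = - f"
proof -
  interpret abelian_group "Lbs X0 X1 :: ('b, 'a list \<Rightarrow>\<^sub>0 'b) superalgebra" by (rule abelian_group_Lbs)
  show ?thesis using assms by (intro minus_equality) auto
qed

lemma superspace_Lbs: "superspace (Lbs X0 X1 :: ('k::field, 'x list \<Rightarrow>\<^sub>0 'k) superalgebra)"
proof -
  let ?L = "Lbs X0 X1 :: ('k, 'x list \<Rightarrow>\<^sub>0 'k) superalgebra"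
  interpret module "ring_of_type_algebra :: 'k ring" ?L by (rule module_Lbs)
  show ?thesis
  proof (intro superspace.intro superspace_axioms.intro module_Lbs)
    fix i
    let ?W = "{w \<in> NF (X0 \<union> X1). wpar X1 w = i}"
    have eq: "hpart ?L i = {f. Poly_Mapping.keys f \<subseteq> ?W}" by auto
    show "submodule (hpart ?L i) (ring_of_type_algebra :: 'k ring) ?L"
    proof (rule submoduleI)
      show "\<ominus>\<^bsub>?L\<^esub> a \<in> hpart ?L i" if "a \<in> hpart ?L i" for a
        using that by simp
      show "a \<oplus>\<^bsub>?L\<^esub> b \<in> hpart ?L i" if "a \<in> hpart ?L i" "b \<in> hpart ?L i" for a b
        using that keys_subset_closed(1)[of a ?W b] unfolding eq by simp
      show "c \<odot>\<^bsub>?L\<^esub> a \<in> hpart ?L i" if "a \<in> hpart ?L i" for c a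
        using that keys_subset_closed(2)[of a ?W c] unfolding eq by simp
    qed auto
  next
    fix f assume f: "f \<in> carrier ?L"
    define part where "part i = linext (\<lambda>w. if wpar X1 w = i then wmono w else 0) f" for i
    have "linext (wmono :: 'x list \<Rightarrow> _) f = f"
      by (rule poly_word_induct[where W = UNIV and f = f]) (simp_all add: linext_add linext_pscale)
    moreover have "(\<lambda>w. (if wpar X1 w = 0 then wmono w else 0) + (if wpar X1 w = 1 then wmono w else 0)) =
        (wmono :: 'x list \<Rightarrow> ('x list \<Rightarrow>\<^sub>0 'k))"
      by (auto simp: fun_eq_iff)
    ultimately have sum: "f = part 0 + part 1"
      unfolding part_def linext_fun_add[symmetric] by simp
    have part: "part i \<in> hpart ?L i" for i
    proof -
      have "Poly_Mapping.keys (part i) \<subseteq> {w \<in> NF (X0 \<union> X1). wpar X1 w = i}"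
        unfolding part_def linext_def using f
        by (intro keys_sum_subset keys_subset_closed(2)) (auto simp: wmono_def)
      then show ?thesis by auto
    qed
    have uniq: "g = 0" if "g \<in> hpart ?L 0" "g \<in> hpart ?L 1" for g
    proof -
      have "Poly_Mapping.keys g = {}" using that by force
      then show ?thesis by simp
    qed
    show "\<exists>!p. p \<in> hpart ?L 0 \<times> hpart ?L 1 \<and> f = fst p \<oplus>\<^bsub>?L\<^esub> snd p"
    proof (rule ex1I[of _ "(part 0, part 1)"])
      show "(part 0, part 1) \<in> hpart ?L 0 \<times> hpart ?L 1 \<and>
          f = fst (part 0, part 1) \<oplus>\<^bsub>?L\<^esub> snd (part 0, part 1)"
        using part[of 0] part[of 1] sum by simp
    next
      fix p assume p: "p \<in> hpart ?L 0 \<times> hpart ?L 1 \<and> f = fst p \<oplus>\<^bsub>?L\<^esub> snd p"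
      let ?g = "fst p - part 0"
      have eq: "?g = part 1 - snd p" using p sum by (auto simp: algebra_simps)
      have mem: "a - b \<in> hpart ?L i" if "a \<in> hpart ?L i" "b \<in> hpart ?L i" for a b i
        using that keys_subset_closed(4)[of a "{w \<in> NF (X0 \<union> X1). wpar X1 w = i}" b] by auto
      have "?g \<in> hpart ?L 0" using p part[of 0] by (intro mem) auto
      moreover have "?g \<in> hpart ?L 1" unfolding eq using p part[of 1] by (intro mem) auto
      ultimately have "?g = 0" by (rule uniq)
      with eq show "p = (part 0, part 1)" by (auto simp: prod_eq_iff)
    qed
  qed
qed

theorem leibniz_superalgebra_Lbs:
  "leibniz_superalgebra (Lbs X0 X1 :: ('k::field, 'x list \<Rightarrow>\<^sub>0 'k) superalgebra)"
proof -
  let ?L = "Lbs X0 X1 :: ('k, 'x list \<Rightarrow>\<^sub>0 'k) superalgebra"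
  interpret superspace ?L by (rule superspace_Lbs)
  interpret superalgebra ?L
  proof
    show "x \<otimes>\<^bsub>?L\<^esub> y \<in> carrier ?L" if "x \<in> carrier ?L" "y \<in> carrier ?L" for x y
      using that by (auto elim: keys_free_mult[of x "X0 \<union> X1" y])
    show "x \<otimes>\<^bsub>?L\<^esub> y \<in> hpart ?L (i + j)" if "x \<in> hpart ?L i" "y \<in> hpart ?L j" for x y i j
    proof -
      have "w \<in> NF (X0 \<union> X1) \<and> wpar X1 w = i + j" if "w \<in> Poly_Mapping.keys (free_mult X1 x y)" for w
        using \<open>x \<in> hpart ?L i\<close> \<open>y \<in> hpart ?L j\<close> that 
        by (elim keys_free_mult[of x "X0 \<union> X1" y w X1, rotated 2]) auto
      then show ?thesis by auto
    qed
  qed (simp_all add: free_mult_add free_mult_pscale)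
  show ?thesis
  proof
    fix x y z i j l
    assume a: "x \<in> hpart ?L i" "y \<in> hpart ?L j" "z \<in> hpart ?L l"
    then have "x \<in> carrier ?L" "y \<in> carrier ?L" "z \<in> carrier ?L" by auto
    then have "free_mult X1 (free_mult X1 x z) y \<in> carrier ?L"
      using prod_closed[of "free_mult X1 x z" y] prod_closed[of x z] by simp
    then have "pscale (koszul l j) (free_mult X1 (free_mult X1 x z) y) \<in> carrier ?L"
      using keys_subset_closed(2)[of _ "NF (X0 \<union> X1)"] by simp
    then have "Poly_Mapping.keys (pscale (koszul l j) (free_mult X1 (free_mult X1 x z) y)) \<subseteq> NF (X0 \<union> X1)"
      by simp
    then have "free_mult X1 (free_mult X1 x y) z \<ominus>\<^bsub>?L\<^esub>
        pscale (koszul l j) (free_mult X1 (free_mult X1 x z) y) =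
        free_mult X1 (free_mult X1 x y) z - pscale (koszul l j) (free_mult X1 (free_mult X1 x z) y)"
      by (simp add: a_minus_def)
    moreover have "free_mult X1 x (free_mult X1 y z) = \<dots> "
      using a by (intro leibniz_free) (auto simp: NF_def)
    ultimately show "x \<otimes>\<^bsub>?L\<^esub> (y \<otimes>\<^bsub>?L\<^esub> z) =
      ((x \<otimes>\<^bsub>?L\<^esub> y) \<otimes>\<^bsub>?L\<^esub> z) \<ominus>\<^bsub>?L\<^esub> (koszul l j \<odot>\<^bsub>?L\<^esub> ((x \<otimes>\<^bsub>?L\<^esub> z) \<otimes>\<^bsub>?L\<^esub> y))"
      by simp
  qed
qed

lemma lnorm_gen:
  "lnorm (Lbs X0 X1 :: ('k::field, 'x list \<Rightarrow>\<^sub>0 'k) superalgebra) (gen a) (map gen as) = wmono (a # as)"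
proof (induction as rule: rev_induct)
  case Nil
  show ?case by (simp add: lnorm_def gen_def)
next
  case (snoc x xs)
  then show ?case using wmono_snoc[of X1 "a # xs" x] by (simp add: lnorm_def)
qed

context leibniz_superalgebra
begin

lemma hpart_carrier: "x \<in> hpart V i \<Longrightarrow> x \<in> carrier V"
  using submoduleE(1)[OF hpart_submodule] by blast

lemma scale_closed: "x \<in> carrier V \<Longrightarrow> (c::'k) \<odot>\<^bsub>V\<^esub> x \<in> carrier V"
  by (rule smult_closed) simp_all

lemma scale_simps:
  "x \<in> carrier V \<Longrightarrow> ((c::'k) + d) \<odot>\<^bsub>V\<^esub> x = c \<odot>\<^bsub>V\<^esub> x \<oplus>\<^bsub>V\<^esub> d \<odot>\<^bsub>V\<^esub> x"
  "x \<in> carrier V \<Longrightarrow> (c * d) \<odot>\<^bsub>V\<^esub> x = c \<odot>\<^bsub>V\<^esub> (d \<odot>\<^bsub>V\<^esub> x)"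
  "x \<in> carrier V \<Longrightarrow> (0::'k) \<odot>\<^bsub>V\<^esub> x = \<zero>\<^bsub>V\<^esub>"
  "x \<in> carrier V \<Longrightarrow> (1::'k) \<odot>\<^bsub>V\<^esub> x = x"
  using smult_l_distr[of c d x] smult_assoc1[of c d x] smult_l_null[of x] smult_one[of x] by simp_all

lemma Lbs_hom_unique:
  fixes X0 X1 :: "'x set"
  assumes "\<phi> \<in> superalg_hom (Lbs X0 X1) V" "\<psi> \<in> superalg_hom (Lbs X0 X1) V"
    and gens: "\<And>x. x \<in> X0 \<union> X1 \<Longrightarrow> \<phi> (gen x) = \<psi> (gen x)"
    and f: "f \<in> carrier (Lbs X0 X1)"
  shows "\<phi> f = \<psi> f"
proof -
  let ?L = "Lbs X0 X1 :: ('k, 'x list \<Rightarrow>\<^sub>0 'k) superalgebra"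
  have hom: "\<chi> (f + h) = \<chi> f \<oplus>\<^bsub>V\<^esub> \<chi> h" "\<chi> (pscale c f) = c \<odot>\<^bsub>V\<^esub> \<chi> f"
      "\<chi> (free_mult X1 f h) = \<chi> f \<otimes>\<^bsub>V\<^esub> \<chi> h" "\<chi> f \<in> carrier V"
    if "\<chi> \<in> superalg_hom ?L V" "f \<in> carrier ?L" "h \<in> carrier ?L" for \<chi> c f h
    using that by (auto simp: superalg_hom_def linear_maps_def)
  have word: "\<phi> (wmono w) = \<psi> (wmono w)" if "w \<in> NF (X0 \<union> X1)" for w
    using that
  proof (induction w rule: rev_induct)
    case (snoc b w)
    show ?case
    proof (cases "w = []")
      case True
      with snoc.prems gens[of b] show ?thesis by (simp add: gen_def NF_def)
    next
      case False
      with snoc.prems have "w \<in> NF (X0 \<union> X1)" "b \<in> X0 \<union> X1" by (auto simp: NF_def)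
      moreover from this have "wmono w \<in> carrier ?L" "gen b \<in> carrier ?L"
        by (auto simp: gen_def wmono_def NF_def)
      ultimately show ?thesis
        using snoc.IH gens[of b] hom(3)[OF assms(1)] hom(3)[OF assms(2)]
        by (simp only: wmono_snoc[of X1, symmetric])
    qed
  qed (simp add: NF_def)
  have zero: "\<chi> 0 = \<zero>\<^bsub>V\<^esub>" if "\<chi> \<in> superalg_hom ?L V" for \<chi>
    using hom(2)[OF that, of 0 0 0] hom(4)[OF that, of 0 0] by (simp add: scale_simps)
  have "f \<in> carrier ?L \<and> \<phi> f = \<psi> f"
  proof (rule poly_word_induct[where W = "NF (X0 \<union> X1)" and f = f])
    show "f + h \<in> carrier ?L \<and> \<phi> (f + h) = \<psi> (f + h)"
      if "f \<in> carrier ?L \<and> \<phi> f = \<psi> f" "h \<in> carrier ?L \<and> \<phi> h = \<psi> h" for f h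
      using that hom(1)[OF assms(1), of f h] hom(1)[OF assms(2), of f h]
      by (simp add: keys_subset_closed(1))
    show "pscale c f \<in> carrier ?L \<and> \<phi> (pscale c f) = \<psi> (pscale c f)"
      if "f \<in> carrier ?L \<and> \<phi> f = \<psi> f" for c f
      using that hom(2)[OF assms(1), of f f c] hom(2)[OF assms(2), of f f c]
      by (simp add: keys_subset_closed(2))
    show "0 \<in> carrier ?L \<and> \<phi> 0 = \<psi> 0" using zero[OF assms(1)] zero[OF assms(2)] by simp
    show "wmono w \<in> carrier ?L \<and> \<phi> (wmono w) = \<psi> (wmono w)" if "w \<in> NF (X0 \<union> X1)" for w
      using that word by (simp add: wmono_def)
  qed (use f in simp)
  then show ?thesis ..
qed

lemma Lbs_hom_exists:
  fixes X0 X1 :: "'x set"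
  assumes "X0 \<inter> X1 = {}"
    and g: "\<And>x. x \<in> X0 \<Longrightarrow> g x \<in> hpart V 0" "\<And>x. x \<in> X1 \<Longrightarrow> g x \<in> hpart V 1"
  shows "\<exists>\<phi>\<in>superalg_hom (Lbs X0 X1) V. \<forall>x\<in>X0 \<union> X1. \<phi> (gen x) = g x"
proof -
  let ?L = "Lbs X0 X1 :: ('k, 'x list \<Rightarrow>\<^sub>0 'k) superalgebra"
  let ?N = "NF (X0 \<union> X1)"
  define \<Phi> where "\<Phi> w = lnorm V (g (hd w)) (map g (tl w))" for w
  define \<phi> where "\<phi> f = (\<Oplus>\<^bsub>V\<^esub>w\<in>Poly_Mapping.keys f. Poly_Mapping.lookup f w \<odot>\<^bsub>V\<^esub> \<Phi> w)" for f :: "'x list \<Rightarrow>\<^sub>0 'k"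
  have gpar: "g x \<in> hpart V (lpar X1 x)" if "x \<in> X0 \<union> X1" for x
    using that g assms(1) by (auto simp: lpar_def)
  have \<Phi>1: "\<Phi> [b] = g b" for b by (simp add: \<Phi>_def lnorm_def)
  have \<Phi>_snoc: "\<Phi> (w @ [b]) = \<Phi> w \<otimes>\<^bsub>V\<^esub> g b" if "w \<noteq> []" for w b
    using that by (simp add: \<Phi>_def lnorm_def)
  have \<Phi>_par: "\<Phi> w \<in> hpart V (wpar X1 w)" if "w \<in> ?N" for w
    using that
  proof (induction w rule: rev_induct)
    case (snoc b w)
    then have b: "g b \<in> hpart V (lpar X1 b)" by (intro gpar) (auto simp: NF_def)
    show ?case
    proof (cases "w = []")
      case True
      moreover have "wpar X1 [b] = lpar X1 b" by simp
      ultimately show ?thesis using b by (simp only: append_Nil \<Phi>1)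
    next
      case False
      then have "\<Phi> w \<in> hpart V (wpar X1 w)" using snoc by (auto simp: NF_def)
      from prod_hpart[OF this b] show ?thesis unfolding \<Phi>_snoc[OF False] wpar_simps by simp
    qed
  qed (simp add: NF_def)
  then have \<Phi>_closed: "\<Phi> w \<in> carrier V" if "w \<in> ?N" for w
    using that hpart_carrier by blast
  have sup: "\<phi> f = (\<Oplus>\<^bsub>V\<^esub>w\<in>W. Poly_Mapping.lookup f w \<odot>\<^bsub>V\<^esub> \<Phi> w)"
    if "finite W" "Poly_Mapping.keys f \<subseteq> W" "W \<subseteq> ?N" for f W
    unfolding \<phi>_def using that
    by (intro add.finprod_mono_neutral_cong_left)
      (auto simp: in_keys_iff scale_simps \<Phi>_closed subset_iff intro!: scale_closed \<Phi>_closed)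
  have closed: "\<phi> f \<in> carrier V" if "f \<in> carrier ?L" for f
    unfolding \<phi>_def using that by (intro finsum_closed) (auto intro!: scale_closed \<Phi>_closed)
  have add: "\<phi> (f + h) = \<phi> f \<oplus>\<^bsub>V\<^esub> \<phi> h" if "f \<in> carrier ?L" "h \<in> carrier ?L" for f h
  proof -
    let ?W = "Poly_Mapping.keys f \<union> Poly_Mapping.keys h"
    have W: "finite ?W" "?W \<subseteq> ?N" using that by auto
    have "\<phi> (f + h) = (\<Oplus>\<^bsub>V\<^esub>w\<in>?W. Poly_Mapping.lookup f w \<odot>\<^bsub>V\<^esub> \<Phi> w \<oplus>\<^bsub>V\<^esub> Poly_Mapping.lookup h w \<odot>\<^bsub>V\<^esub> \<Phi> w)"
      unfolding sup[OF W(1) Poly_Mapping.keys_add W(2)] using W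
      by (intro add.finprod_cong') (auto simp: lookup_add scale_simps \<Phi>_closed subset_iff intro!: scale_closed)
    also have "\<dots> = \<phi> f \<oplus>\<^bsub>V\<^esub> \<phi> h"
      unfolding sup[OF W(1) Un_upper1 W(2)] sup[OF W(1) Un_upper2 W(2)] using W
      by (intro finsum_addf) (auto intro!: scale_closed \<Phi>_closed)
    finally show ?thesis .
  qed
  have scale: "\<phi> (pscale c f) = c \<odot>\<^bsub>V\<^esub> \<phi> f" if "f \<in> carrier ?L" for c f
  proof -
    let ?W = "Poly_Mapping.keys f"
    have W: "finite ?W" "?W \<subseteq> ?N" using that by auto
    have "c \<odot>\<^bsub>V\<^esub> \<phi> f = (\<Oplus>\<^bsub>V\<^esub>w\<in>?W. c \<odot>\<^bsub>V\<^esub> (Poly_Mapping.lookup f w \<odot>\<^bsub>V\<^esub> \<Phi> w))"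
      unfolding \<phi>_def using W by (intro finsum_smult_ldistr) (auto intro!: scale_closed \<Phi>_closed)
    also have "\<dots> = \<phi> (pscale c f)"
      unfolding sup[OF W(1) keys_pscale W(2)] using W
      by (intro add.finprod_cong') (auto simp: scale_simps \<Phi>_closed subset_iff intro!: scale_closed)
    finally show ?thesis ..
  qed
  have word: "\<phi> (wmono w) = \<Phi> w" if "w \<in> ?N" for w
    using that by (simp add: \<phi>_def wmono_def scale_simps \<Phi>_closed)
  have zero: "\<phi> 0 = \<zero>\<^bsub>V\<^esub>" by (simp add: \<phi>_def)
  have minus: "\<phi> (f - h) = \<phi> f \<ominus>\<^bsub>V\<^esub> \<phi> h" if "f \<in> carrier ?L" "h \<in> carrier ?L" for f h
  proof -
    have "\<phi> (f - h) \<oplus>\<^bsub>V\<^esub> \<phi> h = \<phi> f"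
      using add[of "f - h" h] that by (simp add: keys_subset_closed(4))
    then show ?thesis using closed[of f] closed[of h] closed[of "f - h"] that
      by (metis Lbs_simps(1) keys_subset_closed(4) mem_Collect_eq add.inv_solve_right' minus_eq)
  qed
  interpret L: leibniz_superalgebra ?L by (rule leibniz_superalgebra_Lbs)
  have wc: "wmono w \<in> carrier ?L" if "w \<in> ?N" for w using that by (simp add: wmono_def)
  have lift: "\<phi> (free_mult X1 f h) = \<phi> f \<otimes>\<^bsub>V\<^esub> \<phi> h"
    if *: "\<And>u. u \<in> ?N \<Longrightarrow> \<phi> (free_mult X1 (wmono u) h) = \<Phi> u \<otimes>\<^bsub>V\<^esub> \<phi> h"
      and f: "f \<in> carrier ?L" and h: "h \<in> carrier ?L" for f h
  proof -
    have m: "free_mult X1 f h \<in> carrier ?L" if "f \<in> carrier ?L" for f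
      using L.prod_closed[OF that h] by simp
    have "f \<in> carrier ?L \<and> \<phi> (free_mult X1 f h) = \<phi> f \<otimes>\<^bsub>V\<^esub> \<phi> h"
    proof (rule poly_word_induct[where W = ?N and f = f])
      show "0 \<in> carrier ?L \<and> \<phi> (free_mult X1 0 h) = \<phi> 0 \<otimes>\<^bsub>V\<^esub> \<phi> h"
        using scale[of 0 0] prod_smult_left[of "\<phi> 0" "\<phi> h" 0] closed[of 0] closed[OF h]
          prod_closed[of "\<phi> 0" "\<phi> h"] by (simp add: zero scale_simps)
      show "f1 + f2 \<in> carrier ?L \<and> \<phi> (free_mult X1 (f1 + f2) h) = \<phi> (f1 + f2) \<otimes>\<^bsub>V\<^esub> \<phi> h"
        if "f1 \<in> carrier ?L \<and> \<phi> (free_mult X1 f1 h) = \<phi> f1 \<otimes>\<^bsub>V\<^esub> \<phi> h"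
          "f2 \<in> carrier ?L \<and> \<phi> (free_mult X1 f2 h) = \<phi> f2 \<otimes>\<^bsub>V\<^esub> \<phi> h" for f1 f2
        using that m[of f1] m[of f2] closed h
        by (auto simp: add free_mult_add prod_add_left keys_subset_closed(1) simp del: Lbs_simps)
          (simp add: keys_subset_closed(1))
      show "pscale c f1 \<in> carrier ?L \<and> \<phi> (free_mult X1 (pscale c f1) h) = \<phi> (pscale c f1) \<otimes>\<^bsub>V\<^esub> \<phi> h"
        if "f1 \<in> carrier ?L \<and> \<phi> (free_mult X1 f1 h) = \<phi> f1 \<otimes>\<^bsub>V\<^esub> \<phi> h" for c f1
        using that m[of f1] closed h
        by (auto simp: scale free_mult_pscale prod_smult_left simp del: Lbs_simps)
          (simp add: keys_subset_closed(2))
    qed (use f wc * word in auto)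
    then show ?thesis ..
  qed
  have words: "\<phi> (free_mult X1 (wmono u) (wmono v)) = \<Phi> u \<otimes>\<^bsub>V\<^esub> \<Phi> v" if "u \<in> ?N" "v \<in> ?N" for u v
    using that(2,1)
  proof (induction v arbitrary: u rule: rev_induct)
    case (snoc b v)
    then have b: "b \<in> X0 \<union> X1" by (auto simp: NF_def)
    have ub: "u @ [b] \<in> ?N" "\<Phi> (u @ [b]) = \<Phi> u \<otimes>\<^bsub>V\<^esub> g b"
      using b snoc.prems by (auto simp: NF_def \<Phi>_snoc)
    show ?case
    proof (cases "v = []")
      case True
      have "free_mult X1 (wmono u) (wmono [b]) = (wmono (u @ [b]) :: 'x list \<Rightarrow>\<^sub>0 'k)"
        using wmono_snoc[of X1 u b] by (simp add: gen_def)
      with True ub show ?thesis by (simp only: append_Nil \<Phi>1 word)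
    next
      case False
      then have v: "v \<in> ?N" using snoc.prems by (auto simp: NF_def)
      note IH = snoc.IH[OF v]
      have gb: "gen b \<in> carrier ?L" "\<phi> (gen b) = g b"
        using b wc[of "[b]"] word[of "[b]"] by (auto simp: gen_def NF_def \<Phi>1)
      let ?p = "free_mult X1 (free_mult X1 (wmono u) (wmono v)) (gen b)"
      let ?q = "free_mult X1 (wmono (u @ [b])) (wmono v)"
      let ?k = "koszul (lpar X1 b) (wpar X1 v) :: 'k"
      have uv: "free_mult X1 (wmono u) (wmono v) \<in> carrier ?L"
        using L.prod_closed[OF wc wc, of u v] snoc.prems v by simp
      have p: "?p \<in> carrier ?L" using L.prod_closed[OF uv gb(1)] by simp
      have q: "?q \<in> carrier ?L" using L.prod_closed[OF wc wc, of "u @ [b]" v] ub v by simp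
      have kq: "pscale ?k ?q \<in> carrier ?L" using q by (simp add: keys_subset_closed(2))
      have "\<phi> (free_mult X1 w (gen b)) = \<phi> w \<otimes>\<^bsub>V\<^esub> \<phi> (gen b)" if "w \<in> carrier ?L" for w
      proof (rule lift[OF _ that gb(1)])
        fix u assume "u \<in> ?N"
        moreover from this b have "u @ [b] \<in> ?N" "u \<noteq> []" by (auto simp: NF_def)
        ultimately show "\<phi> (free_mult X1 (wmono u) (gen b)) = \<Phi> u \<otimes>\<^bsub>V\<^esub> \<phi> (gen b)"
          by (simp add: wmono_snoc word \<Phi>_snoc gb)
      qed
      from this[OF uv] have \<phi>p: "\<phi> ?p = (\<Phi> u \<otimes>\<^bsub>V\<^esub> \<Phi> v) \<otimes>\<^bsub>V\<^esub> g b"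
        using IH[OF snoc.prems(2)] gb by simp
      have \<phi>q: "\<phi> ?q = (\<Phi> u \<otimes>\<^bsub>V\<^esub> g b) \<otimes>\<^bsub>V\<^esub> \<Phi> v" using IH[OF ub(1)] ub(2) by simp
      have "free_mult X1 (wmono u) (wmono (v @ [b])) = ?p - pscale ?k ?q"
        using leibniz_letter_word[OF False, of X1 "wmono u" b] by (simp only: wmono_snoc)
      then have "\<phi> (free_mult X1 (wmono u) (wmono (v @ [b]))) =
          ((\<Phi> u \<otimes>\<^bsub>V\<^esub> \<Phi> v) \<otimes>\<^bsub>V\<^esub> g b) \<ominus>\<^bsub>V\<^esub> (?k \<odot>\<^bsub>V\<^esub> ((\<Phi> u \<otimes>\<^bsub>V\<^esub> g b) \<otimes>\<^bsub>V\<^esub> \<Phi> v))"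
        by (simp only: minus[OF p kq] scale[OF q] \<phi>p \<phi>q)
      also have "\<dots> = \<Phi> u \<otimes>\<^bsub>V\<^esub> (\<Phi> v \<otimes>\<^bsub>V\<^esub> g b)"
        using leibniz[OF \<Phi>_par[OF snoc.prems(2)] \<Phi>_par[OF v] gpar[OF b]] ..
      finally show ?thesis unfolding \<Phi>_snoc[OF False] .
    qed
  qed (simp add: NF_def)
  have mult: "\<phi> (free_mult X1 f h) = \<phi> f \<otimes>\<^bsub>V\<^esub> \<phi> h" if f: "f \<in> carrier ?L" and h: "h \<in> carrier ?L" for f h
  proof (rule lift[OF _ f h])
    fix u assume u: "u \<in> ?N"
    have m: "free_mult X1 (wmono u) h \<in> carrier ?L" if "h \<in> carrier ?L" for h
      using L.prod_closed[OF wc[OF u] that] by simp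
    note uc = \<Phi>_closed[OF u]
    have "h \<in> carrier ?L \<and> \<phi> (free_mult X1 (wmono u) h) = \<Phi> u \<otimes>\<^bsub>V\<^esub> \<phi> h"
    proof (rule poly_word_induct[where W = ?N and f = h])
      show "0 \<in> carrier ?L \<and> \<phi> (free_mult X1 (wmono u) 0) = \<Phi> u \<otimes>\<^bsub>V\<^esub> \<phi> 0"
        using prod_smult_right[OF uc, of "\<phi> 0" 0] closed[of 0] prod_closed[OF uc, of "\<phi> 0"]
        by (simp add: zero scale_simps)
      show "f1 + f2 \<in> carrier ?L \<and> \<phi> (free_mult X1 (wmono u) (f1 + f2)) = \<Phi> u \<otimes>\<^bsub>V\<^esub> \<phi> (f1 + f2)"
        if "f1 \<in> carrier ?L \<and> \<phi> (free_mult X1 (wmono u) f1) = \<Phi> u \<otimes>\<^bsub>V\<^esub> \<phi> f1"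
          "f2 \<in> carrier ?L \<and> \<phi> (free_mult X1 (wmono u) f2) = \<Phi> u \<otimes>\<^bsub>V\<^esub> \<phi> f2" for f1 f2
        using that m[of f1] m[of f2] closed uc
        by (auto simp: add free_mult_add prod_add_right simp del: Lbs_simps)
          (simp add: keys_subset_closed(1))
      show "pscale c f1 \<in> carrier ?L \<and> \<phi> (free_mult X1 (wmono u) (pscale c f1)) = \<Phi> u \<otimes>\<^bsub>V\<^esub> \<phi> (pscale c f1)"
        if "f1 \<in> carrier ?L \<and> \<phi> (free_mult X1 (wmono u) f1) = \<Phi> u \<otimes>\<^bsub>V\<^esub> \<phi> f1" for c f1
        using that m[of f1] closed uc
        by (auto simp: scale free_mult_pscale prod_smult_right simp del: Lbs_simps)
          (simp add: keys_subset_closed(2))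
    qed (use h wc words[OF u] word in auto)
    then show "\<phi> (free_mult X1 (wmono u) h) = \<Phi> u \<otimes>\<^bsub>V\<^esub> \<phi> h" ..
  qed
  have par: "\<phi> f \<in> hpart V i" if "f \<in> hpart ?L i" for f i
  proof -
    have "f \<in> carrier ?L \<and> \<phi> f \<in> hpart V i"
    proof (rule poly_word_induct[where W = "{w \<in> ?N. wpar X1 w = i}" and f = f])
      note sm = submoduleE[OF hpart_submodule[of i]]
      show "0 \<in> carrier ?L \<and> \<phi> 0 \<in> hpart V i"
        using sm(2) sm(4)[of 0] sm(1) by (auto simp: zero) (metis scale_simps(3) subsetD)
      show "f1 + f2 \<in> carrier ?L \<and> \<phi> (f1 + f2) \<in> hpart V i"
        if "f1 \<in> carrier ?L \<and> \<phi> f1 \<in> hpart V i" "f2 \<in> carrier ?L \<and> \<phi> f2 \<in> hpart V i" for f1 f2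
        using that add[of f1 f2] sm(5)[of "\<phi> f1" "\<phi> f2"] by (simp add: keys_subset_closed(1))
      show "pscale c f1 \<in> carrier ?L \<and> \<phi> (pscale c f1) \<in> hpart V i"
        if "f1 \<in> carrier ?L \<and> \<phi> f1 \<in> hpart V i" for c f1
        using that scale[of f1 c] sm(4)[of c "\<phi> f1"] by (simp add: keys_subset_closed(2))
      show "wmono w \<in> carrier ?L \<and> \<phi> (wmono w) \<in> hpart V i" if "w \<in> {w \<in> ?N. wpar X1 w = i}" for w
        using that wc word \<Phi>_par[of w] by auto
    qed (use that in auto)
    then show ?thesis ..
  qed
  have "\<phi> \<in> superalg_hom ?L V"
    using closed add scale par mult unfolding superalg_hom_def linear_maps_def
    by (simp add: image_subset_iff Pi_iff)
  moreover have "\<forall>x\<in>X0 \<union> X1. \<phi> (gen x) = g x"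
  proof
    fix x assume "x \<in> X0 \<union> X1"
    then have "[x] \<in> ?N" by (simp add: NF_def)
    then show "\<phi> (gen x) = g x" using word[of "[x]"] by (simp add: gen_def \<Phi>1)
  qed
  ultimately show ?thesis by blast
qed

end

theorem Lbs_universal:
  fixes L :: "('k::field, 'v) superalgebra"
  assumes "leibniz_superalgebra L" and "X0 \<inter> X1 = {}"
    and "\<And>x. x \<in> X0 \<Longrightarrow> g x \<in> hpart L 0" and "\<And>x. x \<in> X1 \<Longrightarrow> g x \<in> hpart L 1"
  shows "\<exists>\<phi>\<in>superalg_hom (Lbs X0 X1) L. (\<forall>x\<in>X0 \<union> X1. \<phi> (gen x) = g x) \<and>
    (\<forall>\<psi>\<in>superalg_hom (Lbs X0 X1) L. (\<forall>x\<in>X0 \<union> X1. \<psi> (gen x) = g x) \<longrightarrow>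
      (\<forall>f\<in>carrier (Lbs X0 X1). \<psi> f = \<phi> f))"
proof -
  interpret leibniz_superalgebra L by fact
  obtain \<phi> where \<phi>: "\<phi> \<in> superalg_hom (Lbs X0 X1) L" "\<forall>x\<in>X0 \<union> X1. \<phi> (gen x) = g x"
    using Lbs_hom_exists[OF assms(2), of g] assms(3,4) by blast
  have "\<psi> f = \<phi> f" if "\<psi> \<in> superalg_hom (Lbs X0 X1) L" "\<forall>x\<in>X0 \<union> X1. \<psi> (gen x) = g x"
    "f \<in> carrier (Lbs X0 X1)" for \<psi> f
    by (rule Lbs_hom_unique[OF that(1) \<phi>(1) _ that(3)]) (use \<phi>(2) that(2) in simp)
  with \<phi> show ?thesis by blast
qed

end

theory Submission
  imports Defs
begin

text \<open>
  Write \<open>L\<close> for the free algebra on \<open>B\<close> and \<open>I\<close> for its ideal generated by \<open>R\<close>. Since \<open>R\<close> is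
  reduced, a normal polynomial \<open>[s c\<^sub>1 \<dots> c\<^sub>n]\<^sub>L\<close> is determined by its leading monomial, so the normal
  polynomials form a basis of \<open>I\<close>, and \<open>L\<close> is the direct sum of \<open>I\<close> and the span of \<open>Irr(R)\<close>. Hence
  \<open>[s c\<^sub>1 \<dots> c\<^sub>n]\<^sub>L \<mapsto> \<lfloor>s\<rfloor> \<cdot> c\<^sub>1 \<dots> c\<^sub>n\<close> defines a linear map \<open>F\<close> from \<open>I\<close> to \<open>\<AA>\<close>; the condition on the data
  says exactly that \<open>F\<close> is a map of \<open>L\<close>-bimodules. Then \<open>J = {(- F h, h) | h \<in> I}\<close> is an ideal of the
  split extension of \<open>L\<close> by \<open>\<AA>\<close>, and a rewriting argument in the free algebra on \<open>A \<union> B\<close> shows that \<open>E\<close> is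
  the quotient of this split extension by \<open>J\<close>; its structure can be read off. Conversely, given an
  extension, lift the generators in \<open>B\<close> to a homomorphism \<open>\<sigma>\<close> on \<open>L\<close>, let \<open>\<lfloor>f\<rfloor>\<close> be \<open>\<sigma> f\<close>, and let \<open>\<BB>\<close> act
  on \<open>\<AA>\<close> by multiplication with preimages.
\<close>

section \<open>Superspaces, homomorphisms and quotients\<close>

text \<open>The extension need not split over \<BB>, and \<lfloor>f\<rfloor> measures the failure:
  it is the value at f of a lift of the generators. Over the free algebra \<open>L\<close> there is
  no such obstruction, which is why the actions are pulled back to \<open>L\<close> before anything
  is built. In these terms E is the pushout of the inclusion of \<open>I\<close> into
  \<open>L\<close> along \<open>F\<close>; the sign in \<open>J\<close> is there because the
  quotient has to identify h with \<open>F h\<close>. The compatibility condition speaks only of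
  words times elements of \<open>R\<close>, but it controls all left multiplications: the Leibniz
  identity moves a left factor past the last letter of a left-normed product, at the price of a term
  with a longer left factor, and the module axioms have the same shape. That the relations on A
  \<union> B have no further consequences is not shown by examining their compositions; the
  homomorphism to the split extension detects every nonzero normal form x + d. The delicate point is
  the exact size of \<open>I\<close>: prescribing \<open>F\<close> on normal polynomials requires
  them to be a basis of the ideal, which comes from a unitriangular change of basis of
  \<open>L\<close>.\<close>

lemma (in abelian_group) minus_zero_iff:
  assumes "x \<in> carrier G" "y \<in> carrier G"
  shows "x \<ominus> y = \<zero> \<longleftrightarrow> x = y"
proof
  assume "x \<ominus> y = \<zero>"
  then have "x \<oplus> \<ominus> y \<oplus> y = \<zero> \<oplus> y" by (simp add: minus_eq)
  then show "x = y" using assms by (simp add: a_assoc l_neg)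
qed (use assms in \<open>simp add: minus_eq r_neg\<close>)

section \<open>Consequences of the vector space and grading axioms\<close>

context superspace
begin

lemma smult_in_carrier [simp, intro]: "x \<in> carrier V \<Longrightarrow> (c::'k) \<odot>\<^bsub>V\<^esub> x \<in> carrier V"
  by (rule smult_closed) simp_all

lemma smult_laws:
  "x \<in> carrier V \<Longrightarrow> ((c::'k) + d) \<odot>\<^bsub>V\<^esub> x = c \<odot>\<^bsub>V\<^esub> x \<oplus>\<^bsub>V\<^esub> d \<odot>\<^bsub>V\<^esub> x"
  "x \<in> carrier V \<Longrightarrow> (c * d) \<odot>\<^bsub>V\<^esub> x = c \<odot>\<^bsub>V\<^esub> (d \<odot>\<^bsub>V\<^esub> x)"
  "x \<in> carrier V \<Longrightarrow> (0::'k) \<odot>\<^bsub>V\<^esub> x = \<zero>\<^bsub>V\<^esub>"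
  "x \<in> carrier V \<Longrightarrow> (1::'k) \<odot>\<^bsub>V\<^esub> x = x"
  "x \<in> carrier V \<Longrightarrow> (- 1::'k) \<odot>\<^bsub>V\<^esub> x = \<ominus>\<^bsub>V\<^esub> x"
  "(c::'k) \<odot>\<^bsub>V\<^esub> \<zero>\<^bsub>V\<^esub> = \<zero>\<^bsub>V\<^esub>"
  "\<lbrakk>x \<in> carrier V; y \<in> carrier V\<rbrakk> \<Longrightarrow> c \<odot>\<^bsub>V\<^esub> (x \<oplus>\<^bsub>V\<^esub> y) = c \<odot>\<^bsub>V\<^esub> x \<oplus>\<^bsub>V\<^esub> c \<odot>\<^bsub>V\<^esub> y"
  "x \<in> carrier V \<Longrightarrow> c \<odot>\<^bsub>V\<^esub> (\<ominus>\<^bsub>V\<^esub> x) = \<ominus>\<^bsub>V\<^esub> (c \<odot>\<^bsub>V\<^esub> x)"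
proof -
  show add: "x \<in> carrier V \<Longrightarrow> ((c::'k) + d) \<odot>\<^bsub>V\<^esub> x = c \<odot>\<^bsub>V\<^esub> x \<oplus>\<^bsub>V\<^esub> d \<odot>\<^bsub>V\<^esub> x" for x c d
    using smult_l_distr[of c d x] by simp
  show "x \<in> carrier V \<Longrightarrow> (c * d) \<odot>\<^bsub>V\<^esub> x = c \<odot>\<^bsub>V\<^esub> (d \<odot>\<^bsub>V\<^esub> x)"
    using smult_assoc1[of c d x] by simp
  show zero: "x \<in> carrier V \<Longrightarrow> (0::'k) \<odot>\<^bsub>V\<^esub> x = \<zero>\<^bsub>V\<^esub>" for x
    using smult_l_null[of x] by simp
  show one: "x \<in> carrier V \<Longrightarrow> (1::'k) \<odot>\<^bsub>V\<^esub> x = x" for x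
    using smult_one[of x] by simp
  show "x \<in> carrier V \<Longrightarrow> (- 1::'k) \<odot>\<^bsub>V\<^esub> x = \<ominus>\<^bsub>V\<^esub> x"
    using add[of x "-1" 1] by (intro minus_equality[symmetric]) (simp_all add: zero one)
  show "(c::'k) \<odot>\<^bsub>V\<^esub> \<zero>\<^bsub>V\<^esub> = \<zero>\<^bsub>V\<^esub>" using smult_r_null[of c] by simp
  show "\<lbrakk>x \<in> carrier V; y \<in> carrier V\<rbrakk> \<Longrightarrow> c \<odot>\<^bsub>V\<^esub> (x \<oplus>\<^bsub>V\<^esub> y) = c \<odot>\<^bsub>V\<^esub> x \<oplus>\<^bsub>V\<^esub> c \<odot>\<^bsub>V\<^esub> y"
    using smult_r_distr[of c x y] by simp
  show "x \<in> carrier V \<Longrightarrow> c \<odot>\<^bsub>V\<^esub> (\<ominus>\<^bsub>V\<^esub> x) = \<ominus>\<^bsub>V\<^esub> (c \<odot>\<^bsub>V\<^esub> x)"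
    using smult_r_minus[of c x] by simp
qed

lemma hpart_subset: "x \<in> hpart V i \<Longrightarrow> x \<in> carrier V"
  using submoduleE(1)[OF hpart_submodule] by blast

lemma hpart_zero: "\<zero>\<^bsub>V\<^esub> \<in> hpart V i"
proof -
  obtain x where x: "x \<in> hpart V i" using submoduleE(2)[OF hpart_submodule] by blast
  then have "(0::'k) \<odot>\<^bsub>V\<^esub> x \<in> hpart V i" using submoduleE(4)[OF hpart_submodule, of 0 x] by simp
  then show ?thesis using smult_laws(3)[OF hpart_subset[OF x]] by simp
qed

lemma hpart_closed:
  "\<lbrakk>x \<in> hpart V i; y \<in> hpart V i\<rbrakk> \<Longrightarrow> x \<oplus>\<^bsub>V\<^esub> y \<in> hpart V i"
  "x \<in> hpart V i \<Longrightarrow> (c::'k) \<odot>\<^bsub>V\<^esub> x \<in> hpart V i"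
  "x \<in> hpart V i \<Longrightarrow> \<ominus>\<^bsub>V\<^esub> x \<in> hpart V i"
  "\<lbrakk>x \<in> hpart V i; y \<in> hpart V i\<rbrakk> \<Longrightarrow> x \<ominus>\<^bsub>V\<^esub> y \<in> hpart V i"
  using submoduleE[OF hpart_submodule[of i]] by (auto simp: minus_eq)

text \<open>Writing the two parities as i and i + 1 lets later arguments treat the even and the odd
  case at once; the locale assumption names only 0 and 1.\<close>

lemma hpart_split:
  assumes "v \<in> carrier V"
  obtains y z where "y \<in> hpart V i" "z \<in> hpart V (i + 1)" "v = y \<oplus>\<^bsub>V\<^esub> z"
proof -
  obtain p where "p \<in> hpart V 0 \<times> hpart V 1" "v = fst p \<oplus>\<^bsub>V\<^esub> snd p"
    using hpart_decomp[OF assms] by blast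
  then obtain y z where yz: "y \<in> hpart V 0" "z \<in> hpart V 1" "v = y \<oplus>\<^bsub>V\<^esub> z"
    by (metis mem_Times_iff)
  show thesis
  proof (cases i)
    case zero with yz that[of y z] show ?thesis by simp
  next
    case one with yz that[of z y] show ?thesis by (simp add: a_comm hpart_subset)
  qed
qed

lemma hpart_split_unique:
  assumes "y \<in> hpart V i" "z \<in> hpart V (i + 1)" "y' \<in> hpart V i" "z' \<in> hpart V (i + 1)"
    and eq: "y \<oplus>\<^bsub>V\<^esub> z = y' \<oplus>\<^bsub>V\<^esub> z'"
  shows "y = y' \<and> z = z'"
proof -
  have *: "a = a' \<and> b = b'" if "a \<in> hpart V 0" "b \<in> hpart V 1" "a' \<in> hpart V 0" "b' \<in> hpart V 1"
    "a \<oplus>\<^bsub>V\<^esub> b = a' \<oplus>\<^bsub>V\<^esub> b'" for a b a' b'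
  proof -
    have "a \<oplus>\<^bsub>V\<^esub> b \<in> carrier V" using that hpart_subset by blast
    from hpart_decomp[OF this] that have "(a, b) = (a', b')"
      by (elim ex1E) (metis fst_conv mem_Sigma_iff snd_conv)
    then show ?thesis by simp
  qed
  show ?thesis
  proof (cases i)
    case zero with *[of y z y' z'] assms show ?thesis by simp
  next
    case one with *[of z y z' y'] assms show ?thesis by (simp add: a_comm hpart_subset)
  qed
qed

lemma hpart_sum_zero:
  assumes "y \<in> hpart V i" "z \<in> hpart V (i + 1)" "y \<oplus>\<^bsub>V\<^esub> z = \<zero>\<^bsub>V\<^esub>"
  shows "y = \<zero>\<^bsub>V\<^esub>" "z = \<zero>\<^bsub>V\<^esub>"
  using hpart_split_unique[OF assms(1,2) hpart_zero hpart_zero] assms(3) by simp_all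

text \<open>Used on images: after splitting an element and applying a parity-preserving map, the
  component of the wrong parity must vanish when the sum is known to be homogeneous.\<close>

lemma hpart_sum_mem:
  assumes "y \<in> hpart V i" "z \<in> hpart V (i + 1)" "y \<oplus>\<^bsub>V\<^esub> z \<in> hpart V i"
  shows "z = \<zero>\<^bsub>V\<^esub>"
  using hpart_split_unique[OF assms(1,2) assms(3) hpart_zero] assms hpart_subset by simp

end

section \<open>Linear maps, homomorphisms and isomorphisms\<close>

lemma linear_mapsD:
  assumes "\<phi> \<in> linear_maps V W"
  shows "x \<in> carrier V \<Longrightarrow> \<phi> x \<in> carrier W"
    and "\<lbrakk>x \<in> carrier V; y \<in> carrier V\<rbrakk> \<Longrightarrow> \<phi> (x \<oplus>\<^bsub>V\<^esub> y) = \<phi> x \<oplus>\<^bsub>W\<^esub> \<phi> y"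
    and "x \<in> carrier V \<Longrightarrow> \<phi> (c \<odot>\<^bsub>V\<^esub> x) = c \<odot>\<^bsub>W\<^esub> \<phi> x"
  using assms by (auto simp: linear_maps_def)

lemma superalg_homD:
  assumes "\<phi> \<in> superalg_hom V W"
  shows "\<phi> \<in> linear_maps V W"
    and "x \<in> carrier V \<Longrightarrow> \<phi> x \<in> carrier W"
    and "\<lbrakk>x \<in> carrier V; y \<in> carrier V\<rbrakk> \<Longrightarrow> \<phi> (x \<oplus>\<^bsub>V\<^esub> y) = \<phi> x \<oplus>\<^bsub>W\<^esub> \<phi> y"
    and "x \<in> carrier V \<Longrightarrow> \<phi> (c \<odot>\<^bsub>V\<^esub> x) = c \<odot>\<^bsub>W\<^esub> \<phi> x"
    and "\<lbrakk>x \<in> carrier V; y \<in> carrier V\<rbrakk> \<Longrightarrow> \<phi> (x \<otimes>\<^bsub>V\<^esub> y) = \<phi> x \<otimes>\<^bsub>W\<^esub> \<phi> y"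
    and "x \<in> hpart V i \<Longrightarrow> \<phi> x \<in> hpart W i"
  using assms unfolding superalg_hom_def linear_maps_def by (blast, blast, blast, blast, blast, blast)

lemma linear_maps_group:
  fixes V :: "('k::field, 'v) superalgebra" and W :: "('k, 'w) superalgebra"
  assumes "superspace V" "superspace W" "\<phi> \<in> linear_maps V W"
  shows "\<phi> \<zero>\<^bsub>V\<^esub> = \<zero>\<^bsub>W\<^esub>"
    and "x \<in> carrier V \<Longrightarrow> \<phi> (\<ominus>\<^bsub>V\<^esub> x) = \<ominus>\<^bsub>W\<^esub> \<phi> x"
    and "\<lbrakk>x \<in> carrier V; y \<in> carrier V\<rbrakk> \<Longrightarrow> \<phi> (x \<ominus>\<^bsub>V\<^esub> y) = \<phi> x \<ominus>\<^bsub>W\<^esub> \<phi> y"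
proof -
  interpret V: superspace V by fact
  interpret W: superspace W by fact
  note \<phi> = linear_mapsD[OF assms(3)]
  show "\<phi> \<zero>\<^bsub>V\<^esub> = \<zero>\<^bsub>W\<^esub>"
    using \<phi>(3)[of "\<zero>\<^bsub>V\<^esub>" 0] \<phi>(1)[of "\<zero>\<^bsub>V\<^esub>"] by (simp add: V.smult_laws W.smult_laws)
  show neg: "x \<in> carrier V \<Longrightarrow> \<phi> (\<ominus>\<^bsub>V\<^esub> x) = \<ominus>\<^bsub>W\<^esub> \<phi> x" for x
    using \<phi>(3)[of x "-1"] \<phi>(1)[of x] by (simp add: V.smult_laws W.smult_laws)
  show "\<lbrakk>x \<in> carrier V; y \<in> carrier V\<rbrakk> \<Longrightarrow> \<phi> (x \<ominus>\<^bsub>V\<^esub> y) = \<phi> x \<ominus>\<^bsub>W\<^esub> \<phi> y"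
    using \<phi>(2)[of x "\<ominus>\<^bsub>V\<^esub> y"] neg[of y] by (simp add: V.minus_eq W.minus_eq)
qed

lemma superalg_hom_comp:
  "\<lbrakk>\<phi> \<in> superalg_hom U V; \<psi> \<in> superalg_hom V W\<rbrakk> \<Longrightarrow> \<psi> \<circ> \<phi> \<in> superalg_hom U W"
  unfolding superalg_hom_def linear_maps_def by (auto simp: Pi_iff image_subset_iff)

text \<open>Only parity needs an argument: if y is homogeneous, the component of the wrong parity of
  its preimage is mapped to zero, and then vanishes by injectivity.\<close>

lemma superalg_hom_inv:
  fixes V :: "('k::field, 'v) superalgebra" and W :: "('k, 'w) superalgebra"
  assumes "superalgebra V" "superspace W"
    and \<phi>: "\<phi> \<in> superalg_hom V W" "bij_betw \<phi> (carrier V) (carrier W)"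
  shows "inv_into (carrier V) \<phi> \<in> superalg_hom W V"
proof -
  interpret V: superalgebra V by fact
  interpret W: superspace W by fact
  let ?g = "inv_into (carrier V) \<phi>"
  note hom = superalg_homD[OF \<phi>(1)]
  have g: "y \<in> carrier W \<Longrightarrow> ?g y \<in> carrier V" "y \<in> carrier W \<Longrightarrow> \<phi> (?g y) = y" for y
    using \<phi>(2) by (metis bij_betw_def inv_into_into, metis bij_betw_inv_into_right)
  have gI: "?g y = x" if "x \<in> carrier V" "\<phi> x = y" for x y
    using that \<phi>(2) by (metis bij_betw_inv_into_left)
  have par: "?g y \<in> hpart V i" if y: "y \<in> hpart W i" for y i
  proof -
    have yc: "y \<in> carrier W" using y by (rule W.hpart_subset)
    obtain u v where uv: "u \<in> hpart V i" "v \<in> hpart V (i + 1)" "?g y = u \<oplus>\<^bsub>V\<^esub> v"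
      using V.hpart_split[OF g(1)[OF yc]] .
    have "y = \<phi> u \<oplus>\<^bsub>W\<^esub> \<phi> v" using hom(3)[of u v] uv g(2)[OF yc] V.hpart_subset by simp
    then have "\<phi> v = \<zero>\<^bsub>W\<^esub>"
      using W.hpart_sum_mem[OF hom(6)[OF uv(1)] hom(6)[OF uv(2)]] y by simp
    moreover have "\<phi> \<zero>\<^bsub>V\<^esub> = \<zero>\<^bsub>W\<^esub>"
      by (rule linear_maps_group(1)[OF V.superspace_axioms W.superspace_axioms hom(1)])
    ultimately have "v = \<zero>\<^bsub>V\<^esub>" using \<phi>(2) V.hpart_subset[OF uv(2)] V.zero_closed
      unfolding bij_betw_def inj_on_def by metis
    with uv V.hpart_subset show ?thesis by simp
  qed
  show ?thesis unfolding superalg_hom_def linear_maps_def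
    using g par by (auto intro!: gI simp: hom)
      (auto intro!: V.prod_closed)
qed

lemma superalg_iso_sym:
  fixes V :: "('k::field, 'v) superalgebra" and W :: "('k, 'w) superalgebra"
  assumes "superalgebra V" "superspace W" "superalg_iso V W"
  shows "superalg_iso W V"
  using assms superalg_hom_inv[OF assms(1,2)] bij_betw_inv_into
  unfolding superalg_iso_def by blast

text \<open>The inclusion is composed with the inverse isomorphism and the projection with the
  isomorphism itself. This reduces one direction of the theorem to the presented algebra.\<close>

lemma is_extension_iso:
  fixes E :: "('k::field, 'e) superalgebra" and E' :: "('k, 'f) superalgebra"
  assumes E: "leibniz_superalgebra E" and "superalg_iso E E'" and ext: "is_extension E' B A"
  shows "is_extension E B A"
proof -
  have E': "leibniz_superalgebra E'" and A: "leibniz_superalgebra A" and B: "leibniz_superalgebra B"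
    using ext by (auto simp: is_extension_def)
  interpret E: leibniz_superalgebra E by fact
  interpret E': leibniz_superalgebra E' by fact
  interpret A: leibniz_superalgebra A by fact
  obtain \<phi> where \<phi>: "\<phi> \<in> superalg_hom E E'" "bij_betw \<phi> (carrier E) (carrier E')"
    using assms(2) by (auto simp: superalg_iso_def)
  obtain \<iota> \<pi> where \<iota>: "\<iota> \<in> superalg_hom A E'" "inj_on \<iota> (carrier A)" and \<pi>: "\<pi> \<in> superalg_hom E' B"
    and ex: "\<iota> ` carrier A = {x \<in> carrier E'. \<pi> x = \<zero>\<^bsub>B\<^esub>}" "\<pi> ` carrier E' = carrier B"
    using ext by (auto simp: is_extension_def)
  let ?g = "inv_into (carrier E) \<phi>"
  have g: "?g \<in> superalg_hom E' E"
    by (rule superalg_hom_inv[OF E.superalgebra_axioms E'.superspace_axioms \<phi>])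
  have bij: "bij_betw ?g (carrier E') (carrier E)" by (rule bij_betw_inv_into[OF \<phi>(2)])
  have sub: "\<iota> ` carrier A \<subseteq> carrier E'" using ex by blast
  have gr: "y \<in> carrier E' \<Longrightarrow> \<phi> (?g y) = y" for y
    using \<phi>(2) by (metis bij_betw_inv_into_right)
  have gl: "x \<in> carrier E \<Longrightarrow> ?g (\<phi> x) = x" for x
    using \<phi>(2) by (metis bij_betw_inv_into_left)
  have "inj_on (?g \<circ> \<iota>) (carrier A)"
    using \<iota>(2) bij sub by (meson bij_betw_def comp_inj_on inj_on_subset)
  moreover have "(?g \<circ> \<iota>) ` carrier A = {x \<in> carrier E. (\<pi> \<circ> \<phi>) x = \<zero>\<^bsub>B\<^esub>}"
    unfolding image_comp[symmetric] ex(1) using superalg_homD(2)[OF \<phi>(1)] superalg_homD(2)[OF g] gr gl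
    by (auto simp: image_iff) metis
  moreover have "(\<pi> \<circ> \<phi>) ` carrier E = carrier B"
    unfolding image_comp[symmetric] using \<phi>(2) ex(2) by (simp add: bij_betw_def)
  ultimately show ?thesis unfolding is_extension_def
    using A B E superalg_hom_comp[OF \<iota>(1) g] superalg_hom_comp[OF \<phi>(1) \<pi>] by blast
qed

text \<open>The grading of the image is a direct sum precisely because the kernel is graded.\<close>

lemma leibniz_superalgebra_image:
  fixes V :: "('k::field, 'v) superalgebra" and W :: "('k, 'w) superalgebra"
  assumes "leibniz_superalgebra V"
    and hom: "\<phi> \<in> linear_maps V W" "\<And>x y. \<lbrakk>x \<in> carrier V; y \<in> carrier V\<rbrakk> \<Longrightarrow> \<phi> (x \<otimes>\<^bsub>V\<^esub> y) = \<phi> x \<otimes>\<^bsub>W\<^esub> \<phi> y"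
    and car: "carrier W = \<phi> ` carrier V" and hp: "\<And>i. hpart W i = \<phi> ` hpart V i"
    and zero: "\<zero>\<^bsub>W\<^esub> = \<phi> \<zero>\<^bsub>V\<^esub>"
    and graded: "\<And>y z. \<lbrakk>y \<in> hpart V 0; z \<in> hpart V 1; \<phi> (y \<oplus>\<^bsub>V\<^esub> z) = \<zero>\<^bsub>W\<^esub>\<rbrakk> \<Longrightarrow> \<phi> y = \<zero>\<^bsub>W\<^esub>"
  shows "leibniz_superalgebra W"
proof -
  interpret V: leibniz_superalgebra V by fact
  note \<phi> = linear_mapsD[OF hom(1)]
  note a = V.hpart_subset
  have grp: "abelian_group W"
  proof (rule abelian_groupI)
    fix x assume "x \<in> carrier W"
    then obtain x' where x': "x' \<in> carrier V" "x = \<phi> x'" unfolding car by blast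
    then have "\<phi> (\<ominus>\<^bsub>V\<^esub> x') \<oplus>\<^bsub>W\<^esub> x = \<zero>\<^bsub>W\<^esub>" using \<phi>(2)[of "\<ominus>\<^bsub>V\<^esub> x'" x'] by (simp add: V.l_neg zero)
    then show "\<exists>y\<in>carrier W. y \<oplus>\<^bsub>W\<^esub> x = \<zero>\<^bsub>W\<^esub>" unfolding car using x' by blast
  qed (auto simp: car zero \<phi>(2)[symmetric] V.a_ac intro!: imageI)
  interpret W: abelian_group W by (rule grp)
  have mod: "module (ring_of_type_algebra :: 'k ring) W"
    by (rule moduleI[OF cring_from_type_algebra grp])
      (auto simp: car \<phi>(2,3)[symmetric] V.smult_laws intro!: imageI)
  interpret W: module "ring_of_type_algebra :: 'k ring" W by (rule mod)
  have neg: "\<ominus>\<^bsub>W\<^esub> (\<phi> x) = \<phi> (\<ominus>\<^bsub>V\<^esub> x)" if "x \<in> carrier V" for x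
    using that \<phi>(2)[of "\<ominus>\<^bsub>V\<^esub> x" x] car by (intro W.minus_equality) (auto simp: V.l_neg zero)
  have minus: "\<phi> (x \<ominus>\<^bsub>V\<^esub> y) = \<phi> x \<ominus>\<^bsub>W\<^esub> \<phi> y" if "x \<in> carrier V" "y \<in> carrier V" for x y
    using that \<phi>(2)[of x "\<ominus>\<^bsub>V\<^esub> y"] by (simp add: V.minus_eq W.minus_eq neg)
  have sub: "submodule (hpart W i) (ring_of_type_algebra :: 'k ring) W" for i
  proof (rule W.submoduleI)
    show "hpart W i \<subseteq> carrier W" using a by (auto simp: hp car)
    show "\<zero>\<^bsub>W\<^esub> \<in> hpart W i" using V.hpart_zero by (auto simp: hp zero)
    show "\<ominus>\<^bsub>W\<^esub> x \<in> hpart W i" if "x \<in> hpart W i" for x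
      using that by (auto simp: hp neg a intro!: imageI V.hpart_closed)
    show "x \<oplus>\<^bsub>W\<^esub> y \<in> hpart W i" if "x \<in> hpart W i" "y \<in> hpart W i" for x y
      using that by (auto simp: hp \<phi>(2)[symmetric] a intro!: imageI V.hpart_closed)
    show "c \<odot>\<^bsub>W\<^esub> x \<in> hpart W i" if "x \<in> hpart W i" for c x
      using that by (auto simp: hp \<phi>(3)[symmetric] a intro!: imageI V.hpart_closed)
  qed
  have decomp: "\<exists>!p. p \<in> hpart W 0 \<times> hpart W 1 \<and> v = fst p \<oplus>\<^bsub>W\<^esub> snd p" if v: "v \<in> carrier W" for v
  proof -
    obtain v' where v': "v' \<in> carrier V" "v = \<phi> v'" using v car by blast
    obtain y z where yz: "y \<in> hpart V 0" "z \<in> hpart V 1" "v' = y \<oplus>\<^bsub>V\<^esub> z"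
      using V.hpart_split[OF v'(1), of 0] by auto
    show ?thesis
    proof (rule ex1I[of _ "(\<phi> y, \<phi> z)"])
      show "(\<phi> y, \<phi> z) \<in> hpart W 0 \<times> hpart W 1 \<and> v = fst (\<phi> y, \<phi> z) \<oplus>\<^bsub>W\<^esub> snd (\<phi> y, \<phi> z)"
        using yz v' by (auto simp: hp \<phi>(2) a)
    next
      fix p assume p: "p \<in> hpart W 0 \<times> hpart W 1 \<and> v = fst p \<oplus>\<^bsub>W\<^esub> snd p"
      then obtain y' z' where yz': "y' \<in> hpart V 0" "z' \<in> hpart V 1" "p = (\<phi> y', \<phi> z')"
        by (auto simp: hp)
      have c: "y \<in> carrier V" "z \<in> carrier V" "y' \<in> carrier V" "z' \<in> carrier V" using yz yz' a by auto
      have eq: "\<phi> (y \<oplus>\<^bsub>V\<^esub> z) = \<phi> (y' \<oplus>\<^bsub>V\<^esub> z')" using p yz' v' yz c by (simp add: \<phi>(2))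
      \<comment> \<open>Two decompositions of v are compared through their differences: the even
        difference plus the odd difference lies in the kernel, so \<open>graded\<close> makes the
        image of the even one vanish.\<close>
      have "(y \<ominus>\<^bsub>V\<^esub> y') \<oplus>\<^bsub>V\<^esub> (z \<ominus>\<^bsub>V\<^esub> z') = (y \<oplus>\<^bsub>V\<^esub> z) \<ominus>\<^bsub>V\<^esub> (y' \<oplus>\<^bsub>V\<^esub> z')"
        using c by (simp add: V.minus_eq V.minus_add V.a_ac)
      then have "\<phi> ((y \<ominus>\<^bsub>V\<^esub> y') \<oplus>\<^bsub>V\<^esub> (z \<ominus>\<^bsub>V\<^esub> z')) = \<zero>\<^bsub>W\<^esub>"
        using c eq car by (simp add: minus W.minus_eq W.r_neg)
      then have "\<phi> (y \<ominus>\<^bsub>V\<^esub> y') = \<zero>\<^bsub>W\<^esub>"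
        by (rule graded[rotated 2]) (use yz yz' in \<open>auto intro: V.hpart_closed\<close>)
      then have "\<phi> y = \<phi> y'"
        using c car W.minus_zero_iff[of "\<phi> y" "\<phi> y'"] by (simp add: minus)
      moreover from this have "\<phi> z = \<phi> z'" 
        using eq c car W.add.l_cancel[of "\<phi> y'" "\<phi> z" "\<phi> z'"] by (auto simp: \<phi>(2))
      ultimately show "p = (\<phi> y, \<phi> z)" using yz' by simp
    qed
  qed
  interpret W: superspace W by (intro superspace.intro superspace_axioms.intro mod sub decomp)
  have "superalgebra W"
  proof (intro superalgebra.intro superalgebra_axioms.intro W.superspace_axioms)
    show "x \<otimes>\<^bsub>W\<^esub> y \<in> hpart W (i + j)" if xy: "x \<in> hpart W i" "y \<in> hpart W j" for x y i j
    proof -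
      obtain x' y' where x': "x' \<in> hpart V i" "y' \<in> hpart V j" "x = \<phi> x'" "y = \<phi> y'"
        using xy by (auto simp: hp)
      then show ?thesis using V.prod_hpart[OF x'(1,2)] by (simp add: hp hom(2)[symmetric] a)
    qed
  qed (auto simp: car hom(2)[symmetric] \<phi>(2,3)[symmetric] V.prod_closed V.prod_add_left V.prod_add_right
      V.prod_smult_left V.prod_smult_right intro!: imageI)
  moreover have "x \<otimes>\<^bsub>W\<^esub> (y \<otimes>\<^bsub>W\<^esub> z) =
      ((x \<otimes>\<^bsub>W\<^esub> y) \<otimes>\<^bsub>W\<^esub> z) \<ominus>\<^bsub>W\<^esub> (koszul l j \<odot>\<^bsub>W\<^esub> ((x \<otimes>\<^bsub>W\<^esub> z) \<otimes>\<^bsub>W\<^esub> y))"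
    if xyz: "x \<in> hpart W i" "y \<in> hpart W j" "z \<in> hpart W l" for x y z i j l
  proof -
    obtain x' y' z' where x': "x' \<in> hpart V i" "y' \<in> hpart V j" "z' \<in> hpart V l"
      and x: "x = \<phi> x'" "y = \<phi> y'" "z = \<phi> z'" using xyz by (auto simp: hp)
    note c = x'[THEN a]
    show ?thesis using V.leibniz[OF x', THEN arg_cong[of _ _ \<phi>]] c
      by (simp add: x minus hom(2) \<phi>(3) V.prod_closed)
  qed
  ultimately show ?thesis by (intro leibniz_superalgebra.intro leibniz_superalgebra_axioms.intro)
qed


section \<open>Graded ideals and quotient superalgebras\<close>

definition quot_proj :: "('k, 'v) superalgebra \<Rightarrow> 'v set \<Rightarrow> 'v \<Rightarrow> 'v set"
  where "quot_proj V I x = I +>\<^bsub>V\<^esub> x"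

lemma rel_class_eq: "rel_class X0 X1 S = quot_proj (Lbs X0 X1) (genideal_super (Lbs X0 X1) S)"
  by (simp add: fun_eq_iff rel_class_def quot_proj_def)

context superalgebra
begin

lemma superidealD:
  assumes "superideal I V"
  shows "I \<subseteq> carrier V" "\<zero>\<^bsub>V\<^esub> \<in> I"
    and "\<lbrakk>x \<in> I; y \<in> I\<rbrakk> \<Longrightarrow> x \<oplus>\<^bsub>V\<^esub> y \<in> I"
    and "x \<in> I \<Longrightarrow> (c::'k) \<odot>\<^bsub>V\<^esub> x \<in> I"
    and "x \<in> I \<Longrightarrow> \<ominus>\<^bsub>V\<^esub> x \<in> I"
    and "\<lbrakk>x \<in> I; y \<in> I\<rbrakk> \<Longrightarrow> x \<ominus>\<^bsub>V\<^esub> y \<in> I"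
    and "\<lbrakk>x \<in> I; y \<in> carrier V\<rbrakk> \<Longrightarrow> x \<otimes>\<^bsub>V\<^esub> y \<in> I"
    and "\<lbrakk>x \<in> I; y \<in> carrier V\<rbrakk> \<Longrightarrow> y \<otimes>\<^bsub>V\<^esub> x \<in> I"
proof -
  have sm: "submodule I (ring_of_type_algebra :: 'k ring) V" using assms by (simp add: superideal_def)
  note E = submoduleE[OF sm]
  show sub: "I \<subseteq> carrier V" by (rule E(1))
  show "\<zero>\<^bsub>V\<^esub> \<in> I" using E(2) E(4)[of 0] smult_laws(3) sub by (metis UNIV_I ex_in_conv scalar_ring_simps(1) subsetD)
  show add: "\<lbrakk>x \<in> I; y \<in> I\<rbrakk> \<Longrightarrow> x \<oplus>\<^bsub>V\<^esub> y \<in> I" for x y by (rule E(5))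
  show "x \<in> I \<Longrightarrow> (c::'k) \<odot>\<^bsub>V\<^esub> x \<in> I" using E(4)[of c x] by simp
  show neg: "x \<in> I \<Longrightarrow> \<ominus>\<^bsub>V\<^esub> x \<in> I" for x by (rule E(3))
  show "\<lbrakk>x \<in> I; y \<in> I\<rbrakk> \<Longrightarrow> x \<ominus>\<^bsub>V\<^esub> y \<in> I" using add neg by (simp add: minus_eq)
  show "\<lbrakk>x \<in> I; y \<in> carrier V\<rbrakk> \<Longrightarrow> x \<otimes>\<^bsub>V\<^esub> y \<in> I" "\<lbrakk>x \<in> I; y \<in> carrier V\<rbrakk> \<Longrightarrow> y \<otimes>\<^bsub>V\<^esub> x \<in> I"
    using assms by (auto simp: superideal_def)
qed

lemma superideal_graded:
  assumes "superideal I V" "y \<in> hpart V 0" "z \<in> hpart V 1" "y \<oplus>\<^bsub>V\<^esub> z \<in> I"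
  shows "y \<in> I \<and> z \<in> I"
proof -
  obtain y' z' where "y' \<in> I \<inter> hpart V 0" "z' \<in> I \<inter> hpart V 1" "y \<oplus>\<^bsub>V\<^esub> z = y' \<oplus>\<^bsub>V\<^esub> z'"
    using assms unfolding superideal_def by blast
  with hpart_split_unique[of y 0 z y' z'] assms show ?thesis by auto
qed

text \<open>Gradedness is required in the form that the components of an element of I lie in I.
  Unlike the existential form in \<open>superideal\<close>, this passes at once to intersections and
  preimages.\<close>

lemma superidealI:
  assumes "I \<subseteq> carrier V" "\<zero>\<^bsub>V\<^esub> \<in> I"
    and "\<And>x y. \<lbrakk>x \<in> I; y \<in> I\<rbrakk> \<Longrightarrow> x \<oplus>\<^bsub>V\<^esub> y \<in> I"
    and "\<And>c x. x \<in> I \<Longrightarrow> (c::'k) \<odot>\<^bsub>V\<^esub> x \<in> I"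
    and "\<And>x y. \<lbrakk>x \<in> I; y \<in> carrier V\<rbrakk> \<Longrightarrow> x \<otimes>\<^bsub>V\<^esub> y \<in> I"
    and "\<And>x y. \<lbrakk>x \<in> I; y \<in> carrier V\<rbrakk> \<Longrightarrow> y \<otimes>\<^bsub>V\<^esub> x \<in> I"
    and "\<And>y z. \<lbrakk>y \<in> hpart V 0; z \<in> hpart V 1; y \<oplus>\<^bsub>V\<^esub> z \<in> I\<rbrakk> \<Longrightarrow> y \<in> I \<and> z \<in> I"
  shows "superideal I V"
  unfolding superideal_def
proof (intro conjI ballI submoduleI)
  show "\<ominus>\<^bsub>V\<^esub> x \<in> I" if "x \<in> I" for x
    using assms(4)[OF that, of "-1"] that assms(1) by (auto simp: smult_laws)
  fix x assume x: "x \<in> I"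
  with assms(1) have "x \<in> carrier V" by blast
  then obtain y z where "y \<in> hpart V 0" "z \<in> hpart V (0 + 1)" "x = y \<oplus>\<^bsub>V\<^esub> z" by (rule hpart_split)
  with assms(7)[of y z] x show "\<exists>y\<in>I \<inter> hpart V 0. \<exists>z\<in>I \<inter> hpart V 1. x = y \<oplus>\<^bsub>V\<^esub> z" by auto
qed (use assms in auto)

lemma superideal_genideal_super:
  assumes "S \<subseteq> carrier V"
  shows "superideal (genideal_super V S) V"
proof -
  have "superideal (carrier V) V"
    by (rule superidealI) (auto intro: hpart_subset prod_closed)
  \<comment> \<open>The whole algebra is a member of the intersected family, so the intersection
    stays inside the carrier.\<close>
  with assms have ne: "carrier V \<in> {I. superideal I V \<and> S \<subseteq> I}" by simp
  show ?thesis unfolding genideal_super_def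
  proof (rule superidealI)
    show "\<Inter> {I. superideal I V \<and> S \<subseteq> I} \<subseteq> carrier V" using ne by blast
    show "y \<in> \<Inter> {I. superideal I V \<and> S \<subseteq> I} \<and> z \<in> \<Inter> {I. superideal I V \<and> S \<subseteq> I}"
      if "y \<in> hpart V 0" "z \<in> hpart V 1" "y \<oplus>\<^bsub>V\<^esub> z \<in> \<Inter> {I. superideal I V \<and> S \<subseteq> I}" for y z
      using that superideal_graded[OF _ that(1,2)] by simp
  qed (simp_all add: superidealD)
qed

lemma genideal_super_least: "\<lbrakk>superideal I V; S \<subseteq> I\<rbrakk> \<Longrightarrow> genideal_super V S \<subseteq> I"
  unfolding genideal_super_def by blast

lemma genideal_super_incl: "S \<subseteq> genideal_super V S"
  unfolding genideal_super_def by blast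

text \<open>The tool for bounding a generated ideal from above: once the generators are mapped into
  J, so is the whole ideal. With J zero it shows that a homomorphism killing the relations kills the
  ideal.\<close>

lemma superideal_vimage:
  fixes W :: "('k, 'w) superalgebra"
  assumes W: "superalgebra W" and \<phi>: "\<phi> \<in> superalg_hom V W" and J: "superideal J W"
  shows "superideal {x \<in> carrier V. \<phi> x \<in> J} V"
proof -
  interpret W: superalgebra W by fact
  note hom = superalg_homD[OF \<phi>]
  note Jd = W.superidealD[OF J]
  have "\<phi> \<zero>\<^bsub>V\<^esub> = \<zero>\<^bsub>W\<^esub>"
    by (rule linear_maps_group(1)[OF superspace_axioms W.superspace_axioms hom(1)])
  then show ?thesis
  proof (intro superidealI)
    show "y \<in> {x \<in> carrier V. \<phi> x \<in> J} \<and> z \<in> {x \<in> carrier V. \<phi> x \<in> J}"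
      if "y \<in> hpart V 0" "z \<in> hpart V 1" "y \<oplus>\<^bsub>V\<^esub> z \<in> {x \<in> carrier V. \<phi> x \<in> J}" for y z
      using that W.superideal_graded[OF J hom(6)[OF that(1)] hom(6)[OF that(2)]] hpart_subset
      by (simp add: hom(3))
  qed (auto simp: hom(2-5) intro: Jd prod_closed)
qed

lemma superideal_zero: "superideal {\<zero>\<^bsub>V\<^esub>} V"
proof (rule superidealI)
  show "y \<in> {\<zero>\<^bsub>V\<^esub>} \<and> z \<in> {\<zero>\<^bsub>V\<^esub>}" if "y \<in> hpart V 0" "z \<in> hpart V 1" "y \<oplus>\<^bsub>V\<^esub> z \<in> {\<zero>\<^bsub>V\<^esub>}" for y z
    using hpart_sum_zero[of y 0 z] that by simp
  show "x \<otimes>\<^bsub>V\<^esub> y \<in> {\<zero>\<^bsub>V\<^esub>}" "y \<otimes>\<^bsub>V\<^esub> x \<in> {\<zero>\<^bsub>V\<^esub>}" if "x \<in> {\<zero>\<^bsub>V\<^esub>}" "y \<in> carrier V" for x y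
    using that prod_smult_left[of x y 0] prod_smult_right[of y x 0] prod_closed[of x y] prod_closed[of y x]
    by (simp_all add: smult_laws)
qed (auto simp: smult_laws)

lemma quot_proj_eq_iff:
  assumes I: "superideal I V" and "x \<in> carrier V" "y \<in> carrier V"
  shows "quot_proj V I x = quot_proj V I y \<longleftrightarrow> x \<ominus>\<^bsub>V\<^esub> y \<in> I"
proof -
  interpret abelian_subgroup I V
    by (intro abelian_subgroupI3 additive_subgroup.intro submodule.axioms(1))
      (use I module.axioms(2)[OF module_axioms] in \<open>auto simp: superideal_def\<close>)
  have "x \<ominus>\<^bsub>V\<^esub> y \<in> I \<longleftrightarrow> x \<in> I +>\<^bsub>V\<^esub> y" 
    using a_rcos_module[OF assms(3,2)] by (simp add: minus_eq)
  also have "\<dots> \<longleftrightarrow> quot_proj V I x = quot_proj V I y"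
    unfolding quot_proj_def using a_repr_independence'[of x y] a_rcos_self[of x] assms by auto
  finally show ?thesis ..
qed

text \<open>Scalar multiples and products of cosets are unions over representatives;
  well-definedness makes all cosets in such a union equal, so the union collapses to a single
  class.\<close>

lemma quot_proj_ops:
  assumes I: "superideal I V"
  shows "carrier (quot_superalgebra V I) = quot_proj V I ` carrier V"
    and "hpart (quot_superalgebra V I) i = quot_proj V I ` hpart V i"
    and "\<zero>\<^bsub>quot_superalgebra V I\<^esub> = quot_proj V I \<zero>\<^bsub>V\<^esub>"
    and "\<lbrakk>x \<in> carrier V; y \<in> carrier V\<rbrakk> \<Longrightarrow> quot_proj V I (x \<oplus>\<^bsub>V\<^esub> y) =
      quot_proj V I x \<oplus>\<^bsub>quot_superalgebra V I\<^esub> quot_proj V I y"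
    and "x \<in> carrier V \<Longrightarrow> quot_proj V I (c \<odot>\<^bsub>V\<^esub> x) =
      c \<odot>\<^bsub>quot_superalgebra V I\<^esub> quot_proj V I x"
    and "\<lbrakk>x \<in> carrier V; y \<in> carrier V\<rbrakk> \<Longrightarrow> quot_proj V I (x \<otimes>\<^bsub>V\<^esub> y) =
      quot_proj V I x \<otimes>\<^bsub>quot_superalgebra V I\<^esub> quot_proj V I y"
proof -
  interpret abelian_subgroup I V
    by (intro abelian_subgroupI3 additive_subgroup.intro submodule.axioms(1))
      (use I module.axioms(2)[OF module_axioms] in \<open>auto simp: superideal_def\<close>)
  note Id = superidealD[OF I]
  have mem: "u \<in> quot_proj V I x \<longleftrightarrow> u \<in> carrier V \<and> quot_proj V I u = quot_proj V I x"
    if "x \<in> carrier V" for u x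
    using that a_repr_independence'[of u x] a_rcos_self[of u] a_elemrcos_carrier[of x u]
    unfolding quot_proj_def by auto
  have self: "x \<in> quot_proj V I x" if "x \<in> carrier V" for x using mem[OF that] that by simp
  show "carrier (quot_superalgebra V I) = quot_proj V I ` carrier V"
    by (auto simp: quot_superalgebra_def A_RCOSETS_def' quot_proj_def)
  show "hpart (quot_superalgebra V I) i = quot_proj V I ` hpart V i"
    by (auto simp: quot_superalgebra_def quot_proj_def)
  show "\<zero>\<^bsub>quot_superalgebra V I\<^esub> = quot_proj V I \<zero>\<^bsub>V\<^esub>"
    using a_coset_add_zero[OF Id(1)] by (simp add: quot_superalgebra_def quot_proj_def)
  show "quot_proj V I (x \<oplus>\<^bsub>V\<^esub> y) = quot_proj V I x \<oplus>\<^bsub>quot_superalgebra V I\<^esub> quot_proj V I y"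
    if "x \<in> carrier V" "y \<in> carrier V"
    using a_rcos_sum[OF that] by (simp add: quot_superalgebra_def quot_proj_def)
  show "quot_proj V I (c \<odot>\<^bsub>V\<^esub> x) = c \<odot>\<^bsub>quot_superalgebra V I\<^esub> quot_proj V I x" if x: "x \<in> carrier V"
  proof -
    have "quot_proj V I (c \<odot>\<^bsub>V\<^esub> u) = quot_proj V I (c \<odot>\<^bsub>V\<^esub> x)" if u: "u \<in> quot_proj V I x" for u
    proof -
      have uc: "u \<in> carrier V" and "u \<ominus>\<^bsub>V\<^esub> x \<in> I" using u mem[OF x] quot_proj_eq_iff[OF I _ x] by auto
      then have "c \<odot>\<^bsub>V\<^esub> (u \<ominus>\<^bsub>V\<^esub> x) \<in> I" by (intro Id(4))
      then show ?thesis using uc x quot_proj_eq_iff[OF I, of "c \<odot>\<^bsub>V\<^esub> u" "c \<odot>\<^bsub>V\<^esub> x"]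
        by (simp add: minus_eq smult_laws)
    qed
    then have "(\<Union>u\<in>quot_proj V I x. quot_proj V I (c \<odot>\<^bsub>V\<^esub> u)) = quot_proj V I (c \<odot>\<^bsub>V\<^esub> x)"
      using self[OF x] by blast
    then show ?thesis by (simp add: quot_superalgebra_def quot_proj_def)
  qed
  show "quot_proj V I (x \<otimes>\<^bsub>V\<^esub> y) = quot_proj V I x \<otimes>\<^bsub>quot_superalgebra V I\<^esub> quot_proj V I y"
    if x: "x \<in> carrier V" and y: "y \<in> carrier V"
  proof -
    have "quot_proj V I (u \<otimes>\<^bsub>V\<^esub> v) = quot_proj V I (x \<otimes>\<^bsub>V\<^esub> y)"
      if u: "u \<in> quot_proj V I x" and v: "v \<in> quot_proj V I y" for u v
    proof -
      have c: "u \<in> carrier V" "v \<in> carrier V" and I1: "u \<ominus>\<^bsub>V\<^esub> x \<in> I" "v \<ominus>\<^bsub>V\<^esub> y \<in> I"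
        using u v mem x y quot_proj_eq_iff[OF I] by auto
      have neg: "(\<ominus>\<^bsub>V\<^esub> a) \<otimes>\<^bsub>V\<^esub> b = \<ominus>\<^bsub>V\<^esub> (a \<otimes>\<^bsub>V\<^esub> b)" "b \<otimes>\<^bsub>V\<^esub> (\<ominus>\<^bsub>V\<^esub> a) = \<ominus>\<^bsub>V\<^esub> (b \<otimes>\<^bsub>V\<^esub> a)"
        if "a \<in> carrier V" "b \<in> carrier V" for a b
        using prod_smult_left[OF that, of "-1"] prod_smult_right[OF that(2,1), of "-1"] that
        by (simp_all add: smult_laws prod_closed)
      \<comment> \<open>The telescoping identity uv - xy = (u - x)v + x(v - y) exhibits the
        difference of the two products as an element of the ideal.\<close>
      have "((u \<ominus>\<^bsub>V\<^esub> x) \<otimes>\<^bsub>V\<^esub> v) \<oplus>\<^bsub>V\<^esub> (x \<otimes>\<^bsub>V\<^esub> (v \<ominus>\<^bsub>V\<^esub> y)) \<in> I"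
        using I1 c x by (intro Id(3,7,8))
      also have "((u \<ominus>\<^bsub>V\<^esub> x) \<otimes>\<^bsub>V\<^esub> v) \<oplus>\<^bsub>V\<^esub> (x \<otimes>\<^bsub>V\<^esub> (v \<ominus>\<^bsub>V\<^esub> y)) =
          (u \<otimes>\<^bsub>V\<^esub> v \<oplus>\<^bsub>V\<^esub> \<ominus>\<^bsub>V\<^esub> (x \<otimes>\<^bsub>V\<^esub> v)) \<oplus>\<^bsub>V\<^esub> (x \<otimes>\<^bsub>V\<^esub> v \<oplus>\<^bsub>V\<^esub> \<ominus>\<^bsub>V\<^esub> (x \<otimes>\<^bsub>V\<^esub> y))"
        using c x y by (simp add: minus_eq prod_add_left prod_add_right neg)
      also have "\<dots> = u \<otimes>\<^bsub>V\<^esub> v \<ominus>\<^bsub>V\<^esub> x \<otimes>\<^bsub>V\<^esub> y"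
        using c x y by (simp add: minus_eq a_assoc r_neg1 prod_closed)
      finally show ?thesis using c x y quot_proj_eq_iff[OF I] prod_closed by simp
    qed
    then have "(\<Union>u\<in>quot_proj V I x. \<Union>v\<in>quot_proj V I y. quot_proj V I (u \<otimes>\<^bsub>V\<^esub> v)) =
        quot_proj V I (x \<otimes>\<^bsub>V\<^esub> y)"
      using self[OF x] self[OF y] by blast
    then show ?thesis by (simp add: quot_superalgebra_def quot_proj_def rcoset_mult_def)
  qed
qed

lemma quot_proj_hom: "superideal I V \<Longrightarrow> quot_proj V I \<in> superalg_hom V (quot_superalgebra V I)"
  by (simp add: superalg_hom_def linear_maps_def quot_proj_ops Pi_iff)

lemma quot_proj_zero_iff:
  assumes "superideal I V" "x \<in> carrier V"
  shows "quot_proj V I x = \<zero>\<^bsub>quot_superalgebra V I\<^esub> \<longleftrightarrow> x \<in> I"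
proof -
  have "x \<ominus>\<^bsub>V\<^esub> \<zero>\<^bsub>V\<^esub> = x" using assms(2) by (simp add: M.minus_eq M.add.inv_one)
  then show ?thesis using quot_proj_eq_iff[OF assms, of "\<zero>\<^bsub>V\<^esub>"] quot_proj_ops(3)[OF assms(1)] by simp
qed

text \<open>The value on a coset is read off at an arbitrarily chosen representative; two
  representatives differ by an element of I, where \<psi> vanishes.\<close>

lemma quot_hom_exists:
  fixes W :: "('k, 'w) superalgebra"
  assumes I: "superideal I V" and W: "superspace W" and \<psi>: "\<psi> \<in> superalg_hom V W"
    and ker: "\<And>x. x \<in> I \<Longrightarrow> \<psi> x = \<zero>\<^bsub>W\<^esub>"
  obtains \<chi> where "\<chi> \<in> superalg_hom (quot_superalgebra V I) W"
    "\<And>x. x \<in> carrier V \<Longrightarrow> \<chi> (quot_proj V I x) = \<psi> x"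
proof -
  interpret W: superspace W by fact
  note hom = superalg_homD[OF \<psi>] and q = quot_proj_ops[OF I]
  note minus = linear_maps_group(3)[OF superspace_axioms W hom(1)]
  define \<chi> where "\<chi> C = \<psi> (SOME x. x \<in> carrier V \<and> quot_proj V I x = C)" for C
  have \<chi>: "\<chi> (quot_proj V I x) = \<psi> x" if x: "x \<in> carrier V" for x
  proof -
    let ?y = "SOME y. y \<in> carrier V \<and> quot_proj V I y = quot_proj V I x"
    have y: "?y \<in> carrier V \<and> quot_proj V I ?y = quot_proj V I x" by (rule someI[of _ x]) (simp add: x)
    then have "\<psi> (?y \<ominus>\<^bsub>V\<^esub> x) = \<zero>\<^bsub>W\<^esub>" using quot_proj_eq_iff[OF I _ x] by (intro ker) blast
    then show ?thesis unfolding \<chi>_def using y x by (simp add: minus W.minus_zero_iff hom(2))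
  qed
  have "\<chi> \<in> superalg_hom (quot_superalgebra V I) W"
    unfolding superalg_hom_def linear_maps_def q(1,2)
    by (auto simp: q(4-6)[symmetric] \<chi> hom hpart_subset prod_closed)
  with \<chi> that show thesis by blast
qed

end

lemma leibniz_superalgebra_quot:
  assumes "leibniz_superalgebra V" "superideal I V"
  shows "leibniz_superalgebra (quot_superalgebra V I)"
proof -
  interpret leibniz_superalgebra V by fact
  note q = quot_proj_ops[OF assms(2)]
  show ?thesis
  proof (rule leibniz_superalgebra_image[OF assms(1) superalg_homD(1)[OF quot_proj_hom[OF assms(2)]] q(6,1,2,3)])
    show "quot_proj V I y = \<zero>\<^bsub>quot_superalgebra V I\<^esub>" if "y \<in> hpart V 0" "z \<in> hpart V 1"
      "quot_proj V I (y \<oplus>\<^bsub>V\<^esub> z) = \<zero>\<^bsub>quot_superalgebra V I\<^esub>" for y z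
      using that superideal_graded[OF assms(2), of y z] hpart_subset quot_proj_zero_iff[OF assms(2)] by auto
  qed
qed

section \<open>Linear combinations\<close>

abbreviation "supp \<equiv> Poly_Mapping.keys"
abbreviation "coef \<equiv> Poly_Mapping.lookup"

lemma lookup_linext:
  "coef (linext F f) v = (\<Sum>w\<in>supp f. coef f w * coef (F w) v)"
  by (simp add: linext_def lookup_sum)

lemma keys_linext:
  "(\<And>w. w \<in> supp f \<Longrightarrow> supp (F w) \<subseteq> W) \<Longrightarrow> supp (linext F f) \<subseteq> W"
  unfolding linext_def by (intro keys_sum_subset keys_subset_closed(2)) auto

lemma linext_cong: "(\<And>w. w \<in> supp f \<Longrightarrow> F w = G w) \<Longrightarrow> linext F f = linext G f"
  by (simp add: linext_def)

lemma linext_wmono_id [simp]: "linext wmono f = f"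
  by (rule poly_word_induct[where W = UNIV and f = f]) (simp_all add: linext_add linext_pscale)

lemma push_linear:
  fixes h :: "'y \<Rightarrow> 'z list"
  shows "push h (f + g) = push h f + push h g" "push h (pscale c f) = pscale c (push h f)"
    "push h (f - g) = push h f - push h g" "push h 0 = 0"
  by (simp_all add: push_eq linext_add linext_pscale linext_diff)

lemma push_wmono [simp]: "push h (wmono w) = wmono (h w)"
  by (simp add: push_eq)

lemma lookup_push:
  fixes h :: "'y \<Rightarrow> 'z list"
  assumes "inj h"
  shows "coef (push h f) (h w) = coef f w"
proof -
  have "coef (push h f) (h w) =
      (\<Sum>v\<in>supp f. if v = w then coef f v else 0)"
    unfolding push_eq lookup_linext using assms
    by (intro sum.cong) (auto simp: wmono_def lookup_single when_def dest: injD)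
  then show ?thesis by (simp add: in_keys_iff)
qed

lemma keys_push:
  fixes h :: "'y \<Rightarrow> 'z list"
  assumes "inj h"
  shows "supp (push h f) = h ` supp f"
proof
  show "supp (push h f) \<subseteq> h ` supp f"
    unfolding push_eq by (rule keys_linext) (simp add: wmono_def)
  show "h ` supp f \<subseteq> supp (push h f)"
    using lookup_push[OF assms, of f] by (auto simp: in_keys_iff)
qed

context superspace
begin

text \<open>The counterpart of \<open>linext\<close> with values in an abstract module. The index
  type is arbitrary so that words can serve as indices; \<open>lincomb\<close> is the case of the
  identity.\<close>

definition lsum :: "('y \<Rightarrow> 'v) \<Rightarrow> ('y \<Rightarrow>\<^sub>0 'k) \<Rightarrow> 'v"
  where "lsum G c = (\<Oplus>\<^bsub>V\<^esub>y\<in>supp c. coef c y \<odot>\<^bsub>V\<^esub> G y)"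

lemma lsum_superset:
  assumes "finite W" "supp c \<subseteq> W" "G ` W \<subseteq> carrier V"
  shows "lsum G c = (\<Oplus>\<^bsub>V\<^esub>y\<in>W. coef c y \<odot>\<^bsub>V\<^esub> G y)"
  unfolding lsum_def using assms
  by (intro add.finprod_mono_neutral_cong_left) (auto simp: in_keys_iff smult_laws image_subset_iff)

lemma lsum_closed: "G ` supp c \<subseteq> carrier V \<Longrightarrow> lsum G c \<in> carrier V"
  unfolding lsum_def by (intro M.finsum_closed) auto

lemma lsum_add:
  assumes "G ` supp c \<subseteq> carrier V" "G ` supp d \<subseteq> carrier V"
  shows "lsum G (c + d) = lsum G c \<oplus>\<^bsub>V\<^esub> lsum G d"
proof -
  let ?W = "supp c \<union> supp d"
  have W: "finite ?W" "G ` ?W \<subseteq> carrier V" using assms by auto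
  have "lsum G (c + d) = (\<Oplus>\<^bsub>V\<^esub>y\<in>?W. coef c y \<odot>\<^bsub>V\<^esub> G y \<oplus>\<^bsub>V\<^esub> coef d y \<odot>\<^bsub>V\<^esub> G y)"
    unfolding lsum_superset[OF W(1) Poly_Mapping.keys_add W(2)] using W
    by (intro M.add.finprod_cong') (auto simp: lookup_add smult_laws image_subset_iff)
  also have "\<dots> = lsum G c \<oplus>\<^bsub>V\<^esub> lsum G d"
    unfolding lsum_superset[OF W(1) Un_upper1 W(2)] lsum_superset[OF W(1) Un_upper2 W(2)] using W
    by (intro M.finsum_addf) auto
  finally show ?thesis .
qed

lemma lsum_pscale:
  assumes "G ` supp c \<subseteq> carrier V"
  shows "lsum G (pscale a c) = a \<odot>\<^bsub>V\<^esub> lsum G c"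
proof -
  have "a \<odot>\<^bsub>V\<^esub> lsum G c = (\<Oplus>\<^bsub>V\<^esub>y\<in>supp c. a \<odot>\<^bsub>V\<^esub> (coef c y \<odot>\<^bsub>V\<^esub> G y))"
    unfolding lsum_def using assms by (intro finsum_smult_ldistr) auto
  also have "\<dots> = lsum G (pscale a c)"
    unfolding lsum_superset[OF finite_keys keys_pscale assms] using assms
    by (intro M.add.finprod_cong') (auto simp: smult_laws image_subset_iff)
  finally show ?thesis ..
qed

lemma lsum_single: "G y \<in> carrier V \<Longrightarrow> lsum G (Poly_Mapping.single y 1) = G y"
  by (simp add: lsum_def smult_laws)

lemma lincomb_eq_lsum: "lincomb V c = lsum (\<lambda>x. x) c"
  by (simp add: lincomb_def lsum_def)

lemma lincomb_induct:
  assumes "supp c \<subseteq> A" "A \<subseteq> carrier V"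
    and "P \<zero>\<^bsub>V\<^esub>" "\<And>a. a \<in> A \<Longrightarrow> P a"
    and "\<And>x y. \<lbrakk>x \<in> carrier V; y \<in> carrier V; P x; P y\<rbrakk> \<Longrightarrow> P (x \<oplus>\<^bsub>V\<^esub> y)"
    and "\<And>a x. \<lbrakk>x \<in> carrier V; P x\<rbrakk> \<Longrightarrow> P (a \<odot>\<^bsub>V\<^esub> x)"
  shows "P (lincomb V c)"
proof -
  have "P (\<Oplus>\<^bsub>V\<^esub>y\<in>W. coef c y \<odot>\<^bsub>V\<^esub> y)" if "finite W" "W \<subseteq> A" for W
    using that
  proof (induction W rule: finite_induct)
    case (insert x W)
    then have "W \<subseteq> carrier V" "x \<in> carrier V" using assms(2) by auto
    moreover from this insert have "P (coef c x \<odot>\<^bsub>V\<^esub> x \<oplus>\<^bsub>V\<^esub>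
        (\<Oplus>\<^bsub>V\<^esub>y\<in>W. coef c y \<odot>\<^bsub>V\<^esub> y))"
      by (intro assms(5) assms(6)) (auto intro!: M.finsum_closed assms(4))
    ultimately show ?case using insert by (subst M.finsum_insert) auto
  qed (simp add: assms)
  with assms(1) show ?thesis by (simp add: lincomb_def)
qed

end

section \<open>Leading monomials\<close>

text \<open>The last clause is the compatibility that controls leading monomials: multiplying on the
  right by letters appends a fixed word to every monomial.\<close>

lemma nf_less_order:
  fixes u v w :: "'x::wellorder list"
  shows "nf_less u v \<Longrightarrow> nf_less v w \<Longrightarrow> nf_less u w" and "\<not> nf_less u u"
    and "u \<noteq> v \<Longrightarrow> nf_less u v \<or> nf_less v u"
    and "nf_less u v \<Longrightarrow> nf_less (u @ w) (v @ w)"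
proof -
  have "trans {(x, y :: 'x). x < y}" by (auto simp: trans_def)
  then show "nf_less u v \<Longrightarrow> nf_less v w \<Longrightarrow> nf_less u w"
    unfolding nf_less_def by (rule lenlex_trans[rotated 2])
  show "\<not> nf_less u u" unfolding nf_less_def by (rule lenlex_irreflexive) simp
  have "total {(x, y :: 'x). x < y}" by (auto simp: total_on_def)
  then show "u \<noteq> v \<Longrightarrow> nf_less u v \<or> nf_less v u"
    unfolding nf_less_def using total_lenlex[of "{(x, y :: 'x). x < y}"] by (simp add: total_on_def)
  show "nf_less u v \<Longrightarrow> nf_less (u @ w) (v @ w)"
    unfolding nf_less_def by (rule lenlex_append1) simp_all
qed

lemma wf_nf_less: "wf {(u, v). nf_less u (v :: 'x::wellorder list)}"
proof -
  have "wf {(x, y :: 'x). x < y}" by (rule wf)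
  then have "wf (lenlex {(x, y :: 'x). x < y})" by (rule wf_lenlex)
  then show ?thesis by (simp add: nf_less_def)
qed

lemma lmonI:
  assumes "u \<in> supp f" "\<And>v. v \<in> supp f \<Longrightarrow> v \<noteq> u \<Longrightarrow> nf_less v u"
  shows "lmon f = u"
  unfolding lmon_def using assms by (intro the_equality) (blast, metis nf_less_order(1,2))

lemma lmon_max:
  assumes "f \<noteq> 0"
  shows "lmon f \<in> supp f"
    and "v \<in> supp f \<Longrightarrow> v \<noteq> lmon f \<Longrightarrow> nf_less v (lmon f)"
proof -
  have "\<exists>u\<in>W. \<forall>v\<in>W. v \<noteq> u \<longrightarrow> nf_less v u" if "finite W" "W \<noteq> {}" for W :: "'a list set"
    using that
  proof (induction W rule: finite_ne_induct)
    case (insert x W)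
    then obtain u where u: "u \<in> W" "\<forall>v\<in>W. v \<noteq> u \<longrightarrow> nf_less v u" by blast
    then show ?case
    proof (cases "nf_less u x")
      case True
      then have "\<forall>v\<in>insert x W. v \<noteq> x \<longrightarrow> nf_less v x"
        using u(2) nf_less_order(1)[of _ u x] by (metis insertE)
      then show ?thesis by blast
    next
      case False
      then have "\<forall>v\<in>insert x W. v \<noteq> u \<longrightarrow> nf_less v u" using u nf_less_order(3)[of x u] by auto
      then show ?thesis using u(1) by blast
    qed
  qed simp
  from this[of "supp f"] assms obtain u
    where "u \<in> supp f" "\<forall>v\<in>supp f. v \<noteq> u \<longrightarrow> nf_less v u" by auto
  moreover from this have "lmon f = u" by (intro lmonI) auto
  ultimately show "lmon f \<in> supp f"
    "v \<in> supp f \<Longrightarrow> v \<noteq> lmon f \<Longrightarrow> nf_less v (lmon f)" by auto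
qed

lemma npoly_snoc: "npoly X0 X1 s (c @ [b]) = free_mult X1 (npoly X0 X1 s c) (gen b)"
  by (simp add: npoly_def lnorm_def)

lemma npoly_Nil [simp]: "npoly X0 X1 s [] = s"
  by (simp add: npoly_def lnorm_def)

text \<open>Right multiplication by a letter appends it to a left-normed monomial without correction
  terms. Hence monomials stay distinct and coefficients are carried over unchanged.\<close>

lemma npoly_eq_push: "npoly X0 X1 s c = push (\<lambda>w. w @ c) s"
proof (induction c rule: rev_induct)
  case Nil
  show ?case by (simp add: push_eq)
next
  case (snoc b c)
  show ?case unfolding npoly_snoc snoc free_mult_gen
    by (rule poly_word_induct[where W = UNIV and f = s]) (simp_all add: push_linear)
qed

lemma inj_append_right: "inj (\<lambda>w. w @ c)"
  by (simp add: inj_on_def)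

lemma npoly_keys:
  "supp (npoly X0 X1 s c) = (\<lambda>w. w @ c) ` supp s"
  "coef (npoly X0 X1 s c) (w @ c) = coef s w"
  unfolding npoly_eq_push using keys_push[OF inj_append_right] lookup_push[OF inj_append_right] by blast+

lemma lmon_npoly: "s \<noteq> 0 \<Longrightarrow> lmon (npoly X0 X1 s c) = lmon s @ c"
  by (rule lmonI) (auto simp: npoly_keys lmon_max intro!: nf_less_order(4) lmon_max(2))

section \<open>Reduced Groebner--Shirshov bases\<close>

locale reduced_gs =
  fixes B0 B1 :: "'b::wellorder set" and R :: "('b list \<Rightarrow>\<^sub>0 'k::field) set"
  assumes disjoint: "B0 \<inter> B1 = {}" and gs: "reduced_gs_basis B0 B1 R"
    and long: "\<forall>f\<in>R. length (lmon f) > 1"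
begin

abbreviation "B \<equiv> B0 \<union> B1"
abbreviation "L \<equiv> Lbs B0 B1 :: ('k, 'b list \<Rightarrow>\<^sub>0 'k) superalgebra"
abbreviation "I \<equiv> genideal_super L R"
abbreviation "cl \<equiv> rel_class B0 B1 R"
abbreviation "npol \<equiv> npoly B0 B1 :: ('b list \<Rightarrow>\<^sub>0 'k) \<Rightarrow> _"
abbreviation "mul \<equiv> free_mult B1 :: ('b list \<Rightarrow>\<^sub>0 'k) \<Rightarrow> _"
abbreviation "IrrR \<equiv> Irr B0 B1 R"

sublocale L: leibniz_superalgebra L by (rule leibniz_superalgebra_Lbs)

lemma R_props:
  assumes "s \<in> R"
  shows "s \<noteq> 0" "coef s (lmon s) = 1" "\<exists>i. s \<in> hpart L i" "s \<in> carrier L"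
  using assms gs by (auto simp: reduced_gs_basis_def gs_basis_def monic_homogeneous_def)

lemma normal_of_R: "s \<in> R \<Longrightarrow> normal_of B0 B1 s = npol s ` {c. set c \<subseteq> B}"
  using long by (auto simp: normal_of_def npoly_def)

lemma Irr_iff: "w \<in> IrrR \<longleftrightarrow> w \<in> NF B \<and> (\<forall>s\<in>R. \<forall>c. set c \<subseteq> B \<longrightarrow> w \<noteq> lmon s @ c)"
  unfolding Irr_def by (simp add: normal_of_R lmon_npoly R_props(1))

lemma lmon_NF: "s \<in> R \<Longrightarrow> lmon s \<in> NF B"
  using R_props(4) lmon_max(1)[OF R_props(1)] by auto

text \<open>Of two leading monomials that are prefixes of the same word, one is a prefix of the
  other, hence the longer one is the leading monomial of a normal polynomial of the shorter one. For
  distinct relations this contradicts reducedness.\<close>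

lemma reducible_unique:
  assumes "s \<in> R" "t \<in> R" "set c \<subseteq> B" "set d \<subseteq> B" "lmon s @ c = lmon t @ d"
  shows "s = t \<and> c = d"
proof -
  have *: "s = t" if st: "s \<in> R" "t \<in> R" "set d \<subseteq> B" "lmon s @ c = lmon t @ d" "length c \<le> length d"
    for s t c d
  proof (rule ccontr)
    assume ne: "s \<noteq> t"
    \<comment> \<open>As c is the shorter suffix, \<open>lmon s\<close> is the longer prefix and
      exceeds \<open>lmon t\<close> by a word e over the generators.\<close>
    from st obtain e where "lmon s = lmon t @ e" "d = e @ c"
      by (auto simp: append_eq_append_conv2)
    then have "lmon s = lmon (npol t e)" "npol t e \<in> normal_of B0 B1 t"
      using st by (auto simp: normal_of_R lmon_npoly R_props)
    moreover have "lmon s \<in> Irr B0 B1 (R - {s})"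
      using gs st(1) lmon_max(1)[OF R_props(1)] unfolding reduced_gs_basis_def by blast
    ultimately show False using ne st(2) unfolding Irr_def by blast
  qed
  have "s = t" using *[of s t d c] *[of t s c d] assms by (metis nat_le_linear)
  with assms show ?thesis by simp
qed

section \<open>Change of basis from monomials to normal polynomials\<close>

definition dec :: "'b list \<Rightarrow> ('b list \<Rightarrow>\<^sub>0 'k) \<times> 'b list"
  where "dec w = (SOME p. fst p \<in> R \<and> set (snd p) \<subseteq> B \<and> w = lmon (fst p) @ snd p)"

text \<open>By \<open>reducible_unique\<close> only one pair qualifies, so the choice in
  \<open>dec\<close> is forced.\<close>

lemma dec_eq:
  assumes "s \<in> R" "set c \<subseteq> B"
  shows "dec (lmon s @ c) = (s, c)"
  unfolding dec_def
proof (rule some_equality)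
  fix p assume p: "fst p \<in> R \<and> set (snd p) \<subseteq> B \<and> lmon s @ c = lmon (fst p) @ snd p"
  show "p = (s, c)" using reducible_unique[OF assms(1) _ assms(2), of "fst p" "snd p"] p
    by (simp add: prod_eq_iff)
qed (use assms in simp)

text \<open>The monomials are replaced by the normal polynomials with the same leading monomial, where there
  is one.  This is unitriangular, hence invertible on \<open>L\<close>, and yields the decomposition of \<open>L\<close> into
  the span of \<open>Irr(R)\<close> and the ideal.\<close>

definition tau :: "'b list \<Rightarrow> ('b list \<Rightarrow>\<^sub>0 'k)"
  where "tau w = (if w \<in> IrrR then wmono w else npol (fst (dec w)) (snd (dec w)))"

definition tri :: "('b list \<Rightarrow>\<^sub>0 'k) \<Rightarrow> ('b list \<Rightarrow>\<^sub>0 'k)"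
  where "tri = linext tau"

lemma NF_cases:
  assumes "w \<in> NF B"
  obtains "w \<in> IrrR" | s c where "w \<notin> IrrR" "s \<in> R" "set c \<subseteq> B" "w = lmon s @ c"
  using assms Irr_iff by blast

lemma reducible_NF:
  assumes "s \<in> R" "set c \<subseteq> B"
  shows "lmon s @ c \<in> NF B" "lmon s @ c \<notin> IrrR" "tau (lmon s @ c) = npol s c"
proof -
  show "lmon s @ c \<in> NF B" using lmon_NF[OF assms(1)] assms(2) by (auto simp: NF_def)
  show "lmon s @ c \<notin> IrrR" using assms by (auto simp: Irr_iff)
  then show "tau (lmon s @ c) = npol s c" by (simp add: tau_def dec_eq[OF assms])
qed

lemma npoly_hpart:
  assumes "s \<in> hpart L i" "set c \<subseteq> B"
  shows "npol s c \<in> hpart L (i + wpar B1 c)"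
  unfolding Lbs_simps mem_Collect_eq
proof
  show "supp (npol s c) \<subseteq> NF B" using assms unfolding npoly_keys
    by (force simp: NF_def)
  show "\<forall>w\<in>supp (npol s c). wpar B1 w = i + wpar B1 c"
    using assms(1) unfolding npoly_keys by simp
qed

lemma npoly_carrier: "s \<in> R \<Longrightarrow> set c \<subseteq> B \<Longrightarrow> npol s c \<in> carrier L"
  using R_props(3)[of s] npoly_hpart[of s _ c] L.hpart_subset[of "npol s c"] by blast

lemma tau_props:
  assumes "w \<in> NF B"
  shows "tau w \<in> carrier L" "coef (tau w) w = 1"
    "\<And>v. v \<in> supp (tau w) \<Longrightarrow> v \<noteq> w \<Longrightarrow> nf_less v w"
proof -
  have "tau w \<in> carrier L \<and> coef (tau w) w = 1 \<and>
    (\<forall>v\<in>supp (tau w). v \<noteq> w \<longrightarrow> nf_less v w)"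
    using assms
  proof (cases rule: NF_cases)
    case 1
    then show ?thesis using assms by (simp add: tau_def wmono_def)
  next
    case (2 s c)
    have "nf_less v w" if "v \<in> supp (npol s c)" "v \<noteq> w" for v
    proof -
      from that obtain u where "u \<in> supp s" "v = u @ c" by (auto simp: npoly_keys)
      with that(2) 2 lmon_max(2)[OF R_props(1), of s u] show ?thesis by (auto intro: nf_less_order(4))
    qed
    then show ?thesis
      using 2 npoly_carrier[OF 2(2,3)] by (simp add: reducible_NF npoly_keys R_props)
  qed
  then show "tau w \<in> carrier L" "coef (tau w) w = 1"
    "\<And>v. v \<in> supp (tau w) \<Longrightarrow> v \<noteq> w \<Longrightarrow> nf_less v w" by auto
qed

lemma tri_linear:
  "tri (f + g) = tri f + tri g" "tri (pscale a f) = pscale a (tri f)" "tri (f - g) = tri f - tri g" "tri 0 = 0"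
  by (simp_all add: tri_def linext_add linext_pscale linext_diff)

lemma tri_wmono [simp]: "tri (wmono w) = tau w"
  by (simp add: tri_def)

lemma tri_carrier: "f \<in> carrier L \<Longrightarrow> tri f \<in> carrier L"
  unfolding tri_def Lbs_simps mem_Collect_eq
proof (rule keys_linext)
  fix w assume "supp f \<subseteq> NF B" "w \<in> supp f"
  then have "w \<in> NF B" by blast
  from tau_props(1)[OF this] show "supp (tau w) \<subseteq> NF B" by simp
qed

lemma tri_Irr: "supp d \<subseteq> IrrR \<Longrightarrow> tri d = d"
  unfolding tri_def by (subst linext_cong[where G = wmono]) (auto simp: tau_def)

text \<open>Only the leading word of f can contribute to the coefficient at that word, because
  \<open>tau\<close> turns a smaller word into a polynomial in words that are smaller still or equal
  to it. Injectivity of \<open>tri\<close> follows.\<close>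

lemma tri_lead:
  assumes "f \<in> carrier L" "f \<noteq> 0"
  shows "coef (tri f) (lmon f) = coef f (lmon f)" "lmon (tri f) = lmon f"
proof -
  let ?u = "lmon f"
  note max = lmon_max[OF assms(2)]
  have NF: "w \<in> NF B" if "w \<in> supp f" for w using assms(1) that by auto
  have less: "nf_less v ?u" if "w \<in> supp f" "v \<in> supp (tau w)" "v \<noteq> ?u" for v w
    using that tau_props(3)[OF NF[OF that(1)] that(2)] max(2)[OF that(1)] nf_less_order(1)[of v w ?u] by metis
  have "coef (tri f) ?u = (\<Sum>w\<in>supp f. if w = ?u then coef f w else 0)"
    unfolding tri_def lookup_linext
  proof (rule sum.cong)
    fix w assume w: "w \<in> supp f"
    note p = tau_props[OF NF[OF w]]
    show "coef f w * coef (tau w) ?u = (if w = ?u then coef f w else 0)"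
    proof (cases "w = ?u")
      case True then show ?thesis using p(2) by simp
    next
      case False
      then have "?u \<notin> supp (tau w)" using max(2)[OF w] p(3)[of ?u] nf_less_order(1,2) by blast
      then show ?thesis using False by (simp add: in_keys_iff)
    qed
  qed simp
  also have "\<dots> = coef f ?u" using max(1) by simp
  finally show eq: "coef (tri f) ?u = coef f ?u" .
  show "lmon (tri f) = ?u"
  proof (rule lmonI)
    show "?u \<in> supp (tri f)" using eq max(1) by (simp add: in_keys_iff)
    have "supp (tri f) \<subseteq> {v. v \<noteq> ?u \<longrightarrow> nf_less v ?u}"
      unfolding tri_def using less by (intro keys_linext) blast
    then show "nf_less v ?u" if "v \<in> supp (tri f)" "v \<noteq> ?u" for v using that by blast
  qed
qed

lemma tri_eq_0: "f \<in> carrier L \<Longrightarrow> tri f = 0 \<Longrightarrow> f = 0"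
  using tri_lead(1)[of f] lmon_max(1)[of f] by (metis in_keys_iff lookup_zero)

lemma tri_inj: "inj_on tri (carrier L)"
proof (rule inj_onI)
  fix f g assume "f \<in> carrier L" "g \<in> carrier L" "tri f = tri g"
  then have "f - g = 0"
    using tri_eq_0[of "f - g"] keys_subset_closed(4)[of f "NF B" g] by (simp add: tri_linear)
  then show "f = g" by simp
qed

text \<open>Unitriangularity over a well-founded order: a word equals its image under
  \<open>tau\<close> minus a combination of smaller words, which are reached by induction.\<close>

lemma tri_surj: "tri ` carrier L = carrier L"
proof
  show "tri ` carrier L \<subseteq> carrier L" using tri_carrier by blast
  have closed: "f + g \<in> tri ` carrier L" "pscale a f \<in> tri ` carrier L" "f - g \<in> tri ` carrier L"
    if f: "f \<in> tri ` carrier L" and g: "g \<in> tri ` carrier L" for f g a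
  proof -
    obtain f' where f': "f' \<in> carrier L" "f = tri f'" using f by (rule imageE)
    obtain g' where g': "g' \<in> carrier L" "g = tri g'" using g by (rule imageE)
    have c: "f' + g' \<in> carrier L" "pscale a f' \<in> carrier L" "f' - g' \<in> carrier L"
      using f'(1) g'(1) by (simp_all add: keys_subset_closed)
    show "f + g \<in> tri ` carrier L" "pscale a f \<in> tri ` carrier L" "f - g \<in> tri ` carrier L"
      using c[THEN imageI[where f = tri]] unfolding tri_linear f'(2) g'(2) by auto
  qed
  have zero: "0 \<in> tri ` carrier L" using tri_linear(4) by (metis L.zero_closed Lbs_simps(3) imageI)
  have word: "w \<in> NF B \<longrightarrow> wmono w \<in> tri ` carrier L" for w
  proof (induction w rule: wf_induct_rule[OF wf_nf_less])
    case (1 w)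
    show ?case
    proof
      assume w: "w \<in> NF B"
      note p = tau_props[OF w]
      \<comment> \<open>The word w itself cancels because its coefficient in \<open>tau w\<close> is
        1; only smaller words are left.\<close>
      have sub: "supp (tau w - wmono w) \<subseteq> {v \<in> NF B. nf_less v w}"
      proof
        fix v assume v: "v \<in> supp (tau w - wmono w)"
        then have "v \<noteq> w" using p(2) by (auto simp: in_keys_iff lookup_minus wmono_def)
        moreover from this v have "v \<in> supp (tau w)"
          by (simp add: in_keys_iff lookup_minus wmono_def lookup_single)
        ultimately show "v \<in> {v \<in> NF B. nf_less v w}" using p by auto
      qed
      have "tau w - wmono w \<in> tri ` carrier L"
        by (rule poly_word_induct[OF sub]) (use zero closed(1,2) 1 in simp_all)
      moreover have "tau w \<in> tri ` carrier L"
        using w tri_wmono[of w] by (intro image_eqI[of _ _ "wmono w"]) (auto simp: wmono_def)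
      ultimately have "tau w - (tau w - wmono w) \<in> tri ` carrier L" by (rule closed(3)[rotated])
      then show "wmono w \<in> tri ` carrier L" by simp
    qed
  qed
  show "carrier L \<subseteq> tri ` carrier L"
  proof
    fix f assume "f \<in> carrier L"
    then have "supp f \<subseteq> NF B" by simp
    then show "f \<in> tri ` carrier L"
      by (rule poly_word_induct) (use zero closed(1,2) word in blast)+
  qed
qed

text \<open>Encoded as an image under \<open>tri\<close> rather than as a span of normal
  polynomials: since \<open>tri\<close> fixes the span of \<open>IrrR\<close>, a complement is then
  visible by splitting coordinates. It turns out to be the ideal \<open>I\<close>.\<close>

definition nspan :: "('b list \<Rightarrow>\<^sub>0 'k) set"
  where "nspan = tri ` {c. supp c \<subseteq> NF B - IrrR}"

lemma nspan_npoly: "s \<in> R \<Longrightarrow> set c \<subseteq> B \<Longrightarrow> npol s c \<in> nspan"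
  unfolding nspan_def using reducible_NF[of s c]
  by (intro image_eqI[of _ _ "wmono (lmon s @ c)"]) (simp, simp add: wmono_def)

lemma nspan_closed:
  "0 \<in> nspan" "f \<in> nspan \<Longrightarrow> g \<in> nspan \<Longrightarrow> f + g \<in> nspan" "f \<in> nspan \<Longrightarrow> pscale a f \<in> nspan"
  "f \<in> nspan \<Longrightarrow> g \<in> nspan \<Longrightarrow> f - g \<in> nspan"
proof -
  show "0 \<in> nspan" unfolding nspan_def using tri_linear(4) by (intro image_eqI[of _ _ 0]) simp_all
  show "pscale a f \<in> nspan" if f: "f \<in> nspan" for f
  proof -
    obtain c where "supp c \<subseteq> NF B - IrrR" "f = tri c" using f by (auto simp: nspan_def)
    then show ?thesis unfolding nspan_def
      by (intro image_eqI[of _ _ "pscale a c"]) (simp_all add: tri_linear keys_subset_closed(2))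
  qed
  show "f + g \<in> nspan" "f - g \<in> nspan" if f: "f \<in> nspan" and g: "g \<in> nspan" for f g
  proof -
    obtain c where c: "supp c \<subseteq> NF B - IrrR" "f = tri c" using f by (auto simp: nspan_def)
    obtain d where d: "supp d \<subseteq> NF B - IrrR" "g = tri d" using g by (auto simp: nspan_def)
    show "f + g \<in> nspan" unfolding nspan_def using c d
      by (intro image_eqI[of _ _ "c + d"]) (simp_all add: tri_linear keys_subset_closed(1))
    show "f - g \<in> nspan" unfolding nspan_def using c d
      by (intro image_eqI[of _ _ "c - d"]) (simp_all add: tri_linear keys_subset_closed(4))
  qed
qed

lemma nspan_carrier: "f \<in> nspan \<Longrightarrow> f \<in> carrier L"
  unfolding nspan_def using tri_carrier by auto

lemma nspan_induct [consumes 1, case_names zero npoly add scale]: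
  assumes "h \<in> nspan" and "P 0" "\<And>s c. s \<in> R \<Longrightarrow> set c \<subseteq> B \<Longrightarrow> P (npol s c)"
    "\<And>f g. f \<in> nspan \<Longrightarrow> g \<in> nspan \<Longrightarrow> P f \<Longrightarrow> P g \<Longrightarrow> P (f + g)" "\<And>a f. f \<in> nspan \<Longrightarrow> P f \<Longrightarrow> P (pscale a f)"
  shows "P h"
proof -
  obtain c where c: "supp c \<subseteq> NF B - IrrR" "h = tri c"
    using assms(1) by (auto simp: nspan_def)
  have "tri c \<in> nspan \<and> P (tri c)"
  proof (rule poly_word_induct[OF c(1)])
    fix w assume "w \<in> NF B - IrrR"
    then show "tri (wmono w) \<in> nspan \<and> P (tri (wmono w))"
      using NF_cases[of w] reducible_NF(3) nspan_npoly assms(3) by (metis DiffE tri_wmono)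
  qed (simp_all add: tri_linear assms(2,4,5) nspan_closed)
  with c show ?thesis by simp
qed

text \<open>The coordinates of f with respect to \<open>tri\<close> are split into those at
  irreducible and those at reducible words.\<close>

lemma Irr_nspan_decomp:
  assumes "f \<in> carrier L"
  obtains d h where "supp d \<subseteq> IrrR" "h \<in> nspan" "f = d + h"
proof -
  obtain c where c: "c \<in> carrier L" "f = tri c" using assms tri_surj by blast
  have "\<exists>d e. supp d \<subseteq> IrrR \<and> supp e \<subseteq> NF B - IrrR \<and> c = d + e"
  proof (rule poly_word_induct[where W = "NF B" and f = c])
    fix w assume "w \<in> NF B"
    then show "\<exists>d e. supp d \<subseteq> IrrR \<and> supp e \<subseteq> NF B - IrrR \<and>
        wmono w = d + (e :: 'b list \<Rightarrow>\<^sub>0 'k)"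
      by (cases "w \<in> IrrR")
        (rule exI[of _ "wmono w"], rule exI[of _ 0], simp add: wmono_def,
         rule exI[of _ 0], rule exI[of _ "wmono w"], simp add: wmono_def)
  next
    fix f g :: "'b list \<Rightarrow>\<^sub>0 'k"
    assume "\<exists>d e. supp d \<subseteq> IrrR \<and> supp e \<subseteq> NF B - IrrR \<and> f = d + e"
      "\<exists>d e. supp d \<subseteq> IrrR \<and> supp e \<subseteq> NF B - IrrR \<and> g = d + e"
    then obtain d e d' e' where
      *: "supp d \<subseteq> IrrR" "supp e \<subseteq> NF B - IrrR" "f = d + e"
        "supp d' \<subseteq> IrrR" "supp e' \<subseteq> NF B - IrrR" "g = d' + e'" by blast
    then have "f + g = (d + d') + (e + e')" by simp
    with * show "\<exists>d e. supp d \<subseteq> IrrR \<and> supp e \<subseteq> NF B - IrrR \<and> f + g = d + e"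
      by (metis keys_subset_closed(1))
  next
    fix a and f :: "'b list \<Rightarrow>\<^sub>0 'k"
    assume "\<exists>d e. supp d \<subseteq> IrrR \<and> supp e \<subseteq> NF B - IrrR \<and> f = d + e"
    then show "\<exists>d e. supp d \<subseteq> IrrR \<and> supp e \<subseteq> NF B - IrrR \<and> pscale a f = d + e"
      by (metis pscale_distrib(1) keys_subset_closed(2))
  next
    show "\<exists>d e. supp d \<subseteq> IrrR \<and> supp e \<subseteq> NF B - IrrR \<and>
        0 = d + (e :: 'b list \<Rightarrow>\<^sub>0 'k)"
      by (rule exI[of _ 0], rule exI[of _ 0]) simp
  qed (use c in simp)
  then obtain d e where de: "supp d \<subseteq> IrrR" "supp e \<subseteq> NF B - IrrR" "c = d + e"
    by blast
  then have "f = d + tri e" using c tri_Irr[of d] by (simp add: tri_linear)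
  with de that[of d "tri e"] show thesis by (auto simp: nspan_def)
qed

text \<open>Such a d is its own preimage under \<open>tri\<close> and also has a preimage supported
  on reducible words. Injectivity makes the two equal although their supports are disjoint.\<close>

lemma Irr_nspan_disjoint:
  assumes "supp d \<subseteq> IrrR" "d \<in> nspan"
  shows "d = 0"
proof -
  obtain c where c: "supp c \<subseteq> NF B - IrrR" "d = tri c"
    using assms(2) by (auto simp: nspan_def)
  have "IrrR \<subseteq> NF B" by (auto simp: Irr_iff)
  moreover have "tri c = tri d" using c tri_Irr[OF assms(1)] by simp
  ultimately have "c = d" using c assms(1) tri_inj[THEN inj_onD, of c d] by auto
  with c(1) assms(1) have "supp d \<subseteq> {}" by blast
  then show ?thesis by simp
qed

end

section \<open>The span of the normal polynomials is the ideal generated by R\<close>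

context reduced_gs
begin

lemma wmono_carrier: "w \<in> NF B \<Longrightarrow> wmono w \<in> carrier L"
  by (simp add: wmono_def)

lemma gen_carrier: "b \<in> B \<Longrightarrow> gen b \<in> carrier L"
  by (simp add: wmono_def gen_def NF_def)

lemma gen_hpart: "b \<in> B \<Longrightarrow> gen b \<in> hpart L (lpar B1 b)"
  by (simp add: gen_def wmono_def NF_def)

lemma mul_carrier: "f \<in> carrier L \<Longrightarrow> g \<in> carrier L \<Longrightarrow> mul f g \<in> carrier L"
  using L.prod_closed by simp

lemma NF_snoc: "w \<in> NF B \<Longrightarrow> b \<in> B \<Longrightarrow> w @ [b] \<in> NF B"
  by (auto simp: NF_def)

lemma carrier_induct [consumes 1, case_names zero word add scale]:
  assumes "f \<in> carrier L" "P 0" "\<And>w. w \<in> NF B \<Longrightarrow> P (wmono w)"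
    "\<And>f g. f \<in> carrier L \<Longrightarrow> g \<in> carrier L \<Longrightarrow> P f \<Longrightarrow> P g \<Longrightarrow> P (f + g)"
    "\<And>a f. f \<in> carrier L \<Longrightarrow> P f \<Longrightarrow> P (pscale a f)"
  shows "P f"
proof -
  have "supp f \<subseteq> NF B" using assms(1) by simp
  then have "f \<in> carrier L \<and> P f"
  proof (rule poly_word_induct)
    show "f + g \<in> carrier L \<and> P (f + g)" if "f \<in> carrier L \<and> P f" "g \<in> carrier L \<and> P g" for f g
      using that assms(4) by (simp add: keys_subset_closed(1))
    show "pscale a f \<in> carrier L \<and> P (pscale a f)" if "f \<in> carrier L \<and> P f" for a f
      using that assms(5) by (simp add: keys_subset_closed(2))
  qed (use assms(2,3) wmono_carrier in simp_all)
  then show ?thesis ..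
qed

text \<open>The Leibniz identity read as a recursion on the appended word: f(hb) is expressed by
  (fh)b and (fb)h, where the normal polynomial h is one letter shorter.\<close>

lemma mul_letter_npoly:
  assumes "s \<in> R" "set c \<subseteq> B"
  obtains i where "npol s c \<in> hpart L i"
    "\<And>f b. mul f (npol s (c @ [b])) = mul (mul f (npol s c)) (gen b) -
      pscale (koszul (lpar B1 b) i) (mul (mul f (gen b)) (npol s c))"
proof -
  obtain i where i: "npol s c \<in> hpart L i" using R_props(3)[OF assms(1)] npoly_hpart assms(2) by blast
  then have "\<forall>w\<in>supp (npol s c). w \<noteq> [] \<and> wpar B1 w = i" by (auto simp: NF_def)
  from that[OF i] leibniz_letter[OF this] show thesis by (simp add: npoly_snoc)
qed

lemma nspan_mul_letter:
  assumes "h \<in> nspan" "b \<in> B"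
  shows "mul h (gen b) \<in> nspan"
  using assms(1)
proof (induction rule: nspan_induct)
  case (npoly s c)
  then show ?case using nspan_npoly[of s "c @ [b]"] assms(2) by (simp add: npoly_snoc)
qed (simp_all add: nspan_closed free_mult_add free_mult_pscale)

text \<open>This is the second condition on a Groebner--Shirshov basis, which applies to every
  element of R because all leading monomials are longer than 1. Only membership in the span is
  retained; the degree bound is dropped.\<close>

lemma nspan_word_mul_R:
  assumes "s \<in> R" "w \<in> NF B"
  shows "mul (wmono w) s \<in> nspan"
proof (cases "mul (wmono w) s = 0")
  case False
  then obtain c where c: "supp c \<subseteq> {g. (\<exists>s\<in>R. g \<in> normal_of B0 B1 s)}"
    "mul (wmono w) s = (\<Sum>g\<in>supp c. pscale (coef c g) g)"
  proof -
    have "\<forall>f\<in>R. \<forall>\<mu>\<in>NF B. length (lmon f) > 1 \<and> mul (wmono \<mu>) f \<noteq> 0 \<longrightarrow>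
      trivial_mod B0 B1 R (\<lambda>w. length w \<le> length \<mu> + length (lmon f)) (mul (wmono \<mu>) f)"
      using gs unfolding reduced_gs_basis_def gs_basis_def by simp
    then have "trivial_mod B0 B1 R (\<lambda>v. length v \<le> length w + length (lmon s)) (mul (wmono w) s)"
      using assms long False by simp
    with that show thesis unfolding trivial_mod_def by blast
  qed
  have "(\<Sum>g\<in>W. pscale (coef c g) g) \<in> nspan" if "finite W" "W \<subseteq> supp c" for W
    using that
  proof (induction W rule: finite_induct)
    case (insert g W)
    then obtain s where s: "s \<in> R" "g \<in> normal_of B0 B1 s" using c(1) by blast
    then obtain d where "set d \<subseteq> B" "g = npol s d" unfolding normal_of_R[OF s(1)] by blast
    then show ?case using insert s by (simp add: nspan_closed nspan_npoly)
  qed (simp add: nspan_closed)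
  then show ?thesis using c(2) by simp
qed (simp add: nspan_closed)

text \<open>Induction on the word appended to s, with \<open>nspan_word_mul_R\<close> as the base.
  The left word w has to be arbitrary, since the recursion also calls for the left factor w @
  [b].\<close>

lemma nspan_mul_left:
  assumes "h \<in> nspan" "g \<in> carrier L"
  shows "mul g h \<in> nspan"
proof -
  have np: "mul (wmono w) (npol s c) \<in> nspan"
    if s: "s \<in> R" and "set c \<subseteq> B" "w \<in> NF B" for w s c
    using that(2,3)
  proof (induction c arbitrary: w rule: rev_induct)
    case Nil
    then show ?case using nspan_word_mul_R[OF s] by simp
  next
    case (snoc b c)
    then have bc: "b \<in> B" "set c \<subseteq> B" by auto
    obtain i where eq: "\<And>f b. mul f (npol s (c @ [b])) = mul (mul f (npol s c)) (gen b) -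
        pscale (koszul (lpar B1 b) i) (mul (mul f (gen b)) (npol s c))"
      using mul_letter_npoly[OF s bc(2)] by blast
    show ?case unfolding eq wmono_snoc
      using snoc.IH[OF bc(2)] NF_snoc[OF snoc.prems(2) bc(1)] snoc.prems bc
      by (intro nspan_closed(3,4) nspan_mul_letter) auto
  qed
  show ?thesis using assms(2)
  proof (induction rule: carrier_induct)
    case (word w)
    show ?case using assms(1)
    proof (induction rule: nspan_induct)
      case (npoly s c)
      then show ?case using np word by blast
    qed (simp_all add: nspan_closed free_mult_add free_mult_pscale)
  qed (simp_all add: nspan_closed free_mult_add free_mult_pscale)
qed

text \<open>Only closure under single letters is needed: the Leibniz identity reduces a right factor
  v @ [b] to v and b. Here the left factor varies, as (hb)v occurs.\<close>

lemma nspan_mul_right: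
  assumes "h \<in> nspan" "g \<in> carrier L"
  shows "mul h g \<in> nspan"
proof -
  have word_mul: "mul h (wmono v) \<in> nspan" if "v \<in> NF B" "h \<in> nspan" for v h
    using that
  proof (induction v arbitrary: h rule: rev_induct)
    case (snoc b v)
    then have b: "b \<in> B" by (auto simp: NF_def)
    show ?case
    proof (cases "v = []")
      case True
      then show ?thesis using nspan_mul_letter[OF snoc.prems(2) b] by (simp add: gen_def)
    next
      case False
      then have v: "v \<in> NF B" using snoc.prems by (auto simp: NF_def)
      show ?thesis unfolding leibniz_letter_word[OF False]
        using snoc.IH[OF v] snoc.prems(2) b by (intro nspan_closed(3,4) nspan_mul_letter) (auto intro: nspan_mul_letter)
    qed
  qed (simp add: NF_def)
  show ?thesis using assms(2)
  proof (induction rule: carrier_induct)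
    case (word w)
    then show ?case using word_mul assms(1) by blast
  qed (simp_all add: nspan_closed free_mult_add free_mult_pscale)
qed

text \<open>Every normal polynomial is homogeneous, so it goes wholly into one of the two
  components, and P is tracked along the component of parity i only. A trivial P yields gradedness
  of the span; a homogeneous h yields \<open>nspan_homog_induct\<close>.\<close>

lemma nspan_component_induct:
  assumes "h \<in> nspan" and "P 0"
    "\<And>s c. s \<in> R \<Longrightarrow> set c \<subseteq> B \<Longrightarrow> npol s c \<in> hpart L i \<Longrightarrow> P (npol s c)"
    "\<And>f g. f \<in> nspan \<Longrightarrow> g \<in> nspan \<Longrightarrow> P f \<Longrightarrow> P g \<Longrightarrow> P (f + g)" "\<And>a f. f \<in> nspan \<Longrightarrow> P f \<Longrightarrow> P (pscale a f)"
  shows "\<exists>y z. y \<in> nspan \<and> y \<in> hpart L i \<and> z \<in> nspan \<and> z \<in> hpart L (i + 1) \<and> h = y + z \<and> P y"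
  using assms(1)
proof (induction rule: nspan_induct)
  case zero
  show ?case using L.hpart_zero[of i] L.hpart_zero[of "i + 1"] assms(2) nspan_closed(1)
    by (intro exI[of _ 0]) simp
next
  case (npoly s c)
  then obtain j where j: "npol s c \<in> hpart L j"
    using R_props(3)[OF npoly(1)] npoly_hpart by blast
  show ?case
  proof (cases "j = i")
    case True
    then show ?thesis
      using j L.hpart_zero[of "i + 1"] assms(3)[OF npoly] nspan_npoly[OF npoly] nspan_closed(1)
      by (intro exI[of _ "npol s c"] exI[of _ 0]) simp
  next
    case False
    then have "j = i + 1" by (cases i; cases j) auto
    then show ?thesis using j L.hpart_zero[of i] assms(2) nspan_npoly[OF npoly] nspan_closed(1)
      by (intro exI[of _ 0] exI[of _ "npol s c"]) simp
  qed
next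
  case (add f g)
  obtain y z where y: "y \<in> nspan" "y \<in> hpart L i" "z \<in> nspan" "z \<in> hpart L (i + 1)" "f = y + z" "P y"
    using add.IH(1) by blast
  obtain y' z' where y': "y' \<in> nspan" "y' \<in> hpart L i" "z' \<in> nspan" "z' \<in> hpart L (i + 1)" "g = y' + z'" "P y'"
    using add.IH(2) by blast
  have "y + y' \<in> hpart L i" "z + z' \<in> hpart L (i + 1)"
    using L.hpart_closed(1)[OF y(2) y'(2)] L.hpart_closed(1)[OF y(4) y'(4)] by simp_all
  then show ?case using y y' nspan_closed(2) assms(4)
    by (intro exI[of _ "y + y'"] exI[of _ "z + z'"]) simp
next
  case (scale a f)
  then obtain y z where y: "y \<in> nspan" "y \<in> hpart L i" "z \<in> nspan" "z \<in> hpart L (i + 1)" "f = y + z" "P y"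
    by blast
  have "pscale a y \<in> hpart L i" "pscale a z \<in> hpart L (i + 1)"
    using L.hpart_closed(2)[OF y(2)] L.hpart_closed(2)[OF y(4)] by simp_all
  then show ?case using y nspan_closed(3) assms(5)
    by (intro exI[of _ "pscale a y"] exI[of _ "pscale a z"]) (simp add: pscale_distrib)
qed

text \<open>A combination representing a homogeneous element may contain generators of the other
  parity, but their total contribution vanishes and can be discarded.\<close>

lemma nspan_homog_induct [consumes 2, case_names zero npoly add scale]:
  assumes "h \<in> nspan" "h \<in> hpart L i" and "P 0"
    "\<And>s c. s \<in> R \<Longrightarrow> set c \<subseteq> B \<Longrightarrow> npol s c \<in> hpart L i \<Longrightarrow> P (npol s c)"
    "\<And>f g. f \<in> nspan \<Longrightarrow> g \<in> nspan \<Longrightarrow> P f \<Longrightarrow> P g \<Longrightarrow> P (f + g)" "\<And>a f. f \<in> nspan \<Longrightarrow> P f \<Longrightarrow> P (pscale a f)"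
  shows "P h"
proof -
  obtain y z where yz: "y \<in> hpart L i" "z \<in> hpart L (i + 1)" "h = y + z" "P y"
    using nspan_component_induct[of h P i, OF assms(1,3-6)] by blast
  then have "z = 0" using L.hpart_sum_mem[OF yz(1,2)] assms(2) by simp
  with yz show ?thesis by simp
qed

lemma superideal_nspan: "superideal nspan L"
proof (rule L.superidealI)
  fix y z assume yz: "y \<in> hpart L 0" "z \<in> hpart L 1" "y \<oplus>\<^bsub>L\<^esub> z \<in> nspan"
  then have n: "y + z \<in> nspan" by simp
  obtain u v where uv: "u \<in> nspan" "u \<in> hpart L 0" "v \<in> nspan" "v \<in> hpart L (0 + 1)" "y + z = u + v"
    using nspan_component_induct[OF n, of "\<lambda>_. True" 0] by blast
  have "y = u \<and> z = v"
    by (rule L.hpart_split_unique[of y 0 z u v]) (use uv(2,4,5) yz(1,2) in simp_all)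
  then show "y \<in> nspan \<and> z \<in> nspan" using uv(1,3) by blast
next
  show "nspan \<subseteq> carrier L" using nspan_carrier by (rule subsetI)
  show "x \<otimes>\<^bsub>L\<^esub> y \<in> nspan" if "x \<in> nspan" "y \<in> carrier L" for x y
    using nspan_mul_right[OF that] by simp
  show "y \<otimes>\<^bsub>L\<^esub> x \<in> nspan" if "x \<in> nspan" "y \<in> carrier L" for x y
    using nspan_mul_left[OF that] by simp
qed (simp_all add: nspan_closed)

lemma R_carrier: "R \<subseteq> carrier L" using R_props(4) by blast

lemma superideal_I: "superideal I L"
  by (rule L.superideal_genideal_super[OF R_carrier])

lemma npoly_in_I:
  assumes "s \<in> R" "set c \<subseteq> B"
  shows "npol s c \<in> I"
  using assms(2)
proof (induction c rule: rev_induct)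
  case Nil
  then show ?case using L.genideal_super_incl[of R] assms(1) by auto
next
  case (snoc b c)
  then show ?case using L.superidealD(7)[OF superideal_I, of "npol s c" "gen b"] gen_carrier[of b]
    by (simp add: npoly_snoc)
qed

lemma I_eq_nspan: "I = nspan"
proof
  have "R \<subseteq> nspan" using nspan_npoly[of _ "[]"] by auto
  then show "I \<subseteq> nspan" by (rule L.genideal_super_least[OF superideal_nspan])
  show "nspan \<subseteq> I"
  proof
    fix h assume "h \<in> nspan"
    then show "h \<in> I"
      by (induction rule: nspan_induct)
        (use npoly_in_I L.superidealD(2,3,4)[OF superideal_I] in simp_all)
  qed
qed

text \<open>The linear independence of the normal polynomials is used here: arbitrary values on them
  extend linearly. The map is the linear extension of G composed with the inverse of
  \<open>tri\<close>.\<close>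

lemma npoly_linear_map_exists:
  fixes V :: "('k, 'v) superalgebra"
  assumes "superspace V" and G: "\<And>s c. s \<in> R \<Longrightarrow> set c \<subseteq> B \<Longrightarrow> G s c \<in> carrier V"
  obtains F where "F \<in> linear_maps L V" "\<And>s c. s \<in> R \<Longrightarrow> set c \<subseteq> B \<Longrightarrow> F (npol s c) = G s c"
proof -
  interpret V: superspace V by fact
  \<comment> \<open>The value zero at irreducible words is a default that extends the map from the
    ideal to all of \<open>L\<close>.\<close>
  let ?G = "\<lambda>w. if w \<in> IrrR then \<zero>\<^bsub>V\<^esub> else G (fst (dec w)) (snd (dec w))"
  define nfc where "nfc = inv_into (carrier L) tri"
  define F where "F f = V.lsum ?G (nfc f)" for f
  have nfc: "nfc f \<in> carrier L" "tri (nfc f) = f" if "f \<in> carrier L" for f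
    using that tri_surj unfolding nfc_def by (metis inv_into_into, metis f_inv_into_f)
  have nfcI: "nfc f = c" if "c \<in> carrier L" "f = tri c" for f c
    using that tri_inj unfolding nfc_def by (simp add: inv_into_f_f)
  have Gc: "?G w \<in> carrier V" if "w \<in> NF B" for w
    using that by (cases rule: NF_cases) (auto simp: dec_eq G)
  have Gk: "?G ` supp c \<subseteq> carrier V" if "c \<in> carrier L" for c
  proof
    fix y assume "y \<in> ?G ` supp c"
    then obtain w where "y = ?G w" "w \<in> supp c" by (rule imageE)
    with that Gc[of w] show "y \<in> carrier V" by auto
  qed
  have "F \<in> linear_maps L V"
    unfolding linear_maps_def mem_Collect_eq
  proof (intro conjI ballI allI funcsetI)
    fix f assume f: "f \<in> carrier L"
    show "F f \<in> carrier V" unfolding F_def by (rule V.lsum_closed[OF Gk[OF nfc(1)[OF f]]])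
    fix a
    have "nfc (pscale a f) = pscale a (nfc f)"
      by (rule nfcI) (use nfc[OF f] in \<open>simp_all add: tri_linear keys_subset_closed(2)\<close>)
    then show "F (a \<odot>\<^bsub>L\<^esub> f) = a \<odot>\<^bsub>V\<^esub> F f"
      using V.lsum_pscale[OF Gk[OF nfc(1)[OF f]]] by (simp add: F_def)
  next
    fix f g assume f: "f \<in> carrier L" and g: "g \<in> carrier L"
    have "nfc (f + g) = nfc f + nfc g"
      by (rule nfcI) (use nfc[OF f] nfc[OF g] in \<open>simp_all add: tri_linear keys_subset_closed(1)\<close>)
    then show "F (f \<oplus>\<^bsub>L\<^esub> g) = F f \<oplus>\<^bsub>V\<^esub> F g"
      using V.lsum_add[OF Gk[OF nfc(1)[OF f]] Gk[OF nfc(1)[OF g]]] by (simp add: F_def)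
  qed
  moreover have "F (npol s c) = G s c" if sc: "s \<in> R" "set c \<subseteq> B" for s c
  proof -
    note p = reducible_NF[OF sc]
    have "nfc (npol s c) = wmono (lmon s @ c)"
      by (rule nfcI) (use p wmono_carrier[OF p(1)] in simp_all)
    then show ?thesis using V.lsum_single[of ?G "lmon s @ c", OF Gc[OF p(1)]] p dec_eq[OF sc]
      by (simp add: F_def wmono_def)
  qed
  ultimately show thesis by (rule that)
qed

section \<open>Existence and uniqueness of decreasing expressions\<close>

definition nval :: "('k, 'b) nexpr \<Rightarrow> ('b list \<Rightarrow>\<^sub>0 'k)"
  where "nval es = (\<Sum>(\<alpha>, s, c)\<leftarrow>es. pscale \<alpha> (npol s c))"

text \<open>The clause of \<open>is_nexpr\<close> about the leading monomial of the value is left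
  out because it is a consequence; \<open>is_nexpr_iff\<close> recovers it. Without it the condition
  passes to tails of lists.\<close>

definition nvalid :: "('k, 'b) nexpr \<Rightarrow> bool"
  where "nvalid es \<longleftrightarrow> (\<forall>(\<alpha>, s, c)\<in>set es. \<alpha> \<noteq> 0 \<and> s \<in> R \<and> set c \<subseteq> B) \<and>
    sorted_wrt (\<lambda>(\<alpha>, s, c) (\<beta>, t, d). nf_less (lmon (npol t d)) (lmon (npol s c))) es"

lemma nval_simps [simp]: "nval [] = 0" "nval ((\<alpha>, s, c) # es) = pscale \<alpha> (npol s c) + nval es"
  by (simp_all add: nval_def)

lemma nvalid_Cons: "nvalid ((\<alpha>, s, c) # es) \<longleftrightarrow> \<alpha> \<noteq> 0 \<and> s \<in> R \<and> set c \<subseteq> B \<and> nvalid es \<and>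
    (\<forall>(\<beta>, t, d)\<in>set es. nf_less (lmon (npol t d)) (lmon (npol s c)))"
  by (auto simp: nvalid_def)

lemma nval_in_I: "nvalid es \<Longrightarrow> nval es \<in> I"
proof (induction es)
  case Nil
  then show ?case by (simp add: I_eq_nspan nspan_closed)
next
  case (Cons e es)
  obtain \<alpha> s c where "e = (\<alpha>, s, c)" by (cases e)
  with Cons show ?case by (simp add: nvalid_Cons I_eq_nspan nspan_closed nspan_npoly)
qed

lemma nval_keys_less:
  assumes "nvalid es" "\<forall>(\<beta>, t, d)\<in>set es. nf_less (lmon (npol t d)) u" "v \<in> supp (nval es)"
  shows "nf_less v u"
  using assms
proof (induction es)
  case (Cons e es)
  obtain \<alpha> s c where e: "e = (\<alpha>, s, c)" by (cases e)
  from Cons.prems(3) consider "v \<in> supp (nval es)" | "v \<in> supp (npol s c)"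
    unfolding e nval_simps using keys_pscale[of \<alpha> "npol s c"] Poly_Mapping.keys_add[of "pscale \<alpha> (npol s c)" "nval es"] by blast
  then show ?case
  proof cases
    case 1
    then show ?thesis using Cons by (simp add: e nvalid_Cons)
  next
    case 2
    then have "npol s c \<noteq> 0" by auto
    with 2 lmon_max(2)[of "npol s c" v] Cons.prems(2) show ?thesis
      using nf_less_order(1)[of v "lmon (npol s c)" u] by (cases "v = lmon (npol s c)") (simp_all add: e)
  qed
qed simp

text \<open>The strict decrease prevents any later term from touching the leading word of the first
  one, and s is monic, so the coefficient there is exactly \<alpha>.\<close>

lemma nval_lead:
  assumes "nvalid ((\<alpha>, s, c) # es)"
  shows "lmon (nval ((\<alpha>, s, c) # es)) = lmon s @ c"
    and "coef (nval ((\<alpha>, s, c) # es)) (lmon s @ c) = \<alpha>"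
proof -
  have v: "\<alpha> \<noteq> 0" "s \<in> R" "set c \<subseteq> B" "nvalid es"
      "\<forall>(\<beta>, t, d)\<in>set es. nf_less (lmon (npol t d)) (lmon s @ c)"
    using assms by (auto simp: nvalid_Cons lmon_npoly R_props(1))
  note less = nval_keys_less[OF v(4,5)]
  have "lmon s @ c \<notin> supp (nval es)" using less nf_less_order(2) by blast
  then show eq: "coef (nval ((\<alpha>, s, c) # es)) (lmon s @ c) = \<alpha>"
    using v R_props(2)[OF v(2)] by (simp add: lookup_add npoly_keys in_keys_iff)
  have np: "npol s c \<noteq> 0" using npoly_keys(2)[of B0 B1 s c "lmon s"] R_props(2)[OF v(2)] by auto
  show "lmon (nval ((\<alpha>, s, c) # es)) = lmon s @ c"
  proof (rule lmonI)
    show "lmon s @ c \<in> supp (nval ((\<alpha>, s, c) # es))" using eq v(1) by (simp add: in_keys_iff)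
    fix u assume u: "u \<in> supp (nval ((\<alpha>, s, c) # es))" "u \<noteq> lmon s @ c"
    then consider "u \<in> supp (nval es)" | "u \<in> supp (npol s c)"
      unfolding nval_simps using keys_pscale[of \<alpha> "npol s c"] Poly_Mapping.keys_add[of "pscale \<alpha> (npol s c)" "nval es"] by blast
    then show "nf_less u (lmon s @ c)"
      using less lmon_max(2)[OF np, of u] u(2) lmon_npoly[OF R_props(1)[OF v(2)], of B0 B1 c]
      by cases auto
  qed
qed

lemma is_nexpr_iff: "is_nexpr B0 B1 R h es \<longleftrightarrow> nvalid es \<and> h = nval es"
proof
  assume r: "nvalid es \<and> h = nval es"
  have "es \<noteq> [] \<longrightarrow> (case hd es of (\<alpha>, s, c) \<Rightarrow> lmon (npol s c) = lmon h)"
  proof (cases es)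
    case (Cons e es')
    obtain \<alpha> s c where "e = (\<alpha>, s, c)" by (cases e)
    then show ?thesis using r Cons nval_lead(1)[of \<alpha> s c es'] lmon_npoly[OF R_props(1), of s B0 B1 c]
      by (simp add: nvalid_Cons)
  qed simp
  with r show "is_nexpr B0 B1 R h es" unfolding is_nexpr_def nvalid_def nval_def by blast
qed (simp add: is_nexpr_def nvalid_def nval_def)

text \<open>The first triple can be read off from the value: its leading word determines s and c by
  \<open>reducible_unique\<close>, its leading coefficient is \<alpha>. Cancelling this term leaves
  equal tails.\<close>

lemma nvalid_unique: "nvalid es \<Longrightarrow> nvalid es' \<Longrightarrow> nval es = nval es' \<Longrightarrow> es = es'"
proof (induction es arbitrary: es')
  case Nil
  show ?case
  proof (cases es')
    case (Cons e es'')
    obtain \<alpha> s c where "e = (\<alpha>, s, c)" by (cases e)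
    with Nil Cons nval_lead(2)[of \<alpha> s c es''] show ?thesis by (simp add: nvalid_Cons)
  qed simp
next
  case (Cons e es)
  obtain \<alpha> s c where e: "e = (\<alpha>, s, c)" by (cases e)
  show ?case
  proof (cases es')
    case Nil
    with Cons.prems e nval_lead(2)[of \<alpha> s c es] show ?thesis by (simp add: nvalid_Cons)
  next
    case (Cons e' es'')
    obtain \<beta> t d where e': "e' = (\<beta>, t, d)" by (cases e')
    note v = Cons.prems[unfolded e Cons e']
    have "lmon s @ c = lmon t @ d" using nval_lead(1)[OF v(1)] nval_lead(1)[OF v(2)] v(3) by metis
    then have st: "s = t" "c = d" using v reducible_unique[of s t c d] by (simp_all add: nvalid_Cons)
    moreover have "\<alpha> = \<beta>" using nval_lead(2)[OF v(1)] nval_lead(2)[OF v(2)] v(3) st by metis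
    moreover have "es = es''" using Cons.IH[of es''] v st calculation by (simp add: nvalid_Cons)
    ultimately show ?thesis using e e' Cons by simp
  qed
qed

text \<open>Division with respect to R: the leading word of an element of the ideal is reducible, so
  a multiple of one normal polynomial removes it, and the order on words is well-founded.\<close>

lemma nvalid_exists:
  assumes "h \<in> I"
  shows "\<exists>es. nvalid es \<and> h = nval es"
proof -
  have "\<forall>h. h \<in> I \<and> h \<noteq> 0 \<and> lmon h = u \<longrightarrow> (\<exists>es. nvalid es \<and> h = nval es)" for u
  proof (induction u rule: wf_induct_rule[OF wf_nf_less])
    case (1 u)
    show ?case
    proof (intro allI impI)
      fix h assume h: "h \<in> I \<and> h \<noteq> 0 \<and> lmon h = u"
      then have hc: "h \<in> carrier L" and hn: "h \<in> nspan" using nspan_carrier by (auto simp: I_eq_nspan simp del: Lbs_simps)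
      have max: "u \<in> supp h" "\<And>v. v \<in> supp h \<Longrightarrow> v \<noteq> u \<Longrightarrow> nf_less v u"
        using h lmon_max by auto
      \<comment> \<open>The element is \<open>tri c\<close> with c supported on reducible words, and
        \<open>tri\<close> preserves the leading word.\<close>
      have "u \<notin> IrrR"
      proof -
        obtain c where c: "supp c \<subseteq> NF B - IrrR" "h = tri c"
          using hn by (auto simp: nspan_def)
        then have c0: "c \<noteq> 0" using h tri_linear(4) by auto
        have "c \<in> carrier L" using c(1) by auto
        then have "lmon c = u" using tri_lead(2)[OF _ c0] c(2) h by simp
        then show ?thesis using lmon_max(1)[OF c0] c(1) by blast
      qed
      moreover have "u \<in> NF B" using max(1) hc by auto
      ultimately obtain s c where sc: "s \<in> R" "set c \<subseteq> B" "u = lmon s @ c"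
        using Irr_iff by blast
      define \<alpha> where "\<alpha> = coef h u"
      have \<alpha>: "\<alpha> \<noteq> 0" using max(1) by (simp add: \<alpha>_def in_keys_iff)
      let ?g = "h - pscale \<alpha> (npol s c)"
      have gI: "?g \<in> I" using hn nspan_npoly[OF sc(1,2)] by (simp add: I_eq_nspan nspan_closed)
      have np: "npol s c \<noteq> 0" "lmon (npol s c) = u"
        using npoly_keys(2)[of B0 B1 s c "lmon s"] R_props(2)[OF sc(1)] lmon_npoly[OF R_props(1)[OF sc(1)]] sc(3)
        by auto
      have gu: "v \<in> supp ?g \<Longrightarrow> nf_less v u" for v
      proof -
        assume v: "v \<in> supp ?g"
        have "coef ?g u = 0"
          using npoly_keys(2)[of B0 B1 s c "lmon s"] R_props(2)[OF sc(1)] sc(3) by (simp add: lookup_minus \<alpha>_def)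
        then have "v \<noteq> u" using v by (auto simp: in_keys_iff)
        moreover have "v \<in> supp h \<or> v \<in> supp (npol s c)"
          using v by (auto simp: in_keys_iff lookup_minus)
        ultimately show "nf_less v u" using max(2) lmon_max(2)[OF np(1), of v] np(2) by blast
      qed
      \<comment> \<open>The bound on every term is what allows the new first term to be prepended.
        For the head of \<open>es\<close> it comes from the leading word of the remainder, for the
        others from the strict decrease.\<close>
      have "\<exists>es. nvalid es \<and> ?g = nval es \<and> (\<forall>(\<beta>, t, d)\<in>set es. nf_less (lmon (npol t d)) u)"
      proof (cases "?g = 0")
        case True
        then show ?thesis by (intro exI[of _ "[]"]) (simp add: nvalid_def)
      next
        case False
        have lg: "nf_less (lmon ?g) u" using gu[OF lmon_max(1)[OF False]] .
        then obtain es where es: "nvalid es" "?g = nval es" using 1[of "lmon ?g"] gI False by auto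
        have "\<forall>(\<beta>, t, d)\<in>set es. nf_less (lmon (npol t d)) u"
        proof (cases es)
          case (Cons e es')
          obtain \<beta> t d where e: "e = (\<beta>, t, d)" by (cases e)
          have v: "nvalid ((\<beta>, t, d) # es')" using es Cons e by simp
          have "lmon (npol t d) = lmon ?g"
            using nval_lead(1)[OF v] es(2) Cons e lmon_npoly[OF R_props(1), of t B0 B1 d] v by (simp add: nvalid_Cons)
          then have "nf_less (lmon (npol t d)) u" using lg by simp
          then show ?thesis using v nf_less_order(1)[of _ "lmon (npol t d)" u] unfolding Cons e
            by (auto simp: nvalid_Cons)
        qed simp
        with es show ?thesis by blast
      qed
      then obtain es where es: "nvalid es" "?g = nval es" "\<forall>(\<beta>, t, d)\<in>set es. nf_less (lmon (npol t d)) u" by blast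
      have "nvalid ((\<alpha>, s, c) # es)" using es sc \<alpha> np(2) by (simp add: nvalid_Cons)
      moreover have "h = nval ((\<alpha>, s, c) # es)" using es(2) by (simp add: algebra_simps)
      ultimately show "\<exists>es. nvalid es \<and> h = nval es" by blast
    qed
  qed
  from this[of "lmon h"] assms show ?thesis
    by (cases "h = 0") (auto intro!: exI[of _ "[]"] simp: nvalid_def)
qed

lemma nexpr_of_I:
  assumes "h \<in> I"
  shows "is_nexpr B0 B1 R h (nexpr_of B0 B1 R h)"
proof -
  obtain es where es: "nvalid es" "h = nval es" using nvalid_exists[OF assms] by blast
  then have "is_nexpr B0 B1 R h es" by (simp add: is_nexpr_iff)
  then show ?thesis unfolding nexpr_of_def
    by (rule theI) (use es nvalid_unique in \<open>simp add: is_nexpr_iff\<close>)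
qed

end

section \<open>Split extensions\<close>

lemma koszul_commute: "koszul i j = koszul j i"
  by (auto simp: koszul_def)

text \<open>The semidirect product in which M becomes an abelian ideal: the products of elements of
  M with each other are zero.\<close>

definition split_ext :: "('k, 'b) superalgebra \<Rightarrow> ('k, 'a) superalgebra \<Rightarrow> ('b \<Rightarrow> 'a \<Rightarrow> 'a) \<Rightarrow>
    ('a \<Rightarrow> 'b \<Rightarrow> 'a) \<Rightarrow> ('k, 'a \<times> 'b) superalgebra"
  where "split_ext B M lact ract =
    \<lparr>carrier = carrier M \<times> carrier B,
     monoid.mult = (\<lambda>p q. (ract (fst p) (snd q) \<oplus>\<^bsub>M\<^esub> lact (snd p) (fst q), snd p \<otimes>\<^bsub>B\<^esub> snd q)),
     one = (\<one>\<^bsub>M\<^esub>, \<one>\<^bsub>B\<^esub>), ring.zero = (\<zero>\<^bsub>M\<^esub>, \<zero>\<^bsub>B\<^esub>),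
     add = (\<lambda>p q. (fst p \<oplus>\<^bsub>M\<^esub> fst q, snd p \<oplus>\<^bsub>B\<^esub> snd q)),
     module.smult = (\<lambda>c p. (c \<odot>\<^bsub>M\<^esub> fst p, c \<odot>\<^bsub>B\<^esub> snd p)),
     hpart = (\<lambda>i. hpart M i \<times> hpart B i)\<rparr>"

lemma split_ext_simps [simp]:
  "carrier (split_ext B M lact ract) = carrier M \<times> carrier B"
  "p \<otimes>\<^bsub>split_ext B M lact ract\<^esub> q = (ract (fst p) (snd q) \<oplus>\<^bsub>M\<^esub> lact (snd p) (fst q), snd p \<otimes>\<^bsub>B\<^esub> snd q)"
  "\<zero>\<^bsub>split_ext B M lact ract\<^esub> = (\<zero>\<^bsub>M\<^esub>, \<zero>\<^bsub>B\<^esub>)"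
  "p \<oplus>\<^bsub>split_ext B M lact ract\<^esub> q = (fst p \<oplus>\<^bsub>M\<^esub> fst q, snd p \<oplus>\<^bsub>B\<^esub> snd q)"
  "c \<odot>\<^bsub>split_ext B M lact ract\<^esub> p = (c \<odot>\<^bsub>M\<^esub> fst p, c \<odot>\<^bsub>B\<^esub> snd p)"
  "hpart (split_ext B M lact ract) i = hpart M i \<times> hpart B i"
  by (simp_all add: split_ext_def)

context supermodule
begin

lemma act_zero:
  "x \<in> carrier B \<Longrightarrow> lact x \<zero>\<^bsub>M\<^esub> = \<zero>\<^bsub>M\<^esub>" "f \<in> carrier M \<Longrightarrow> lact \<zero>\<^bsub>B\<^esub> f = \<zero>\<^bsub>M\<^esub>"
  "x \<in> carrier B \<Longrightarrow> ract \<zero>\<^bsub>M\<^esub> x = \<zero>\<^bsub>M\<^esub>" "f \<in> carrier M \<Longrightarrow> ract f \<zero>\<^bsub>B\<^esub> = \<zero>\<^bsub>M\<^esub>"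
  using lact_smult_right[of x "\<zero>\<^bsub>M\<^esub>" 0] lact_closed[of x "\<zero>\<^bsub>M\<^esub>"]
    lact_smult_left[of "\<zero>\<^bsub>B\<^esub>" f 0] lact_closed[of "\<zero>\<^bsub>B\<^esub>" f]
    ract_smult_left[of x "\<zero>\<^bsub>M\<^esub>" 0] ract_closed[of x "\<zero>\<^bsub>M\<^esub>"]
    ract_smult_right[of "\<zero>\<^bsub>B\<^esub>" f 0] ract_closed[of "\<zero>\<^bsub>B\<^esub>" f]
  by (simp_all add: M.smult_laws B.smult_laws)

lemma act_uminus:
  "\<lbrakk>x \<in> carrier B; f \<in> carrier M\<rbrakk> \<Longrightarrow> lact x (\<ominus>\<^bsub>M\<^esub> f) = \<ominus>\<^bsub>M\<^esub> lact x f"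
  "\<lbrakk>x \<in> carrier B; f \<in> carrier M\<rbrakk> \<Longrightarrow> ract (\<ominus>\<^bsub>M\<^esub> f) x = \<ominus>\<^bsub>M\<^esub> ract f x"
  using lact_smult_right[of x f "-1"] lact_closed[of x f] ract_smult_left[of x f "-1"] ract_closed[of x f]
  by (simp_all add: M.smult_laws)

text \<open>The three mixed axioms of a supermodule are the Leibniz identity with one factor from M,
  one axiom for each of its three positions. Terms with two or more factors from M vanish.\<close>

lemma leibniz_superalgebra_split_ext: "leibniz_superalgebra (split_ext B M lact ract)"
proof -
  let ?P = "split_ext B M lact ract"
  note closed = lact_closed ract_closed B.prod_closed
  have grp: "abelian_group ?P"
  proof (rule abelian_groupI)
    fix x assume x: "x \<in> carrier ?P"
    then show "\<exists>y\<in>carrier ?P. y \<oplus>\<^bsub>?P\<^esub> x = \<zero>\<^bsub>?P\<^esub>"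
      by (intro bexI[of _ "(\<ominus>\<^bsub>M\<^esub> fst x, \<ominus>\<^bsub>B\<^esub> snd x)"]) (auto simp: M.M.l_neg B.M.l_neg)
  qed (auto simp: M.M.a_ac B.M.a_ac)
  have mod: "module (ring_of_type_algebra :: 'k ring) ?P"
    by (rule moduleI[OF cring_from_type_algebra grp])
      (auto simp: M.smult_laws B.smult_laws)
  interpret P: module "ring_of_type_algebra :: 'k ring" ?P by (rule mod)
  have neg: "\<ominus>\<^bsub>?P\<^esub> p = (\<ominus>\<^bsub>M\<^esub> fst p, \<ominus>\<^bsub>B\<^esub> snd p)" if "p \<in> carrier ?P" for p
    using that by (intro P.M.minus_equality) (auto simp: M.M.l_neg B.M.l_neg)
  have space: "superspace ?P"
  proof (intro superspace.intro superspace_axioms.intro mod P.submoduleI)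
    fix i
    show "hpart ?P i \<subseteq> carrier ?P" using M.hpart_subset B.hpart_subset by auto
    show "\<ominus>\<^bsub>?P\<^esub> p \<in> hpart ?P i" if "p \<in> hpart ?P i" for p
      using that M.hpart_subset B.hpart_subset
      by (subst neg) (auto intro: M.hpart_closed B.hpart_closed)
  next
    fix p assume p: "p \<in> carrier ?P"
    then have p': "fst p \<in> carrier M" "snd p \<in> carrier B" by auto
    obtain u0 u1 where u: "u0 \<in> hpart M 0" "u1 \<in> hpart M (0 + 1)" "fst p = u0 \<oplus>\<^bsub>M\<^esub> u1"
      using M.hpart_split[OF p'(1)] .
    obtain v0 v1 where v: "v0 \<in> hpart B 0" "v1 \<in> hpart B (0 + 1)" "snd p = v0 \<oplus>\<^bsub>B\<^esub> v1"
      using B.hpart_split[OF p'(2)] .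
    show "\<exists>!q. q \<in> hpart ?P 0 \<times> hpart ?P 1 \<and> p = fst q \<oplus>\<^bsub>?P\<^esub> snd q"
    proof (rule ex1I[of _ "((u0, v0), (u1, v1))"])
      show "((u0, v0), (u1, v1)) \<in> hpart ?P 0 \<times> hpart ?P 1 \<and>
          p = fst ((u0, v0), (u1, v1)) \<oplus>\<^bsub>?P\<^esub> snd ((u0, v0), (u1, v1))"
        using u v by (simp add: prod_eq_iff)
      fix q assume q: "q \<in> hpart ?P 0 \<times> hpart ?P 1 \<and> p = fst q \<oplus>\<^bsub>?P\<^esub> snd q"
      obtain a0 b0 a1 b1 where qq: "q = ((a0, b0), (a1, b1))" by (metis prod.exhaust)
      have "a0 = u0 \<and> a1 = u1" by (rule M.hpart_split_unique[where i = 0]) (use q u qq in auto)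
      moreover have "b0 = v0 \<and> b1 = v1" by (rule B.hpart_split_unique[where i = 0]) (use q v qq in auto)
      ultimately show "q = ((u0, v0), (u1, v1))" using qq by simp
    qed
  qed (auto intro: M.hpart_zero B.hpart_zero M.hpart_closed B.hpart_closed)
  have alg: "superalgebra ?P"
  proof (intro superalgebra.intro superalgebra_axioms.intro space)
    show "p \<otimes>\<^bsub>?P\<^esub> q \<in> hpart ?P (i + j)" if pq: "p \<in> hpart ?P i" "q \<in> hpart ?P j" for p q i j
    proof -
      have "ract (fst p) (snd q) \<in> hpart M (i + j)" "lact (snd p) (fst q) \<in> hpart M (i + j)"
        "snd p \<otimes>\<^bsub>B\<^esub> snd q \<in> hpart B (i + j)"
        using pq unfolding split_ext_simps mem_Times_iff by (blast intro: ract_hpart lact_hpart B.prod_hpart)+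
      then show ?thesis by (simp add: M.hpart_closed)
    qed
  qed (auto simp: closed M.M.a_ac lact_add_left lact_add_right ract_add_left ract_add_right
      lact_smult_left lact_smult_right ract_smult_left ract_smult_right M.smult_laws
      B.prod_add_left B.prod_add_right B.prod_smult_left B.prod_smult_right)
  show ?thesis
  proof (intro leibniz_superalgebra.intro leibniz_superalgebra_axioms.intro alg)
    fix p q r i j l
    assume h: "p \<in> hpart ?P i" "q \<in> hpart ?P j" "r \<in> hpart ?P l"
    obtain x f y g z h' where pq: "p = (x, f)" "q = (y, g)" "r = (z, h')" by (metis prod.exhaust)
    have m: "x \<in> hpart M i" "y \<in> hpart M j" "z \<in> hpart M l" "f \<in> hpart B i" "g \<in> hpart B j" "h' \<in> hpart B l"
      using h pq by auto
    note mc = m(1,2,3)[THEN M.hpart_subset] m(4,5,6)[THEN B.hpart_subset]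
    let ?k = "koszul l j :: 'k"
    have ks: "?k \<odot>\<^bsub>M\<^esub> u \<in> carrier M" if "u \<in> carrier M" for u using that by simp
    \<comment> \<open>The element of M stands first in equation 1, last in 2 and in the middle in 3.
      The sign factor is symmetric, which reconciles the orders in which the axioms write
      it.\<close>
    have 1: "ract x (g \<otimes>\<^bsub>B\<^esub> h') = ract (ract x g) h' \<ominus>\<^bsub>M\<^esub> (?k \<odot>\<^bsub>M\<^esub> ract (ract x h') g)"
      using ract_prod[OF m(1,5,6)] by (simp add: koszul_commute)
    have 2: "lact f (lact g z) = lact (f \<otimes>\<^bsub>B\<^esub> g) z \<ominus>\<^bsub>M\<^esub> (?k \<odot>\<^bsub>M\<^esub> ract (lact f z) g)"
      using lact_lact[OF m(3,4,5)] .
    have 3: "lact f (ract y h') = ract (lact f y) h' \<ominus>\<^bsub>M\<^esub> (?k \<odot>\<^bsub>M\<^esub> lact (f \<otimes>\<^bsub>B\<^esub> h') y)"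
      using lact_ract[OF m(2,4,6)] by (simp add: koszul_commute)
    have R: "(p \<otimes>\<^bsub>?P\<^esub> q) \<otimes>\<^bsub>?P\<^esub> r \<in> carrier ?P" "?k \<odot>\<^bsub>?P\<^esub> ((p \<otimes>\<^bsub>?P\<^esub> r) \<otimes>\<^bsub>?P\<^esub> q) \<in> carrier ?P"
      using mc by (simp_all add: pq closed)
    have c: "ract (ract x g) h' \<in> carrier M" "ract (ract x h') g \<in> carrier M" "lact (f \<otimes>\<^bsub>B\<^esub> g) z \<in> carrier M"
      "ract (lact f z) g \<in> carrier M" "ract (lact f y) h' \<in> carrier M" "lact (f \<otimes>\<^bsub>B\<^esub> h') y \<in> carrier M"
      using mc by (simp_all add: closed)
    have "ract x (g \<otimes>\<^bsub>B\<^esub> h') \<oplus>\<^bsub>M\<^esub> (lact f (ract y h') \<oplus>\<^bsub>M\<^esub> lact f (lact g z)) =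
      (ract (ract x g) h' \<oplus>\<^bsub>M\<^esub> ract (lact f y) h' \<oplus>\<^bsub>M\<^esub> lact (f \<otimes>\<^bsub>B\<^esub> g) z) \<ominus>\<^bsub>M\<^esub>
      (?k \<odot>\<^bsub>M\<^esub> (ract (ract x h') g \<oplus>\<^bsub>M\<^esub> ract (lact f z) g \<oplus>\<^bsub>M\<^esub> lact (f \<otimes>\<^bsub>B\<^esub> h') y))"
      unfolding 1 2 3 using c
      by (simp add: M.smult_laws M.M.minus_eq M.M.minus_add M.M.a_ac)
    then show "p \<otimes>\<^bsub>?P\<^esub> (q \<otimes>\<^bsub>?P\<^esub> r) = ((p \<otimes>\<^bsub>?P\<^esub> q) \<otimes>\<^bsub>?P\<^esub> r) \<ominus>\<^bsub>?P\<^esub> (?k \<odot>\<^bsub>?P\<^esub> ((p \<otimes>\<^bsub>?P\<^esub> r) \<otimes>\<^bsub>?P\<^esub> q))"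
      unfolding P.M.minus_eq neg[OF R(2)] using B.leibniz[OF m(4,5,6)] mc
      by (simp add: pq closed lact_add_right ract_add_left M.M.minus_eq B.M.minus_eq)
  qed
qed

text \<open>Applied to the projection of \<open>L\<close> onto \<BB>: the products to be compared
  with the actions live in \<open>L\<close>.\<close>

lemma supermodule_pullback:
  assumes "leibniz_superalgebra C" and \<phi>: "\<phi> \<in> superalg_hom C B"
  shows "supermodule C M (\<lambda>x. lact (\<phi> x)) (\<lambda>f x. ract f (\<phi> x))"
proof -
  interpret C: leibniz_superalgebra C by fact
  note h = superalg_homD[OF \<phi>]
  show ?thesis
  proof (intro supermodule.intro supermodule_axioms.intro assms(1) M.superspace_axioms)
    fix x y f i j l assume m: "f \<in> hpart M l" "x \<in> hpart C i" "y \<in> hpart C j"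
    have c: "x \<in> carrier C" "y \<in> carrier C" using m C.hpart_subset by auto
    show "ract f (\<phi> (x \<otimes>\<^bsub>C\<^esub> y)) = ract (ract f (\<phi> x)) (\<phi> y) \<ominus>\<^bsub>M\<^esub> (koszul i j \<odot>\<^bsub>M\<^esub> ract (ract f (\<phi> y)) (\<phi> x))"
      using ract_prod[OF m(1) h(6)[OF m(2)] h(6)[OF m(3)]] c by (simp add: h(5))
    show "lact (\<phi> x) (lact (\<phi> y) f) = lact (\<phi> (x \<otimes>\<^bsub>C\<^esub> y)) f \<ominus>\<^bsub>M\<^esub> (koszul l j \<odot>\<^bsub>M\<^esub> ract (lact (\<phi> x) f) (\<phi> y))"
      using lact_lact[OF m(1) h(6)[OF m(2)] h(6)[OF m(3)]] c by (simp add: h(5))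
    show "lact (\<phi> x) (ract f (\<phi> y)) = ract (lact (\<phi> x) f) (\<phi> y) \<ominus>\<^bsub>M\<^esub> (koszul l j \<odot>\<^bsub>M\<^esub> lact (\<phi> (x \<otimes>\<^bsub>C\<^esub> y)) f)"
      using lact_ract[OF m(1) h(6)[OF m(2)] h(6)[OF m(3)]] c by (simp add: h(5))
  next
    show "lact (\<phi> x) f \<in> hpart M (i + j)" if "x \<in> hpart C i" "f \<in> hpart M j" for x f i j
      using that by (intro lact_hpart h(6))
    show "ract f (\<phi> x) \<in> hpart M (i + j)" if "f \<in> hpart M i" "x \<in> hpart C j" for x f i j
      using that by (intro ract_hpart h(6))
  qed (simp_all add: h(2-4) lact_closed ract_closed lact_add_left lact_add_right ract_add_left ract_add_right
      lact_smult_left lact_smult_right ract_smult_left ract_smult_right)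
qed

end

section \<open>Homogeneous bases and the free algebra on \<open>A \<union> B\<close>\<close>

locale super_basis = superspace V for V :: "('k::field, 'a) superalgebra" +
  fixes A0 A1 :: "'a set"
  assumes basis0: "basis_of V (hpart V 0) A0" and basis1: "basis_of V (hpart V 1) A1"
begin

lemma A_hpart: "a \<in> A0 \<Longrightarrow> a \<in> hpart V 0" "a \<in> A1 \<Longrightarrow> a \<in> hpart V 1"
  using basis0 basis1 by (auto simp: basis_of_def)

lemma A_parity:
  assumes "a \<in> A0 \<union> A1"
  shows "a \<in> hpart V (lpar A1 a)"
  by (cases "a \<in> A1") (use assms A_hpart in \<open>auto simp: lpar_def\<close>)

lemma A_carrier: "A0 \<union> A1 \<subseteq> carrier V"
  using A_hpart hpart_subset by blast

text \<open>A common element a would make a + (- a) = 0 a sum of an even and an odd element, forcing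
  a = 0, and zero cannot belong to a linearly independent set.\<close>

lemma A_disjoint: "A0 \<inter> A1 = {}"
proof (rule ccontr)
  assume "A0 \<inter> A1 \<noteq> {}"
  then obtain a where a: "a \<in> A0" "a \<in> A1" by blast
  have h: "a \<in> hpart V 0" "a \<in> hpart V 1" using a A_hpart by auto
  then have c: "a \<in> carrier V" using hpart_subset by blast
  have "\<ominus>\<^bsub>V\<^esub> a \<in> hpart V (0 + 1)" using hpart_closed(3)[OF h(2)] by simp
  from hpart_sum_zero(1)[OF h(1) this] have "a = \<zero>\<^bsub>V\<^esub>" using c by (simp add: M.r_neg)
  moreover have "lincomb V (Poly_Mapping.single a 1) = a"
    unfolding lincomb_eq_lsum using lsum_single[of "\<lambda>x. x" a] c by simp
  moreover have "supp (Poly_Mapping.single a (1::'k)) \<subseteq> A0" using a by simp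
  ultimately have "Poly_Mapping.single a (1::'k) = 0" using basis0 unfolding basis_of_def by metis
  then show False by (metis lookup_single_eq lookup_zero zero_neq_one)
qed

lemma lincomb_linear:
  assumes "supp c \<subseteq> A0 \<union> A1" "supp d \<subseteq> A0 \<union> A1"
  shows "lincomb V (c + d) = lincomb V c \<oplus>\<^bsub>V\<^esub> lincomb V d" "lincomb V (pscale a c) = a \<odot>\<^bsub>V\<^esub> lincomb V c"
    "lincomb V c \<in> carrier V"
  unfolding lincomb_eq_lsum using assms A_carrier
  by (intro lsum_add lsum_pscale lsum_closed; blast)+

lemma lincomb_hpart:
  "supp c \<subseteq> A0 \<Longrightarrow> lincomb V c \<in> hpart V 0" "supp c \<subseteq> A1 \<Longrightarrow> lincomb V c \<in> hpart V 1"
  by (rule lincomb_induct[where A = A0]; use A_carrier A_hpart hpart_zero hpart_closed in blast)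
    (rule lincomb_induct[where A = A1]; use A_carrier A_hpart hpart_zero hpart_closed in blast)

text \<open>A vanishing combination has vanishing even and odd components, so the independence of
  the two homogeneous bases applies to each separately.\<close>

lemma independent:
  assumes "supp c \<subseteq> A0 \<union> A1" "lincomb V c = \<zero>\<^bsub>V\<^esub>"
  shows "c = 0"
proof -
  define part where "part W = (\<Sum>a\<in>supp c \<inter> W. Poly_Mapping.single a (coef c a))" for W
  have keys: "supp (part W) \<subseteq> W" for W
    unfolding part_def by (rule keys_sum_subset) auto
  have "coef (part W) x = (if x \<in> W then coef c x else 0)" for W x
    unfolding part_def
    by (auto simp: lookup_sum lookup_single when_def in_keys_iff if_distrib sum.delta cong: if_cong)
  then have eq: "c = part A0 + part A1" using assms(1) A_disjoint
    by (intro poly_mapping_eqI) (auto simp: lookup_add in_keys_iff)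
  have "lincomb V (part A0) \<oplus>\<^bsub>V\<^esub> lincomb V (part A1) = \<zero>\<^bsub>V\<^esub>"
    using assms(2) eq lincomb_linear(1)[of "part A0" "part A1"] keys[of A0] keys[of A1] by (metis le_supI1 le_supI2)
  moreover have "lincomb V (part A0) \<in> hpart V 0" "lincomb V (part A1) \<in> hpart V (0 + 1)"
    using lincomb_hpart keys by simp_all
  ultimately have "lincomb V (part A0) = \<zero>\<^bsub>V\<^esub>" "lincomb V (part A1) = \<zero>\<^bsub>V\<^esub>"
    using hpart_sum_zero by blast+
  then have "part A0 = 0" "part A1 = 0" using basis0 basis1 keys unfolding basis_of_def by blast+
  with eq show ?thesis by simp
qed

lemma spanning:
  assumes "x \<in> carrier V"
  shows "\<exists>c. supp c \<subseteq> A0 \<union> A1 \<and> x = lincomb V c"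
proof -
  obtain y z where yz: "y \<in> hpart V 0" "z \<in> hpart V (0 + 1)" "x = y \<oplus>\<^bsub>V\<^esub> z" using hpart_split[OF assms] .
  obtain c where c: "supp c \<subseteq> A0" "y = lincomb V c" using basis0 yz(1) unfolding basis_of_def by blast
  obtain d where d: "supp d \<subseteq> A1" "z = lincomb V d" using basis1 yz(2) unfolding basis_of_def by auto
  have k: "supp c \<subseteq> A0 \<union> A1" "supp d \<subseteq> A0 \<union> A1" using c d by auto
  then have "x = lincomb V (c + d)" using lincomb_linear(1)[OF k] c d yz by simp
  then show ?thesis using keys_subset_closed(1)[OF k] by blast
qed

lemma coords_eqI:
  assumes "supp c \<subseteq> A0 \<union> A1" "x = lincomb V c"
  shows "coords V (A0 \<union> A1) x = c"
  unfolding coords_def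
proof (rule the_equality)
  fix d assume d: "supp d \<subseteq> A0 \<union> A1 \<and> x = lincomb V d"
  have k: "supp (pscale (-1) c) \<subseteq> A0 \<union> A1" using assms(1) by (rule keys_subset_closed(2))
  have "lincomb V (d + pscale (-1) c) = x \<oplus>\<^bsub>V\<^esub> (- 1) \<odot>\<^bsub>V\<^esub> x"
    using lincomb_linear(1)[OF _ k, of d] lincomb_linear(2)[OF assms(1,1), of "-1"] d assms(2) by simp
  also have "\<dots> = \<zero>\<^bsub>V\<^esub>" using lincomb_linear(3)[OF assms(1,1)] assms(2) by (simp add: smult_laws M.r_neg)
  finally have "d + pscale (-1) c = 0"
    using d k by (intro independent keys_subset_closed(1)) auto
  then show "d = c" by simp
qed (use assms in simp)

lemma coords:
  assumes "x \<in> carrier V"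
  shows "supp (coords V (A0 \<union> A1) x) \<subseteq> A0 \<union> A1" "x = lincomb V (coords V (A0 \<union> A1) x)"
  using spanning[OF assms] coords_eqI by (metis, metis)

lemma basis_induct [consumes 1, case_names zero basis add scale]:
  assumes "x \<in> carrier V" "P \<zero>\<^bsub>V\<^esub>" "\<And>a. a \<in> A0 \<union> A1 \<Longrightarrow> P a"
    and "\<And>x y. \<lbrakk>x \<in> carrier V; y \<in> carrier V; P x; P y\<rbrakk> \<Longrightarrow> P (x \<oplus>\<^bsub>V\<^esub> y)"
    and "\<And>a x. \<lbrakk>x \<in> carrier V; P x\<rbrakk> \<Longrightarrow> P (a \<odot>\<^bsub>V\<^esub> x)"
  shows "P x"
proof -
  have "P (lincomb V (coords V (A0 \<union> A1) x))"
    by (rule lincomb_induct[OF coords(1)[OF assms(1)] A_carrier]) (fact assms)+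
  then show ?thesis using coords(2)[OF assms(1)] by simp
qed

lemma brace_linear:
  shows "\<lbrakk>x \<in> carrier V; y \<in> carrier V\<rbrakk> \<Longrightarrow> brace V (A0 \<union> A1) (x \<oplus>\<^bsub>V\<^esub> y) = brace V (A0 \<union> A1) x + brace V (A0 \<union> A1) y"
    and "x \<in> carrier V \<Longrightarrow> brace V (A0 \<union> A1) (k \<odot>\<^bsub>V\<^esub> x) = pscale k (brace V (A0 \<union> A1) x)"
    and "brace V (A0 \<union> A1) \<zero>\<^bsub>V\<^esub> = 0"
    and "a \<in> A0 \<union> A1 \<Longrightarrow> brace V (A0 \<union> A1) a = gen (Inl a)"
proof -
  show "\<lbrakk>x \<in> carrier V; y \<in> carrier V\<rbrakk> \<Longrightarrow> brace V (A0 \<union> A1) (x \<oplus>\<^bsub>V\<^esub> y) = brace V (A0 \<union> A1) x + brace V (A0 \<union> A1) y" for x y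
    unfolding brace_def push_linear[symmetric] using coords[of x] coords[of y]
    by (subst coords_eqI[OF keys_subset_closed(1)]) (simp_all add: lincomb_linear)
  show sc: "x \<in> carrier V \<Longrightarrow> brace V (A0 \<union> A1) (k \<odot>\<^bsub>V\<^esub> x) = pscale k (brace V (A0 \<union> A1) x)" for x k
    unfolding brace_def push_linear[symmetric] using coords[of x]
    by (subst coords_eqI[OF keys_subset_closed(2)]) (simp_all add: lincomb_linear)
  show "brace V (A0 \<union> A1) \<zero>\<^bsub>V\<^esub> = 0" using sc[of "\<zero>\<^bsub>V\<^esub>" 0] by (simp add: smult_laws)
  show "brace V (A0 \<union> A1) a = gen (Inl a)" if "a \<in> A0 \<union> A1" for a
  proof -
    have "coords V (A0 \<union> A1) a = Poly_Mapping.single a 1"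
      using that A_carrier lsum_single[of "\<lambda>x. x" a] by (intro coords_eqI) (auto simp: lincomb_eq_lsum)
    then show ?thesis by (simp add: brace_def push_def gen_def wmono_def)
  qed
qed

end

section \<open>The free algebra on B inside the free algebra on A and B\<close>

lemma gsum_parity [simp]:
  "lpar (gsum A1 B1) (Inl a) = lpar A1 a" "lpar (gsum A1 B1) (Inr b) = lpar B1 b"
  "wpar (gsum A1 B1) (map Inr w) = wpar B1 w"
  "gsum A0 B0 \<union> gsum A1 B1 = gsum (A0 \<union> A1) (B0 \<union> B1)"
proof -
  show *: "lpar (gsum A1 B1) (Inl a) = lpar A1 a" "lpar (gsum A1 B1) (Inr b) = lpar B1 b" for b
    by (auto simp: lpar_def gsum_def)
  show "wpar (gsum A1 B1) (map Inr w) = wpar B1 w" by (induction w) (simp_all add: *)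
qed (auto simp: gsum_def)

lemma map_Inr_NF: "map Inr w \<in> NF (gsum A B) \<longleftrightarrow> w \<in> NF B"
  by (auto simp: NF_def gsum_def)

lemma inj_map_Inr: "inj (map Inr)"
  by (simp add: inj_on_def inj_map_eq_map)

lemma emb_linear:
  "emb (f + g) = emb f + emb g" "emb (pscale c f) = pscale c (emb f)" "emb (f - g) = emb f - emb g" "emb 0 = 0"
  by (simp_all add: emb_def push_linear)

lemma emb_wmono [simp]: "emb (wmono w) = wmono (map Inr w)"
  by (simp add: emb_def)

lemma emb_gen [simp]: "emb (gen b) = gen (Inr b)"
  by (simp add: gen_def)

lemma keys_emb: "supp (emb f) = map Inr ` supp f"
  unfolding emb_def by (rule keys_push[OF inj_map_Inr])

lemma emb_mul_gen: "emb (free_mult B1 f (gen b)) = free_mult (gsum A1 B1) (emb f) (gen (Inr b))"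
  by (rule poly_word_induct[where W = UNIV and f = f])
    (simp_all add: emb_linear free_mult_add free_mult_pscale wmono_snoc)

text \<open>The empty word is no monomial, but induction over all lists meets it; a product with it
  on the right is zero by the first equation of \<open>rev_mult\<close>.\<close>

lemma free_mult_wmono_Nil: "free_mult Y1 f (wmono []) = 0"
  by (simp add: free_mult_def word_mult_def wmono_def)

text \<open>Renaming letters commutes with appending them and preserves parity, and the Leibniz
  recursion on the right factor involves nothing else.\<close>

lemma emb_mul: "emb (free_mult B1 f g) = free_mult (gsum A1 B1) (emb f) (emb g)"
proof -
  have word: "emb (free_mult B1 f (wmono v)) = free_mult (gsum A1 B1) (emb f) (wmono (map Inr v))" for f v
  proof (induction v arbitrary: f rule: rev_induct)
    case Nil
    show ?case by (simp add: emb_linear free_mult_wmono_Nil)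
  next
    case (snoc b v)
    show ?case
    proof (cases "v = []")
      case True
      then show ?thesis using emb_mul_gen[of B1 f b A1] by (simp add: gen_def)
    next
      case False
      then have ne: "map Inr v \<noteq> []" by simp
      show ?thesis using leibniz_letter_word[OF ne, of "gsum A1 B1" "emb f" "Inr b"] 
          snoc.IH[of f] snoc.IH[of "free_mult B1 f (gen b)"]
        by (simp add: leibniz_letter_word[OF False] emb_linear emb_mul_gen[where ?A1.0 = A1])
    qed
  qed
  show ?thesis
    by (rule poly_word_induct[where W = UNIV and f = g])
      (simp_all add: emb_linear free_mult_add free_mult_pscale word)
qed

lemma emb_hom:
  "emb \<in> superalg_hom (Lbs B0 B1 :: ('k::field, 'b list \<Rightarrow>\<^sub>0 'k) superalgebra) (Lbs (gsum A0 B0) (gsum A1 B1))"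
  unfolding superalg_hom_def linear_maps_def
  by (auto simp: keys_emb emb_linear emb_mul map_Inr_NF subset_iff)

lemma gsum_hom_exists:
  fixes V :: "('k::field, 'v) superalgebra"
  assumes "leibniz_superalgebra V" "A0 \<inter> A1 = {}" "B0 \<inter> B1 = {}"
    and "\<And>a. a \<in> A0 \<union> A1 \<Longrightarrow> p a \<in> hpart V (lpar A1 a)" "\<And>b. b \<in> B0 \<union> B1 \<Longrightarrow> q b \<in> hpart V (lpar B1 b)"
  shows "\<exists>\<phi>. \<phi> \<in> superalg_hom (Lbs (gsum A0 B0) (gsum A1 B1)) V \<and>
    (\<forall>a\<in>A0 \<union> A1. \<phi> (gen (Inl a)) = p a) \<and> (\<forall>b\<in>B0 \<union> B1. \<phi> (gen (Inr b)) = q b)"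
proof -
  interpret leibniz_superalgebra V by fact
  let ?g = "case_sum p q"
  have par: "?g t \<in> hpart V (lpar (gsum A1 B1) t)" if "t \<in> gsum (A0 \<union> A1) (B0 \<union> B1)" for t
    using that assms(4,5) by (cases t) (auto simp: gsum_def[of "A0 \<union> A1"])
  have dis: "gsum A0 B0 \<inter> gsum A1 B1 = {}" using assms(2,3) by (auto simp: gsum_def)
  have "?g t \<in> hpart V 0" if t: "t \<in> gsum A0 B0" for t
  proof -
    have "lpar (gsum A1 B1) t = 0" using t dis by (auto simp: lpar_def)
    moreover have "t \<in> gsum (A0 \<union> A1) (B0 \<union> B1)" using t by (auto simp: gsum_def)
    ultimately show ?thesis using par[of t] by simp
  qed
  moreover have "?g t \<in> hpart V 1" if t: "t \<in> gsum A1 B1" for t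
  proof -
    have "lpar (gsum A1 B1) t = 1" using t by (simp add: lpar_def)
    moreover have "t \<in> gsum (A0 \<union> A1) (B0 \<union> B1)" using t by (auto simp: gsum_def)
    ultimately show ?thesis using par[of t] by simp
  qed
  ultimately obtain \<phi> where \<phi>: "\<phi> \<in> superalg_hom (Lbs (gsum A0 B0) (gsum A1 B1)) V"
      "\<forall>t\<in>gsum A0 B0 \<union> gsum A1 B1. \<phi> (gen t) = ?g t"
    using Lbs_hom_exists[OF dis, of ?g] by blast
  then show ?thesis by (intro exI[of _ \<phi>]) (auto simp: gsum_def)
qed

lemma (in super_basis) brace_hpart:
  assumes "x \<in> hpart V i"
  shows "brace V (A0 \<union> A1) x \<in> hpart (Lbs (gsum A0 B0) (gsum A1 B1) :: ('k, ('a + 'b) list \<Rightarrow>\<^sub>0 'k) superalgebra) i"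
proof -
  let ?K = "Lbs (gsum A0 B0) (gsum A1 B1) :: ('k, ('a + 'b) list \<Rightarrow>\<^sub>0 'k) superalgebra"
  interpret K: superspace ?K by (rule superspace_Lbs)
  define A where "A = (if i = 0 then A0 else A1)"
  have sub: "A \<subseteq> A0 \<union> A1" by (auto simp: A_def)
  have "basis_of V (hpart V i) A" using basis0 basis1 by (cases i) (simp_all add: A_def)
  then obtain c where c: "supp c \<subseteq> A" "x = lincomb V c" using assms unfolding basis_of_def by blast
  have par: "lpar A1 a = i" if "a \<in> A" for a using that A_disjoint by (cases i) (auto simp: A_def lpar_def)
  show ?thesis unfolding c(2)
  proof (rule lincomb_induct[OF c(1)])
    show "A \<subseteq> carrier V" using sub A_carrier by blast
    show "brace V (A0 \<union> A1) \<zero>\<^bsub>V\<^esub> \<in> hpart ?K i" unfolding brace_linear using K.hpart_zero by simp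
    show "brace V (A0 \<union> A1) a \<in> hpart ?K i" if "a \<in> A" for a
      using that sub par[OF that] by (subst brace_linear(4)) (auto simp: gen_def wmono_def NF_def gsum_def[of "A0 \<union> A1"])
    show "brace V (A0 \<union> A1) (y \<oplus>\<^bsub>V\<^esub> z) \<in> hpart ?K i"
      if "y \<in> carrier V" "z \<in> carrier V" "brace V (A0 \<union> A1) y \<in> hpart ?K i" "brace V (A0 \<union> A1) z \<in> hpart ?K i" for y z
      unfolding brace_linear(1)[OF that(1,2)] using K.hpart_closed(1)[OF that(3,4)] by simp
    show "brace V (A0 \<union> A1) (a \<odot>\<^bsub>V\<^esub> y) \<in> hpart ?K i"
      if "y \<in> carrier V" "brace V (A0 \<union> A1) y \<in> hpart ?K i" for a y
      unfolding brace_linear(2)[OF that(1)] using K.hpart_closed(2)[OF that(2)] by simp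
  qed
qed

section \<open>Presented superalgebras\<close>

lemma Lbs_minus [simp]:
  "f \<in> carrier (Lbs X0 X1) \<Longrightarrow> g \<in> carrier (Lbs X0 X1) \<Longrightarrow> f \<ominus>\<^bsub>Lbs X0 X1\<^esub> g = f - g"
  by (simp add: a_minus_def)

text \<open>Instantiated twice: with R over B, which gives \<BB>, and with the relations over A
  \<union> B, which gives E.\<close>

locale presentation =
  fixes X0 X1 :: "'x set" and S :: "('x list \<Rightarrow>\<^sub>0 'k::field) set"
  assumes relations: "S \<subseteq> carrier (Lbs X0 X1)"
begin

abbreviation "Fr \<equiv> Lbs X0 X1 :: ('k, 'x list \<Rightarrow>\<^sub>0 'k) superalgebra"
abbreviation "IdS \<equiv> genideal_super Fr S"
abbreviation "Pr \<equiv> Lbs_rel X0 X1 S"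
abbreviation "pr \<equiv> rel_class X0 X1 S"

sublocale Fr: leibniz_superalgebra Fr by (rule leibniz_superalgebra_Lbs)

lemma ideal: "superideal IdS Fr"
  by (rule Fr.superideal_genideal_super[OF relations])

lemma IdS_closed:
  "0 \<in> IdS" "x \<in> IdS \<Longrightarrow> y \<in> IdS \<Longrightarrow> x + y \<in> IdS" "x \<in> IdS \<Longrightarrow> pscale c x \<in> IdS"
  "x \<in> IdS \<Longrightarrow> y \<in> IdS \<Longrightarrow> x - y \<in> IdS"
  "x \<in> IdS \<Longrightarrow> y \<in> carrier Fr \<Longrightarrow> free_mult X1 x y \<in> IdS"
  "x \<in> IdS \<Longrightarrow> x \<in> carrier Fr" "x \<in> S \<Longrightarrow> x \<in> IdS"
proof -
  note d = Fr.superidealD[OF ideal]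
  show "0 \<in> IdS" using d(2) by simp
  show "x \<in> IdS \<Longrightarrow> y \<in> IdS \<Longrightarrow> x + y \<in> IdS" using d(3)[of x y] by simp
  show "x \<in> IdS \<Longrightarrow> pscale c x \<in> IdS" using d(4)[of x c] by simp
  show c: "x \<in> IdS \<Longrightarrow> x \<in> carrier Fr" for x using d(1) by blast
  show "x \<in> IdS \<Longrightarrow> y \<in> IdS \<Longrightarrow> x - y \<in> IdS" using d(6)[of x y] c by (metis Lbs_minus)
  show "x \<in> IdS \<Longrightarrow> y \<in> carrier Fr \<Longrightarrow> free_mult X1 x y \<in> IdS" using d(7)[of x y] by simp
  show "x \<in> S \<Longrightarrow> x \<in> IdS" using Fr.genideal_super_incl[of S] by blast
qed

lemma leibniz_Pr: "leibniz_superalgebra Pr"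
  unfolding Lbs_rel_def by (rule leibniz_superalgebra_quot[OF Fr.leibniz_superalgebra_axioms ideal])

lemma pr_hom: "pr \<in> superalg_hom Fr Pr"
  unfolding Lbs_rel_def rel_class_eq by (rule Fr.quot_proj_hom[OF ideal])

lemma pr_image: "carrier Pr = pr ` carrier Fr" "hpart Pr i = pr ` hpart Fr i"
  unfolding Lbs_rel_def rel_class_eq by (rule Fr.quot_proj_ops[OF ideal])+

lemma pr_eq_iff: "f \<in> carrier Fr \<Longrightarrow> g \<in> carrier Fr \<Longrightarrow> pr f = pr g \<longleftrightarrow> f - g \<in> IdS"
  unfolding rel_class_eq using Fr.quot_proj_eq_iff[OF ideal] by (metis Lbs_minus)

lemma pr_zero_iff: "f \<in> carrier Fr \<Longrightarrow> pr f = \<zero>\<^bsub>Pr\<^esub> \<longleftrightarrow> f \<in> IdS"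
  unfolding rel_class_eq Lbs_rel_def by (rule Fr.quot_proj_zero_iff[OF ideal])

text \<open>It suffices to test \<psi> on the relations, because its kernel is a graded ideal, being
  the preimage of the zero ideal.\<close>

lemma pr_lift:
  fixes W :: "('k, 'w) superalgebra"
  assumes "superalgebra W" and \<psi>: "\<psi> \<in> superalg_hom Fr W" and "\<And>x. x \<in> S \<Longrightarrow> \<psi> x = \<zero>\<^bsub>W\<^esub>"
  obtains \<chi> where "\<chi> \<in> superalg_hom Pr W" "\<And>x. x \<in> carrier Fr \<Longrightarrow> \<chi> (pr x) = \<psi> x"
proof -
  interpret W: superalgebra W by fact
  have "IdS \<subseteq> {x \<in> carrier Fr. \<psi> x \<in> {\<zero>\<^bsub>W\<^esub>}}"
    by (rule Fr.genideal_super_least[OF Fr.superideal_vimage[OF assms(1) \<psi> W.superideal_zero]])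
      (use relations assms(3) in blast)
  then have "\<And>x. x \<in> IdS \<Longrightarrow> \<psi> x = \<zero>\<^bsub>W\<^esub>" by blast
  from Fr.quot_hom_exists[OF ideal W.superspace_axioms \<psi> this] that show thesis
    unfolding Lbs_rel_def rel_class_eq by blast
qed

lemma pr_linear:
  "f \<in> carrier Fr \<Longrightarrow> g \<in> carrier Fr \<Longrightarrow> pr (f + g) = pr f \<oplus>\<^bsub>Pr\<^esub> pr g"
  "f \<in> carrier Fr \<Longrightarrow> pr (pscale c f) = c \<odot>\<^bsub>Pr\<^esub> pr f"
  "f \<in> carrier Fr \<Longrightarrow> g \<in> carrier Fr \<Longrightarrow> pr (free_mult X1 f g) = pr f \<otimes>\<^bsub>Pr\<^esub> pr g"
  "f \<in> carrier Fr \<Longrightarrow> pr f \<in> carrier Pr" "f \<in> hpart Fr i \<Longrightarrow> pr f \<in> hpart Pr i"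
  using superalg_homD(3-5)[OF pr_hom, of f] superalg_homD(2)[OF pr_hom, of f] superalg_homD(6)[OF pr_hom, of f i] by simp_all

end

section \<open>The algebra of extension data\<close>

locale ext_setup = reduced_gs B0 B1 R + AA: super_basis AA A0 A1
  for B0 B1 :: "'b::wellorder set" and R :: "('b list \<Rightarrow>\<^sub>0 'k::field) set"
    and AA :: "('k, 'a) superalgebra" and A0 A1 :: "'a set" +
  fixes lact :: "('b list \<Rightarrow>\<^sub>0 'k) set \<Rightarrow> 'a \<Rightarrow> 'a" and ract :: "'a \<Rightarrow> ('b list \<Rightarrow>\<^sub>0 'k) set \<Rightarrow> 'a"
    and fl :: "('b list \<Rightarrow>\<^sub>0 'k) \<Rightarrow> 'a"
  assumes data: "extension_data AA B0 B1 R lact ract fl"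
begin

sublocale Q: presentation B0 B1 R
  by unfold_locales (rule R_carrier)

text \<open>The actions of \<open>L\<close> through its quotient \<BB>.\<close>

definition la :: "('b list \<Rightarrow>\<^sub>0 'k) \<Rightarrow> 'a \<Rightarrow> 'a" where "la f x = lact (cl f) x"
definition ra :: "'a \<Rightarrow> ('b list \<Rightarrow>\<^sub>0 'k) \<Rightarrow> 'a" where "ra x f = ract x (cl f)"

sublocale P: supermodule L AA la ra
proof -
  interpret supermodule "Lbs_rel B0 B1 R" AA lact ract using data by (simp add: extension_data_def)
  have "supermodule L AA (\<lambda>x. lact (cl x)) (\<lambda>f x. ract f (cl x))"
    by (rule supermodule_pullback[OF L.leibniz_superalgebra_axioms Q.pr_hom])
  then show "supermodule L AA la ra" by (simp add: la_def[abs_def] ra_def[abs_def])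
qed

text \<open>The actions see only the class modulo \<open>I\<close>. This makes the mixed terms
  disappear when \<open>J\<close> is multiplied by arbitrary elements.\<close>

lemma act_I:
  assumes "h \<in> I" "x \<in> carrier AA"
  shows "la h x = \<zero>\<^bsub>AA\<^esub>" "ra x h = \<zero>\<^bsub>AA\<^esub>"
proof -
  have "h \<in> carrier L" using assms(1) by (rule Q.IdS_closed(6))
  then have "cl h = cl 0" using assms(1) Q.pr_eq_iff[of h 0] by simp
  then have "la h x = la 0 x" "ra x h = ra x 0" by (simp_all add: la_def ra_def)
  then show "la h x = \<zero>\<^bsub>AA\<^esub>" "ra x h = \<zero>\<^bsub>AA\<^esub>" using P.act_zero(2,4)[OF assms(2)] by simp_all
qed

section \<open>The linear map from the ideal to the module and its compatibility with
  products\<close>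

abbreviation "hfl s c \<equiv> hfloor B0 B1 R ract (fl s) c"

lemma hfl_Nil [simp]: "hfloor B0 B1 R ract x [] = x"
  by (simp add: hfloor_def)

lemma hfl_snoc: "hfloor B0 B1 R ract x (c @ [b]) = ra (hfloor B0 B1 R ract x c) (gen b)"
  by (simp add: hfloor_def ra_def)

lemma fl_hpart: "s \<in> R \<Longrightarrow> s \<in> hpart L i \<Longrightarrow> fl s \<in> hpart AA i"
  using data unfolding extension_data_def by blast

lemma hfl_hpart:
  assumes "s \<in> R" "s \<in> hpart L i" "set c \<subseteq> B"
  shows "hfl s c \<in> hpart AA (i + wpar B1 c)"
  using assms(3)
proof (induction c rule: rev_induct)
  case Nil
  show ?case using fl_hpart[OF assms(1,2)] by (simp only: hfl_Nil wpar_simps add_0_right)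
next
  case (snoc b c)
  then have "hfl s c \<in> hpart AA (i + wpar B1 c)" "gen b \<in> hpart L (lpar B1 b)"
    using gen_hpart[of b] by simp_all
  from P.ract_hpart[OF this] show ?case by (simp only: hfl_snoc wpar_simps add.assoc add_0_right)
qed

lemma hfl_carrier:
  assumes "s \<in> R" "set c \<subseteq> B"
  shows "hfl s c \<in> carrier AA"
  using R_props(3)[OF assms(1)] hfl_hpart[OF assms(1) _ assms(2)] AA.hpart_subset by blast

text \<open>The prescribed values determine it on the ideal, which the normal polynomials span;
  elsewhere it is an arbitrary linear extension.\<close>

definition F :: "('b list \<Rightarrow>\<^sub>0 'k) \<Rightarrow> 'a"
  where "F = (SOME F. F \<in> linear_maps L AA \<and> (\<forall>s\<in>R. \<forall>c. set c \<subseteq> B \<longrightarrow> F (npol s c) = hfl s c))"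

lemma F: "F \<in> linear_maps L AA" "s \<in> R \<Longrightarrow> set c \<subseteq> B \<Longrightarrow> F (npol s c) = hfl s c"
proof -
  obtain F' where "F' \<in> linear_maps L AA" "\<And>s c. s \<in> R \<Longrightarrow> set c \<subseteq> B \<Longrightarrow> F' (npol s c) = hfl s c"
    using npoly_linear_map_exists[OF AA.superspace_axioms, of hfl] hfl_carrier by blast
  then have "\<exists>F. F \<in> linear_maps L AA \<and> (\<forall>s\<in>R. \<forall>c. set c \<subseteq> B \<longrightarrow> F (npol s c) = hfl s c)" by blast
  then have "F \<in> linear_maps L AA \<and> (\<forall>s\<in>R. \<forall>c. set c \<subseteq> B \<longrightarrow> F (npol s c) = hfl s c)"
    unfolding F_def by (rule someI_ex)
  then show "F \<in> linear_maps L AA" "s \<in> R \<Longrightarrow> set c \<subseteq> B \<Longrightarrow> F (npol s c) = hfl s c" by blast+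
qed

lemma F_linear:
  "f \<in> carrier L \<Longrightarrow> F f \<in> carrier AA"
  "f \<in> carrier L \<Longrightarrow> g \<in> carrier L \<Longrightarrow> F (f + g) = F f \<oplus>\<^bsub>AA\<^esub> F g"
  "f \<in> carrier L \<Longrightarrow> F (pscale a f) = a \<odot>\<^bsub>AA\<^esub> F f"
  "f \<in> carrier L \<Longrightarrow> g \<in> carrier L \<Longrightarrow> F (f - g) = F f \<ominus>\<^bsub>AA\<^esub> F g"
  "F 0 = \<zero>\<^bsub>AA\<^esub>"
proof -
  note d = linear_mapsD[OF F(1)] and e = linear_maps_group[OF L.superspace_axioms AA.superspace_axioms F(1)]
  show "f \<in> carrier L \<Longrightarrow> F f \<in> carrier AA" by (rule d(1))
  show "f \<in> carrier L \<Longrightarrow> g \<in> carrier L \<Longrightarrow> F (f + g) = F f \<oplus>\<^bsub>AA\<^esub> F g" using d(2)[of f g] by simp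
  show "f \<in> carrier L \<Longrightarrow> F (pscale a f) = a \<odot>\<^bsub>AA\<^esub> F f" using d(3)[of f a] by simp
  show "f \<in> carrier L \<Longrightarrow> g \<in> carrier L \<Longrightarrow> F (f - g) = F f \<ominus>\<^bsub>AA\<^esub> F g" using e(3)[of f g] by (metis Lbs_minus)
  show "F 0 = \<zero>\<^bsub>AA\<^esub>" using e(1) by simp
qed

text \<open>With this translation the condition on the data reads: \<mu> acting on
  \<lfloor>f\<rfloor> is the value of \<open>F\<close> at the product of \<mu> and f.\<close>

lemma F_nval: "nvalid es \<Longrightarrow> nexpr_floor AA B0 B1 R ract fl es = F (nval es)"
proof (induction es)
  case Nil
  show ?case by (simp add: nexpr_floor_def F_linear)
next
  case (Cons e es)
  obtain \<alpha> s c where e: "e = (\<alpha>, s, c)" by (cases e)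
  then have v: "s \<in> R" "set c \<subseteq> B" "nvalid es" using Cons.prems by (simp_all add: nvalid_Cons)
  have c: "npol s c \<in> carrier L" "nval es \<in> carrier L"
    using npoly_carrier[OF v(1,2)] Q.IdS_closed(6)[OF nval_in_I[OF v(3)]] .
  have "pscale \<alpha> (npol s c) \<in> carrier L" using c(1) by (simp add: keys_subset_closed(2))
  with Cons.IH[OF v(3)] show ?case
    by (simp only: e nval_simps F_linear(2)[OF _ c(2)] F_linear(3)[OF c(1)] F(2)[OF v(1,2)])
      (simp add: nexpr_floor_def)
qed

lemma I_carrier: "h \<in> I \<Longrightarrow> h \<in> carrier L" by (rule Q.IdS_closed(6))

lemma carrier_pscale: "f \<in> carrier L \<Longrightarrow> pscale a f \<in> carrier L"
  by (simp add: keys_subset_closed(2))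

text \<open>Built into the definition: multiplying by b appends b to c, and \<open>hfloor\<close>
  then acts by b once more.\<close>

lemma F_mul_letter:
  assumes "h \<in> nspan" "b \<in> B"
  shows "F (mul h (gen b)) = ra (F h) (gen b)"
  using assms(1)
proof (induction rule: nspan_induct)
  case zero
  then show ?case using P.act_zero(3)[OF gen_carrier[OF assms(2)]] by (simp add: F_linear)
next
  case (npoly s c)
  then show ?case using F(2)[of s "c @ [b]"] F(2)[of s c] assms(2) by (simp add: npoly_snoc hfl_snoc)
next
  case (add f g)
  note c = nspan_carrier[OF add(1)] nspan_carrier[OF add(2)]
  note m = c[THEN mul_carrier, OF gen_carrier[OF assms(2)]]
  show ?case unfolding free_mult_add F_linear(2)[OF m] add.IH F_linear(2)[OF c]
    by (rule P.ract_add_left[OF gen_carrier[OF assms(2)] F_linear(1)[OF c(1)] F_linear(1)[OF c(2)], symmetric])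
next
  case (scale a f)
  note c = nspan_carrier[OF scale(1)]
  note m = mul_carrier[OF c gen_carrier[OF assms(2)]]
  show ?case unfolding free_mult_pscale F_linear(3)[OF m] scale.IH F_linear(3)[OF c]
    by (rule P.ract_smult_left[OF gen_carrier[OF assms(2)] F_linear(1)[OF c], symmetric])
qed

lemma wmono_hpart: "w \<in> NF B \<Longrightarrow> wmono w \<in> hpart L (wpar B1 w)"
  by (simp add: wmono_def)

text \<open>Induction on c. The base case is the compatibility condition of the data. In the step
  the Leibniz identity in \<open>L\<close> and the axiom \<open>lact_ract\<close> have the same
  shape, with the same sign because \<open>F\<close> of a normal polynomial has its parity; the term
  (wb)h is the reason for an arbitrary w.\<close>

lemma F_word_npoly:
  assumes s: "s \<in> R" and "set c \<subseteq> B" "w \<in> NF B"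
  shows "F (mul (wmono w) (npol s c)) = la (wmono w) (F (npol s c))"
  using assms(2,3)
proof (induction c arbitrary: w rule: rev_induct)
  case Nil
  have mI: "mul (wmono w) s \<in> I" using nspan_word_mul_R[OF s Nil(2)] by (simp add: I_eq_nspan)
  have "la (wmono w) (fl s) = nexpr_floor AA B0 B1 R ract fl (nexpr_of B0 B1 R (mul (wmono w) s))"
    using data s Nil(2) unfolding extension_data_def la_def by blast
  also have "\<dots> = F (mul (wmono w) s)"
    using nexpr_of_I[OF mI] F_nval unfolding is_nexpr_iff by metis
  finally show ?case using F(2)[OF s, of "[]"] by simp
next
  case (snoc b c)
  then have b: "b \<in> B" and c: "set c \<subseteq> B" by auto
  let ?h = "npol s c"
  obtain j where j: "s \<in> hpart L j" using R_props(3)[OF s] by blast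
  define i where "i = j + wpar B1 c"
  have hi: "?h \<in> hpart L i" "F ?h \<in> hpart AA i"
    using npoly_hpart[OF j c] hfl_hpart[OF s j c] F(2)[OF s c] by (simp_all only: i_def)
  have "\<forall>w\<in>supp ?h. w \<noteq> [] \<and> wpar B1 w = i" using hi(1) by (auto simp: NF_def)
  from leibniz_letter[OF this, of "wmono w" b]
  have eq: "mul (wmono w) (npol s (c @ [b])) = mul (mul (wmono w) ?h) (gen b) -
      pscale (koszul (lpar B1 b) i) (mul (wmono (w @ [b])) ?h)"
    by (simp add: npoly_snoc wmono_snoc)
  have wb: "w @ [b] \<in> NF B" by (rule NF_snoc[OF snoc.prems(2) b])
  have hn: "?h \<in> nspan" by (rule nspan_npoly[OF s c])
  have n: "mul (wmono w) ?h \<in> nspan" "mul (wmono (w @ [b])) ?h \<in> nspan"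
    using nspan_mul_left[OF hn] wmono_carrier[OF snoc.prems(2)] wmono_carrier[OF wb] by blast+
  have "F (mul (wmono w) (npol s (c @ [b]))) = ra (la (wmono w) (F ?h)) (gen b) \<ominus>\<^bsub>AA\<^esub>
      (koszul (lpar B1 b) i \<odot>\<^bsub>AA\<^esub> la (wmono (w @ [b])) (F ?h))"
    unfolding eq F_linear(4)[OF nspan_carrier[OF nspan_mul_letter[OF n(1) b]] carrier_pscale[OF nspan_carrier[OF n(2)]]]
      F_mul_letter[OF n(1) b] F_linear(3)[OF nspan_carrier[OF n(2)]] snoc.IH[OF c snoc.prems(2)] snoc.IH[OF c wb] ..
  also have "\<dots> = la (wmono w) (ra (F ?h) (gen b))"
    using P.lact_ract[OF hi(2) wmono_hpart[OF snoc.prems(2)] gen_hpart[OF b]]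
    by (simp add: wmono_snoc koszul_commute)
  also have "ra (F ?h) (gen b) = F (npol s (c @ [b]))"
    using F_mul_letter[OF hn b] by (simp add: npoly_snoc)
  finally show ?case .
qed

lemma F_mul_left:
  assumes h: "h \<in> nspan" and g: "g \<in> carrier L"
  shows "F (mul g h) = la g (F h)"
proof -
  have word: "F (mul (wmono w) h) = la (wmono w) (F h)" if w: "w \<in> NF B" for w
    using h
  proof (induction rule: nspan_induct)
    case zero
    then show ?case using P.act_zero(1)[OF wmono_carrier[OF w]] by (simp add: F_linear)
  next
    case (npoly s c)
    then show ?case using F_word_npoly w by blast
  next
    case (add f g)
    note c = nspan_carrier[OF add(1)] nspan_carrier[OF add(2)]
    note m = c[THEN mul_carrier[OF wmono_carrier[OF w]]]
    show ?case unfolding free_mult_add F_linear(2)[OF m] add.IH F_linear(2)[OF c]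
      by (rule P.lact_add_right[OF wmono_carrier[OF w] F_linear(1)[OF c(1)] F_linear(1)[OF c(2)], symmetric])
  next
    case (scale a f)
    note c = nspan_carrier[OF scale(1)]
    note m = mul_carrier[OF wmono_carrier[OF w] c]
    show ?case unfolding free_mult_pscale F_linear(3)[OF m] scale.IH F_linear(3)[OF c]
      by (rule P.lact_smult_right[OF wmono_carrier[OF w] F_linear(1)[OF c], symmetric])
  qed
  note hc = nspan_carrier[OF h]
  show ?thesis using g
  proof (induction rule: carrier_induct)
    case zero
    show ?case using P.act_zero(2)[OF F_linear(1)[OF hc]] by (simp add: F_linear)
  next
    case (add f g)
    show ?case
      unfolding free_mult_add F_linear(2)[OF mul_carrier[OF add(1) hc] mul_carrier[OF add(2) hc]] add.IH
      using P.lact_add_left[OF add(1,2) F_linear(1)[OF hc]] by simp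
  next
    case (scale a f)
    show ?case unfolding free_mult_pscale F_linear(3)[OF mul_carrier[OF scale(1) hc]] scale.IH
      using P.lact_smult_left[OF scale(1) F_linear(1)[OF hc]] by simp
  qed (rule word)
qed

text \<open>The Leibniz recursion on the right factor matches the axiom \<open>ract_prod\<close>. As
  that axiom speaks of homogeneous elements, the induction runs over words and normal polynomials
  first; c varies because multiplying by b replaces c by c @ [b].\<close>

lemma F_mul_right:
  assumes h: "h \<in> nspan" and g: "g \<in> carrier L"
  shows "F (mul h g) = ra (F h) g"
proof -
  have word_npoly: "F (mul (npol s c) (wmono v)) = ra (F (npol s c)) (wmono v)"
    if "v \<in> NF B" "s \<in> R" "set c \<subseteq> B" for s c v
    using that
  proof (induction v arbitrary: c rule: rev_induct)
    case (snoc b v)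
    let ?h = "npol s c"
    have b: "b \<in> B" using snoc.prems(1) by (auto simp: NF_def)
    have hn: "?h \<in> nspan" by (rule nspan_npoly[OF snoc.prems(2,3)])
    show ?case
    proof (cases "v = []")
      case True
      then show ?thesis using F_mul_letter[OF hn b] by (simp add: gen_def)
    next
      case False
      then have v: "v \<in> NF B" using snoc.prems by (auto simp: NF_def)
      obtain j where j: "s \<in> hpart L j" using R_props(3)[OF snoc.prems(2)] by blast
      have Fh: "F ?h \<in> hpart AA (j + wpar B1 c)"
        using hfl_hpart[OF snoc.prems(2) j snoc.prems(3)] F(2)[OF snoc.prems(2,3)] by simp
      have cb: "set (c @ [b]) \<subseteq> B" using snoc.prems(3) b by simp
      have IH: "F (mul ?h (wmono v)) = ra (F ?h) (wmono v)"
        "F (mul (mul ?h (gen b)) (wmono v)) = ra (ra (F ?h) (gen b)) (wmono v)"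
        using snoc.IH[OF v snoc.prems(2,3)] snoc.IH[OF v snoc.prems(2) cb] F_mul_letter[OF hn b]
        by (simp_all add: npoly_snoc)
      have n: "mul ?h (wmono v) \<in> nspan" "mul (mul ?h (gen b)) (wmono v) \<in> nspan"
        using nspan_mul_right[OF hn wmono_carrier[OF v]] nspan_mul_right[OF nspan_mul_letter[OF hn b] wmono_carrier[OF v]] .
      have "F (mul ?h (wmono (v @ [b]))) = ra (ra (F ?h) (wmono v)) (gen b) \<ominus>\<^bsub>AA\<^esub>
          (koszul (lpar B1 b) (wpar B1 v) \<odot>\<^bsub>AA\<^esub> ra (ra (F ?h) (gen b)) (wmono v))"
        unfolding leibniz_letter_word[OF False] F_linear(4)[OF nspan_carrier[OF nspan_mul_letter[OF n(1) b]] carrier_pscale[OF nspan_carrier[OF n(2)]]]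
          F_mul_letter[OF n(1) b] F_linear(3)[OF nspan_carrier[OF n(2)]] IH ..
      also have "\<dots> = ra (F ?h) (wmono (v @ [b]))"
        using P.ract_prod[OF Fh wmono_hpart[OF v] gen_hpart[OF b]] by (simp add: wmono_snoc koszul_commute)
      finally show ?thesis .
    qed
  qed (simp add: NF_def)
  have np: "F (mul (npol s c) g) = ra (F (npol s c)) g" if sc: "s \<in> R" "set c \<subseteq> B" for s c
    using g
  proof (induction rule: carrier_induct)
    case zero
    show ?case using P.act_zero(4)[OF F_linear(1)[OF npoly_carrier[OF sc]]] by (simp add: F_linear)
  next
    case (word w)
    then show ?case using word_npoly sc by blast
  next
    case (add f g)
    note hc = npoly_carrier[OF sc]
    show ?case
      unfolding free_mult_add F_linear(2)[OF mul_carrier[OF hc add(1)] mul_carrier[OF hc add(2)]] add.IH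
      using P.ract_add_right[OF add(1,2) F_linear(1)[OF hc]] by simp
  next
    case (scale a f)
    note hc = npoly_carrier[OF sc]
    show ?case unfolding free_mult_pscale F_linear(3)[OF mul_carrier[OF hc scale(1)]] scale.IH
      using P.ract_smult_right[OF scale(1) F_linear(1)[OF hc]] by simp
  qed
  show ?thesis using h
  proof (induction rule: nspan_induct)
    case zero
    then show ?case using P.act_zero(3)[OF g] by (simp add: F_linear)
  next
    case (add f h)
    note c = nspan_carrier[OF add(1)] nspan_carrier[OF add(2)]
    note m = c[THEN mul_carrier, OF g]
    show ?case unfolding free_mult_add F_linear(2)[OF m] add.IH F_linear(2)[OF c]
      by (rule P.ract_add_left[OF g F_linear(1)[OF c(1)] F_linear(1)[OF c(2)], symmetric])
  next
    case (scale a f)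
    note c = nspan_carrier[OF scale(1)]
    show ?case unfolding free_mult_pscale F_linear(3)[OF mul_carrier[OF c g]] scale.IH F_linear(3)[OF c]
      by (rule P.ract_smult_left[OF g F_linear(1)[OF c], symmetric])
  qed (rule np)
qed

text \<open>Induction through normal polynomials of the same parity as h only. This is what makes
  \<open>J\<close> a graded ideal.\<close>

lemma F_hpart:
  assumes "h \<in> nspan" "h \<in> hpart L i"
  shows "F h \<in> hpart AA i"
  using assms
proof (induction rule: nspan_homog_induct)
  case zero
  show ?case by (simp add: F_linear AA.hpart_zero)
next
  case (npoly s c)
  obtain j where j: "s \<in> hpart L j" using R_props(3)[OF npoly(1)] by blast
  have "npol s c \<in> hpart L (j + wpar B1 c)" by (rule npoly_hpart[OF j npoly(2)])
  \<comment> \<open>The leading word shows that the normal polynomial is nonzero, so the parity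
    computed from s and c is the assumed parity i.\<close>
  moreover have "lmon s @ c \<in> supp (npol s c)"
    using R_props(2)[OF npoly(1)] by (simp add: in_keys_iff npoly_keys)
  ultimately have "j + wpar B1 c = i" using npoly(3) by (metis (mono_tags, lifting) Lbs_simps(6) mem_Collect_eq)
  then show ?case using hfl_hpart[OF npoly(1) j npoly(2)] F(2)[OF npoly(1,2)] by simp
next
  case (add f g)
  then show ?case using F_linear(2)[of f g] nspan_carrier AA.hpart_closed(1) by simp
next
  case (scale a f)
  then show ?case using F_linear(3)[of f a] nspan_carrier AA.hpart_closed(2) by simp
qed

end

section \<open>Rewriting modulo the relations in the free algebra on A and B\<close>

context ext_setup
begin

abbreviation "A \<equiv> A0 \<union> A1"
abbreviation "rels \<equiv> ext_relations AA A0 A1 B0 B1 R lact ract fl"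
abbreviation "KK \<equiv> Lbs (gsum A0 B0) (gsum A1 B1) :: ('k, ('a + 'b) list \<Rightarrow>\<^sub>0 'k) superalgebra"
abbreviation "kmul \<equiv> free_mult (gsum A1 B1) :: (('a + 'b) list \<Rightarrow>\<^sub>0 'k) \<Rightarrow> _"
abbreviation "br \<equiv> brace AA A :: 'a \<Rightarrow> (('a + 'b) list \<Rightarrow>\<^sub>0 'k)"
abbreviation "em \<equiv> emb :: ('b list \<Rightarrow>\<^sub>0 'k) \<Rightarrow> (('a + 'b) list \<Rightarrow>\<^sub>0 'k)"

lemma rels_eq: "rels =
    {kmul (gen (Inl a)) (gen (Inl a')) | a a'. a \<in> A \<and> a' \<in> A} \<union>
    {kmul (gen (Inl a)) (gen (Inr b)) - br (ra a (gen b)) | a b. a \<in> A \<and> b \<in> B} \<union>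
    {kmul (em (wmono \<nu>)) (gen (Inl a)) - br (la (wmono \<nu>) a) | \<nu> a. a \<in> A \<and> \<nu> \<in> NF B} \<union>
    {em f - br (fl f) | f. f \<in> R}"
  unfolding ext_relations_def Let_def la_def ra_def by (rule refl)

lemma K_closed:
  "f \<in> carrier KK \<Longrightarrow> g \<in> carrier KK \<Longrightarrow> f + g \<in> carrier KK"
  "f \<in> carrier KK \<Longrightarrow> g \<in> carrier KK \<Longrightarrow> f - g \<in> carrier KK"
  "f \<in> carrier KK \<Longrightarrow> pscale c f \<in> carrier KK"
  "f \<in> carrier KK \<Longrightarrow> g \<in> carrier KK \<Longrightarrow> kmul f g \<in> carrier KK"
proof -
  interpret K: leibniz_superalgebra KK by (rule leibniz_superalgebra_Lbs)
  show "f \<in> carrier KK \<Longrightarrow> g \<in> carrier KK \<Longrightarrow> kmul f g \<in> carrier KK" using K.prod_closed[of f g] by simp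
qed (simp_all add: keys_subset_closed)

lemma K_elems:
  "a \<in> A \<Longrightarrow> gen (Inl a) \<in> carrier KK" "b \<in> B \<Longrightarrow> gen (Inr b) \<in> carrier KK"
  "f \<in> carrier L \<Longrightarrow> em f \<in> carrier KK" "x \<in> carrier AA \<Longrightarrow> br x \<in> carrier KK"
proof -
  show g: "a \<in> A \<Longrightarrow> gen (Inl a) \<in> carrier KK" for a by (simp add: gen_def wmono_def NF_def gsum_def[of A])
  show "b \<in> B \<Longrightarrow> gen (Inr b) \<in> carrier KK" by (simp add: gen_def wmono_def NF_def gsum_def[of A])
  show "f \<in> carrier L \<Longrightarrow> em f \<in> carrier KK" by (rule superalg_homD(2)[OF emb_hom])
  show "x \<in> carrier AA \<Longrightarrow> br x \<in> carrier KK"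
  proof (induction rule: AA.basis_induct)
    case zero
    show ?case by (simp add: AA.brace_linear)
  next
    case (basis a)
    show ?case unfolding AA.brace_linear(4)[OF basis] by (rule g[OF basis])
  next
    case (add x y)
    show ?case unfolding AA.brace_linear(1)[OF add(1,2)] by (rule K_closed(1)[OF add(3,4)])
  next
    case (scale a x)
    show ?case unfolding AA.brace_linear(2)[OF scale(1)] by (rule K_closed(3)[OF scale(2)])
  qed
qed

lemma A_in: "a \<in> A \<Longrightarrow> a \<in> carrier AA" using AA.A_carrier by blast

lemma fl_carrier: "s \<in> R \<Longrightarrow> fl s \<in> carrier AA" using hfl_carrier[of s "[]"] by simp

sublocale K: presentation "gsum A0 B0" "gsum A1 B1" rels
proof
  show "rels \<subseteq> carrier KK"
    unfolding rels_eq
  proof (intro Un_least subsetI; elim CollectE exE conjE)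
    fix x a a' assume "x = kmul (gen (Inl a)) (gen (Inl a'))" "a \<in> A" "a' \<in> A"
    then show "x \<in> carrier KK" using K_closed(4)[OF K_elems(1) K_elems(1)] by blast
  next
    fix x a b assume x: "x = kmul (gen (Inl a)) (gen (Inr b)) - br (ra a (gen b))" "a \<in> A" "b \<in> B"
    show "x \<in> carrier KK" unfolding x(1)
      by (rule K_closed(2)[OF K_closed(4)[OF K_elems(1)[OF x(2)] K_elems(2)[OF x(3)]] K_elems(4)[OF P.ract_closed[OF gen_carrier[OF x(3)] A_in[OF x(2)]]]])
  next
    fix x \<nu> a assume x: "x = kmul (em (wmono \<nu>)) (gen (Inl a)) - br (la (wmono \<nu>) a)" "a \<in> A" "\<nu> \<in> NF B"
    show "x \<in> carrier KK" unfolding x(1)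
      by (rule K_closed(2)[OF K_closed(4)[OF K_elems(3)[OF wmono_carrier[OF x(3)]] K_elems(1)[OF x(2)]] K_elems(4)[OF P.lact_closed[OF wmono_carrier[OF x(3)] A_in[OF x(2)]]]])
  next
    fix x f assume x: "x = em f - br (fl f)" "f \<in> R"
    show "x \<in> carrier KK" unfolding x(1)
      by (rule K_closed(2)[OF K_elems(3)[OF R_props(4)[OF x(2)]] K_elems(4)[OF fl_carrier[OF x(2)]]])
  qed
qed

lemma rels_mem:
  "a \<in> A \<Longrightarrow> a' \<in> A \<Longrightarrow> kmul (gen (Inl a)) (gen (Inl a')) \<in> K.IdS"
  "a \<in> A \<Longrightarrow> b \<in> B \<Longrightarrow> kmul (gen (Inl a)) (gen (Inr b)) - br (ra a (gen b)) \<in> K.IdS"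
  "a \<in> A \<Longrightarrow> \<nu> \<in> NF B \<Longrightarrow> kmul (em (wmono \<nu>)) (gen (Inl a)) - br (la (wmono \<nu>) a) \<in> K.IdS"
  "f \<in> R \<Longrightarrow> em f - br (fl f) \<in> K.IdS"
proof -
  note m = K.IdS_closed(7)
  show "a \<in> A \<Longrightarrow> a' \<in> A \<Longrightarrow> kmul (gen (Inl a)) (gen (Inl a')) \<in> K.IdS"
    by (rule m) (unfold rels_eq, blast)
  show "a \<in> A \<Longrightarrow> b \<in> B \<Longrightarrow> kmul (gen (Inl a)) (gen (Inr b)) - br (ra a (gen b)) \<in> K.IdS"
    by (rule m) (unfold rels_eq, blast)
  show "a \<in> A \<Longrightarrow> \<nu> \<in> NF B \<Longrightarrow> kmul (em (wmono \<nu>)) (gen (Inl a)) - br (la (wmono \<nu>) a) \<in> K.IdS"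
    by (rule m) (unfold rels_eq, blast)
  show "f \<in> R \<Longrightarrow> em f - br (fl f) \<in> K.IdS"
    by (rule m) (unfold rels_eq, blast)
qed

lemma br_mul_Inl:
  assumes "x \<in> carrier AA" "a \<in> A"
  shows "kmul (br x) (gen (Inl a)) \<in> K.IdS"
  using assms(1)
proof (induction rule: AA.basis_induct)
  case zero
  show ?case by (simp add: AA.brace_linear K.IdS_closed)
next
  case (basis a')
  show ?case unfolding AA.brace_linear(4)[OF basis] by (rule rels_mem(1)[OF basis assms(2)])
next
  case (add x y)
  show ?case unfolding AA.brace_linear(1)[OF add(1,2)] free_mult_add by (rule K.IdS_closed(2)[OF add(3,4)])
next
  case (scale c x)
  show ?case unfolding AA.brace_linear(2)[OF scale(1)] free_mult_pscale by (rule K.IdS_closed(3)[OF scale(2)])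
qed

lemma br_mul_Inr:
  assumes "x \<in> carrier AA" "b \<in> B"
  shows "kmul (br x) (gen (Inr b)) - br (ra x (gen b)) \<in> K.IdS"
  using assms(1)
proof (induction rule: AA.basis_induct)
  case zero
  show ?case using P.act_zero(3)[OF gen_carrier[OF assms(2)]] by (simp add: AA.brace_linear K.IdS_closed)
next
  case (basis a')
  show ?case unfolding AA.brace_linear(4)[OF basis] by (rule rels_mem(2)[OF basis assms(2)])
next
  case (add x y)
  note r = P.ract_add_left[OF gen_carrier[OF assms(2)] add(1,2)] and c = P.ract_closed[OF gen_carrier[OF assms(2)]]
  have eq: "kmul (br (x \<oplus>\<^bsub>AA\<^esub> y)) (gen (Inr b)) - br (ra (x \<oplus>\<^bsub>AA\<^esub> y) (gen b)) =
      (kmul (br x) (gen (Inr b)) - br (ra x (gen b))) + (kmul (br y) (gen (Inr b)) - br (ra y (gen b)))"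
    unfolding r AA.brace_linear(1)[OF add(1,2)] AA.brace_linear(1)[OF c[OF add(1)] c[OF add(2)]] free_mult_add by simp
  show ?case unfolding eq by (rule K.IdS_closed(2)[OF add(3,4)])
next
  case (scale k x)
  note r = P.ract_smult_left[OF gen_carrier[OF assms(2)] scale(1)] and c = P.ract_closed[OF gen_carrier[OF assms(2)] scale(1)]
  have eq: "kmul (br (k \<odot>\<^bsub>AA\<^esub> x)) (gen (Inr b)) - br (ra (k \<odot>\<^bsub>AA\<^esub> x) (gen b)) =
      pscale k (kmul (br x) (gen (Inr b)) - br (ra x (gen b)))"
    unfolding r AA.brace_linear(2)[OF scale(1)] AA.brace_linear(2)[OF c] free_mult_pscale pscale_distrib ..
  show ?case unfolding eq by (rule K.IdS_closed(3)[OF scale(2)])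
qed

lemma em_mul_Inl:
  assumes "f \<in> carrier L" and a: "a \<in> A"
  shows "kmul (em f) (gen (Inl a)) - br (la f a) \<in> K.IdS"
  using assms(1)
proof (induction rule: carrier_induct)
  case zero
  show ?case using P.act_zero(2)[OF A_in[OF a]] by (simp add: emb_linear AA.brace_linear K.IdS_closed)
next
  case (word w)
  show ?case by (rule rels_mem(3)[OF a word])
next
  case (add f g)
  note r = P.lact_add_left[OF add(1,2) A_in[OF a]] and c = P.lact_closed[OF _ A_in[OF a]]
  have eq: "kmul (em (f + g)) (gen (Inl a)) - br (la (f + g) a) =
      (kmul (em f) (gen (Inl a)) - br (la f a)) + (kmul (em g) (gen (Inl a)) - br (la g a))"
    unfolding r[simplified] AA.brace_linear(1)[OF c[OF add(1)] c[OF add(2)]] by (simp add: emb_linear free_mult_add)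
  show ?case unfolding eq by (rule K.IdS_closed(2)[OF add(3,4)])
next
  case (scale k f)
  note r = P.lact_smult_left[OF scale(1) A_in[OF a]] and c = P.lact_closed[OF scale(1) A_in[OF a]]
  have eq: "kmul (em (pscale k f)) (gen (Inl a)) - br (la (pscale k f) a) =
      pscale k (kmul (em f) (gen (Inl a)) - br (la f a))"
    unfolding r[simplified] AA.brace_linear(2)[OF c] by (simp add: emb_linear free_mult_pscale pscale_distrib)
  show ?case unfolding eq by (rule K.IdS_closed(3)[OF scale(2)])
qed

text \<open>For elements of R this is a relation. Multiplying it by a letter b appends b on one
  side, and on the other the relations for products of A with B turn b into its action, which
  \<open>F\<close> follows by \<open>F_mul_letter\<close>.\<close>

lemma em_I:
  assumes "h \<in> I"
  shows "em h - br (F h) \<in> K.IdS"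
  using assms unfolding I_eq_nspan
proof (induction rule: nspan_induct)
  case zero
  show ?case by (simp add: emb_linear F_linear AA.brace_linear K.IdS_closed)
next
  case (npoly s c)
  show ?case using npoly(2)
  proof (induction c rule: rev_induct)
    case Nil
    show ?case using rels_mem(4)[OF npoly(1)] F(2)[OF npoly(1), of "[]"] by simp
  next
    case (snoc b c)
    then have c: "set c \<subseteq> B" and b: "b \<in> B" by auto
    let ?h = "npol s c"
    have hc: "?h \<in> carrier L" by (rule npoly_carrier[OF npoly(1) c])
    have "em (npol s (c @ [b])) - br (F (npol s (c @ [b]))) =
        kmul (em ?h - br (F ?h)) (gen (Inr b)) + (kmul (br (F ?h)) (gen (Inr b)) - br (ra (F ?h) (gen b)))"
      using F_mul_letter[OF nspan_npoly[OF npoly(1) c] b]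
      by (simp add: npoly_snoc emb_mul_gen[where ?A1.0 = A1] free_mult_diff)
    moreover have "\<dots> \<in> K.IdS"
      using K.IdS_closed(2)[OF K.IdS_closed(5)[OF snoc.IH[OF c] K_elems(2)[OF b]] br_mul_Inr[OF F_linear(1)[OF hc] b]] .
    ultimately show ?case by simp
  qed
next
  case (add f g)
  note c = nspan_carrier[OF add(1)] nspan_carrier[OF add(2)]
  have eq: "em (f + g) - br (F (f + g)) = (em f - br (F f)) + (em g - br (F g))"
    unfolding F_linear(2)[OF c] AA.brace_linear(1)[OF F_linear(1)[OF c(1)] F_linear(1)[OF c(2)]] by (simp add: emb_linear)
  show ?case unfolding eq by (rule K.IdS_closed(2)[OF add(3,4)])
next
  case (scale k f)
  note c = nspan_carrier[OF scale(1)]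
  have eq: "em (pscale k f) - br (F (pscale k f)) = pscale k (em f - br (F f))"
    unfolding F_linear(3)[OF c] AA.brace_linear(2)[OF F_linear(1)[OF c]] by (simp add: emb_linear pscale_distrib)
  show ?case unfolding eq by (rule K.IdS_closed(3)[OF scale(2)])
qed

text \<open>Monomials are left-normed, so it is enough that the elements x + f are, modulo the
  relations, stable under right multiplication by one letter.\<close>

lemma K_span_L:
  assumes "k \<in> carrier KK"
  shows "\<exists>x\<in>carrier AA. \<exists>f\<in>carrier L. k - (br x + em f) \<in> K.IdS"
proof -
  have gen_case: "\<exists>x\<in>carrier AA. \<exists>f\<in>carrier L. gen t - (br x + em f) \<in> K.IdS" if t: "t \<in> gsum A B" for t
  proof -
    from t consider a where "a \<in> A" "t = Inl a" | b where "b \<in> B" "t = Inr b" by (auto simp: gsum_def)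
    then show ?thesis
    proof cases
      case (1 a)
      have "gen t - (br a + em 0) = 0" unfolding AA.brace_linear(4)[OF 1(1)] by (simp add: 1(2) emb_linear)
      then show ?thesis using K.IdS_closed(1) A_in[OF 1(1)] by (intro bexI[of _ a] bexI[of _ 0]) simp_all
    next
      case (2 b)
      have "gen t - (br \<zero>\<^bsub>AA\<^esub> + em (gen b)) = 0" using 2(2) by (simp add: AA.brace_linear)
      then show ?thesis using K.IdS_closed(1) gen_carrier[OF 2(1)]
        by (intro bexI[of _ "\<zero>\<^bsub>AA\<^esub>"] bexI[of _ "gen b"]) simp_all
    qed
  qed
  have word: "\<exists>x\<in>carrier AA. \<exists>f\<in>carrier L. wmono w - (br x + em f) \<in> K.IdS" if "w \<in> NF (gsum A B)" for w
    using that
  proof (induction w rule: rev_induct)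
    case (snoc t w)
    then have t: "t \<in> gsum A B" by (auto simp: NF_def)
    show ?case
    proof (cases "w = []")
      case True
      then show ?thesis using gen_case[OF t] by (simp add: gen_def)
    next
      case False
      then have w: "w \<in> NF (gsum A B)" using snoc.prems by (auto simp: NF_def)
      from snoc.IH[OF w] obtain x f where xf: "x \<in> carrier AA" "f \<in> carrier L" "wmono w - (br x + em f) \<in> K.IdS" by blast
      from t consider a where "a \<in> A" "t = Inl a" | b where "b \<in> B" "t = Inr b" by (auto simp: gsum_def)
      then show ?thesis
      proof cases
        case (1 a)
        \<comment> \<open>For a letter a of A the product xa falls into the ideal and fa becomes the
          action of f on a; no component in \<open>L\<close> survives.\<close>
        have "wmono (w @ [t]) - (br (la f a) + em 0) = kmul (wmono w - (br x + em f)) (gen (Inl a)) +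
            (kmul (br x) (gen (Inl a)) + (kmul (em f) (gen (Inl a)) - br (la f a)))"
          using 1(2) by (simp add: wmono_snoc[of "gsum A1 B1", symmetric] free_mult_diff free_mult_add emb_linear)
        also have "\<dots> \<in> K.IdS"
          by (rule K.IdS_closed(2)[OF K.IdS_closed(5)[OF xf(3) K_elems(1)[OF 1(1)]]
            K.IdS_closed(2)[OF br_mul_Inl[OF xf(1) 1(1)] em_mul_Inl[OF xf(2) 1(1)]]])
        finally show ?thesis using P.lact_closed[OF xf(2) A_in[OF 1(1)]]
          by (intro bexI[of _ "la f a"] bexI[of _ 0]) simp_all
      next
        case (2 b)
        \<comment> \<open>For a letter b of B the product xb becomes the action of b on x, while fb
          is a product in \<open>L\<close>.\<close>
        have "wmono (w @ [t]) - (br (ra x (gen b)) + em (mul f (gen b))) =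
            kmul (wmono w - (br x + em f)) (gen (Inr b)) + (kmul (br x) (gen (Inr b)) - br (ra x (gen b)))"
          using 2(2) by (simp add: wmono_snoc[of "gsum A1 B1", symmetric] free_mult_diff free_mult_add emb_mul_gen[where ?A1.0 = A1])
        also have "\<dots> \<in> K.IdS"
          by (rule K.IdS_closed(2)[OF K.IdS_closed(5)[OF xf(3) K_elems(2)[OF 2(1)]] br_mul_Inr[OF xf(1) 2(1)]])
        finally show ?thesis
          using P.ract_closed[OF gen_carrier[OF 2(1)] xf(1)] mul_carrier[OF xf(2) gen_carrier[OF 2(1)]]
          by (intro bexI[of _ "ra x (gen b)"] bexI[of _ "mul f (gen b)"])
      qed
    qed
  qed (simp add: NF_def)
  have "supp k \<subseteq> NF (gsum A B)" using assms by simp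
  then show ?thesis
  proof (rule poly_word_induct)
    show "\<exists>x\<in>carrier AA. \<exists>f\<in>carrier L. 0 - (br x + em f) \<in> K.IdS"
      by (rule bexI[of _ "\<zero>\<^bsub>AA\<^esub>"], rule bexI[of _ 0]) (simp_all add: AA.brace_linear emb_linear K.IdS_closed)
  next
    fix k l
    assume "\<exists>x\<in>carrier AA. \<exists>f\<in>carrier L. k - (br x + em f) \<in> K.IdS" "\<exists>x\<in>carrier AA. \<exists>f\<in>carrier L. l - (br x + em f) \<in> K.IdS"
    then obtain x f y g where xf: "x \<in> carrier AA" "f \<in> carrier L" "k - (br x + em f) \<in> K.IdS"
      "y \<in> carrier AA" "g \<in> carrier L" "l - (br y + em g) \<in> K.IdS" by blast
    have "k + l - (br (x \<oplus>\<^bsub>AA\<^esub> y) + em (f + g)) = (k - (br x + em f)) + (l - (br y + em g))"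
      unfolding AA.brace_linear(1)[OF xf(1,4)] by (simp add: emb_linear)
    also have "\<dots> \<in> K.IdS" by (rule K.IdS_closed(2)[OF xf(3,6)])
    finally show "\<exists>x\<in>carrier AA. \<exists>f\<in>carrier L. k + l - (br x + em f) \<in> K.IdS"
      using xf(1,2,4,5) by (intro bexI[of _ "x \<oplus>\<^bsub>AA\<^esub> y"] bexI[of _ "f + g"]) (simp_all add: keys_subset_closed(1))
  next
    fix c k assume "\<exists>x\<in>carrier AA. \<exists>f\<in>carrier L. k - (br x + em f) \<in> K.IdS"
    then obtain x f where xf: "x \<in> carrier AA" "f \<in> carrier L" "k - (br x + em f) \<in> K.IdS" by blast
    have "pscale c k - (br (c \<odot>\<^bsub>AA\<^esub> x) + em (pscale c f)) = pscale c (k - (br x + em f))"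
      unfolding AA.brace_linear(2)[OF xf(1)] by (simp add: emb_linear pscale_distrib)
    also have "\<dots> \<in> K.IdS" by (rule K.IdS_closed(3)[OF xf(3)])
    finally show "\<exists>x\<in>carrier AA. \<exists>f\<in>carrier L. pscale c k - (br x + em f) \<in> K.IdS"
      using xf(1,2) by (intro bexI[of _ "c \<odot>\<^bsub>AA\<^esub> x"] bexI[of _ "pscale c f"]) (simp_all add: keys_subset_closed(2))
  qed (rule word)
qed

text \<open>The component in \<open>L\<close> is split into an irreducible part and an element h of
  the ideal, and h is exchanged for \<open>F h\<close>, which joins the component in A.\<close>

lemma K_span:
  assumes "k \<in> carrier KK"
  obtains x d where "x \<in> carrier AA" "supp d \<subseteq> IrrR" "k - (br x + em d) \<in> K.IdS"
proof -
  obtain x f where xf: "x \<in> carrier AA" "f \<in> carrier L" "k - (br x + em f) \<in> K.IdS"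
    using K_span_L[OF assms] by blast
  obtain d h where dh: "supp d \<subseteq> IrrR" "h \<in> nspan" "f = d + h" using Irr_nspan_decomp[OF xf(2)] .
  have Fh: "F h \<in> carrier AA" using F_linear(1)[OF nspan_carrier[OF dh(2)]] .
  have "k - (br (x \<oplus>\<^bsub>AA\<^esub> F h) + em d) = (k - (br x + em f)) + (em h - br (F h))"
    unfolding AA.brace_linear(1)[OF xf(1) Fh] by (simp add: emb_linear dh(3))
  also have "\<dots> \<in> K.IdS" using K.IdS_closed(2)[OF xf(3) em_I] dh(2) by (simp add: I_eq_nspan)
  finally show thesis using that[of "x \<oplus>\<^bsub>AA\<^esub> F h" d] xf(1) Fh dh(1) by simp
qed

section \<open>Comparison with the split extension of the free algebra\<close>

abbreviation "PP \<equiv> split_ext L AA la ra"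

sublocale PP: leibniz_superalgebra PP by (rule P.leibniz_superalgebra_split_ext)

definition \<Phi> :: "(('a + 'b) list \<Rightarrow>\<^sub>0 'k) \<Rightarrow> 'a \<times> ('b list \<Rightarrow>\<^sub>0 'k)"
  where "\<Phi> = (SOME \<phi>. \<phi> \<in> superalg_hom KK PP \<and> (\<forall>a\<in>A. \<phi> (gen (Inl a)) = (a, 0)) \<and>
    (\<forall>b\<in>B. \<phi> (gen (Inr b)) = (\<zero>\<^bsub>AA\<^esub>, gen b)))"

lemma \<Phi>_gen: "\<Phi> \<in> superalg_hom KK PP" "a \<in> A \<Longrightarrow> \<Phi> (gen (Inl a)) = (a, 0)" "b \<in> B \<Longrightarrow> \<Phi> (gen (Inr b)) = (\<zero>\<^bsub>AA\<^esub>, gen b)"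
proof -
  have "\<exists>\<phi>. \<phi> \<in> superalg_hom KK PP \<and> (\<forall>a\<in>A. \<phi> (gen (Inl a)) = (a, 0)) \<and>
      (\<forall>b\<in>B. \<phi> (gen (Inr b)) = (\<zero>\<^bsub>AA\<^esub>, gen b))"
  proof (rule gsum_hom_exists[OF PP.leibniz_superalgebra_axioms AA.A_disjoint disjoint])
    show "(a, 0) \<in> hpart PP (lpar A1 a)" if "a \<in> A" for a
      using AA.A_parity[OF that] L.hpart_zero by simp
    show "(\<zero>\<^bsub>AA\<^esub>, gen b) \<in> hpart PP (lpar B1 b)" if "b \<in> B" for b
      using gen_hpart[OF that] AA.hpart_zero by simp
  qed
  from someI_ex[OF this]
  have *: "\<Phi> \<in> superalg_hom KK PP \<and> (\<forall>a\<in>A. \<Phi> (gen (Inl a)) = (a, 0)) \<and> (\<forall>b\<in>B. \<Phi> (gen (Inr b)) = (\<zero>\<^bsub>AA\<^esub>, gen b))"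
    unfolding \<Phi>_def .
  then show "\<Phi> \<in> superalg_hom KK PP" "a \<in> A \<Longrightarrow> \<Phi> (gen (Inl a)) = (a, 0)" "b \<in> B \<Longrightarrow> \<Phi> (gen (Inr b)) = (\<zero>\<^bsub>AA\<^esub>, gen b)" by blast+
qed

lemma \<Phi>_linear:
  "k \<in> carrier KK \<Longrightarrow> \<Phi> k \<in> carrier AA \<times> carrier L"
  "k \<in> carrier KK \<Longrightarrow> l \<in> carrier KK \<Longrightarrow> \<Phi> (k + l) = (fst (\<Phi> k) \<oplus>\<^bsub>AA\<^esub> fst (\<Phi> l), snd (\<Phi> k) + snd (\<Phi> l))"
  "k \<in> carrier KK \<Longrightarrow> \<Phi> (pscale c k) = (c \<odot>\<^bsub>AA\<^esub> fst (\<Phi> k), pscale c (snd (\<Phi> k)))"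
  "k \<in> carrier KK \<Longrightarrow> l \<in> carrier KK \<Longrightarrow> \<Phi> (k - l) = (fst (\<Phi> k) \<ominus>\<^bsub>AA\<^esub> fst (\<Phi> l), snd (\<Phi> k) - snd (\<Phi> l))"
  "k \<in> carrier KK \<Longrightarrow> l \<in> carrier KK \<Longrightarrow> \<Phi> (kmul k l) =
    (ra (fst (\<Phi> k)) (snd (\<Phi> l)) \<oplus>\<^bsub>AA\<^esub> la (snd (\<Phi> k)) (fst (\<Phi> l)), mul (snd (\<Phi> k)) (snd (\<Phi> l)))"
proof -
  note h = superalg_homD[OF \<Phi>_gen(1)]
  show c: "k \<in> carrier KK \<Longrightarrow> \<Phi> k \<in> carrier AA \<times> carrier L" for k using h(2)[of k] by simp
  show a: "k \<in> carrier KK \<Longrightarrow> l \<in> carrier KK \<Longrightarrow> \<Phi> (k + l) = (fst (\<Phi> k) \<oplus>\<^bsub>AA\<^esub> fst (\<Phi> l), snd (\<Phi> k) + snd (\<Phi> l))" for k l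
    using h(3)[of k l] by simp
  show s: "k \<in> carrier KK \<Longrightarrow> \<Phi> (pscale c k) = (c \<odot>\<^bsub>AA\<^esub> fst (\<Phi> k), pscale c (snd (\<Phi> k)))" for c k
    using h(4)[of k c] by simp
  show "\<Phi> (k - l) = (fst (\<Phi> k) \<ominus>\<^bsub>AA\<^esub> fst (\<Phi> l), snd (\<Phi> k) - snd (\<Phi> l))" if kl: "k \<in> carrier KK" "l \<in> carrier KK"
  proof -
    have "k - l = k + pscale (- 1) l" by simp
    moreover have "fst (\<Phi> l) \<in> carrier AA" using c[OF kl(2)] by auto
    ultimately show ?thesis using a[OF kl(1) K_closed(3)[OF kl(2), of "-1"]] s[OF kl(2), of "-1"]
      by (simp add: AA.smult_laws AA.M.minus_eq)
  qed
  show "k \<in> carrier KK \<Longrightarrow> l \<in> carrier KK \<Longrightarrow> \<Phi> (kmul k l) =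
    (ra (fst (\<Phi> k)) (snd (\<Phi> l)) \<oplus>\<^bsub>AA\<^esub> la (snd (\<Phi> k)) (fst (\<Phi> l)), mul (snd (\<Phi> k)) (snd (\<Phi> l)))"
    using h(5)[of k l] by simp
qed

text \<open>Both sides are homomorphisms on \<open>L\<close> that agree on the generators, so
  uniqueness in the universal property applies.\<close>

lemma \<Phi>_em:
  assumes "f \<in> carrier L"
  shows "\<Phi> (em f) = (\<zero>\<^bsub>AA\<^esub>, f)"
proof -
  have "(\<lambda>f. (\<zero>\<^bsub>AA\<^esub>, f)) \<in> superalg_hom L PP"
    unfolding superalg_hom_def linear_maps_def
    using P.act_zero(1,3) by (simp add: AA.smult_laws AA.hpart_zero image_subset_iff)
  moreover have "\<Phi> \<circ> em \<in> superalg_hom L PP" by (rule superalg_hom_comp[OF emb_hom \<Phi>_gen(1)])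
  ultimately have "(\<Phi> \<circ> em) f = (\<zero>\<^bsub>AA\<^esub>, f)"
    by (intro PP.Lbs_hom_unique[of "\<Phi> \<circ> em" B0 B1 "\<lambda>f. (\<zero>\<^bsub>AA\<^esub>, f)" f, OF _ _ _ assms]) (simp_all add: \<Phi>_gen)
  then show ?thesis by simp
qed

lemma \<Phi>_br:
  assumes "x \<in> carrier AA"
  shows "\<Phi> (br x) = (x, 0)"
  using assms
proof (induction rule: AA.basis_induct)
  case zero
  show ?case using \<Phi>_em[of 0] by (simp add: AA.brace_linear emb_linear)
next
  case (basis a)
  show ?case unfolding AA.brace_linear(4)[OF basis] by (rule \<Phi>_gen(2)[OF basis])
next
  case (add x y)
  show ?case unfolding AA.brace_linear(1)[OF add(1,2)] \<Phi>_linear(2)[OF K_elems(4)[OF add(1)] K_elems(4)[OF add(2)]] add(3,4) by simp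
next
  case (scale k x)
  show ?case unfolding AA.brace_linear(2)[OF scale(1)] \<Phi>_linear(3)[OF K_elems(4)[OF scale(1)]] scale(2) by simp
qed

lemma uminus_zero: "\<ominus>\<^bsub>AA\<^esub> \<zero>\<^bsub>AA\<^esub> = \<zero>\<^bsub>AA\<^esub>"
  by (rule AA.M.minus_equality) simp_all

definition J :: "('a \<times> ('b list \<Rightarrow>\<^sub>0 'k)) set"
  where "J = {(\<ominus>\<^bsub>AA\<^esub> F h, h) | h. h \<in> I}"

lemma J_iff: "p \<in> J \<longleftrightarrow> snd p \<in> I \<and> fst p = \<ominus>\<^bsub>AA\<^esub> F (snd p)"
  by (auto simp: J_def prod_eq_iff)

text \<open>Multiplying (- F h, h) by (x, g) on the right gives - F h acted on by g, plus the action
  of h on x, which is zero, and the second entry hg. Since \<open>F\<close> respects right actions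
  this is again in \<open>J\<close>; the left side is symmetric.\<close>

lemma superideal_J: "superideal J PP"
proof (rule PP.superidealI)
  show "J \<subseteq> carrier PP" using F_linear(1) I_carrier by (auto simp: J_def simp del: Lbs_simps)
  show "\<zero>\<^bsub>PP\<^esub> \<in> J" using Q.IdS_closed(1) by (simp add: J_iff F_linear uminus_zero)
  show "p \<oplus>\<^bsub>PP\<^esub> q \<in> J" if pq: "p \<in> J" "q \<in> J" for p q
  proof -
    have h: "snd p \<in> I" "snd q \<in> I" using pq by (simp_all add: J_iff)
    note c = I_carrier[OF h(1)] I_carrier[OF h(2)]
    show ?thesis using pq Q.IdS_closed(2)[OF h] F_linear(1)[OF c(1)] F_linear(1)[OF c(2)]
      by (simp add: J_iff F_linear(2)[OF c] AA.M.minus_add)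
  qed
  show "c \<odot>\<^bsub>PP\<^esub> p \<in> J" if p: "p \<in> J" for c p
  proof -
    have h: "snd p \<in> I" using p by (simp add: J_iff)
    note cc = I_carrier[OF h]
    show ?thesis using p Q.IdS_closed(3)[OF h] F_linear(1)[OF cc] by (simp add: J_iff F_linear(3)[OF cc] AA.smult_laws)
  qed
  show "p \<otimes>\<^bsub>PP\<^esub> q \<in> J" "q \<otimes>\<^bsub>PP\<^esub> p \<in> J" if p: "p \<in> J" and q: "q \<in> carrier PP" for p q
  proof -
    have h: "snd p \<in> I" "snd p \<in> nspan" using p by (simp_all add: J_iff I_eq_nspan)
    note c = I_carrier[OF h(1)] and Fc = F_linear(1)[OF I_carrier[OF h(1)]]
    have q': "fst q \<in> carrier AA" "snd q \<in> carrier L" using q by auto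
    have m: "mul (snd p) (snd q) \<in> I" "mul (snd q) (snd p) \<in> I"
      using nspan_mul_right[OF h(2) q'(2)] nspan_mul_left[OF h(2) q'(2)] by (simp_all add: I_eq_nspan)
    show "p \<otimes>\<^bsub>PP\<^esub> q \<in> J"
      using p m(1) act_I(1)[OF h(1) q'(1)] F_mul_right[OF h(2) q'(2)] P.act_uminus(2)[OF q'(2) Fc] P.ract_closed[OF q'(2) Fc]
      by (simp add: J_iff)
    show "q \<otimes>\<^bsub>PP\<^esub> p \<in> J"
      using p m(2) act_I(2)[OF h(1) q'(1)] F_mul_left[OF h(2) q'(2)] P.act_uminus(1)[OF q'(2) Fc] P.lact_closed[OF q'(2) Fc]
      by (simp add: J_iff)
  qed
  fix p q assume pq: "p \<in> hpart PP 0" "q \<in> hpart PP 1" "p \<oplus>\<^bsub>PP\<^esub> q \<in> J"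
  have f: "fst p \<in> hpart AA 0" "fst q \<in> hpart AA 1" and s: "snd p \<in> hpart L 0" "snd q \<in> hpart L 1"
    using pq(1,2) by auto
  have sI: "snd p \<in> I \<and> snd q \<in> I"
    by (rule L.superideal_graded[OF superideal_I s]) (use pq(3) in \<open>simp add: J_iff\<close>)
  then have n: "snd p \<in> nspan" "snd q \<in> nspan" by (simp_all add: I_eq_nspan)
  note c = nspan_carrier[OF n(1)] nspan_carrier[OF n(2)]
  have h: "\<ominus>\<^bsub>AA\<^esub> F (snd p) \<in> hpart AA 0" "\<ominus>\<^bsub>AA\<^esub> F (snd q) \<in> hpart AA 1"
    using F_hpart[OF n(1) s(1)] F_hpart[OF n(2) s(2)] AA.hpart_closed(3) by blast+
  have "fst p = \<ominus>\<^bsub>AA\<^esub> F (snd p) \<and> fst q = \<ominus>\<^bsub>AA\<^esub> F (snd q)"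
  proof (rule AA.hpart_split_unique[where i = 0])
    show "fst p \<oplus>\<^bsub>AA\<^esub> fst q = \<ominus>\<^bsub>AA\<^esub> F (snd p) \<oplus>\<^bsub>AA\<^esub> \<ominus>\<^bsub>AA\<^esub> F (snd q)"
      using pq(3) F_linear(1)[OF c(1)] F_linear(1)[OF c(2)] by (simp add: J_iff F_linear(2)[OF c] AA.M.minus_add)
  qed (use f h in simp_all)
  with sI show "p \<in> J \<and> q \<in> J" by (simp add: J_iff)
qed

text \<open>One inclusion is a check on the four kinds of relations. For the other,
  \<open>K_span\<close> provides a representative x + d that \<open>\<Phi>\<close> maps to (x, d),
  and \<open>J\<close> contains no nonzero pair with d in the span of \<open>IrrR\<close>. This
  settles linear independence in E.\<close>

lemma IdS_iff:
  assumes "k \<in> carrier KK"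
  shows "k \<in> K.IdS \<longleftrightarrow> \<Phi> k \<in> J"
proof -
  have J0: "(\<zero>\<^bsub>AA\<^esub>, 0) \<in> J" using PP.superidealD(2)[OF superideal_J] by simp
  have "K.IdS \<subseteq> {k \<in> carrier KK. \<Phi> k \<in> J}"
  proof (rule K.Fr.genideal_super_least[OF K.Fr.superideal_vimage[OF PP.superalgebra_axioms \<Phi>_gen(1) superideal_J]], rule subsetI)
    fix k assume k: "k \<in> rels"
    then have kc: "k \<in> carrier KK" using K.relations by blast
    consider (aa) a a' where "k = kmul (gen (Inl a)) (gen (Inl a'))" "a \<in> A" "a' \<in> A"
      | (ab) a b where "k = kmul (gen (Inl a)) (gen (Inr b)) - br (ra a (gen b))" "a \<in> A" "b \<in> B"
      | (na) \<nu> a where "k = kmul (em (wmono \<nu>)) (gen (Inl a)) - br (la (wmono \<nu>) a)" "a \<in> A" "\<nu> \<in> NF B"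
      | (f) f where "k = em f - br (fl f)" "f \<in> R"
      using k unfolding rels_eq by blast
    then have "\<Phi> k \<in> J"
    proof cases
      case (aa a a')
      note x = aa
      show "\<Phi> k \<in> J" unfolding x(1) \<Phi>_linear(5)[OF K_elems(1)[OF x(2)] K_elems(1)[OF x(3)]]
        using J0 P.act_zero(2,4)[OF A_in] x(2,3) by (simp add: \<Phi>_gen)
    next
      case (ab a b)
      note x = ab
      have r: "ra a (gen b) \<in> carrier AA" by (rule P.ract_closed[OF gen_carrier[OF x(3)] A_in[OF x(2)]])
      show "\<Phi> k \<in> J" unfolding x(1) \<Phi>_linear(4)[OF K_closed(4)[OF K_elems(1)[OF x(2)] K_elems(2)[OF x(3)]] K_elems(4)[OF r]]
          \<Phi>_linear(5)[OF K_elems(1)[OF x(2)] K_elems(2)[OF x(3)]] \<Phi>_br[OF r] \<Phi>_gen(2)[OF x(2)] \<Phi>_gen(3)[OF x(3)]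
        using J0 P.act_zero(2)[of "\<zero>\<^bsub>AA\<^esub>"] r by (simp add: AA.M.minus_eq AA.M.r_neg)
    next
      case (na \<nu> a)
      note x = na
      note w = wmono_carrier[OF x(3)]
      have r: "la (wmono \<nu>) a \<in> carrier AA" by (rule P.lact_closed[OF w A_in[OF x(2)]])
      show "\<Phi> k \<in> J" unfolding x(1) \<Phi>_linear(4)[OF K_closed(4)[OF K_elems(3)[OF w] K_elems(1)[OF x(2)]] K_elems(4)[OF r]]
          \<Phi>_linear(5)[OF K_elems(3)[OF w] K_elems(1)[OF x(2)]] \<Phi>_br[OF r] \<Phi>_gen(2)[OF x(2)] \<Phi>_em[OF w]
        using J0 P.act_zero(4)[of "\<zero>\<^bsub>AA\<^esub>"] r by (simp add: AA.M.minus_eq AA.M.r_neg)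
    next
      case (f f)
      note x = f
      note c = R_props(4)[OF x(2)] and r = fl_carrier[OF x(2)]
      show "\<Phi> k \<in> J" unfolding x(1) \<Phi>_linear(4)[OF K_elems(3)[OF c] K_elems(4)[OF r]] \<Phi>_br[OF r] \<Phi>_em[OF c]
        using Q.IdS_closed(7)[OF x(2)] F(2)[OF x(2), of "[]"] r by (simp add: J_iff AA.M.minus_eq)
    qed
    with kc show "k \<in> {k \<in> carrier KK. \<Phi> k \<in> J}" by simp
  qed
  then have sub: "l \<in> K.IdS \<Longrightarrow> \<Phi> l \<in> J" for l by blast
  moreover have "k \<in> K.IdS" if J: "\<Phi> k \<in> J"
  proof -
    obtain x d where xd: "x \<in> carrier AA" "supp d \<subseteq> IrrR" "k - (br x + em d) \<in> K.IdS"
      using K_span[OF assms] .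
    have dc: "d \<in> carrier L" using xd(2) Irr_iff by auto
    let ?l = "br x + em d"
    have lc: "?l \<in> carrier KK" by (rule K_closed(1)[OF K_elems(4)[OF xd(1)] K_elems(3)[OF dc]])
    have \<Phi>l: "\<Phi> ?l = (x, d)"
      unfolding \<Phi>_linear(2)[OF K_elems(4)[OF xd(1)] K_elems(3)[OF dc]] \<Phi>_br[OF xd(1)] \<Phi>_em[OF dc] using xd(1) by simp
    have kl: "?l = k - (k - ?l)" by simp
    have m: "k - ?l \<in> carrier KK" by (rule K_closed(2)[OF assms lc])
    \<comment> \<open>The representative differs from k by an element of the ideal, so the inclusion
      already proved puts its image into \<open>J\<close> as well.\<close>
    have "\<Phi> k \<ominus>\<^bsub>PP\<^esub> \<Phi> (k - ?l) \<in> J" by (rule PP.superidealD(6)[OF superideal_J J sub[OF xd(3)]])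
    moreover have "\<Phi> k \<ominus>\<^bsub>PP\<^esub> \<Phi> (k - ?l) = \<Phi> ?l"
      using linear_maps_group(3)[OF K.Fr.superspace_axioms PP.superspace_axioms superalg_homD(1)[OF \<Phi>_gen(1)] assms m] Lbs_minus[OF assms m] kl by simp
    ultimately have "(x, d) \<in> J" using \<Phi>l by simp
    then have "d \<in> nspan" "x = \<ominus>\<^bsub>AA\<^esub> F d" by (simp_all add: J_iff I_eq_nspan)
    with Irr_nspan_disjoint[OF xd(2)] have "d = 0" "x = \<zero>\<^bsub>AA\<^esub>" by (simp_all add: F_linear uminus_zero)
    with xd(3) show ?thesis by (simp add: AA.brace_linear emb_linear)
  qed
  ultimately show ?thesis by blast
qed

end

section \<open>Unique normal forms modulo the ideal generated by R\<close>

lemma (in reduced_gs) Irr_carrier: "supp d \<subseteq> IrrR \<Longrightarrow> d \<in> carrier L"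
  using Irr_iff by auto

lemma (in reduced_gs) presentation_R: "presentation B0 B1 R"
  by (rule presentation.intro[OF R_carrier])

lemma (in reduced_gs) irr_space_iso: "linear_iso (irr_space B0 B1 R) (Lbs_rel B0 B1 R) cl"
proof -
  interpret Q: presentation B0 B1 R by (rule presentation_R)
  have lin: "cl \<in> linear_maps (irr_space B0 B1 R) Q.Pr"
    unfolding linear_maps_def irr_space_def
    using Q.pr_linear(1,2,4)[OF Irr_carrier] Irr_carrier by (simp add: Q.pr_linear del: Lbs_simps(1))
  have "bij_betw cl {d. supp d \<subseteq> IrrR} (carrier Q.Pr)"
    unfolding bij_betw_def
  proof
    show "inj_on cl {d. supp d \<subseteq> IrrR}"
    proof (rule inj_onI)
      fix d e assume de: "d \<in> {d. supp d \<subseteq> IrrR}" "e \<in> {d. supp d \<subseteq> IrrR}" "cl d = cl e"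
      then have k: "supp d \<subseteq> IrrR" "supp e \<subseteq> IrrR" by auto
      have "d - e \<in> nspan" using Q.pr_eq_iff[OF Irr_carrier[OF k(1)] Irr_carrier[OF k(2)]] de(3) by (simp add: I_eq_nspan)
      then have "d - e = 0" by (rule Irr_nspan_disjoint[OF keys_subset_closed(4)[OF k]])
      then show "d = e" by simp
    qed
    show "cl ` {d. supp d \<subseteq> IrrR} = carrier Q.Pr"
    proof
      show "cl ` {d. supp d \<subseteq> IrrR} \<subseteq> carrier Q.Pr" using Q.pr_linear(4) Irr_carrier by blast
      show "carrier Q.Pr \<subseteq> cl ` {d. supp d \<subseteq> IrrR}"
      proof
        fix Y assume "Y \<in> carrier Q.Pr"
        then obtain f where f: "f \<in> carrier L" "Y = cl f" unfolding Q.pr_image by blast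
        obtain d h where dh: "supp d \<subseteq> IrrR" "h \<in> nspan" "f = d + h" using Irr_nspan_decomp[OF f(1)] .
        have "cl f = cl d" using Q.pr_eq_iff[OF f(1) Irr_carrier[OF dh(1)]] dh(2,3) by (simp add: I_eq_nspan)
        then show "Y \<in> cl ` {d. supp d \<subseteq> IrrR}" using f dh by blast
      qed
    qed
  qed
  with lin show ?thesis by (simp add: linear_iso_def irr_space_def)
qed

text \<open>Any such d is the component in the direct sum decomposition of \<open>L\<close>, because
  an expression always has its value in the ideal; then uniqueness of expressions applies to f -
  d.\<close>

lemma (in reduced_gs) normal_form_unique:
  assumes "f \<in> carrier L"
  shows "\<exists>!(d, es). d \<in> carrier (irr_space B0 B1 R) \<and> is_nexpr B0 B1 R (f - d) es"
proof -
  obtain d h where dh: "supp d \<subseteq> IrrR" "h \<in> nspan" "f = d + h" using Irr_nspan_decomp[OF assms] .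
  obtain es where es: "nvalid es" "h = nval es" using nvalid_exists[of h] dh(2) by (auto simp: I_eq_nspan)
  show ?thesis
  proof (rule ex1I[of _ "(d, es)"])
    show "case (d, es) of (d, es) \<Rightarrow> d \<in> carrier (irr_space B0 B1 R) \<and> is_nexpr B0 B1 R (f - d) es"
      using dh es by (simp add: irr_space_def is_nexpr_iff)
    fix p assume p: "case p of (d, es) \<Rightarrow> d \<in> carrier (irr_space B0 B1 R) \<and> is_nexpr B0 B1 R (f - d) es"
    obtain d' es' where pp: "p = (d', es')" by (cases p)
    then have d': "supp d' \<subseteq> IrrR" and es': "nvalid es'" "f - d' = nval es'"
      using p by (simp_all add: irr_space_def is_nexpr_iff)
    have "f - d' \<in> nspan" using nval_in_I[OF es'(1)] es'(2) by (simp add: I_eq_nspan)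
    then have "(f - d') - h \<in> nspan" using dh(2) by (rule nspan_closed(4))
    then have "d - d' \<in> nspan" using dh(3) by simp
    then have "d - d' = 0" by (rule Irr_nspan_disjoint[OF keys_subset_closed(4)[OF dh(1) d']])
    then have "d = d'" by simp
    moreover from this have "es = es'" using nvalid_unique[OF es(1) es'(1)] es(2) es'(2) dh(3) by simp
    ultimately show "p = (d, es)" using pp by simp
  qed
qed

section \<open>Vector space, product and exact sequence of the presented algebra\<close>

context ext_setup
begin

lemma ext_superalgebra_eq: "ext_superalgebra AA A0 A1 B0 B1 R lact ract fl = K.Pr"
  by (simp add: ext_superalgebra_def)

lemma ext_elem_eq: "ext_elem AA A0 A1 B0 B1 R lact ract fl p = K.pr (br (fst p) + em (snd p))"
  by (simp add: ext_elem_def)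

lemma em_br_carrier: "x \<in> carrier AA \<Longrightarrow> f \<in> carrier L \<Longrightarrow> br x + em f \<in> carrier KK"
  by (rule K_closed(1)[OF K_elems(4) K_elems(3)])

lemma \<Phi>_em_br:
  assumes "x \<in> carrier AA" "f \<in> carrier L"
  shows "\<Phi> (br x + em f) = (x, f)"
  unfolding \<Phi>_linear(2)[OF K_elems(4)[OF assms(1)] K_elems(3)[OF assms(2)]] \<Phi>_br[OF assms(1)] \<Phi>_em[OF assms(2)]
  using assms(1) by simp

text \<open>The kernel criterion in usable form: in the quotient a summand h of the second entry may
  be moved to the first entry as \<open>F h\<close>.\<close>

lemma K_pr_eqI:
  assumes "k \<in> carrier KK" "l \<in> carrier KK" "snd (\<Phi> k) - snd (\<Phi> l) = h" "h \<in> I"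
    "fst (\<Phi> k) \<oplus>\<^bsub>AA\<^esub> F h = fst (\<Phi> l)"
  shows "K.pr k = K.pr l"
proof -
  have c: "fst (\<Phi> k) \<in> carrier AA" "F h \<in> carrier AA"
    using \<Phi>_linear(1)[OF assms(1)] F_linear(1)[OF I_carrier[OF assms(4)]] by auto
  have "fst (\<Phi> k) \<ominus>\<^bsub>AA\<^esub> fst (\<Phi> l) = \<ominus>\<^bsub>AA\<^esub> F h"
    unfolding assms(5)[symmetric] using c by (simp add: AA.M.minus_eq AA.M.minus_add AA.M.r_neg2 AA.M.r_neg1)
  then have "\<Phi> (k - l) \<in> J" using assms by (simp add: \<Phi>_linear(4)[OF assms(1,2)] J_iff)
  then show ?thesis using K.pr_eq_iff[OF assms(1,2)] IdS_iff[OF K_closed(2)[OF assms(1,2)]] by simp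
qed

text \<open>Surjectivity is \<open>K_span\<close>. For injectivity, a difference in \<open>J\<close>
  has its second entry both in the ideal and in the span of \<open>IrrR\<close>, hence zero; its
  first entry is then minus \<open>F 0\<close>, which is zero.\<close>

lemma dsum_iso:
  "linear_iso (dsum AA (irr_space B0 B1 R)) (ext_superalgebra AA A0 A1 B0 B1 R lact ract fl)
    (ext_elem AA A0 A1 B0 B1 R lact ract fl)"
proof -
  let ?e = "ext_elem AA A0 A1 B0 B1 R lact ract fl" and ?D = "dsum AA (irr_space B0 B1 R)"
  have car: "carrier ?D = carrier AA \<times> {d. supp d \<subseteq> IrrR}" by (simp add: dsum_def irr_space_def)
  have mem: "fst p \<in> carrier AA" "snd p \<in> carrier L" "supp (snd p) \<subseteq> IrrR" if "p \<in> carrier ?D" for p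
    using that Irr_carrier[of "snd p"] unfolding car by auto
  have "?e \<in> linear_maps ?D K.Pr"
    unfolding linear_maps_def mem_Collect_eq
  proof (intro conjI ballI allI funcsetI)
    fix p assume p: "p \<in> carrier ?D"
    note m = em_br_carrier[OF mem(1,2)[OF p]]
    show "?e p \<in> carrier K.Pr" unfolding ext_elem_eq by (rule K.pr_linear(4)[OF m])
    fix c
    have "br (c \<odot>\<^bsub>AA\<^esub> fst p) + em (pscale c (snd p)) = pscale c (br (fst p) + em (snd p))"
      unfolding AA.brace_linear(2)[OF mem(1)[OF p]] by (simp add: emb_linear pscale_distrib)
    then show "?e (c \<odot>\<^bsub>?D\<^esub> p) = c \<odot>\<^bsub>K.Pr\<^esub> ?e p"
      using K.pr_linear(2)[OF m, of c] by (simp add: ext_elem_eq dsum_def irr_space_def)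
  next
    fix p q assume p: "p \<in> carrier ?D" and q: "q \<in> carrier ?D"
    have "br (fst p \<oplus>\<^bsub>AA\<^esub> fst q) + em (snd p + snd q) = (br (fst p) + em (snd p)) + (br (fst q) + em (snd q))"
      unfolding AA.brace_linear(1)[OF mem(1)[OF p] mem(1)[OF q]] by (simp add: emb_linear)
    then show "?e (p \<oplus>\<^bsub>?D\<^esub> q) = ?e p \<oplus>\<^bsub>K.Pr\<^esub> ?e q"
      using K.pr_linear(1)[OF em_br_carrier[OF mem(1,2)[OF p]] em_br_carrier[OF mem(1,2)[OF q]]]
      by (simp add: ext_elem_eq dsum_def irr_space_def)
  qed
  moreover have "bij_betw ?e (carrier ?D) (carrier K.Pr)"
    unfolding bij_betw_def
  proof
    show "inj_on ?e (carrier ?D)"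
    proof (rule inj_onI)
      fix p q assume p: "p \<in> carrier ?D" and q: "q \<in> carrier ?D" and eq: "?e p = ?e q"
      note mp = em_br_carrier[OF mem(1,2)[OF p]] and mq = em_br_carrier[OF mem(1,2)[OF q]]
      have "\<Phi> ((br (fst p) + em (snd p)) - (br (fst q) + em (snd q))) \<in> J"
        using eq K.pr_eq_iff[OF mp mq] IdS_iff[OF K_closed(2)[OF mp mq]] by (simp add: ext_elem_eq)
      then have J: "snd p - snd q \<in> I" "fst p \<ominus>\<^bsub>AA\<^esub> fst q = \<ominus>\<^bsub>AA\<^esub> F (snd p - snd q)"
        unfolding \<Phi>_linear(4)[OF mp mq] \<Phi>_em_br[OF mem(1,2)[OF p]] \<Phi>_em_br[OF mem(1,2)[OF q]] by (simp_all add: J_iff)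
      have "snd p - snd q = 0"
        using J(1) Irr_nspan_disjoint[OF keys_subset_closed(4)[OF mem(3)[OF p] mem(3)[OF q]]] by (simp add: I_eq_nspan)
      moreover from this J(2) have "fst p = fst q"
        using AA.M.minus_zero_iff[OF mem(1)[OF p] mem(1)[OF q]] by (simp add: F_linear uminus_zero)
      ultimately show "p = q" by (simp add: prod_eq_iff)
    qed
    show "?e ` carrier ?D = carrier K.Pr"
    proof
      show "?e ` carrier ?D \<subseteq> carrier K.Pr"
        using K.pr_linear(4)[OF em_br_carrier[OF mem(1,2)]] unfolding ext_elem_eq by blast
      show "carrier K.Pr \<subseteq> ?e ` carrier ?D"
      proof
        fix Y assume "Y \<in> carrier K.Pr"
        then obtain k where k: "k \<in> carrier KK" "Y = K.pr k" unfolding K.pr_image by blast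
        obtain x d where xd: "x \<in> carrier AA" "supp d \<subseteq> IrrR" "k - (br x + em d) \<in> K.IdS"
          using K_span[OF k(1)] .
        have "Y = ?e (x, d)"
          using K.pr_eq_iff[OF k(1) em_br_carrier[OF xd(1) Irr_carrier[OF xd(2)]]] k(2) xd(3) by (simp add: ext_elem_eq)
        moreover have "(x, d) \<in> carrier ?D" unfolding car using xd by simp
        ultimately show "Y \<in> ?e ` carrier ?D" by blast
      qed
    qed
  qed
  ultimately show ?thesis by (simp add: linear_iso_def ext_superalgebra_eq)
qed

text \<open>The product is computed in the split extension, where its second entry is the product of
  the two words. Subtracting d leaves an element of the ideal, which moves to the first entry
  through \<open>F\<close>; \<open>F_nval\<close> evaluates it along the given expression.\<close>

lemma ext_product:
  assumes \<nu>: "\<nu> \<in> IrrR" "\<nu>' \<in> IrrR" and d: "d \<in> carrier (irr_space B0 B1 R)"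
    and es: "is_nexpr B0 B1 R (mul (wmono \<nu>) (wmono \<nu>') - d) es" and a: "a \<in> A" "a' \<in> A"
  shows "ext_elem AA A0 A1 B0 B1 R lact ract fl (a, wmono \<nu>)
      \<otimes>\<^bsub>ext_superalgebra AA A0 A1 B0 B1 R lact ract fl\<^esub> ext_elem AA A0 A1 B0 B1 R lact ract fl (a', wmono \<nu>') =
    ext_elem AA A0 A1 B0 B1 R lact ract fl
      (ract a (cl (wmono \<nu>')) \<oplus>\<^bsub>AA\<^esub> lact (cl (wmono \<nu>)) a' \<oplus>\<^bsub>AA\<^esub> nexpr_floor AA B0 B1 R ract fl es, d)"
proof -
  have w: "wmono \<nu> \<in> carrier L" "wmono \<nu>' \<in> carrier L" using \<nu> Irr_iff wmono_carrier by blast+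
  note ac = A_in[OF a(1)] A_in[OF a(2)]
  have v: "nvalid es" "mul (wmono \<nu>) (wmono \<nu>') - d = nval es" using es by (simp_all add: is_nexpr_iff)
  let ?h = "mul (wmono \<nu>) (wmono \<nu>') - d"
  have hI: "?h \<in> I" using nval_in_I[OF v(1)] v(2) by simp
  have dc: "d \<in> carrier L" using d Irr_carrier by (simp add: irr_space_def del: Lbs_simps)
  have fl: "nexpr_floor AA B0 B1 R ract fl es = F ?h" using F_nval[OF v(1)] v(2) by simp
  have rc: "ra a (wmono \<nu>') \<in> carrier AA" "la (wmono \<nu>) a' \<in> carrier AA" "F ?h \<in> carrier AA"
    using P.ract_closed[OF w(2) ac(1)] P.lact_closed[OF w(1) ac(2)] F_linear(1)[OF I_carrier[OF hI]] .
  let ?x = "ra a (wmono \<nu>') \<oplus>\<^bsub>AA\<^esub> la (wmono \<nu>) a' \<oplus>\<^bsub>AA\<^esub> F ?h"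
  have xc: "?x \<in> carrier AA" using rc by simp
  note m = em_br_carrier[OF ac(1) w(1)] em_br_carrier[OF ac(2) w(2)]
  have "K.pr (kmul (br a + em (wmono \<nu>)) (br a' + em (wmono \<nu>'))) = K.pr (br ?x + em d)"
  proof (rule K_pr_eqI[OF K_closed(4)[OF m] em_br_carrier[OF xc dc] _ hI])
    show "snd (\<Phi> (kmul (br a + em (wmono \<nu>)) (br a' + em (wmono \<nu>')))) - snd (\<Phi> (br ?x + em d)) = ?h"
      unfolding \<Phi>_linear(5)[OF m] \<Phi>_em_br[OF ac(1) w(1)] \<Phi>_em_br[OF ac(2) w(2)] \<Phi>_em_br[OF xc dc] by simp
    show "fst (\<Phi> (kmul (br a + em (wmono \<nu>)) (br a' + em (wmono \<nu>')))) \<oplus>\<^bsub>AA\<^esub> F ?h = fst (\<Phi> (br ?x + em d))"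
      unfolding \<Phi>_linear(5)[OF m] \<Phi>_em_br[OF ac(1) w(1)] \<Phi>_em_br[OF ac(2) w(2)] \<Phi>_em_br[OF xc dc] by simp
  qed
  then show ?thesis
    unfolding ext_elem_eq ext_superalgebra_eq fst_conv snd_conv K.pr_linear(3)[OF m, symmetric] fl la_def ra_def by simp
qed

lemma ext_is_extension:
  assumes "leibniz_superalgebra AA" "abelian_superalgebra AA"
  shows "is_extension (ext_superalgebra AA A0 A1 B0 B1 R lact ract fl) (Lbs_rel B0 B1 R) AA"
proof -
  define \<iota> where "\<iota> x = K.pr (br x)" for x
  interpret Qr: leibniz_superalgebra Q.Pr by (rule Q.leibniz_Pr)
  have J0: "(\<zero>\<^bsub>AA\<^esub>, 0) \<in> J" using PP.superidealD(2)[OF superideal_J] by simp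
  have \<iota>_hom: "\<iota> \<in> superalg_hom AA K.Pr"
    unfolding superalg_hom_def linear_maps_def mem_Collect_eq
  proof (intro conjI ballI allI funcsetI image_subsetI)
    fix x assume x: "x \<in> carrier AA"
    show "\<iota> x \<in> carrier K.Pr" unfolding \<iota>_def by (rule K.pr_linear(4)[OF K_elems(4)[OF x]])
    show "\<iota> (c \<odot>\<^bsub>AA\<^esub> x) = c \<odot>\<^bsub>K.Pr\<^esub> \<iota> x" for c
      unfolding \<iota>_def AA.brace_linear(2)[OF x] by (rule K.pr_linear(2)[OF K_elems(4)[OF x]])
    fix y assume y: "y \<in> carrier AA"
    show "\<iota> (x \<oplus>\<^bsub>AA\<^esub> y) = \<iota> x \<oplus>\<^bsub>K.Pr\<^esub> \<iota> y"
      unfolding \<iota>_def AA.brace_linear(1)[OF x y] by (rule K.pr_linear(1)[OF K_elems(4)[OF x] K_elems(4)[OF y]])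
    \<comment> \<open>Two elements of the module part multiply to zero in the split extension, which
      agrees with the product of the abelian algebra.\<close>
    have "kmul (br x) (br y) \<in> K.IdS"
      unfolding IdS_iff[OF K_closed(4)[OF K_elems(4)[OF x] K_elems(4)[OF y]]] \<Phi>_linear(5)[OF K_elems(4)[OF x] K_elems(4)[OF y]]
        \<Phi>_br[OF x] \<Phi>_br[OF y] using J0 P.act_zero(2)[OF y] P.act_zero(4)[OF x] by simp
    then have "K.pr (kmul (br x) (br y)) = K.pr 0"
      using K.pr_eq_iff[OF K_closed(4)[OF K_elems(4)[OF x] K_elems(4)[OF y]], of 0] by simp
    moreover have "x \<otimes>\<^bsub>AA\<^esub> y = \<zero>\<^bsub>AA\<^esub>" using assms(2) x y by (simp add: abelian_superalgebra_def)
    ultimately show "\<iota> (x \<otimes>\<^bsub>AA\<^esub> y) = \<iota> x \<otimes>\<^bsub>K.Pr\<^esub> \<iota> y"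
      unfolding \<iota>_def K.pr_linear(3)[OF K_elems(4)[OF x] K_elems(4)[OF y], symmetric] by (simp add: AA.brace_linear)
  next
    fix i x assume "x \<in> hpart AA i"
    then show "\<iota> x \<in> hpart K.Pr i" unfolding \<iota>_def by (intro K.pr_linear(5) AA.brace_hpart)
  qed
  have snd_hom: "snd \<in> superalg_hom PP L"
    unfolding superalg_hom_def linear_maps_def mem_Collect_eq
    by (intro conjI ballI allI funcsetI image_subsetI) auto
  \<comment> \<open>The projection onto \<BB> is the class of the second entry; it descends to E
    because second entries of relations lie in \<open>I\<close>.\<close>
  have \<psi>: "cl \<circ> (snd \<circ> \<Phi>) \<in> superalg_hom KK Q.Pr"
    by (rule superalg_hom_comp[OF superalg_hom_comp[OF \<Phi>_gen(1) snd_hom] Q.pr_hom])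
  have ker: "(cl \<circ> (snd \<circ> \<Phi>)) k = \<zero>\<^bsub>Q.Pr\<^esub>" if k: "k \<in> rels" for k
  proof -
    have "snd (\<Phi> k) \<in> I" using IdS_iff[OF subsetD[OF K.relations k]] K.IdS_closed(7)[OF k] by (simp add: J_iff)
    then show ?thesis using Q.pr_zero_iff[OF I_carrier] by simp
  qed
  obtain \<pi> where \<pi>: "\<pi> \<in> superalg_hom K.Pr Q.Pr" "\<And>k. k \<in> carrier KK \<Longrightarrow> \<pi> (K.pr k) = (cl \<circ> (snd \<circ> \<Phi>)) k"
    using K.pr_lift[OF Qr.superalgebra_axioms \<psi> ker] by blast
  have "inj_on \<iota> (carrier AA)"
  proof (rule inj_onI)
    fix x y assume x: "x \<in> carrier AA" and y: "y \<in> carrier AA" and eq: "\<iota> x = \<iota> y"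
    note m = K_elems(4)[OF x] K_elems(4)[OF y]
    have "\<Phi> (br x - br y) \<in> J" using eq K.pr_eq_iff[OF m] IdS_iff[OF K_closed(2)[OF m]] by (simp add: \<iota>_def)
    then have "x \<ominus>\<^bsub>AA\<^esub> y = \<zero>\<^bsub>AA\<^esub>"
      unfolding \<Phi>_linear(4)[OF m] \<Phi>_br[OF x] \<Phi>_br[OF y] by (simp add: J_iff F_linear uminus_zero)
    then show "x = y" using AA.M.minus_zero_iff[OF x y] by simp
  qed
  moreover have "\<iota> ` carrier AA = {Y \<in> carrier K.Pr. \<pi> Y = \<zero>\<^bsub>Q.Pr\<^esub>}"
  proof
    show "\<iota> ` carrier AA \<subseteq> {Y \<in> carrier K.Pr. \<pi> Y = \<zero>\<^bsub>Q.Pr\<^esub>}"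
    proof (rule image_subsetI)
      fix x assume x: "x \<in> carrier AA"
      have "cl 0 = \<zero>\<^bsub>Q.Pr\<^esub>" using Q.pr_zero_iff[of 0] Q.IdS_closed(1) by simp
      then have "\<pi> (\<iota> x) = \<zero>\<^bsub>Q.Pr\<^esub>" unfolding \<iota>_def \<pi>(2)[OF K_elems(4)[OF x]] by (simp add: \<Phi>_br[OF x])
      then show "\<iota> x \<in> {Y \<in> carrier K.Pr. \<pi> Y = \<zero>\<^bsub>Q.Pr\<^esub>}" using superalg_homD(2)[OF \<iota>_hom x] by simp
    qed
    show "{Y \<in> carrier K.Pr. \<pi> Y = \<zero>\<^bsub>Q.Pr\<^esub>} \<subseteq> \<iota> ` carrier AA"
    proof
      fix Y assume Y: "Y \<in> {Y \<in> carrier K.Pr. \<pi> Y = \<zero>\<^bsub>Q.Pr\<^esub>}"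
      then obtain k where k: "k \<in> carrier KK" "Y = K.pr k" unfolding K.pr_image by blast
      obtain y h where yh: "\<Phi> k = (y, h)" by (cases "\<Phi> k")
      have c: "y \<in> carrier AA" "h \<in> carrier L" using \<Phi>_linear(1)[OF k(1)] yh by auto
      have "cl h = \<zero>\<^bsub>Q.Pr\<^esub>" using Y \<pi>(2)[OF k(1)] k(2) yh by simp
      then have hI: "h \<in> I" using Q.pr_zero_iff[OF c(2)] by simp
      have x: "y \<oplus>\<^bsub>AA\<^esub> F h \<in> carrier AA" using c(1) F_linear(1)[OF c(2)] by simp
      \<comment> \<open>Modulo \<open>J\<close> the pair (y, h) with h in \<open>I\<close> equals (y
        + F h, 0), so an element of the kernel comes from A.\<close>
      have "K.pr k = K.pr (br (y \<oplus>\<^bsub>AA\<^esub> F h))"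
        by (rule K_pr_eqI[OF k(1) K_elems(4)[OF x] _ hI]) (simp_all add: \<Phi>_br[OF x] yh)
      then show "Y \<in> \<iota> ` carrier AA" using x k(2) unfolding \<iota>_def by blast
    qed
  qed
  moreover have "\<pi> ` carrier K.Pr = carrier Q.Pr"
  proof
    show "\<pi> ` carrier K.Pr \<subseteq> carrier Q.Pr" using superalg_homD(2)[OF \<pi>(1)] by blast
    show "carrier Q.Pr \<subseteq> \<pi> ` carrier K.Pr"
    proof
      fix Y assume "Y \<in> carrier Q.Pr"
      then obtain f where f: "f \<in> carrier L" "Y = cl f" unfolding Q.pr_image by blast
      have "Y = \<pi> (K.pr (em f))" unfolding \<pi>(2)[OF K_elems(3)[OF f(1)]] by (simp add: \<Phi>_em[OF f(1)] f(2))
      then show "Y \<in> \<pi> ` carrier K.Pr" using K.pr_linear(4)[OF K_elems(3)[OF f(1)]] by blast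
    qed
  qed
  ultimately show ?thesis unfolding is_extension_def ext_superalgebra_eq
    using assms(1) K.leibniz_Pr Q.leibniz_Pr \<iota>_hom \<pi>(1) by blast
qed

end

section \<open>The data of a given extension\<close>

lemma (in superalgebra) prod_zero:
  "x \<in> carrier V \<Longrightarrow> x \<otimes>\<^bsub>V\<^esub> \<zero>\<^bsub>V\<^esub> = \<zero>\<^bsub>V\<^esub>" "x \<in> carrier V \<Longrightarrow> \<zero>\<^bsub>V\<^esub> \<otimes>\<^bsub>V\<^esub> x = \<zero>\<^bsub>V\<^esub>"
  using superidealD(7,8)[OF superideal_zero, of "\<zero>\<^bsub>V\<^esub>" x] by simp_all

locale given_extension = reduced_gs B0 B1 R + AA: super_basis AA A0 A1
  for B0 B1 :: "'b::wellorder set" and R :: "('b list \<Rightarrow>\<^sub>0 'k::field) set"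
    and AA :: "('k, 'a) superalgebra" and A0 A1 :: "'a set" +
  fixes EE :: "('k, 'e) superalgebra" and \<iota> :: "'a \<Rightarrow> 'e" and \<pi> :: "'e \<Rightarrow> ('b list \<Rightarrow>\<^sub>0 'k) set"
  assumes leibniz_AA: "leibniz_superalgebra AA" and abelian: "abelian_superalgebra AA"
    and leibniz_EE: "leibniz_superalgebra EE"
    and \<iota>: "\<iota> \<in> superalg_hom AA EE" and \<pi>: "\<pi> \<in> superalg_hom EE (Lbs_rel B0 B1 R)"
    and inj: "inj_on \<iota> (carrier AA)"
    and exact: "\<iota> ` carrier AA = {x \<in> carrier EE. \<pi> x = \<zero>\<^bsub>Lbs_rel B0 B1 R\<^esub>}"
    and surj: "\<pi> ` carrier EE = carrier (Lbs_rel B0 B1 R)"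
begin

sublocale Q: presentation B0 B1 R by (rule presentation_R)
sublocale Qr: leibniz_superalgebra Q.Pr by (rule Q.leibniz_Pr)
sublocale E: leibniz_superalgebra EE by (rule leibniz_EE)

lemmas i_hom = superalg_homD[OF \<iota>]
lemmas p_hom = superalg_homD[OF \<pi>]
lemmas i_grp = linear_maps_group[OF AA.superspace_axioms E.superspace_axioms i_hom(1)]
lemmas p_grp = linear_maps_group[OF E.superspace_axioms Qr.superspace_axioms p_hom(1)]

lemma i_inj: "x \<in> carrier AA \<Longrightarrow> y \<in> carrier AA \<Longrightarrow> \<iota> x = \<iota> y \<Longrightarrow> x = y"
  using inj by (simp add: inj_on_def)

lemma p_i: "x \<in> carrier AA \<Longrightarrow> \<pi> (\<iota> x) = \<zero>\<^bsub>Q.Pr\<^esub>"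
  using exact by blast

section \<open>The actions induced by multiplication in the given extension\<close>

definition j :: "'e \<Rightarrow> 'a" where "j = inv_into (carrier AA) \<iota>"

lemma j:
  assumes "e \<in> carrier EE" "\<pi> e = \<zero>\<^bsub>Q.Pr\<^esub>"
  shows "j e \<in> carrier AA" "\<iota> (j e) = e"
proof -
  have "e \<in> \<iota> ` carrier AA" using assms exact by blast
  then show "j e \<in> carrier AA" "\<iota> (j e) = e"
    unfolding j_def by (rule inv_into_into, rule f_inv_into_f)
qed

lemma i_prod: "x \<in> carrier AA \<Longrightarrow> y \<in> carrier AA \<Longrightarrow> \<iota> x \<otimes>\<^bsub>EE\<^esub> \<iota> y = \<zero>\<^bsub>EE\<^esub>"
  using i_hom(5)[of x y] abelian i_grp(1) by (simp add: abelian_superalgebra_def)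

text \<open>The component of the wrong parity is killed by injectivity, so parity can be tested in
  the extension.\<close>

lemma i_hpart:
  assumes x: "x \<in> carrier AA" and "\<iota> x \<in> hpart EE i"
  shows "x \<in> hpart AA i"
proof -
  obtain u v where uv: "u \<in> hpart AA i" "v \<in> hpart AA (i + 1)" "x = u \<oplus>\<^bsub>AA\<^esub> v" using AA.hpart_split[OF x] .
  note c = AA.hpart_subset[OF uv(1)] AA.hpart_subset[OF uv(2)]
  have "\<iota> v = \<zero>\<^bsub>EE\<^esub>"
    by (rule E.hpart_sum_mem[OF i_hom(6)[OF uv(1)] i_hom(6)[OF uv(2)]]) (use assms(2) uv(3) i_hom(3)[OF c] in simp)
  then have "v = \<zero>\<^bsub>AA\<^esub>" using i_inj[OF c(2)] i_grp(1) by simp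
  then show ?thesis using uv c by simp
qed

lemma p_lift:
  assumes "Y \<in> carrier Q.Pr"
  obtains e where "e \<in> carrier EE" "Y = \<pi> e"
proof -
  have "Y \<in> \<pi> ` carrier EE" unfolding surj by (rule assms)
  then show thesis by (elim imageE) (rule that)
qed

text \<open>Of an arbitrary preimage only the component of the right parity is kept; the other one
  is mapped to zero.\<close>

lemma p_hpart_lift:
  assumes "Y \<in> hpart Q.Pr i"
  obtains e where "e \<in> hpart EE i" "\<pi> e = Y"
proof -
  have "Y \<in> carrier Q.Pr" using assms by (rule Qr.hpart_subset)
  then obtain e where e: "e \<in> carrier EE" "Y = \<pi> e" by (rule p_lift)
  obtain u v where uv: "u \<in> hpart EE i" "v \<in> hpart EE (i + 1)" "e = u \<oplus>\<^bsub>EE\<^esub> v" using E.hpart_split[OF e(1)] .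
  note c = E.hpart_subset[OF uv(1)] E.hpart_subset[OF uv(2)]
  have eq: "Y = \<pi> u \<oplus>\<^bsub>Q.Pr\<^esub> \<pi> v" using p_hom(3)[OF c] e(2) uv(3) by simp
  have "\<pi> v = \<zero>\<^bsub>Q.Pr\<^esub>"
    by (rule Qr.hpart_sum_mem[OF p_hom(6)[OF uv(1)] p_hom(6)[OF uv(2)]]) (use assms eq in simp)
  then have "\<pi> u = Y" using eq p_hom(2)[OF c(1)] by simp
  with uv(1) that show thesis by blast
qed

text \<open>Only a set-theoretic section. Linearity and parity of the actions are recovered by
  substituting preimages adapted to each axiom.\<close>

definition sec :: "('b list \<Rightarrow>\<^sub>0 'k) set \<Rightarrow> 'e" where "sec Y = inv_into (carrier EE) \<pi> Y"
definition lact :: "('b list \<Rightarrow>\<^sub>0 'k) set \<Rightarrow> 'a \<Rightarrow> 'a" where "lact Y x = j (sec Y \<otimes>\<^bsub>EE\<^esub> \<iota> x)"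
definition ract :: "'a \<Rightarrow> ('b list \<Rightarrow>\<^sub>0 'k) set \<Rightarrow> 'a" where "ract x Y = j (\<iota> x \<otimes>\<^bsub>EE\<^esub> sec Y)"

text \<open>The actions do not depend on the choice of preimages, since \<open>\<AA>\<close> is abelian.\<close>

lemma act:
  assumes e: "e \<in> carrier EE" and x: "x \<in> carrier AA"
  shows "lact (\<pi> e) x \<in> carrier AA" "\<iota> (lact (\<pi> e) x) = e \<otimes>\<^bsub>EE\<^esub> \<iota> x"
    "ract x (\<pi> e) \<in> carrier AA" "\<iota> (ract x (\<pi> e)) = \<iota> x \<otimes>\<^bsub>EE\<^esub> e"
proof -
  let ?s = "sec (\<pi> e)"
  have "\<pi> e \<in> \<pi> ` carrier EE" using e by blast
  then have s: "?s \<in> carrier EE" "\<pi> ?s = \<pi> e"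
    unfolding sec_def by (rule inv_into_into, rule f_inv_into_f)
  note ix = i_hom(2)[OF x]
  have "\<pi> (e \<ominus>\<^bsub>EE\<^esub> ?s) = \<zero>\<^bsub>Q.Pr\<^esub>"
    using p_grp(3)[OF e s(1)] s(2) p_hom(2)[OF e] by (simp add: Qr.M.minus_eq Qr.M.r_neg)
  then obtain y where y: "y \<in> carrier AA" "\<iota> y = e \<ominus>\<^bsub>EE\<^esub> ?s" using j[of "e \<ominus>\<^bsub>EE\<^esub> ?s"] e s(1) by blast
  then have "\<iota> y \<oplus>\<^bsub>EE\<^esub> ?s = e" using e s(1) by (simp add: E.M.minus_eq E.M.a_assoc E.M.l_neg)
  then have eq: "e \<otimes>\<^bsub>EE\<^esub> \<iota> x = ?s \<otimes>\<^bsub>EE\<^esub> \<iota> x" "\<iota> x \<otimes>\<^bsub>EE\<^esub> e = \<iota> x \<otimes>\<^bsub>EE\<^esub> ?s"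
    using E.prod_add_left[OF i_hom(2)[OF y(1)] s(1) ix] E.prod_add_right[OF ix i_hom(2)[OF y(1)] s(1)]
      i_prod[OF y(1) x] i_prod[OF x y(1)] E.prod_closed[OF s(1) ix] E.prod_closed[OF ix s(1)] by simp_all
  have k: "\<pi> (?s \<otimes>\<^bsub>EE\<^esub> \<iota> x) = \<zero>\<^bsub>Q.Pr\<^esub>" "\<pi> (\<iota> x \<otimes>\<^bsub>EE\<^esub> ?s) = \<zero>\<^bsub>Q.Pr\<^esub>"
    using p_hom(5)[OF s(1) ix] p_hom(5)[OF ix s(1)] p_i[OF x] Qr.prod_zero[OF p_hom(2)[OF s(1)]] by simp_all
  show "lact (\<pi> e) x \<in> carrier AA" "\<iota> (lact (\<pi> e) x) = e \<otimes>\<^bsub>EE\<^esub> \<iota> x"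
    unfolding lact_def eq using j[OF E.prod_closed[OF s(1) ix] k(1)] .
  show "ract x (\<pi> e) \<in> carrier AA" "\<iota> (ract x (\<pi> e)) = \<iota> x \<otimes>\<^bsub>EE\<^esub> e"
    unfolding ract_def eq using j[OF E.prod_closed[OF ix s(1)] k(2)] .
qed

text \<open>Every identity is checked after applying the injective map \<open>\<iota>\<close>, which
  turns the actions into products with freely chosen preimages: sums and multiples of preimages for
  linearity, homogeneous ones for the graded axioms.\<close>

lemma act_supermodule: "supermodule Q.Pr AA lact ract"
proof (intro supermodule.intro supermodule_axioms.intro Q.leibniz_Pr AA.superspace_axioms)
  fix Y x assume Y: "Y \<in> carrier Q.Pr" and x: "x \<in> carrier AA"
  obtain e where e: "e \<in> carrier EE" "Y = \<pi> e" using p_lift[OF Y] .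
  note a = act[OF e(1) x]
  show l: "lact Y x \<in> carrier AA" and r: "ract x Y \<in> carrier AA" using a e(2) by simp_all
  fix c
  have cx: "c \<odot>\<^bsub>AA\<^esub> x \<in> carrier AA" using x by simp
  have ce: "c \<odot>\<^bsub>EE\<^esub> e \<in> carrier EE" using e(1) by simp
  note ix = i_hom(2)[OF x]
  have pc: "c \<odot>\<^bsub>Q.Pr\<^esub> Y = \<pi> (c \<odot>\<^bsub>EE\<^esub> e)" using p_hom(4)[OF e(1)] e(2) by simp
  show "lact (c \<odot>\<^bsub>Q.Pr\<^esub> Y) x = c \<odot>\<^bsub>AA\<^esub> lact Y x"
    unfolding pc unfolding e(2)
    by (rule i_inj[OF act(1)[OF ce x]]) (use a i_hom(4)[OF a(1)] act(2)[OF ce x] E.prod_smult_left[OF e(1) ix] in simp_all)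
  show "lact Y (c \<odot>\<^bsub>AA\<^esub> x) = c \<odot>\<^bsub>AA\<^esub> lact Y x"
    unfolding e(2)
    by (rule i_inj[OF act(1)[OF e(1) cx]]) (use a i_hom(4)[OF a(1)] i_hom(4)[OF x] act(2)[OF e(1) cx] E.prod_smult_right[OF e(1) ix] in simp_all)
  show "ract (c \<odot>\<^bsub>AA\<^esub> x) Y = c \<odot>\<^bsub>AA\<^esub> ract x Y"
    unfolding e(2)
    by (rule i_inj[OF act(3)[OF e(1) cx]]) (use a i_hom(4)[OF a(3)] i_hom(4)[OF x] act(4)[OF e(1) cx] E.prod_smult_left[OF ix e(1)] in simp_all)
  show "ract x (c \<odot>\<^bsub>Q.Pr\<^esub> Y) = c \<odot>\<^bsub>AA\<^esub> ract x Y"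
    unfolding pc unfolding e(2)
    by (rule i_inj[OF act(3)[OF ce x]]) (use a i_hom(4)[OF a(3)] act(4)[OF ce x] E.prod_smult_right[OF ix e(1)] in simp_all)
next
  fix Y Z x assume Y: "Y \<in> carrier Q.Pr" "Z \<in> carrier Q.Pr" and x: "x \<in> carrier AA"
  obtain e where e: "e \<in> carrier EE" "Y = \<pi> e" using p_lift[OF Y(1)] .
  obtain e' where e': "e' \<in> carrier EE" "Z = \<pi> e'" using p_lift[OF Y(2)] .
  note a = act[OF e(1) x] and a' = act[OF e'(1) x] and ix = i_hom(2)[OF x]
  have s: "e \<oplus>\<^bsub>EE\<^esub> e' \<in> carrier EE" using e e' by simp
  have ps: "Y \<oplus>\<^bsub>Q.Pr\<^esub> Z = \<pi> (e \<oplus>\<^bsub>EE\<^esub> e')" using p_hom(3)[OF e(1) e'(1)] e e' by simp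
  show "lact (Y \<oplus>\<^bsub>Q.Pr\<^esub> Z) x = lact Y x \<oplus>\<^bsub>AA\<^esub> lact Z x"
    unfolding ps unfolding e(2) e'(2)
    by (rule i_inj[OF act(1)[OF s x]]) (use a a' i_hom(3)[OF a(1) a'(1)] act(2)[OF s x] E.prod_add_left[OF e(1) e'(1) ix] in simp_all)
  show "ract x (Y \<oplus>\<^bsub>Q.Pr\<^esub> Z) = ract x Y \<oplus>\<^bsub>AA\<^esub> ract x Z"
    unfolding ps unfolding e(2) e'(2)
    by (rule i_inj[OF act(3)[OF s x]]) (use a a' i_hom(3)[OF a(3) a'(3)] act(4)[OF s x] E.prod_add_right[OF ix e(1) e'(1)] in simp_all)
next
  fix Y x y assume Y: "Y \<in> carrier Q.Pr" and x: "x \<in> carrier AA" and y: "y \<in> carrier AA"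
  obtain e where e: "e \<in> carrier EE" "Y = \<pi> e" using p_lift[OF Y] .
  note a = act[OF e(1) x] and a' = act[OF e(1) y] and ix = i_hom(2)[OF x] and iy = i_hom(2)[OF y]
  have s: "x \<oplus>\<^bsub>AA\<^esub> y \<in> carrier AA" using x y by simp
  show "lact Y (x \<oplus>\<^bsub>AA\<^esub> y) = lact Y x \<oplus>\<^bsub>AA\<^esub> lact Y y"
    unfolding e(2)
    by (rule i_inj[OF act(1)[OF e(1) s]]) (use a a' i_hom(3)[OF a(1) a'(1)] i_hom(3)[OF x y] act(2)[OF e(1) s] E.prod_add_right[OF e(1) ix iy] in simp_all)
  show "ract (x \<oplus>\<^bsub>AA\<^esub> y) Y = ract x Y \<oplus>\<^bsub>AA\<^esub> ract y Y"
    unfolding e(2)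
    by (rule i_inj[OF act(3)[OF e(1) s]]) (use a a' i_hom(3)[OF a(3) a'(3)] i_hom(3)[OF x y] act(4)[OF e(1) s] E.prod_add_left[OF ix iy e(1)] in simp_all)
next
  fix Y x i l assume Y: "Y \<in> hpart Q.Pr i" and x: "x \<in> hpart AA l"
  obtain e where e: "e \<in> hpart EE i" "\<pi> e = Y" using p_hpart_lift[OF Y] .
  note a = act[OF E.hpart_subset[OF e(1)] AA.hpart_subset[OF x], unfolded e(2)]
  show "lact Y x \<in> hpart AA (i + l)"
    by (rule i_hpart[OF a(1)]) (simp only: a(2) E.prod_hpart[OF e(1) i_hom(6)[OF x]])
next
  fix Y x i l assume x: "x \<in> hpart AA l" and Y: "Y \<in> hpart Q.Pr i"
  obtain e where e: "e \<in> hpart EE i" "\<pi> e = Y" using p_hpart_lift[OF Y] .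
  note a = act[OF E.hpart_subset[OF e(1)] AA.hpart_subset[OF x], unfolded e(2)]
  show "ract x Y \<in> hpart AA (l + i)"
    by (rule i_hpart[OF a(3)]) (simp only: a(4) E.prod_hpart[OF i_hom(6)[OF x] e(1)])
next
  fix x Y Z l i m assume x: "x \<in> hpart AA l" and Y: "Y \<in> hpart Q.Pr i" and Z: "Z \<in> hpart Q.Pr m"
  obtain e where e: "e \<in> hpart EE i" "\<pi> e = Y" using p_hpart_lift[OF Y] .
  obtain e' where e': "e' \<in> hpart EE m" "\<pi> e' = Z" using p_hpart_lift[OF Z] .
  note xc = AA.hpart_subset[OF x] and ec = E.hpart_subset[OF e(1)] and ec' = E.hpart_subset[OF e'(1)]
  note p = E.prod_closed[OF ec ec']
  have pp: "Y \<otimes>\<^bsub>Q.Pr\<^esub> Z = \<pi> (e \<otimes>\<^bsub>EE\<^esub> e')" using p_hom(5)[OF ec ec'] e e' by simp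
  note a = act[OF ec xc, unfolded e(2)] and a' = act[OF ec' xc, unfolded e'(2)]
  note ap = act[OF p xc, folded pp]
  note b = act[OF ec' a(3), unfolded e'(2)] and b' = act[OF ec a'(3), unfolded e(2)]
  note d = act[OF ec a'(1), unfolded e(2)] and d' = act[OF ec' a(1), unfolded e'(2)]
  \<comment> \<open>The three identities are the Leibniz identity of the extension with the element
    of A placed first, last and in the middle.\<close>
  show "ract x (Y \<otimes>\<^bsub>Q.Pr\<^esub> Z) = ract (ract x Y) Z \<ominus>\<^bsub>AA\<^esub> (koszul i m \<odot>\<^bsub>AA\<^esub> ract (ract x Z) Y)"
    by (rule i_inj[OF ap(3)])
      (use E.leibniz[OF i_hom(6)[OF x] e(1) e'(1)] in
        \<open>simp_all add: i_grp(3) i_hom(4) ap a a' b b' koszul_commute[of i] AA.M.minus_closed\<close>)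
  show "lact Y (lact Z x) = lact (Y \<otimes>\<^bsub>Q.Pr\<^esub> Z) x \<ominus>\<^bsub>AA\<^esub> (koszul l m \<odot>\<^bsub>AA\<^esub> ract (lact Y x) Z)"
    by (rule i_inj[OF d(1)])
      (use E.leibniz[OF e(1) e'(1) i_hom(6)[OF x]] in
        \<open>simp_all add: i_grp(3) i_hom(4) ap a a' d d' AA.M.minus_closed\<close>)
  show "lact Y (ract x Z) = ract (lact Y x) Z \<ominus>\<^bsub>AA\<^esub> (koszul l m \<odot>\<^bsub>AA\<^esub> lact (Y \<otimes>\<^bsub>Q.Pr\<^esub> Z) x)"
    by (rule i_inj[OF b'(1)])
      (use E.leibniz[OF e(1) i_hom(6)[OF x] e'(1)] in
        \<open>simp_all add: i_grp(3) i_hom(4) ap a a' b' d' koszul_commute[of l] AA.M.minus_closed\<close>)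
qed

text \<open>In general \<open>\<pi>\<close> has no multiplicative section, but \<open>L\<close> is
  free: its generators can be sent to homogeneous preimages of their classes, and the composite with
  \<open>\<pi>\<close> is the class map by uniqueness.\<close>

lemma lift_hom_exists: "\<exists>\<sigma>\<in>superalg_hom L EE. \<forall>f\<in>carrier L. \<pi> (\<sigma> f) = cl f"
proof -
  define lift where "lift b = (SOME e. e \<in> hpart EE (lpar B1 b) \<and> \<pi> e = cl (gen b))" for b
  have lift: "lift b \<in> hpart EE (lpar B1 b) \<and> \<pi> (lift b) = cl (gen b)" if b: "b \<in> B" for b
  proof -
    have "\<exists>e. e \<in> hpart EE (lpar B1 b) \<and> \<pi> e = cl (gen b)"
      by (rule p_hpart_lift[OF Q.pr_linear(5)[OF gen_hpart[OF b]]]) (intro exI conjI)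
    then show ?thesis unfolding lift_def by (rule someI_ex)
  qed
  have "lift b \<in> hpart EE 0" if "b \<in> B0" for b
  proof -
    have "lpar B1 b = 0" using that disjoint by (auto simp: lpar_def)
    with lift[of b] that show ?thesis by simp
  qed
  moreover have "lift b \<in> hpart EE 1" if "b \<in> B1" for b
    using lift[of b] that by (simp add: lpar_def)
  ultimately obtain \<sigma> where \<sigma>: "\<sigma> \<in> superalg_hom L EE" "\<forall>b\<in>B. \<sigma> (gen b) = lift b"
    using E.Lbs_hom_exists[OF disjoint, of lift] by blast
  have "(\<pi> \<circ> \<sigma>) f = cl f" if "f \<in> carrier L" for f
    by (rule Qr.Lbs_hom_unique[OF superalg_hom_comp[OF \<sigma>(1) \<pi>] Q.pr_hom _ that]) (use \<sigma>(2) lift in simp)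
  with \<sigma>(1) show ?thesis by auto
qed

section \<open>The map on relations obtained from a lift of the generators\<close>

definition \<sigma> :: "('b list \<Rightarrow>\<^sub>0 'k) \<Rightarrow> 'e"
  where "\<sigma> = (SOME \<sigma>. \<sigma> \<in> superalg_hom L EE \<and> (\<forall>f\<in>carrier L. \<pi> (\<sigma> f) = cl f))"

lemma \<sigma>: "\<sigma> \<in> superalg_hom L EE" "f \<in> carrier L \<Longrightarrow> \<pi> (\<sigma> f) = cl f"
proof -
  have "\<exists>\<sigma>. \<sigma> \<in> superalg_hom L EE \<and> (\<forall>f\<in>carrier L. \<pi> (\<sigma> f) = cl f)" using lift_hom_exists by blast
  from someI_ex[OF this] show "\<sigma> \<in> superalg_hom L EE" "f \<in> carrier L \<Longrightarrow> \<pi> (\<sigma> f) = cl f"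
    unfolding \<sigma>_def by blast+
qed

lemmas s_hom = superalg_homD[OF \<sigma>(1)]

definition fl :: "('b list \<Rightarrow>\<^sub>0 'k) \<Rightarrow> 'a" where "fl s = j (\<sigma> s)"

lemma fl:
  assumes "s \<in> R"
  shows "fl s \<in> carrier AA" "\<iota> (fl s) = \<sigma> s"
proof -
  note c = R_props(4)[OF assms]
  have "\<pi> (\<sigma> s) = \<zero>\<^bsub>Q.Pr\<^esub>" using \<sigma>(2)[OF c] Q.pr_zero_iff[OF c] Q.IdS_closed(7)[OF assms] by simp
  from j[OF s_hom(2)[OF c] this] show "fl s \<in> carrier AA" "\<iota> (fl s) = \<sigma> s" by (simp_all add: fl_def)
qed

text \<open>Acting by the class of b is multiplying by the preimage \<open>\<sigma> (gen b)\<close>,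
  so the iterated action reproduces the value of the homomorphism \<open>\<sigma>\<close> at the
  left-normed product.\<close>

lemma s_npoly:
  assumes s: "s \<in> R" and "set c \<subseteq> B"
  shows "hfloor B0 B1 R ract (fl s) c \<in> carrier AA \<and> \<iota> (hfloor B0 B1 R ract (fl s) c) = \<sigma> (npol s c)"
  using assms(2)
proof (induction c rule: rev_induct)
  case Nil
  show ?case using fl[OF s] by (simp add: hfloor_def)
next
  case (snoc b c)
  then have c: "set c \<subseteq> B" and b: "b \<in> B" by auto
  let ?x = "hfloor B0 B1 R ract (fl s) c"
  have IH: "?x \<in> carrier AA" "\<iota> ?x = \<sigma> (npol s c)" using snoc.IH[OF c] by auto
  have bc: "gen b \<in> carrier L" by (rule gen_carrier[OF b])
  note a = act[OF s_hom(2)[OF bc] IH(1), unfolded \<sigma>(2)[OF bc]]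
  have "\<sigma> (npol s (c @ [b])) = \<sigma> (npol s c) \<otimes>\<^bsub>EE\<^esub> \<sigma> (gen b)"
    using s_hom(5)[OF npoly_carrier[OF s c] bc] by (simp add: npoly_snoc)
  then show ?case using a(3,4) IH(2) by (simp add: hfloor_def)
qed

lemma s_nval:
  "nvalid es \<Longrightarrow> nexpr_floor AA B0 B1 R ract fl es \<in> carrier AA \<and> \<iota> (nexpr_floor AA B0 B1 R ract fl es) = \<sigma> (nval es)"
proof (induction es)
  case Nil
  show ?case using i_grp(1) linear_maps_group(1)[OF L.superspace_axioms E.superspace_axioms s_hom(1)]
    by (simp add: nexpr_floor_def)
next
  case (Cons e es)
  obtain \<alpha> s c where e: "e = (\<alpha>, s, c)" by (cases e)
  then have v: "s \<in> R" "set c \<subseteq> B" "nvalid es" using Cons.prems by (simp_all add: nvalid_Cons)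
  let ?x = "hfloor B0 B1 R ract (fl s) c" and ?y = "nexpr_floor AA B0 B1 R ract fl es"
  have x: "?x \<in> carrier AA" "\<iota> ?x = \<sigma> (npol s c)" using s_npoly[OF v(1,2)] by auto
  have y: "?y \<in> carrier AA" "\<iota> ?y = \<sigma> (nval es)" using Cons.IH[OF v(3)] by auto
  have c: "npol s c \<in> carrier L" "nval es \<in> carrier L"
    using npoly_carrier[OF v(1,2)] Q.IdS_closed(6)[OF nval_in_I[OF v(3)]] .
  have pc: "pscale \<alpha> (npol s c) \<in> carrier L" using c(1) by (simp add: keys_subset_closed(2))
  have eq: "nexpr_floor AA B0 B1 R ract fl (e # es) = \<alpha> \<odot>\<^bsub>AA\<^esub> ?x \<oplus>\<^bsub>AA\<^esub> ?y" by (simp add: nexpr_floor_def e)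
  have "\<sigma> (nval (e # es)) = \<alpha> \<odot>\<^bsub>EE\<^esub> \<sigma> (npol s c) \<oplus>\<^bsub>EE\<^esub> \<sigma> (nval es)"
    using s_hom(3)[OF pc c(2)] s_hom(4)[OF c(1), of \<alpha>] by (simp add: e)
  then show ?case unfolding eq using x y i_hom(3)[of "\<alpha> \<odot>\<^bsub>AA\<^esub> ?x" ?y] i_hom(4)[OF x(1)] by simp
qed

text \<open>Under \<open>\<iota>\<close> both sides of the compatibility condition become the value
  of \<open>\<sigma>\<close> at the product of \<mu> and f, once by multiplicativity and once by
  expanding this product into normal polynomials.\<close>

lemma data: "extension_data AA B0 B1 R lact ract fl"
  unfolding extension_data_def
proof (intro conjI ballI allI impI act_supermodule)
  fix f i assume f: "f \<in> R" "f \<in> hpart L i"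
  show "fl f \<in> hpart AA i" by (rule i_hpart[OF fl(1)[OF f(1)]]) (simp only: fl(2)[OF f(1)] s_hom(6)[OF f(2)])
next
  fix \<mu> f assume \<mu>: "\<mu> \<in> NF B" and f: "f \<in> R"
  note w = wmono_carrier[OF \<mu>]
  have mI: "mul (wmono \<mu>) f \<in> I" using nspan_word_mul_R[OF f \<mu>] by (simp add: I_eq_nspan)
  let ?es = "nexpr_of B0 B1 R (mul (wmono \<mu>) f)"
  have es: "nvalid ?es" "mul (wmono \<mu>) f = nval ?es" using nexpr_of_I[OF mI] by (simp_all add: is_nexpr_iff)
  note a = act[OF s_hom(2)[OF w] fl(1)[OF f], unfolded \<sigma>(2)[OF w]]
  have "\<iota> (lact (cl (wmono \<mu>)) (fl f)) = \<sigma> (mul (wmono \<mu>) f)"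
    using a(2) fl(2)[OF f] s_hom(5)[OF w R_props(4)[OF f]] by simp
  also have "\<dots> = \<iota> (nexpr_floor AA B0 B1 R ract fl ?es)" using s_nval[OF es(1)] es(2) by simp
  finally show "lact (cl (wmono \<mu>)) (fl f) = nexpr_floor AA B0 B1 R ract fl ?es"
    using i_inj[OF a(1)] s_nval[OF es(1)] by blast
qed

section \<open>Isomorphism of the given extension with the presented algebra\<close>

sublocale Ex: ext_setup B0 B1 R AA A0 A1 lact ract fl
  by (intro ext_setup.intro ext_setup_axioms.intro reduced_gs_axioms AA.super_basis_axioms data)

text \<open>The homomorphism given by \<open>\<iota>\<close> on A and \<open>\<sigma>\<close> on B
  kills the relations by construction of the data. That the induced map is bijective is a short five
  lemma argument on the normal forms x + d.\<close>

lemma superalg_iso_ext: "superalg_iso EE (ext_superalgebra AA A0 A1 B0 B1 R lact ract fl)"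
proof -
  have "\<exists>\<psi>. \<psi> \<in> superalg_hom Ex.KK EE \<and> (\<forall>a\<in>A0 \<union> A1. \<psi> (gen (Inl a)) = \<iota> a) \<and>
      (\<forall>b\<in>B. \<psi> (gen (Inr b)) = \<sigma> (gen b))"
    by (rule gsum_hom_exists[OF leibniz_EE AA.A_disjoint disjoint])
      (rule i_hom(6)[OF AA.A_parity], assumption, rule s_hom(6)[OF gen_hpart], assumption)
  then obtain \<psi> where \<psi>: "\<psi> \<in> superalg_hom Ex.KK EE"
      and gens: "\<forall>a\<in>A0 \<union> A1. \<psi> (gen (Inl a)) = \<iota> a" "\<forall>b\<in>B. \<psi> (gen (Inr b)) = \<sigma> (gen b)"
    by (elim exE conjE) (rule that)
  note \<psi>A = bspec[OF gens(1)] and \<psi>B = bspec[OF gens(2)]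
  note h = superalg_homD[OF \<psi>]
  note hg = linear_maps_group[OF Ex.K.Fr.superspace_axioms E.superspace_axioms h(1)]
  have minus: "\<psi> (k - l) = \<psi> k \<ominus>\<^bsub>EE\<^esub> \<psi> l" if "k \<in> carrier Ex.KK" "l \<in> carrier Ex.KK" for k l
    using hg(3)[OF that] Lbs_minus[OF that] by simp
  have \<psi>_em: "\<psi> (Ex.em f) = \<sigma> f" if f: "f \<in> carrier L" for f
  proof -
    have "(\<psi> \<circ> Ex.em) f = \<sigma> f"
      by (rule E.Lbs_hom_unique[OF superalg_hom_comp[OF emb_hom \<psi>] \<sigma>(1) _ f]) (use \<psi>B in simp)
    then show ?thesis by simp
  qed
  have \<psi>_br: "\<psi> (Ex.br x) = \<iota> x" if "x \<in> carrier AA" for x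
    using that
  proof (induction rule: AA.basis_induct)
    case zero
    show ?case using hg(1) i_grp(1) by (simp add: AA.brace_linear)
  next
    case (basis a)
    show ?case unfolding AA.brace_linear(4)[OF basis] by (rule \<psi>A[OF basis])
  next
    case (add x y)
    show ?case unfolding AA.brace_linear(1)[OF add(1,2)]
      using h(3)[OF Ex.K_elems(4)[OF add(1)] Ex.K_elems(4)[OF add(2)]] add(3,4) i_hom(3)[OF add(1,2)] by simp
  next
    case (scale c x)
    show ?case unfolding AA.brace_linear(2)[OF scale(1)]
      using h(4)[OF Ex.K_elems(4)[OF scale(1)], of c] scale(2) i_hom(4)[OF scale(1)] by simp
  qed
  have ker: "\<psi> k = \<zero>\<^bsub>EE\<^esub>" if k: "k \<in> Ex.rels" for k
  proof -
    have mz: "u \<ominus>\<^bsub>EE\<^esub> v = \<zero>\<^bsub>EE\<^esub>" if "u = v" "u \<in> carrier EE" for u v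
      using that by (simp add: E.M.minus_eq E.M.r_neg)
    consider (aa) a a' where "k = Ex.kmul (gen (Inl a)) (gen (Inl a'))" "a \<in> A0 \<union> A1" "a' \<in> A0 \<union> A1"
      | (ab) a b where "k = Ex.kmul (gen (Inl a)) (gen (Inr b)) - Ex.br (Ex.ra a (gen b))" "a \<in> A0 \<union> A1" "b \<in> B"
      | (na) \<nu> a where "k = Ex.kmul (Ex.em (wmono \<nu>)) (gen (Inl a)) - Ex.br (Ex.la (wmono \<nu>) a)" "a \<in> A0 \<union> A1" "\<nu> \<in> NF B"
      | (f) f where "k = Ex.em f - Ex.br (fl f)" "f \<in> R"
      using k unfolding Ex.rels_eq by blast
    then show ?thesis
    proof cases
      case (aa a a')
      show ?thesis unfolding aa(1)
        using h(5)[OF Ex.K_elems(1)[OF aa(2)] Ex.K_elems(1)[OF aa(3)]] \<psi>A[OF aa(2)] \<psi>A[OF aa(3)] i_prod[OF Ex.A_in[OF aa(2)] Ex.A_in[OF aa(3)]] by simp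
    next
      case (ab a b)
      note bc = gen_carrier[OF ab(3)] and ac = Ex.A_in[OF ab(2)]
      note c = act[OF s_hom(2)[OF bc] ac, unfolded \<sigma>(2)[OF bc], folded Ex.ra_def]
      note kc = Ex.K_closed(4)[OF Ex.K_elems(1)[OF ab(2)] Ex.K_elems(2)[OF ab(3)]]
      show ?thesis unfolding ab(1) minus[OF kc Ex.K_elems(4)[OF c(3)]] \<psi>_br[OF c(3)]
        by (rule mz) (use h(5)[OF Ex.K_elems(1)[OF ab(2)] Ex.K_elems(2)[OF ab(3)]] h(2)[OF kc] \<psi>A[OF ab(2)] \<psi>B[OF ab(3)] c(4) in simp_all)
    next
      case (na \<nu> a)
      note wc = wmono_carrier[OF na(3)] and ac = Ex.A_in[OF na(2)]
      note c = act[OF s_hom(2)[OF wc] ac, unfolded \<sigma>(2)[OF wc], folded Ex.la_def]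
      note kc = Ex.K_closed(4)[OF Ex.K_elems(3)[OF wc] Ex.K_elems(1)[OF na(2)]]
      show ?thesis unfolding na(1) minus[OF kc Ex.K_elems(4)[OF c(1)]] \<psi>_br[OF c(1)]
        by (rule mz[OF _ h(2)[OF kc]]) (use h(5)[OF Ex.K_elems(3)[OF wc] Ex.K_elems(1)[OF na(2)]] \<psi>A[OF na(2)] \<psi>_em[OF wc] c(2) in simp)
    next
      case (f f)
      note fc = R_props(4)[OF f(2)]
      show ?thesis unfolding f(1) minus[OF Ex.K_elems(3)[OF fc] Ex.K_elems(4)[OF fl(1)[OF f(2)]]] \<psi>_br[OF fl(1)[OF f(2)]] \<psi>_em[OF fc] fl(2)[OF f(2)]
        by (rule mz[OF refl s_hom(2)[OF fc]])
    qed
  qed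
  obtain \<chi> where \<chi>: "\<chi> \<in> superalg_hom Ex.K.Pr EE" "\<And>k. k \<in> carrier Ex.KK \<Longrightarrow> \<chi> (Ex.K.pr k) = \<psi> k"
    using Ex.K.pr_lift[OF E.superalgebra_axioms \<psi> ker] by blast
  interpret Kr: leibniz_superalgebra Ex.K.Pr by (rule Ex.K.leibniz_Pr)
  \<comment> \<open>Applying \<open>\<pi>\<close> removes x and puts d into the ideal, so d = 0 by
    irreducibility; then injectivity of \<open>\<iota>\<close> gives x = 0.\<close>
  have ker0: "C = \<zero>\<^bsub>Ex.K.Pr\<^esub>" if C: "C \<in> carrier Ex.K.Pr" "\<chi> C = \<zero>\<^bsub>EE\<^esub>" for C
  proof -
    obtain k where k: "k \<in> carrier Ex.KK" "C = Ex.K.pr k" using C(1) unfolding Ex.K.pr_image by blast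
    obtain x d where xd: "x \<in> carrier AA" "supp d \<subseteq> IrrR" "k - (Ex.br x + Ex.em d) \<in> Ex.K.IdS"
      using Ex.K_span[OF k(1)] .
    note dc = Irr_carrier[OF xd(2)]
    note lc = Ex.em_br_carrier[OF xd(1) dc]
    have C': "C = Ex.K.pr (Ex.br x + Ex.em d)" using Ex.K.pr_eq_iff[OF k(1) lc] xd(3) k(2) by simp
    have z: "\<iota> x \<oplus>\<^bsub>EE\<^esub> \<sigma> d = \<zero>\<^bsub>EE\<^esub>"
      using C(2) \<chi>(2)[OF lc] h(3)[OF Ex.K_elems(4)[OF xd(1)] Ex.K_elems(3)[OF dc]] \<psi>_br[OF xd(1)] \<psi>_em[OF dc] unfolding C' by simp
    have "\<zero>\<^bsub>Q.Pr\<^esub> = \<pi> (\<iota> x) \<oplus>\<^bsub>Q.Pr\<^esub> \<pi> (\<sigma> d)"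
      using p_hom(3)[OF i_hom(2)[OF xd(1)] s_hom(2)[OF dc]] z p_grp(1) by simp
    then have "cl d = \<zero>\<^bsub>Q.Pr\<^esub>" using p_i[OF xd(1)] \<sigma>(2)[OF dc] Q.pr_linear(4)[OF dc] by simp
    then have "d \<in> nspan" using Q.pr_zero_iff[OF dc] by (simp add: I_eq_nspan)
    then have d0: "d = 0" by (rule Irr_nspan_disjoint[OF xd(2)])
    have s0: "\<sigma> 0 = \<zero>\<^bsub>EE\<^esub>" using linear_maps_group(1)[OF L.superspace_axioms E.superspace_axioms s_hom(1)] by simp
    have "\<iota> x = \<iota> \<zero>\<^bsub>AA\<^esub>" using z i_hom(2)[OF xd(1)] i_grp(1) unfolding d0 s0 by simp
    then have "x = \<zero>\<^bsub>AA\<^esub>" by (rule i_inj[OF xd(1) AA.M.zero_closed])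
    then show ?thesis using C' d0 Ex.K.pr_zero_iff[of 0] Ex.K.IdS_closed(1) by (simp add: AA.brace_linear emb_linear)
  qed
  have "inj_on \<chi> (carrier Ex.K.Pr)"
  proof (rule inj_onI)
    fix C D assume CD: "C \<in> carrier Ex.K.Pr" "D \<in> carrier Ex.K.Pr" "\<chi> C = \<chi> D"
    have "\<chi> (C \<ominus>\<^bsub>Ex.K.Pr\<^esub> D) = \<zero>\<^bsub>EE\<^esub>"
      using linear_maps_group(3)[OF Kr.superspace_axioms E.superspace_axioms superalg_homD(1)[OF \<chi>(1)] CD(1,2)] CD(3)
        superalg_homD(2)[OF \<chi>(1) CD(2)] by (simp add: E.M.minus_eq E.M.r_neg)
    then have "C \<ominus>\<^bsub>Ex.K.Pr\<^esub> D = \<zero>\<^bsub>Ex.K.Pr\<^esub>" by (rule ker0[OF Kr.M.minus_closed[OF CD(1,2)]])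
    then show "C = D" using Kr.M.minus_zero_iff[OF CD(1,2)] by simp
  qed
  moreover have "\<chi> ` carrier Ex.K.Pr = carrier EE"
  proof
    show "\<chi> ` carrier Ex.K.Pr \<subseteq> carrier EE" using superalg_homD(2)[OF \<chi>(1)] by blast
    show "carrier EE \<subseteq> \<chi> ` carrier Ex.K.Pr"
    proof
      fix e assume e: "e \<in> carrier EE"
      then have "\<pi> e \<in> carrier Q.Pr" by (rule p_hom(2))
      then obtain f where f: "f \<in> carrier L" "\<pi> e = cl f" unfolding Q.pr_image by blast
      note sf = s_hom(2)[OF f(1)]
      \<comment> \<open>Subtracting the lift of its class moves e into the kernel of
        \<open>\<pi>\<close>, that is, into the image of A.\<close>
      have "\<pi> (e \<ominus>\<^bsub>EE\<^esub> \<sigma> f) = \<zero>\<^bsub>Q.Pr\<^esub>"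
        using p_grp(3)[OF e sf] f(2) \<sigma>(2)[OF f(1)] p_hom(2)[OF e] by (simp add: Qr.M.minus_eq Qr.M.r_neg)
      then obtain x where x: "x \<in> carrier AA" "\<iota> x = e \<ominus>\<^bsub>EE\<^esub> \<sigma> f" using j[of "e \<ominus>\<^bsub>EE\<^esub> \<sigma> f"] e sf by blast
      have "\<iota> x \<oplus>\<^bsub>EE\<^esub> \<sigma> f = e" using x(2) e sf by (simp add: E.M.minus_eq E.M.a_assoc E.M.l_neg)
      then have "\<chi> (Ex.K.pr (Ex.br x + Ex.em f)) = e"
        using \<chi>(2)[OF Ex.em_br_carrier[OF x(1) f(1)]] h(3)[OF Ex.K_elems(4)[OF x(1)] Ex.K_elems(3)[OF f(1)]]
          \<psi>_br[OF x(1)] \<psi>_em[OF f(1)] by simp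
      then show "e \<in> \<chi> ` carrier Ex.K.Pr" using Ex.K.pr_linear(4)[OF Ex.em_br_carrier[OF x(1) f(1)]] by blast
    qed
  qed
  \<comment> \<open>The universal property yields a map out of the presented algebra, so the
    isomorphism is found in this direction and then inverted.\<close>
  ultimately have "superalg_iso Ex.K.Pr EE" using \<chi>(1) unfolding superalg_iso_def bij_betw_def by blast
  then show ?thesis unfolding Ex.ext_superalgebra_eq
    by (rule superalg_iso_sym[OF Kr.superalgebra_axioms E.superspace_axioms])
qed

end

theorem corollary6p11:
  fixes \<AA> :: "('k::field, 'a) superalgebra"
    and A0 A1 :: "'a set"
    and rA :: "'a rel"
    and B0 B1 :: "'b::wellorder set"
    and R :: "('b list \<Rightarrow>\<^sub>0 'k) set"
    and \<EE> :: "('k, 'e) superalgebra"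
  assumes "leibniz_superalgebra \<AA>" and "abelian_superalgebra \<AA>"
    and "basis_of \<AA> (hpart \<AA> 0) A0" and "basis_of \<AA> (hpart \<AA> 1) A1"
    and "well_order_on (A0 \<union> A1) rA"
    and "B0 \<inter> B1 = {}"
    and "reduced_gs_basis B0 B1 R"
    and "\<forall>f\<in>R. length (lmon f) > 1"
    and "leibniz_superalgebra \<EE>"
  shows
    "(is_extension \<EE> (Lbs_rel B0 B1 R) \<AA> \<longleftrightarrow>
       (\<exists>lact ract fl. extension_data \<AA> B0 B1 R lact ract fl \<and>
          superalg_iso \<EE> (ext_superalgebra \<AA> A0 A1 B0 B1 R lact ract fl))) \<and>
     (\<forall>lact ract fl. extension_data \<AA> B0 B1 R lact ract fl \<and>
          superalg_iso \<EE> (ext_superalgebra \<AA> A0 A1 B0 B1 R lact ract fl) \<longrightarrow>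
        linear_iso (irr_space B0 B1 R) (Lbs_rel B0 B1 R) (rel_class B0 B1 R) \<and>
        linear_iso (dsum \<AA> (irr_space B0 B1 R)) (ext_superalgebra \<AA> A0 A1 B0 B1 R lact ract fl)
          (ext_elem \<AA> A0 A1 B0 B1 R lact ract fl) \<and>
        (\<forall>\<nu>\<in>Irr B0 B1 R. \<forall>\<nu>'\<in>Irr B0 B1 R.
           (\<exists>!(d, es). d \<in> carrier (irr_space B0 B1 R) \<and>
              is_nexpr B0 B1 R (free_mult B1 (wmono \<nu>) (wmono \<nu>') - d) es) \<and>
           (\<forall>d es. d \<in> carrier (irr_space B0 B1 R) \<and>
              is_nexpr B0 B1 R (free_mult B1 (wmono \<nu>) (wmono \<nu>') - d) es \<longrightarrow>
              (\<forall>a\<in>A0 \<union> A1. \<forall>a'\<in>A0 \<union> A1.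
                 ext_elem \<AA> A0 A1 B0 B1 R lact ract fl (a, wmono \<nu>)
                   \<otimes>\<^bsub>ext_superalgebra \<AA> A0 A1 B0 B1 R lact ract fl\<^esub>
                   ext_elem \<AA> A0 A1 B0 B1 R lact ract fl (a', wmono \<nu>') =
                 ext_elem \<AA> A0 A1 B0 B1 R lact ract fl
                   (ract a (rel_class B0 B1 R (wmono \<nu>'))
                      \<oplus>\<^bsub>\<AA>\<^esub> lact (rel_class B0 B1 R (wmono \<nu>)) a'
                      \<oplus>\<^bsub>\<AA>\<^esub> nexpr_floor \<AA> B0 B1 R ract fl es,
                    d)))))"
proof -
  interpret reduced_gs B0 B1 R by (rule reduced_gs.intro) fact+
  interpret AA: leibniz_superalgebra \<AA> by fact
  interpret Ab: super_basis \<AA> A0 A1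
    by (intro super_basis.intro super_basis_axioms.intro AA.superspace_axioms) fact+
  \<comment> \<open>The data are bound inside the conclusion, so membership in the locale is
    recorded for every choice instead of being interpreted once.\<close>
  have data_setup: "ext_setup B0 B1 R \<AA> A0 A1 lact ract fl" if "extension_data \<AA> B0 B1 R lact ract fl" for lact ract fl
    by (intro ext_setup.intro ext_setup_axioms.intro reduced_gs_axioms Ab.super_basis_axioms that)
  show ?thesis
  proof (intro conjI iffI allI impI ballI)
    assume "is_extension \<EE> (Lbs_rel B0 B1 R) \<AA>"
    then obtain \<iota> \<pi> where ext: "\<iota> \<in> superalg_hom \<AA> \<EE>" "\<pi> \<in> superalg_hom \<EE> (Lbs_rel B0 B1 R)"
      "inj_on \<iota> (carrier \<AA>)" "\<iota> ` carrier \<AA> = {x \<in> carrier \<EE>. \<pi> x = \<zero>\<^bsub>Lbs_rel B0 B1 R\<^esub>}"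
      "\<pi> ` carrier \<EE> = carrier (Lbs_rel B0 B1 R)"
      unfolding is_extension_def by (elim conjE bexE) (rule that)
    interpret given_extension B0 B1 R \<AA> A0 A1 \<EE> \<iota> \<pi>
      by (intro given_extension.intro given_extension_axioms.intro reduced_gs_axioms Ab.super_basis_axioms
          assms(1,2,9) ext)
    show "\<exists>lact ract fl. extension_data \<AA> B0 B1 R lact ract fl \<and>
        superalg_iso \<EE> (ext_superalgebra \<AA> A0 A1 B0 B1 R lact ract fl)"
      by (intro exI conjI) (rule data, rule superalg_iso_ext)
  next
    assume "\<exists>lact ract fl. extension_data \<AA> B0 B1 R lact ract fl \<and>
      superalg_iso \<EE> (ext_superalgebra \<AA> A0 A1 B0 B1 R lact ract fl)"
    then obtain lact ract fl where d: "extension_data \<AA> B0 B1 R lact ract fl"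
      "superalg_iso \<EE> (ext_superalgebra \<AA> A0 A1 B0 B1 R lact ract fl)"
      by (elim exE conjE) (rule that)
    show "is_extension \<EE> (Lbs_rel B0 B1 R) \<AA>"
      by (rule is_extension_iso[OF assms(9) d(2) ext_setup.ext_is_extension[OF data_setup[OF d(1)] assms(1,2)]])
  next
    show "linear_iso (irr_space B0 B1 R) (Lbs_rel B0 B1 R) (rel_class B0 B1 R)"
      by (rule irr_space_iso)
  next
    fix lact ract fl
    assume "extension_data \<AA> B0 B1 R lact ract fl \<and>
      superalg_iso \<EE> (ext_superalgebra \<AA> A0 A1 B0 B1 R lact ract fl)"
    then show "linear_iso (dsum \<AA> (irr_space B0 B1 R)) (ext_superalgebra \<AA> A0 A1 B0 B1 R lact ract fl)
        (ext_elem \<AA> A0 A1 B0 B1 R lact ract fl)"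
      using ext_setup.dsum_iso[OF data_setup] by simp
  next
    fix \<nu> \<nu>' assume "\<nu> \<in> Irr B0 B1 R" "\<nu>' \<in> Irr B0 B1 R"
    then have "wmono \<nu> \<in> carrier L" "wmono \<nu>' \<in> carrier L" using Irr_iff wmono_carrier by simp_all
    then show "\<exists>!(d, es). d \<in> carrier (irr_space B0 B1 R) \<and>
        is_nexpr B0 B1 R (free_mult B1 (wmono \<nu>) (wmono \<nu>') - d) es"
      by (intro normal_form_unique mul_carrier)
  next
    fix lact ract fl \<nu> \<nu>' d es a a'
    assume "extension_data \<AA> B0 B1 R lact ract fl \<and>
        superalg_iso \<EE> (ext_superalgebra \<AA> A0 A1 B0 B1 R lact ract fl)"
      and "\<nu> \<in> Irr B0 B1 R" "\<nu>' \<in> Irr B0 B1 R"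
      and "d \<in> carrier (irr_space B0 B1 R) \<and>
        is_nexpr B0 B1 R (free_mult B1 (wmono \<nu>) (wmono \<nu>') - d) es"
      and "a \<in> A0 \<union> A1" "a' \<in> A0 \<union> A1"
    then show "ext_elem \<AA> A0 A1 B0 B1 R lact ract fl (a, wmono \<nu>)
          \<otimes>\<^bsub>ext_superalgebra \<AA> A0 A1 B0 B1 R lact ract fl\<^esub>
          ext_elem \<AA> A0 A1 B0 B1 R lact ract fl (a', wmono \<nu>') =
        ext_elem \<AA> A0 A1 B0 B1 R lact ract fl
          (ract a (rel_class B0 B1 R (wmono \<nu>'))
             \<oplus>\<^bsub>\<AA>\<^esub> lact (rel_class B0 B1 R (wmono \<nu>)) a'
             \<oplus>\<^bsub>\<AA>\<^esub> nexpr_floor \<AA> B0 B1 R ract fl es, d)"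
      by (intro ext_setup.ext_product[OF data_setup]) simp_all
  qed
qed

end
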